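(* Let $\Omega\subset\mathbb{R}^N$ be a bounded connected open set with smooth boundary and let $V\ge0$ almost everywhere on $\Omega$. Assume that $V\in L^q(\Omega)$ for some $q>N$. Then, for every solution $u$ of $-\Delta u+Vu=f$ in $\Omega$, $u=0$ on $\partial\Omega$, involving a nonnegative datum $f\in L^\infty(\Omega)$, $f\not\equiv0$, the normal derivative of $\hat u$ exists at every point $a\in\partial\Omega$ and satisfies $$\frac{\partial\hat u}{\partial n}(a)>0.$$
   Context: For $f\in L^\infty(\Omega)$, the solution $u$ is the unique function in $W_0^{1,2}(\Omega)\cap L^2(\Omega;V\,dx)$ satisfying $-\Delta u+Vu=f$ in the sense of distributions in $\Omega$. $\hat u$ denotes the precise representative of $u$ (limit of averages over shrinking balls, which exists at every point of $\Omega$). $n$ is the inward unit normal vector on $\partial\Omega$; the normal derivative of $\hat u$ at $a\in\partial\Omega$ is $\frac{\partial\hat u}{\partial n}(a)=\lim_{t\downarrow0}\hat u(a+t\,n(a))/t$ when this limit exists (with $\hat u=0$ on $\partial\Omega$). *)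

theory Defs
  imports "HOL-Analysis.Analysis"
begin

definition partial_deriv :: "'a::euclidean_space \<Rightarrow> ('a \<Rightarrow> real) \<Rightarrow> 'a \<Rightarrow> real" where
  "partial_deriv b f x = frechet_derivative f (at x) b"

definition grad :: "('a::euclidean_space \<Rightarrow> real) \<Rightarrow> 'a \<Rightarrow> 'a" where
  "grad f x = (\<Sum>b\<in>Basis. partial_deriv b f x *\<^sub>R b)"

definition laplacian :: "('a::euclidean_space \<Rightarrow> real) \<Rightarrow> 'a \<Rightarrow> real" where
  "laplacian f x = (\<Sum>b\<in>Basis. partial_deriv b (partial_deriv b f) x)"

text \<open>The class \<open>C\<^sup>k(S)\<close>; meant for open \<open>S\<close>, since derivatives are two-sided.\<close>

primrec Ck_on :: "nat \<Rightarrow> 'a::euclidean_space set \<Rightarrow> ('a \<Rightarrow> real) \<Rightarrow> bool" where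
  "Ck_on 0 S f \<longleftrightarrow> continuous_on S f"
| "Ck_on (Suc k) S f \<longleftrightarrow>
     (\<forall>x\<in>S. f differentiable (at x)) \<and> (\<forall>b\<in>Basis. Ck_on k S (partial_deriv b f))"

definition smooth_on :: "'a::euclidean_space set \<Rightarrow> ('a \<Rightarrow> real) \<Rightarrow> bool" where
  "smooth_on S f \<longleftrightarrow> (\<forall>k. Ck_on k S f)"

definition test_functions :: "'a::euclidean_space set \<Rightarrow> ('a \<Rightarrow> real) set" where
  "test_functions \<Omega> = {\<phi>. smooth_on UNIV \<phi> \<and>
     compact (closure {x. \<phi> x \<noteq> 0}) \<and> closure {x. \<phi> x \<noteq> 0} \<subseteq> \<Omega>}"

text \<open>\<open>\<rho>\<close> is a smooth defining function of \<open>\<Omega>\<close> on the open neighbourhood \<open>U\<close> of the boundary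
  point \<open>a\<close>. The condition on \<open>\<Omega>\<close> forces \<open>\<rho> = 0\<close> on \<open>frontier \<Omega> \<inter> U\<close>, and \<open>\<rho>\<close> is negative
  on the other side of the boundary because its gradient does not vanish.\<close>

definition local_defining_function ::
  "'a::euclidean_space set \<Rightarrow> 'a \<Rightarrow> 'a set \<Rightarrow> ('a \<Rightarrow> real) \<Rightarrow> bool" where
  "local_defining_function \<Omega> a U \<rho> \<longleftrightarrow>
     open U \<and> a \<in> U \<and> smooth_on U \<rho> \<and> (\<forall>x\<in>U. grad \<rho> x \<noteq> 0) \<and> \<Omega> \<inter> U = {x\<in>U. \<rho> x > 0}"

definition smooth_boundary :: "'a::euclidean_space set \<Rightarrow> bool" where
  "smooth_boundary \<Omega> \<longleftrightarrow> (\<forall>a\<in>frontier \<Omega>. \<exists>U \<rho>. local_defining_function \<Omega> a U \<rho>)"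

text \<open>The normalised gradient of any local defining function; well defined by
  \<open>inward_unit_normal_eq\<close> below.\<close>

definition inward_unit_normal :: "'a::euclidean_space set \<Rightarrow> 'a \<Rightarrow> 'a" where
  "inward_unit_normal \<Omega> a =
     (THE \<nu>. \<exists>U \<rho>. local_defining_function \<Omega> a U \<rho> \<and> \<nu> = sgn (grad \<rho> a))"

lemma has_derivative_grad:
  assumes "f differentiable (at x)"
  shows "(f has_derivative (\<lambda>v. grad f x \<bullet> v)) (at x)"
proof -
  have D: "(f has_derivative frechet_derivative f (at x)) (at x)"
    using assms frechet_derivative_works by blast
  then interpret linear "frechet_derivative f (at x)"
    by (rule has_derivative_linear)
  have "frechet_derivative f (at x) v = grad f x \<bullet> v" for v
  proof -
    have "frechet_derivative f (at x) v
        = frechet_derivative f (at x) (\<Sum>b\<in>Basis. (v \<bullet> b) *\<^sub>R b)"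
      by (simp add: euclidean_representation)
    also have "\<dots> = grad f x \<bullet> v"
      unfolding sum scale grad_def partial_deriv_def inner_sum_left
      by (simp add: inner_commute[of v] mult.commute)
    finally show ?thesis .
  qed
  then have "frechet_derivative f (at x) = (\<lambda>v. grad f x \<bullet> v)" by (rule ext)
  with D show ?thesis by metis
qed

lemma local_defining_function_props:
  assumes "local_defining_function \<Omega> a U \<rho>" "a \<in> frontier \<Omega>" "open \<Omega>"
  shows "(\<rho> has_derivative (\<lambda>v. grad \<rho> a \<bullet> v)) (at a)" "\<rho> a = 0"
proof -
  have U: "open U" "a \<in> U" "Ck_on (Suc 0) U \<rho>" and eq: "\<Omega> \<inter> U = {x\<in>U. \<rho> x > 0}"
    using assms(1) by (auto simp: local_defining_function_def smooth_on_def)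
  show D: "(\<rho> has_derivative (\<lambda>v. grad \<rho> a \<bullet> v)) (at a)"
    using U by (intro has_derivative_grad) auto
  have "a \<notin> \<Omega>" using assms(2,3) by (simp add: frontier_def interior_open)
  then have "a \<notin> {x\<in>U. \<rho> x > 0}" using eq by blast
  then have "\<rho> a \<le> 0" using U by simp
  moreover have "\<not> \<rho> a < 0"
  proof
    assume "\<rho> a < 0"
    moreover have "isCont \<rho> a" using D by (rule has_derivative_continuous)
    ultimately have "eventually (\<lambda>x. \<rho> x < 0) (at a)"
      unfolding isCont_def by (intro order_tendstoD(2))
    then have "eventually (\<lambda>x. \<rho> x < 0) (nhds a)"
      unfolding eventually_at_filter
      by (rule eventually_mono) (use \<open>\<rho> a < 0\<close> in auto)
    moreover have "eventually (\<lambda>x. x \<in> U) (nhds a)"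
      using U by (intro eventually_nhds_in_open)
    ultimately have "eventually (\<lambda>x. \<rho> x < 0 \<and> x \<in> U) (nhds a)"
      by (rule eventually_conj)
    then obtain S where S: "open S" "a \<in> S" "\<And>x. x \<in> S \<Longrightarrow> \<rho> x < 0 \<and> x \<in> U"
      by (auto simp: eventually_nhds)
    have "x \<notin> \<Omega>" if "x \<in> S" for x
    proof
      assume "x \<in> \<Omega>"
      with S(3)[OF that] have "x \<in> \<Omega> \<inter> U" by blast
      with eq have "\<rho> x > 0" by blast
      with S(3)[OF that] show False by simp
    qed
    then have "S \<inter> \<Omega> = {}" by blast
    moreover have "a \<in> closure \<Omega>" using assms(2) by (simp add: frontier_def)
    ultimately show False using S open_Int_closure_eq_empty[of S \<Omega>] by blast
  qed
  ultimately show "\<rho> a = 0" by simp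
qed

lemma gradient_halfspace_subset:
  assumes 1: "local_defining_function \<Omega> a U \<rho>" and 2: "local_defining_function \<Omega> a W \<sigma>"
    and a: "a \<in> frontier \<Omega>" "open \<Omega>" and v: "grad \<rho> a \<bullet> v > 0"
  shows "grad \<sigma> a \<bullet> v \<ge> 0"
proof -
  have lim: "((\<lambda>t. f (a + t *\<^sub>R v) / t) \<longlongrightarrow> grad f a \<bullet> v) (at_right 0)"
    if "(f has_derivative (\<lambda>v. grad f a \<bullet> v)) (at a)" "f a = 0" for f
  proof -
    have "((\<lambda>t. a + t *\<^sub>R v) has_derivative (\<lambda>t. t *\<^sub>R v)) (at 0)"
      by (auto intro!: derivative_eq_intros)
    from has_derivative_compose[OF this, of f "\<lambda>v. grad f a \<bullet> v"] that(1)
    have "((\<lambda>t. f (a + t *\<^sub>R v)) has_field_derivative grad f a \<bullet> v) (at 0)"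
      by (simp add: has_field_derivative_def mult.commute[of _ "grad f a \<bullet> v"])
    then have "((\<lambda>t. f (a + t *\<^sub>R v) / t) \<longlongrightarrow> grad f a \<bullet> v) (at 0)"
      using that(2) by (simp add: DERIV_def)
    then show ?thesis by (rule tendsto_within_subset) simp
  qed
  note P = local_defining_function_props[OF 1 a] local_defining_function_props[OF 2 a]
  have "eventually (\<lambda>t. \<rho> (a + t *\<^sub>R v) / t > 0) (at_right 0)"
    using lim[OF P(1,2)] v by (rule order_tendstoD(1))
  moreover have "eventually (\<lambda>t::real. a + t *\<^sub>R v \<in> U \<inter> W) (at_right 0)"
  proof -
    have "((\<lambda>t::real. a + t *\<^sub>R v) \<longlongrightarrow> a + 0 *\<^sub>R v) (at_right 0)"
      by (intro tendsto_intros)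
    then show ?thesis
      using 1 2 by (intro topological_tendstoD) (auto simp: local_defining_function_def)
  qed
  moreover have "eventually (\<lambda>t::real. t > 0) (at_right 0)"
    by (rule eventually_at_right_less)
  ultimately have "eventually (\<lambda>t. \<sigma> (a + t *\<^sub>R v) / t \<ge> 0) (at_right 0)"
  proof eventually_elim
    case (elim t)
    then have "\<rho> (a + t *\<^sub>R v) > 0" by (simp add: zero_less_divide_iff)
    with elim 1 have "a + t *\<^sub>R v \<in> \<Omega>" unfolding local_defining_function_def by blast
    with elim 2 have "\<sigma> (a + t *\<^sub>R v) > 0" unfolding local_defining_function_def by blast
    with elim show ?case by simp
  qed
  then show ?thesis
    using lim[OF P(3,4)] by (intro tendsto_lowerbound) auto
qed

lemma inward_unit_normal_eq:
  assumes 1: "local_defining_function \<Omega> a U \<rho>" and a: "a \<in> frontier \<Omega>" "open \<Omega>"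
  shows "inward_unit_normal \<Omega> a = sgn (grad \<rho> a)"
  unfolding inward_unit_normal_def
proof (rule the_equality)
  fix \<nu> assume "\<exists>U \<rho>. local_defining_function \<Omega> a U \<rho> \<and> \<nu> = sgn (grad \<rho> a)"
  then obtain W \<sigma> where 2: "local_defining_function \<Omega> a W \<sigma>" and \<nu>: "\<nu> = sgn (grad \<sigma> a)"
    by blast
  define \<mu> where "\<mu> = sgn (grad \<rho> a)"
  have nz: "grad \<rho> a \<noteq> 0" "grad \<sigma> a \<noteq> 0"
    using 1 2 by (auto simp: local_defining_function_def)
  have unit: "norm \<mu> = 1" "norm \<nu> = 1" using nz by (auto simp: \<mu>_def \<nu> norm_sgn)
  have dot: "\<mu> \<bullet> \<mu> = 1" "\<nu> \<bullet> \<nu> = 1" "\<nu> \<bullet> \<mu> = \<mu> \<bullet> \<nu>"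
    using unit by (simp_all add: dot_square_norm inner_commute)
  have le: "\<mu> \<bullet> \<nu> \<le> 1" using norm_cauchy_schwarz[of \<mu> \<nu>] unit by simp
  have ge: "\<mu> \<bullet> \<nu> \<ge> 1 - \<epsilon>" if "\<epsilon> > 0" for \<epsilon>
  proof -
    define v where "v = (1 + \<epsilon>) *\<^sub>R \<mu> - \<nu>"
    have "\<mu> \<bullet> v = (1 + \<epsilon>) - \<mu> \<bullet> \<nu>"
      by (simp add: v_def inner_diff_right dot)
    with le that have "\<mu> \<bullet> v > 0" by linarith
    moreover have "grad \<rho> a = norm (grad \<rho> a) *\<^sub>R \<mu>"
      using nz by (simp add: \<mu>_def sgn_div_norm)
    ultimately have "grad \<rho> a \<bullet> v > 0"
      using nz(1) by (metis inner_scaleR_left mult_pos_pos zero_less_norm_iff)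
    from gradient_halfspace_subset[OF 1 2 a this] have "\<nu> \<bullet> v \<ge> 0"
      unfolding \<nu> sgn_div_norm by simp
    then have "0 \<le> (1 + \<epsilon>) * (\<mu> \<bullet> \<nu>) - 1"
      by (simp add: v_def inner_diff_right dot)
    moreover have "\<epsilon> * (\<mu> \<bullet> \<nu>) \<le> \<epsilon>"
      using mult_left_mono[OF le, of \<epsilon>] that by simp
    ultimately show ?thesis by (simp add: distrib_right)
  qed
  have "1 \<le> \<mu> \<bullet> \<nu> + \<epsilon>" if "\<epsilon> > 0" for \<epsilon>
    using ge[OF that] by simp
  then have "\<mu> \<bullet> \<nu> \<ge> 1" by (rule field_le_epsilon)
  with le have "\<mu> \<bullet> \<nu> = 1" by simp
  then have "(\<nu> - \<mu>) \<bullet> (\<nu> - \<mu>) = 0"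
    by (simp add: inner_diff_left inner_diff_right dot del: inner_eq_zero_iff)
  then show "\<nu> = sgn (grad \<rho> a)" by (simp add: \<mu>_def)
qed (use 1 in blast)

definition Lp_on :: "real \<Rightarrow> 'a::euclidean_space set \<Rightarrow> ('a \<Rightarrow> 'b::euclidean_space) set" where
  "Lp_on p \<Omega> = {f \<in> borel_measurable (lebesgue_on \<Omega>).
     integrable (lebesgue_on \<Omega>) (\<lambda>x. norm (f x) powr p)}"

definition Linf_on :: "'a::euclidean_space set \<Rightarrow> ('a \<Rightarrow> real) set" where
  "Linf_on \<Omega> = {f \<in> borel_measurable (lebesgue_on \<Omega>).
     \<exists>C. AE x in lebesgue_on \<Omega>. \<bar>f x\<bar> \<le> C}"

text \<open>The space \<open>L\<^sup>2(\<Omega>; V dx)\<close>; meant for \<open>V \<ge> 0\<close> almost everywhere.\<close>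

definition weighted_L2_on :: "('a::euclidean_space \<Rightarrow> real) \<Rightarrow> 'a set \<Rightarrow> ('a \<Rightarrow> real) set" where
  "weighted_L2_on V \<Omega> = {u \<in> borel_measurable (lebesgue_on \<Omega>).
     integrable (lebesgue_on \<Omega>) (\<lambda>x. (u x)\<^sup>2 * V x)}"

definition is_weak_gradient ::
  "'a::euclidean_space set \<Rightarrow> ('a \<Rightarrow> real) \<Rightarrow> ('a \<Rightarrow> 'a) \<Rightarrow> bool" where
  "is_weak_gradient \<Omega> u G \<longleftrightarrow> (\<forall>\<phi>\<in>test_functions \<Omega>.
     (LINT x|lebesgue_on \<Omega>. u x *\<^sub>R grad \<phi> x) = - (LINT x|lebesgue_on \<Omega>. \<phi> x *\<^sub>R G x))"

text \<open>\<open>W\<^sub>0\<^sup>1\<^sup>,\<^sup>2(\<Omega>)\<close>: the closure of the test functions in the norm of \<open>W\<^sup>1\<^sup>,\<^sup>2(\<Omega>)\<close>.\<close>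

definition W12_0 :: "'a::euclidean_space set \<Rightarrow> ('a \<Rightarrow> real) set" where
  "W12_0 \<Omega> = {u \<in> Lp_on 2 \<Omega>. \<exists>G \<in> Lp_on 2 \<Omega>. is_weak_gradient \<Omega> u G \<and>
     (\<exists>\<phi>. (\<forall>k::nat. \<phi> k \<in> test_functions \<Omega>) \<and>
       (\<lambda>k. (LINT x|lebesgue_on \<Omega>. (u x - \<phi> k x)\<^sup>2)
          + (LINT x|lebesgue_on \<Omega>. (norm (G x - grad (\<phi> k) x))\<^sup>2)) \<longlonglongrightarrow> 0)}"

text \<open>The integrability of \<open>V u \<phi>\<close> says that \<open>V u\<close> is a distribution; without it the Bochner
  integral would silently be zero.\<close>

definition distributional_solution ::
  "'a::euclidean_space set \<Rightarrow> ('a \<Rightarrow> real) \<Rightarrow> ('a \<Rightarrow> real) \<Rightarrow> ('a \<Rightarrow> real) \<Rightarrow> bool" where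
  "distributional_solution \<Omega> V f u \<longleftrightarrow> (\<forall>\<phi>\<in>test_functions \<Omega>.
     integrable (lebesgue_on \<Omega>) (\<lambda>x. V x * u x * \<phi> x) \<and>
     - (LINT x|lebesgue_on \<Omega>. u x * laplacian \<phi> x) + (LINT x|lebesgue_on \<Omega>. V x * u x * \<phi> x)
       = (LINT x|lebesgue_on \<Omega>. f x * \<phi> x))"

definition dirichlet_solution ::
  "'a::euclidean_space set \<Rightarrow> ('a \<Rightarrow> real) \<Rightarrow> ('a \<Rightarrow> real) \<Rightarrow> ('a \<Rightarrow> real) \<Rightarrow> bool" where
  "dirichlet_solution \<Omega> V f u \<longleftrightarrow>
     u \<in> W12_0 \<Omega> \<inter> weighted_L2_on V \<Omega> \<and> distributional_solution \<Omega> V f u"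

text \<open>For a function given on an open set, small balls around its points lie inside that set,
  so the values elsewhere do not matter.\<close>

definition precise_representative :: "('a::euclidean_space \<Rightarrow> real) \<Rightarrow> 'a \<Rightarrow> real" where
  "precise_representative u x =
     Lim (at_right 0) (\<lambda>r. (LINT y|lebesgue_on (ball x r). u y) / measure lebesgue (ball x r))"

text \<open>Inward normal derivative at a boundary point of a function with zero boundary values.\<close>

definition has_normal_derivative ::
  "'a::euclidean_space set \<Rightarrow> ('a \<Rightarrow> real) \<Rightarrow> 'a \<Rightarrow> real \<Rightarrow> bool" where
  "has_normal_derivative \<Omega> w a D \<longleftrightarrow>
     ((\<lambda>t. w (a + t *\<^sub>R inward_unit_normal \<Omega> a) / t) \<longlongrightarrow> D) (at_right 0)"

end

theory Submission
  imports Defs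
begin

text \<open>The idea is to compare the solution with explicit functions, first from above and in the interior,
  then at a boundary point on a sequence of shrinking balls.

  Put \<open>g = f - V u\<close>, so that \<open>- \<Delta> u = g\<close> weakly. For smooth \<open>\<psi>\<close> and a smooth nondecreasing \<open>E\<close>
  vanishing on the negative axis, the function \<open>E (\<psi> - u)\<close>, cut off in space, may be used as a test
  function once \<open>u\<close> is replaced by the test functions that approximate it
  (\<open>comparison_integral\<close>). Consequently \<open>\<psi>\<close> cannot exceed \<open>u\<close> on a set of positive measure on which
  \<open>- \<Delta> \<psi> < g\<close>. This yields \<open>u \<ge> 0\<close>, and together with a ball touching \<open>\<Omega>\<close> from outside at the boundary
  point \<open>a\<close> it yields a bound \<open>u \<le> w\<close> with \<open>w (a + t n) \<le> C t\<close> (\<open>exterior_ball_barrier\<close>). Hence \<open>\<bar>g\<bar>\<close> is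
  at most a multiple of \<open>W\<close>, the function equal to \<open>1 + V\<^sup>+\<close> on \<open>\<Omega>\<close> and to 0 elsewhere.

  From here on the integrability of \<open>V\<close> enters only through the growth of \<open>W\<close>: its integral over a ball
  of radius \<open>t\<close> is \<open>O(t\<^bsup>N - 1 + 2 \<beta>\<^esup>)\<close> with \<open>\<beta> > 0\<close> (\<open>morrey_of_Lp\<close>). There is a test function \<open>k\<close> whose
  Laplacian is the difference of the mollifiers of radius 1 and 1/2. Summing the convolutions of \<open>W\<close>
  with the dyadic rescalings of \<open>k\<close> gives a potential \<open>p\<close> with \<open>\<Delta> p = \<phi> * W - W\<close>, where \<open>\<phi> * W\<close> is bounded,
  and the growth of \<open>W\<close> makes \<open>p\<close> differentiable with a remainder \<open>O(\<bar>x - a\<bar>\<^bsup>1 + \<beta>\<^esup>)\<close>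
  (\<open>potential_taylor\<close>). The same kernels show that \<open>u\<close> agrees almost everywhere with a continuous
  function \<open>v\<close>, which differs from its mollification at scale \<open>t\<close> by \<open>O(t\<^bsup>1 + 2 \<beta>\<^esup>)\<close>
  (\<open>mean_value_estimate\<close>); this \<open>v\<close> is the precise representative.

  A smooth \<open>Q\<close> with large Laplacian turns into a barrier \<open>Q - p \<le> 1\<close> for every \<open>v / c\<close> with \<open>c > 0\<close>, because
  \<open>g / c \<ge> - V v / c \<ge> - W\<close> wherever \<open>v / c < 1\<close> (\<open>barrier_pointwise\<close>). With Gaussians for \<open>Q\<close> this gives the
  strong maximum principle, so \<open>v > 0\<close> in \<open>\<Omega>\<close>.

  At the boundary point let \<open>\<xi> x = (x - a) \<bullet> n\<close>. Suppose that \<open>v \<ge> m \<xi> - e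
  r\<close> on \<open>\<Omega>\<close> within distance \<open>r\<close> of \<open>a\<close>, and that \<open>v \<ge> m
  \<xi> + \<delta> r\<close> on a small ball around \<open>a + (r / 4) n\<close>. One barrier then improves the slope
  \<open>m\<close> by a multiple of \<open>\<delta>\<close> at the price of a multiple of \<open>e + r\<close>, with
  errors quadratic in \<open>x - a\<close> or of order \<open>r\<^bsup>1 + \<beta>\<^esup>\<close>
  (\<open>one_step\<close>). Iterating with \<open>\<delta> = 0\<close> over the radii \<open>r / 16\<^sup>k\<close>
  makes the errors summable, since the powers of exponent \<open>\<beta>\<close> of these radii form a convergent
  series: in the limit some slope \<open>m'\<close> close to \<open>m\<close> is \<open>admissible\<close>, meaning that
  \<open>v \<ge> m' \<xi> - o(\<bar>x - a\<bar>)\<close> (\<open>iteration\<close>). Positivity in the interior starts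
  this scheme and makes a positive slope admissible (\<open>hopf\<close>).

  Let \<open>m\<close> be the largest admissible slope; the linear upper bound makes it finite. The lower limit of
  \<open>v (a + t n) / t\<close> is at least \<open>m\<close>. If the upper limit exceeded \<open>m\<close>, the mean value estimate, applied as a
  Harnack inequality to the almost nonnegative function \<open>v - m \<xi>\<close>, would spread the excess at
  \<open>a + t n\<close> over a ball of comparable radius for arbitrarily small \<open>t\<close> (\<open>harnack_at_boundary\<close>), and \<open>one_step\<close>
  followed by the iteration would produce an admissible slope larger than \<open>m\<close>
  (\<open>growth_of_slope\<close>). So the limit exists, equals \<open>m\<close> and is positive.\<close>

section \<open>Calculus of smooth functions\<close>

lemma partial_deriv_eq: "(f has_derivative f') (at x) \<Longrightarrow> partial_deriv b f x = f' b"
  by (simp add: partial_deriv_def frechet_derivative_at[symmetric])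

lemma partial_deriv_cong_open:
  assumes "open S" "x \<in> S" "\<And>y. y \<in> S \<Longrightarrow> f y = g y"
  shows "partial_deriv b f x = partial_deriv b g x"
proof -
  have "(f has_derivative f') (at x) = (g has_derivative f') (at x)" for f'
    using has_derivative_transform_within_open[OF _ assms(1,2), of f f' UNIV g]
      has_derivative_transform_within_open[OF _ assms(1,2), of g f' UNIV f] assms(3) by auto
  then show ?thesis by (simp add: partial_deriv_def frechet_derivative_def)
qed

lemma differentiable_cong_open:
  assumes "open S" "x \<in> S" "\<And>y. y \<in> S \<Longrightarrow> f y = g y" "f differentiable (at x)"
  shows "g differentiable (at x)"
  using assms has_derivative_transform_within_open[OF _ assms(1,2), of f _ UNIV g]
  unfolding differentiable_def by blast

lemma Ck_on_subset: "Ck_on k S f \<Longrightarrow> T \<subseteq> S \<Longrightarrow> Ck_on k T f"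
proof (induction k arbitrary: f)
  case 0
  then show ?case using continuous_on_subset by auto
next
  case (Suc k)
  then show ?case by auto
qed

lemma Ck_on_imp_continuous: "Ck_on k S f \<Longrightarrow> continuous_on S f"
  by (cases k) (auto intro!: continuous_at_imp_continuous_on differentiable_imp_continuous_within)

lemma Ck_on_Suc_imp: "Ck_on (Suc k) S f \<Longrightarrow> Ck_on k S f"
proof (induction k arbitrary: f)
  case 0
  then show ?case using Ck_on_imp_continuous[of "Suc 0" S f] by simp
next
  case (Suc k)
  then show ?case by (metis Ck_on.simps(2))
qed

lemma Ck_on_locally:
  assumes "\<And>x. x \<in> S \<Longrightarrow> \<exists>U h. open U \<and> x \<in> U \<and> (\<forall>y\<in>U. f y = h y) \<and> Ck_on k U h"
  shows "Ck_on k S f"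
  using assms
proof (induction k arbitrary: f)
  case 0
  show ?case unfolding Ck_on.simps
  proof (rule continuous_at_imp_continuous_on, rule ballI)
    fix x assume "x \<in> S"
    with 0 obtain U h where U: "open U" "x \<in> U" "\<forall>y\<in>U. f y = h y" "continuous_on U h"
      by (metis Ck_on.simps(1))
    then have "continuous_on U f" using continuous_on_cong by (metis (no_types, lifting))
    then show "isCont f x" using U continuous_on_eq_continuous_at by blast
  qed
next
  case (Suc k)
  show ?case unfolding Ck_on.simps
  proof (intro conjI ballI)
    fix x assume "x \<in> S"
    with Suc.prems obtain U h where U: "open U" "x \<in> U" "\<forall>y\<in>U. f y = h y" "Ck_on (Suc k) U h"
      by blast
    then show "f differentiable at x" using differentiable_cong_open[of U x h f] by auto
  next
    fix b :: 'a assume b: "b \<in> Basis"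
    show "Ck_on k S (partial_deriv b f)"
    proof (rule Suc.IH)
      fix x assume "x \<in> S"
      with Suc.prems obtain U h where U: "open U" "x \<in> U" "\<forall>y\<in>U. f y = h y" "Ck_on (Suc k) U h"
        by blast
      then have "\<forall>y\<in>U. partial_deriv b f y = partial_deriv b h y"
        using partial_deriv_cong_open[of U _ f h] by auto
      with U b show "\<exists>U h. open U \<and> x \<in> U \<and> (\<forall>y\<in>U. partial_deriv b f y = h y) \<and> Ck_on k U h"
        by (intro exI[of _ U] exI[of _ "partial_deriv b h"]) auto
    qed
  qed
qed

lemma Ck_on_cong:
  assumes "open S" "\<And>x. x \<in> S \<Longrightarrow> f x = g x" "Ck_on k S f"
  shows "Ck_on k S g"
  by (rule Ck_on_locally) (use assms in \<open>auto intro!: exI[of _ S] exI[of _ f]\<close>)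

lemma Ck_on_const [simp]: "Ck_on k S (\<lambda>x. c)"
proof (induction k arbitrary: c)
  case (Suc k)
  have "partial_deriv b (\<lambda>x. c) = (\<lambda>x::'a. 0)" for b
    by (rule ext, rule partial_deriv_eq) auto
  with Suc show ?case by auto
qed auto

lemma partial_deriv_add:
  "f differentiable (at x) \<Longrightarrow> g differentiable (at x) \<Longrightarrow>
    partial_deriv b (\<lambda>x. f x + g x) x = partial_deriv b f x + partial_deriv b g x"
  using partial_deriv_eq[OF has_derivative_add[OF has_derivative_grad has_derivative_grad], of f x g b]
    partial_deriv_eq[OF has_derivative_grad, of f x b] partial_deriv_eq[OF has_derivative_grad, of g x b]
  by simp

lemma partial_deriv_mult:
  assumes "f differentiable (at x)" "g differentiable (at x)"
  shows "partial_deriv b (\<lambda>x. f x * g x) x = f x * partial_deriv b g x + partial_deriv b f x * g x"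
  by (rule partial_deriv_eq[THEN trans])
     (rule has_derivative_mult[OF has_derivative_grad[OF assms(1)] has_derivative_grad[OF assms(2)]],
      use partial_deriv_eq[OF has_derivative_grad[OF assms(1)]]
        partial_deriv_eq[OF has_derivative_grad[OF assms(2)]] in simp)

lemma Ck_on_add:
  "open S \<Longrightarrow> Ck_on k S f \<Longrightarrow> Ck_on k S g \<Longrightarrow> Ck_on k S (\<lambda>x. f x + g x)"
proof (induction k arbitrary: f g)
  case 0
  then show ?case by (auto intro: continuous_intros)
next
  case (Suc k)
  show ?case unfolding Ck_on.simps
  proof (intro conjI ballI)
    fix b :: 'a assume b: "b \<in> Basis"
    show "Ck_on k S (partial_deriv b (\<lambda>x. f x + g x))"
      by (rule Ck_on_cong[OF Suc.prems(1) _ Suc.IH[of "partial_deriv b f" "partial_deriv b g"]])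
         (use Suc.prems b in \<open>auto simp: partial_deriv_add\<close>)
  qed (use Suc.prems in auto)
qed

lemma Ck_on_mult:
  "open S \<Longrightarrow> Ck_on k S f \<Longrightarrow> Ck_on k S g \<Longrightarrow> Ck_on k S (\<lambda>x. f x * g x)"
proof (induction k arbitrary: f g)
  case 0
  then show ?case by (auto intro: continuous_intros)
next
  case (Suc k)
  show ?case unfolding Ck_on.simps
  proof (intro conjI ballI)
    fix b :: 'a assume b: "b \<in> Basis"
    have 1: "Ck_on k S (\<lambda>x. f x * partial_deriv b g x)"
      by (rule Suc.IH) (use Suc.prems b Ck_on_Suc_imp in auto)
    have 2: "Ck_on k S (\<lambda>x. partial_deriv b f x * g x)"
      by (rule Suc.IH) (use Suc.prems b Ck_on_Suc_imp in auto)
    show "Ck_on k S (partial_deriv b (\<lambda>x. f x * g x))"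
      by (rule Ck_on_cong[OF Suc.prems(1) _ Ck_on_add[OF Suc.prems(1) 1 2]])
         (use Suc.prems b in \<open>auto simp: partial_deriv_mult\<close>)
  qed (use Suc.prems in auto)
qed

lemma partial_deriv_chain:
  assumes "f differentiable (at x)" "(F has_real_derivative F') (at (f x))"
  shows "partial_deriv b (\<lambda>x. F (f x)) x = F' * partial_deriv b f x"
proof -
  have "((\<lambda>x. F (f x)) has_derivative (\<lambda>v. F' * (grad f x \<bullet> v))) (at x)"
    by (rule has_derivative_compose[OF has_derivative_grad[OF assms(1)]])
       (use assms(2) in \<open>simp add: has_field_derivative_def\<close>)
  from partial_deriv_eq[OF this] partial_deriv_eq[OF has_derivative_grad[OF assms(1)]]
  show ?thesis by simp
qed

text \<open>A function of one variable comes with the whole sequence of its derivatives, so that the chain rule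
  below is an induction over the order with a variable starting index.\<close>

definition smooth_real :: "(real \<Rightarrow> real) \<Rightarrow> bool" where
  "smooth_real f \<longleftrightarrow> (\<exists>F. F 0 = f \<and> (\<forall>n s. (F n has_real_derivative F (Suc n) s) (at s)))"

lemma Ck_on_compose:
  assumes "open S" "\<And>n s. (F n has_real_derivative F (Suc n) s) (at s)" "Ck_on k S f"
  shows "Ck_on k S (\<lambda>x. F n (f x))"
  using assms(3)
proof (induction k arbitrary: n)
  case 0
  have "continuous_on UNIV (F n)"
    using assms(2) by (intro continuous_at_imp_continuous_on ballI DERIV_isCont) blast
  with 0 show ?case by (auto intro: continuous_on_compose2[of UNIV "F n"])
next
  case (Suc k)
  show ?case unfolding Ck_on.simps
  proof (intro conjI ballI)
    fix x assume "x \<in> S"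
    then have "f differentiable (at x)" using Suc.prems by auto
    from has_derivative_compose[OF has_derivative_grad[OF this]
        assms(2)[of n "f x", unfolded has_field_derivative_def]]
    show "(\<lambda>x. F n (f x)) differentiable at x"
      by (rule differentiableI)
  next
    fix b :: 'a assume b: "b \<in> Basis"
    have "Ck_on k S (\<lambda>x. F (Suc n) (f x) * partial_deriv b f x)"
      using Suc b by (intro Ck_on_mult assms(1) Suc.IH Ck_on_Suc_imp[OF Suc.prems]) auto
    then show "Ck_on k S (partial_deriv b (\<lambda>x. F n (f x)))"
      by (rule Ck_on_cong[OF assms(1), rotated])
         (use Suc.prems in \<open>auto intro!: partial_deriv_chain[OF _ assms(2), symmetric]\<close>)
  qed
qed

lemma smooth_on_const [simp]: "smooth_on S (\<lambda>x. c)"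
  by (simp add: smooth_on_def)

lemma smooth_on_add: "open S \<Longrightarrow> smooth_on S f \<Longrightarrow> smooth_on S g \<Longrightarrow> smooth_on S (\<lambda>x. f x + g x)"
  by (simp add: smooth_on_def Ck_on_add)

lemma smooth_on_mult: "open S \<Longrightarrow> smooth_on S f \<Longrightarrow> smooth_on S g \<Longrightarrow> smooth_on S (\<lambda>x. f x * g x)"
  by (simp add: smooth_on_def Ck_on_mult)

lemma smooth_on_diff:
  assumes "open S" "smooth_on S f" "smooth_on S g" shows "smooth_on S (\<lambda>x. f x - g x)"
  using smooth_on_add[OF assms(1,2) smooth_on_mult[OF assms(1) smooth_on_const[of S "-1"] assms(3)]] by simp

lemma smooth_on_minus:
  assumes "open S" "smooth_on S f" shows "smooth_on S (\<lambda>x. - f x)"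
  using smooth_on_diff[OF assms(1) smooth_on_const[of S 0] assms(2)] by simp

lemma smooth_on_sum:
  "open S \<Longrightarrow> (\<And>i. i \<in> I \<Longrightarrow> smooth_on S (f i)) \<Longrightarrow> smooth_on S (\<lambda>x. \<Sum>i\<in>I. f i x)"
  by (induction I rule: infinite_finite_induct) (auto intro: smooth_on_add)

lemma smooth_on_compose: "open S \<Longrightarrow> smooth_real F \<Longrightarrow> smooth_on S f \<Longrightarrow> smooth_on S (\<lambda>x. F (f x))"
  unfolding smooth_on_def smooth_real_def using Ck_on_compose[of S _ _ f 0] by blast

lemma smooth_on_partial: "smooth_on S f \<Longrightarrow> b \<in> Basis \<Longrightarrow> smooth_on S (partial_deriv b f)"
  unfolding smooth_on_def using Ck_on.simps(2) by blast

lemma smooth_on_differentiable: "smooth_on S f \<Longrightarrow> x \<in> S \<Longrightarrow> f differentiable (at x)"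
  unfolding smooth_on_def using Ck_on.simps(2) by blast

lemma smooth_on_continuous: "smooth_on S f \<Longrightarrow> continuous_on S f"
  unfolding smooth_on_def using Ck_on.simps(1) by blast

lemma smooth_on_subset: "smooth_on S f \<Longrightarrow> T \<subseteq> S \<Longrightarrow> smooth_on T f"
  unfolding smooth_on_def using Ck_on_subset by blast

lemma smooth_on_locally:
  assumes "\<And>x. x \<in> S \<Longrightarrow> \<exists>U h. open U \<and> x \<in> U \<and> (\<forall>y\<in>U. f y = h y) \<and> smooth_on U h"
  shows "smooth_on S f"
  unfolding smooth_on_def
proof
  fix k show "Ck_on k S f"
  proof (rule Ck_on_locally)
    fix x assume "x \<in> S"
    from assms[OF this] obtain U h where "open U" "x \<in> U" "\<forall>y\<in>U. f y = h y" "smooth_on U h" by blast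
    then show "\<exists>U h. open U \<and> x \<in> U \<and> (\<forall>y\<in>U. f y = h y) \<and> Ck_on k U h"
      unfolding smooth_on_def by (intro exI[of _ U] exI[of _ h]) auto
  qed
qed

lemma partial_deriv_linear:
  assumes "bounded_linear f" shows "partial_deriv b f = (\<lambda>x. f b)"
  by (rule ext, rule partial_deriv_eq, rule bounded_linear_imp_has_derivative[OF assms])

lemma smooth_on_linear: assumes "bounded_linear f" shows "smooth_on S f"
  unfolding smooth_on_def
proof
  fix k show "Ck_on k S f"
    by (cases k) (auto simp: partial_deriv_linear[OF assms] linear_continuous_on[OF assms]
      bounded_linear_imp_differentiable[OF assms])
qed

lemma smooth_on_inner: "smooth_on S (\<lambda>x. (x - a) \<bullet> b)"
proof -
  have "smooth_on UNIV (\<lambda>x. x \<bullet> b - a \<bullet> b)"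
    by (intro smooth_on_diff smooth_on_linear bounded_linear_inner_left smooth_on_const) auto
  then show ?thesis by (auto simp: inner_diff_left intro: smooth_on_subset)
qed

lemma smooth_on_norm_square: "smooth_on S (\<lambda>x::'a::euclidean_space. (norm (x - a))\<^sup>2)"
proof -
  have "(norm (x - a))\<^sup>2 = (\<Sum>b\<in>Basis. ((x - a) \<bullet> b) * ((x - a) \<bullet> b))" for x :: 'a
    unfolding power2_norm_eq_inner by (rule euclidean_inner)
  moreover have "smooth_on UNIV (\<lambda>x::'a. \<Sum>b\<in>Basis. ((x - a) \<bullet> b) * ((x - a) \<bullet> b))"
    by (intro smooth_on_sum smooth_on_mult smooth_on_inner) auto
  ultimately show ?thesis by (auto intro: smooth_on_subset)
qed

lemma grad_eqI:
  assumes "(f has_derivative (\<lambda>v. g \<bullet> v)) (at x)" shows "grad f x = g"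
  unfolding grad_def partial_deriv_eq[OF assms] by (simp add: euclidean_representation)

lemma partial_deriv_inner_grad: "b \<in> Basis \<Longrightarrow> grad f x \<bullet> b = partial_deriv b f x"
  unfolding grad_def by (simp add: inner_sum_left inner_Basis if_distrib cong: if_cong)

lemma grad_mult: "f differentiable (at x) \<Longrightarrow> g differentiable (at x) \<Longrightarrow>
    grad (\<lambda>x. f x * g x) x = f x *\<^sub>R grad g x + g x *\<^sub>R grad f x"
  by (simp add: grad_def partial_deriv_mult sum.distrib algebra_simps scaleR_sum_right)

lemma grad_chain: "f differentiable (at x) \<Longrightarrow> (F has_real_derivative F') (at (f x)) \<Longrightarrow>
   grad (\<lambda>x. F (f x)) x = F' *\<^sub>R grad f x"
  by (simp add: grad_def partial_deriv_chain scaleR_sum_right)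

lemma grad_cong_open:
  assumes "open S" "x \<in> S" "\<And>y. y \<in> S \<Longrightarrow> f y = g y"
  shows "grad f x = grad g x"
  unfolding grad_def using partial_deriv_cong_open[OF assms] by simp

lemma partial_deriv_cmult: "f differentiable (at x) \<Longrightarrow> partial_deriv b (\<lambda>x. c * f x) x = c * partial_deriv b f x"
proof (subst partial_deriv_mult)
  show "f differentiable at x \<Longrightarrow> c * partial_deriv b f x + partial_deriv b (\<lambda>x. c) x * f x = c * partial_deriv b f x"
    by (simp add: partial_deriv_eq[OF has_derivative_const])
qed auto

lemma grad_cmult: "f differentiable (at x) \<Longrightarrow> grad (\<lambda>x. c * f x) x = c *\<^sub>R grad f x"
  by (simp add: grad_def partial_deriv_cmult scaleR_sum_right)

lemma laplacian_add: 
  assumes "smooth_on UNIV f" "smooth_on UNIV g"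
  shows "laplacian (\<lambda>x. f x + g x) x = laplacian f x + laplacian g x"
proof -
  have "partial_deriv b (\<lambda>x. f x + g x) = (\<lambda>x. partial_deriv b f x + partial_deriv b g x)" for b
    using assms smooth_on_differentiable by (intro ext partial_deriv_add) blast+
  then have "partial_deriv b (partial_deriv b (\<lambda>x. f x + g x)) x 
      = partial_deriv b (partial_deriv b f) x + partial_deriv b (partial_deriv b g) x" if "b \<in> Basis" for b
    using smooth_on_partial[OF _ that] assms smooth_on_differentiable by (simp, intro partial_deriv_add) blast+
  then show ?thesis by (simp add: laplacian_def sum.distrib)
qed

lemma laplacian_cmult:
  assumes "smooth_on UNIV f" shows "laplacian (\<lambda>x. c * f x) x = c * laplacian f x"
proof -
  have "partial_deriv b (\<lambda>x. c * f x) = (\<lambda>x. c * partial_deriv b f x)" for b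
    using assms smooth_on_differentiable by (intro ext partial_deriv_cmult) blast+
  then have "partial_deriv b (partial_deriv b (\<lambda>x. c * f x)) x 
      = c * partial_deriv b (partial_deriv b f) x" if "b \<in> Basis" for b
    using smooth_on_partial[OF _ that] assms smooth_on_differentiable by (simp, intro partial_deriv_cmult) blast+
  then show ?thesis by (simp add: laplacian_def sum_distrib_left)
qed

lemma laplacian_diff: 
  assumes "smooth_on UNIV f" "smooth_on UNIV g"
  shows "laplacian (\<lambda>x. f x - g x) x = laplacian f x - laplacian g x"
  using laplacian_add[OF assms(1), of "\<lambda>x. -1 * g x"] laplacian_cmult[OF assms(2), of "-1"] 
     smooth_on_minus[OF _ assms(2)] by simp

lemma laplacian_const [simp]: "laplacian (\<lambda>x. c) x = 0"
proof -
  have "partial_deriv b (\<lambda>x. c) = (\<lambda>x::'a. 0)" for b and c :: real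
    by (rule ext, rule partial_deriv_eq) auto
  then show ?thesis by (simp add: laplacian_def)
qed

lemma laplacian_sum:
  assumes "finite I" "\<And>i. i \<in> I \<Longrightarrow> smooth_on UNIV (f i)"
  shows "laplacian (\<lambda>x. \<Sum>i\<in>I. f i x) x = (\<Sum>i\<in>I. laplacian (f i) x)"
  using assms by (induction I rule: finite_induct) (auto simp: laplacian_add smooth_on_sum)

lemma laplacian_inner [simp]: "laplacian (\<lambda>x. (x - a) \<bullet> v) x = 0"
proof -
  have "partial_deriv b (\<lambda>x. (x - a) \<bullet> v) = (\<lambda>x. b \<bullet> v)" for b
    by (rule ext, rule partial_deriv_eq) (auto intro!: derivative_eq_intros)
  moreover have "partial_deriv b (\<lambda>x. c) = (\<lambda>x::'a. 0)" for b and c :: real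
    by (rule ext, rule partial_deriv_eq) auto
  ultimately show ?thesis by (simp add: laplacian_def)
qed

lemma laplacian_radial:
  fixes a :: "'a::euclidean_space" and F F1 F2 :: "real \<Rightarrow> real"
  assumes F: "\<And>s. (F has_real_derivative F1 s) (at s)" "\<And>s. (F1 has_real_derivative F2 s) (at s)"
  shows "laplacian (\<lambda>x::'a. F ((norm (x - a))\<^sup>2)) x 
    = 4 * (norm (x - a))\<^sup>2 * F2 ((norm (x - a))\<^sup>2) + 2 * real DIM('a) * F1 ((norm (x - a))\<^sup>2)"
proof -
  have D: "((\<lambda>x::'a. G ((norm (x - a))\<^sup>2)) has_derivative (\<lambda>v. G1 ((norm (x - a))\<^sup>2) * (2 * ((x - a) \<bullet> v)))) (at x)"
    if "\<And>s. (G has_real_derivative G1 s) (at s)" for G G1 x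
  proof -
    have "((\<lambda>x. (norm (x - a))\<^sup>2) has_derivative (\<lambda>v. 2 * ((x - a) \<bullet> v))) (at x)"
      unfolding power2_norm_eq_inner
      by (auto intro!: derivative_eq_intros simp: inner_commute)
    from has_derivative_compose[OF this, of G "\<lambda>h. G1 ((norm (x - a))\<^sup>2) * h"] that
    show ?thesis by (simp add: has_field_derivative_def)
  qed
  have 1: "partial_deriv b (\<lambda>x. F ((norm (x - a))\<^sup>2)) = (\<lambda>x. F1 ((norm (x - a))\<^sup>2) * (2 * ((x - a) \<bullet> b)))" for b
    using partial_deriv_eq[OF D[OF F(1)]] by auto
  have 2: "partial_deriv b (\<lambda>x. F1 ((norm (x - a))\<^sup>2) * (2 * ((x - a) \<bullet> b))) x
     = 4 * F2 ((norm (x - a))\<^sup>2) * (((x - a) \<bullet> b) * ((x - a) \<bullet> b)) + 2 * F1 ((norm (x - a))\<^sup>2)" if "b \<in> Basis" for b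
  proof -
    have "((\<lambda>x. 2 * ((x - a) \<bullet> b)) has_derivative (\<lambda>v. 2 * (v \<bullet> b))) (at x)"
      by (auto intro!: derivative_eq_intros)
    from partial_deriv_eq[OF has_derivative_mult[OF D[OF F(2)] this], of b] that
    show ?thesis by (simp add: inner_Basis del: inner_diff_left)
  qed
  have "laplacian (\<lambda>x. F ((norm (x - a))\<^sup>2)) x
     = (\<Sum>b\<in>Basis. 4 * F2 ((norm (x - a))\<^sup>2) * (((x - a) \<bullet> b) * ((x - a) \<bullet> b)) + 2 * F1 ((norm (x - a))\<^sup>2))"
    unfolding laplacian_def 1 by (rule sum.cong) (use 2 in auto)
  also have "\<dots> = 4 * F2 ((norm (x - a))\<^sup>2) * ((x - a) \<bullet> (x - a)) + 2 * real DIM('a) * F1 ((norm (x - a))\<^sup>2)"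
    unfolding sum.distrib sum_distrib_left[symmetric] by (subst euclidean_inner[of "x - a" "x - a"]) simp
  finally show ?thesis by (simp add: power2_norm_eq_inner)
qed

lemma laplacian_coordinate_square:
  fixes v :: "'a::euclidean_space"
  shows "laplacian (\<lambda>x. ((x - a) \<bullet> v + c)\<^sup>2) x = 2 * (v \<bullet> v)"
proof -
  have D: "((\<lambda>x. (x - a) \<bullet> v + c) has_derivative (\<lambda>h. h \<bullet> v)) (at x)" for x
    by (auto intro!: derivative_eq_intros)
  have 1: "partial_deriv b (\<lambda>x. ((x - a) \<bullet> v + c)\<^sup>2) = (\<lambda>x. 2 * (b \<bullet> v) * ((x - a) \<bullet> v + c))" for b
  proof
    fix x show "partial_deriv b (\<lambda>x. ((x - a) \<bullet> v + c)\<^sup>2) x = 2 * (b \<bullet> v) * ((x - a) \<bullet> v + c)"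
      using partial_deriv_eq[OF has_derivative_mult[OF D D], of b x] by (simp add: power2_eq_square algebra_simps)
  qed
  have 2: "partial_deriv b (\<lambda>x. 2 * (b \<bullet> v) * ((x - a) \<bullet> v + c)) x = 2 * ((v \<bullet> b) * (v \<bullet> b))" for b
    using partial_deriv_cmult[OF differentiableI[OF D], of b "2 * (b \<bullet> v)" x] partial_deriv_eq[OF D, of b x]
    by (simp add: inner_commute)
  show ?thesis unfolding laplacian_def 1 2 sum_distrib_left[symmetric] by (subst euclidean_inner[of v v]) simp
qed

section \<open>A smooth bump and test functions\<close>

fun bump_poly :: "nat \<Rightarrow> real poly" where
  "bump_poly 0 = 1"
| "bump_poly (Suc n) = [:0, 0, 1:] * (bump_poly n - pderiv (bump_poly n))"

text \<open>The \<open>n\<close>-th derivative of the function equal to \<open>exp (- 1 / s)\<close> for \<open>s > 0\<close> and to 0 otherwise.\<close>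

definition bump_deriv :: "nat \<Rightarrow> real \<Rightarrow> real" where
  "bump_deriv n s = (if s > 0 then poly (bump_poly n) (1 / s) * exp (- (1 / s)) else 0)"

lemma poly_exp_decay: "((\<lambda>y. poly p y * exp (- y)) \<longlongrightarrow> (0::real)) at_top"
proof -
  have "((\<lambda>y. \<Sum>i\<le>degree p. coeff p i * (y ^ i / exp y)) \<longlongrightarrow> (\<Sum>i\<le>degree p. coeff p i * 0)) at_top"
    by (intro tendsto_sum tendsto_mult tendsto_const tendsto_power_div_exp_0)
  then show ?thesis
    by (simp add: poly_altdef exp_minus sum_distrib_right divide_inverse mult.assoc)
qed

lemma bump_deriv_tendsto_0: "((\<lambda>h. bump_deriv n h / h) \<longlongrightarrow> 0) (at 0)"
proof -
  have "((\<lambda>h. poly ([:0,1:] * bump_poly n) (inverse h) * exp (- inverse h)) \<longlongrightarrow> 0) (at_right 0)"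
    by (rule filterlim_compose[OF poly_exp_decay filterlim_inverse_at_top_right])
  moreover have "eventually (\<lambda>h. poly ([:0,1:] * bump_poly n) (inverse h) * exp (- inverse h) = bump_deriv n h / h) (at_right (0::real))"
    using eventually_at_right_less[of "0::real"]
    by eventually_elim (simp add: bump_deriv_def divide_inverse)
  ultimately have "((\<lambda>h. bump_deriv n h / h) \<longlongrightarrow> 0) (at_right 0)"
    by (rule Lim_transform_eventually)
  moreover have "((\<lambda>h. bump_deriv n h / h) \<longlongrightarrow> 0) (at_left 0)"
    by (rule Lim_transform_eventually[OF tendsto_const])
       (auto simp: bump_deriv_def eventually_at_left_field intro!: exI[of _ "-1"])
  ultimately show ?thesis by (simp add: filterlim_at_split)
qed

lemma bump_deriv_DERIV: "(bump_deriv n has_real_derivative bump_deriv (Suc n) s) (at s)"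
proof -
  consider "s > 0" | "s < 0" | "s = 0" by linarith
  then show ?thesis
  proof cases
    case 1
    have "((\<lambda>s. poly (bump_poly n) (1 / s) * exp (- (1 / s))) has_real_derivative
        poly (pderiv (bump_poly n)) (1 / s) * (- (1 / s^2)) * exp (- (1 / s))
        + exp (- (1 / s)) * (1 / s^2) * poly (bump_poly n) (1 / s)) (at s)"
      using 1 by (auto intro!: derivative_eq_intros DERIV_chain2[OF poly_DERIV] simp: power2_eq_square)
    then have "((\<lambda>s. poly (bump_poly n) (1 / s) * exp (- (1 / s))) has_real_derivative bump_deriv (Suc n) s) (at s)"
      using 1 by (simp add: bump_deriv_def power2_eq_square algebra_simps)
    then show ?thesis
      by (rule has_field_derivative_transform_within_open[of _ _ _ "{0<..}"]) (use 1 in \<open>auto simp: bump_deriv_def\<close>)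
  next
    case 2
    have "((\<lambda>s. 0) has_real_derivative bump_deriv (Suc n) s) (at s)"
      using 2 by (simp add: bump_deriv_def)
    then show ?thesis
      by (rule has_field_derivative_transform_within_open[of _ _ _ "{..<0}"]) (use 2 in \<open>auto simp: bump_deriv_def\<close>)
  next
    case 3
    have "bump_deriv (Suc n) 0 = 0" "bump_deriv n 0 = 0" by (simp_all add: bump_deriv_def)
    with 3 bump_deriv_tendsto_0[of n] show ?thesis by (simp add: DERIV_def)
  qed
qed

lemma smooth_real_bump_deriv: "smooth_real (bump_deriv n)"
  unfolding smooth_real_def
  by (intro exI[of _ "\<lambda>m. bump_deriv (n + m)"]) (auto simp: bump_deriv_DERIV)

lemma bump_0: "bump_deriv 0 s = (if s > 0 then exp (- (1 / s)) else 0)"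
  by (simp add: bump_deriv_def)

lemma bump_1: "bump_deriv 1 s = (if s > 0 then (1 / s)^2 * exp (- (1 / s)) else 0)"
  by (simp add: bump_deriv_def power2_eq_square)

lemma bump_bounds: "0 \<le> bump_deriv 0 s" "bump_deriv 0 s \<le> 1" "0 \<le> bump_deriv 1 s" "bump_deriv 1 s \<le> 2"
proof -
  show "bump_deriv 1 s \<le> 2"
  proof (cases "s > 0")
    case True
    have "0 < 1 / s" using True by simp
    then have "(1 / s)^2 / 2 \<le> exp (1 / s)"
      using exp_lower_Taylor_quadratic[of "1/s"] by linarith
    with True show ?thesis by (simp add: bump_1 exp_minus field_simps del: One_nat_def)
  qed (simp add: bump_1 del: One_nat_def)
qed (simp_all add: bump_0 bump_1 del: One_nat_def)

lemma bump_pos: "s > 0 \<Longrightarrow> 0 < bump_deriv 0 s" "s > 0 \<Longrightarrow> 0 < bump_deriv 1 s"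
  by (simp_all add: bump_0 bump_1 del: One_nat_def)

lemma bump_eq_0: "s \<le> 0 \<Longrightarrow> bump_deriv n s = 0"
  by (auto simp: bump_deriv_def)

lemma bump_continuous: "continuous_on S (bump_deriv n)"
  by (rule continuous_at_imp_continuous_on) (use bump_deriv_DERIV DERIV_isCont in blast)

lemma bump_measurable [measurable]: "bump_deriv n \<in> borel_measurable borel"
  by (rule borel_measurable_continuous_onI[OF bump_continuous])

abbreviation "TF \<equiv> test_functions UNIV"

lemma TF_I:
  assumes "smooth_on UNIV f" "\<And>x. x \<notin> cball z R \<Longrightarrow> f x = 0"
  shows "f \<in> TF"
proof -
  have "closure {x. f x \<noteq> 0} \<subseteq> cball z R"
    by (rule closure_minimal) (use assms(2) in blast, simp)
  then show ?thesis using assms(1)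
    by (auto simp: test_functions_def compact_eq_bounded_closed intro: bounded_subset[OF bounded_cball])
qed

lemma test_functions_mono: "f \<in> test_functions S \<Longrightarrow> S \<subseteq> T \<Longrightarrow> f \<in> test_functions T"
  by (auto simp: test_functions_def)

lemma test_functions_D:
  assumes "f \<in> test_functions S"
  shows "smooth_on UNIV f" "continuous_on UNIV f" "f differentiable (at x)" "\<exists>R>0. \<forall>x. x \<notin> ball 0 R \<longrightarrow> f x = 0"
    "x \<notin> S \<Longrightarrow> f x = 0"
proof -
  show 1: "smooth_on UNIV f" using assms by (simp add: test_functions_def)
  from smooth_on_continuous[OF this] show "continuous_on UNIV f" .
  from smooth_on_differentiable[OF 1] show "f differentiable (at x)" by simp
  have "bounded (closure {x. f x \<noteq> 0})"
    using assms by (auto simp: test_functions_def compact_imp_bounded)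
  then have "bounded {x. f x \<noteq> 0}" using bounded_subset closure_subset by blast
  then obtain R where "R > 0" "\<forall>x\<in>{x. f x \<noteq> 0}. norm x < R" using bounded_pos_less by blast
  then show "\<exists>R>0. \<forall>x. x \<notin> ball 0 R \<longrightarrow> f x = 0" by (intro exI[of _ R]) auto
  show "x \<notin> S \<Longrightarrow> f x = 0" using assms closure_subset[of "{x. f x \<noteq> 0}"] by (auto simp: test_functions_def)
qed

lemma TF_vanish_nbhd:
  assumes "f \<in> test_functions S" "x \<notin> closure {x. f x \<noteq> 0}"
  shows "partial_deriv b f x = 0"
proof -
  have "partial_deriv b f x = partial_deriv b (\<lambda>x. 0) x"
    by (rule partial_deriv_cong_open[of "- closure {x. f x \<noteq> 0}"])
       (use assms(2) closure_subset[of "{x. f x \<noteq> 0}"] in auto)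
  then show ?thesis using partial_deriv_eq[OF has_derivative_const[of 0 "at x"]] by simp
qed

lemma test_functions_partial:
  assumes "f \<in> test_functions S" "b \<in> Basis"
  shows "partial_deriv b f \<in> test_functions S"
proof -
  have "{x. partial_deriv b f x \<noteq> 0} \<subseteq> closure {x. f x \<noteq> 0}"
    using TF_vanish_nbhd[OF assms(1)] by auto
  then have "closure {x. partial_deriv b f x \<noteq> 0} \<subseteq> closure {x. f x \<noteq> 0}"
    using closure_minimal by blast
  moreover from this have "bounded (closure {x. partial_deriv b f x \<noteq> 0})"
    using assms by (auto simp: test_functions_def intro: bounded_subset compact_imp_bounded)
  ultimately show ?thesis using assms smooth_on_partial
    by (auto simp: test_functions_def compact_eq_bounded_closed)
qed

lemma TF_mult:
  assumes "f \<in> test_functions S" "smooth_on UNIV g" 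
  shows "(\<lambda>x. g x * f x) \<in> test_functions S"
proof -
  have "{x. g x * f x \<noteq> 0} \<subseteq> {x. f x \<noteq> 0}" by auto
  then have "closure {x. g x * f x \<noteq> 0} \<subseteq> closure {x. f x \<noteq> 0}" by (rule closure_mono)
  moreover from this have "bounded (closure {x. g x * f x \<noteq> 0})"
    using assms by (auto simp: test_functions_def intro: bounded_subset compact_imp_bounded)
  ultimately show ?thesis using assms smooth_on_mult[OF open_UNIV]
    by (auto simp: test_functions_def compact_eq_bounded_closed)
qed

lemma TF_bounded:
  assumes "f \<in> test_functions S" shows "\<exists>C>0. \<forall>x. \<bar>f x\<bar> \<le> C"
proof -
  obtain R where R: "R > 0" "\<forall>x. x \<notin> ball 0 R \<longrightarrow> f x = 0" using test_functions_D(4)[OF assms] by blast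
  have "compact (f ` cball 0 R)"
    by (intro compact_continuous_image continuous_on_subset[OF test_functions_D(2)[OF assms]]) auto
  then obtain C where C: "C > 0" "\<forall>y\<in>f ` cball 0 R. norm y \<le> C"
    using compact_imp_bounded bounded_pos by blast
  then have "\<bar>f x\<bar> \<le> C" for x
    using R by (cases "x \<in> ball 0 R") auto
  with C show ?thesis by blast
qed

lemma norm_grad_le: "norm (grad f x) \<le> (\<Sum>b\<in>Basis. \<bar>partial_deriv b f x\<bar>)"
  by (rule norm_le_l1[THEN order_trans], rule sum_mono) (simp add: partial_deriv_inner_grad)

lemma lipschitz_from_grad:
  assumes "convex S" "\<And>x. x \<in> S \<Longrightarrow> f differentiable (at x)" "\<And>x. x \<in> S \<Longrightarrow> norm (grad f x - g) \<le> C"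
    "x \<in> S" "y \<in> S"
  shows "\<bar>f x - f y - g \<bullet> (x - y)\<bar> \<le> C * norm (x - y)"
proof -
  have "norm ((f x - g \<bullet> x) - (f y - g \<bullet> y)) \<le> C * norm (x - y)"
  proof (rule differentiable_bound[where f'="\<lambda>z v. (grad f z - g) \<bullet> v" and S=S])
    fix z assume "z \<in> S"
    have "((\<lambda>x. f x - g \<bullet> x) has_derivative (\<lambda>v. grad f z \<bullet> v - g \<bullet> v)) (at z within S)"
      by (intro has_derivative_diff has_derivative_at_withinI[OF has_derivative_grad[OF assms(2)[OF \<open>z \<in> S\<close>]]]
            bounded_linear_imp_has_derivative bounded_linear_inner_right)
    then show "((\<lambda>x. f x - g \<bullet> x) has_derivative (\<lambda>v. (grad f z - g) \<bullet> v)) (at z within S)"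
      by (simp add: inner_diff_left)
    show "onorm (\<lambda>v. (grad f z - g) \<bullet> v) \<le> C"
    proof (rule onorm_bound)
      show "0 \<le> C" using assms(3)[OF \<open>z \<in> S\<close>] norm_ge_zero order_trans by blast
      fix v
      have "norm ((grad f z - g) \<bullet> v) \<le> norm (grad f z - g) * norm v"
        using Cauchy_Schwarz_ineq2 by simp
      also have "\<dots> \<le> C * norm v" using assms(3)[OF \<open>z \<in> S\<close>] by (rule mult_right_mono) simp
      finally show "norm ((grad f z - g) \<bullet> v) \<le> C * norm v" .
    qed
  qed (use assms in auto)
  then show ?thesis by (simp add: inner_diff_right algebra_simps)
qed

lemma TF_lipschitz:
  assumes "f \<in> test_functions S" shows "\<exists>C>0. \<forall>x y. \<bar>f x - f y\<bar> \<le> C * norm (x - y)"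
proof -
  have "\<exists>C>0. \<forall>x. norm (grad f x) \<le> C"
  proof -
    have "\<forall>b\<in>Basis. \<exists>C>0. \<forall>x. \<bar>partial_deriv b f x\<bar> \<le> C"
      using TF_bounded test_functions_partial[OF assms] by blast
    then obtain C where C: "\<And>b. b \<in> Basis \<Longrightarrow> C b > 0" "\<And>b x. b \<in> Basis \<Longrightarrow> \<bar>partial_deriv b f x\<bar> \<le> C b"
      by metis
    have "norm (grad f x) \<le> (\<Sum>b\<in>Basis. C b)" for x
      using norm_grad_le[of f x] sum_mono[of Basis "\<lambda>b. \<bar>partial_deriv b f x\<bar>" C] C(2) by fastforce
    moreover have "(\<Sum>b\<in>Basis. C b) > 0" using C(1) by (intro sum_pos) auto
    ultimately show ?thesis by blast
  qed
  then obtain C where "C > 0" "\<And>x. norm (grad f x) \<le> C" by blast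
  then show ?thesis
    using lipschitz_from_grad[of UNIV f 0 C] test_functions_D(3)[OF assms] by (intro exI[of _ C]) auto
qed

text \<open>Second derivatives of a test function are bounded, hence its gradient is Lipschitz continuous.\<close>

lemma TF_taylor:
  assumes "f \<in> test_functions S" shows "\<exists>C>0. \<forall>x y. \<bar>f x - f y - grad f y \<bullet> (x - y)\<bar> \<le> C * (norm (x - y))\<^sup>2"
proof -
  have "\<forall>b\<in>Basis. \<exists>C>0. \<forall>x y. \<bar>partial_deriv b f x - partial_deriv b f y\<bar> \<le> C * norm (x - y)"
    using TF_lipschitz test_functions_partial[OF assms] by blast
  then obtain C where C: "\<And>b. b \<in> Basis \<Longrightarrow> C b > 0"
    "\<And>b x y. b \<in> Basis \<Longrightarrow> \<bar>partial_deriv b f x - partial_deriv b f y\<bar> \<le> C b * norm (x - y)"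
    by metis
  define D where "D = (\<Sum>b\<in>Basis. C b)"
  have D: "norm (grad f x - grad f y) \<le> D * norm (x - y)" for x y
  proof -
    have "norm (grad f x - grad f y) \<le> (\<Sum>b\<in>Basis. \<bar>(grad f x - grad f y) \<bullet> b\<bar>)" by (rule norm_le_l1)
    also have "\<dots> \<le> (\<Sum>b\<in>Basis. C b * norm (x - y))"
      using C(2) by (intro sum_mono) (auto simp: inner_diff_left partial_deriv_inner_grad)
    finally show ?thesis by (simp add: D_def sum_distrib_right)
  qed
  have "D > 0" unfolding D_def using C(1) by (intro sum_pos) auto
  moreover have "\<bar>f x - f y - grad f y \<bullet> (x - y)\<bar> \<le> D * (norm (x - y))\<^sup>2" for x y
  proof -
    have "\<bar>f x - f y - grad f y \<bullet> (x - y)\<bar> \<le> (D * norm (x - y)) * norm (x - y)"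
    proof (rule lipschitz_from_grad[of "cball y (norm (x - y))"])
      fix z assume "z \<in> cball y (norm (x - y))"
      then have "norm (z - y) \<le> norm (x - y)" by (simp add: dist_norm norm_minus_commute)
      with D[of z y] \<open>D > 0\<close> show "norm (grad f z - grad f y) \<le> D * norm (x - y)"
        by (meson mult_left_mono order_trans less_imp_le)
    qed (use test_functions_D(3)[OF assms] in \<open>auto simp: dist_norm norm_minus_commute\<close>)
    then show ?thesis by (simp add: power2_eq_square mult.assoc)
  qed
  ultimately show ?thesis by blast
qed

lemma partial_deriv_scale:
  assumes "f differentiable (at (c *\<^sub>R (x - y)))"
  shows "partial_deriv b (\<lambda>x. f (c *\<^sub>R (x - y))) x = c * partial_deriv b f (c *\<^sub>R (x - y))"
proof -
  have "((\<lambda>x. c *\<^sub>R (x - y)) has_derivative (\<lambda>v. c *\<^sub>R v)) (at x)"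
    by (auto intro!: derivative_eq_intros)
  from partial_deriv_eq[OF has_derivative_compose[OF this has_derivative_grad[OF assms]], of b]
    partial_deriv_eq[OF has_derivative_grad[OF assms], of b]
  show ?thesis by simp
qed

lemma Ck_on_scale:
  "Ck_on k UNIV f \<Longrightarrow> Ck_on k UNIV (\<lambda>x. f (c *\<^sub>R (x - y)))"
proof (induction k arbitrary: f)
  case 0
  then show ?case by (auto intro!: continuous_on_compose2[of UNIV f] continuous_intros)
next
  case (Suc k)
  have "partial_deriv b (\<lambda>x. f (c *\<^sub>R (x - y))) = (\<lambda>x. c * partial_deriv b f (c *\<^sub>R (x - y)))" for b
    using Suc.prems by (intro ext partial_deriv_scale) auto
  moreover have "(\<lambda>x. f (c *\<^sub>R (x - y))) differentiable (at x)" for x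
  proof -
    have "((\<lambda>x. c *\<^sub>R (x - y)) has_derivative (\<lambda>v. c *\<^sub>R v)) (at x)"
      by (auto intro!: derivative_eq_intros)
    from has_derivative_compose[OF this has_derivative_grad, of f] Suc.prems
    show ?thesis by (auto intro: differentiableI)
  qed
  ultimately show ?case using Suc by (auto intro!: Ck_on_mult)
qed

lemma smooth_on_scale: "smooth_on UNIV f \<Longrightarrow> smooth_on UNIV (\<lambda>x. f (c *\<^sub>R (x - y)))"
  by (simp add: smooth_on_def Ck_on_scale)

lemma laplacian_scale:
  assumes "smooth_on UNIV f"
  shows "laplacian (\<lambda>x. f (c *\<^sub>R (x - y))) x = c\<^sup>2 * laplacian f (c *\<^sub>R (x - y))"
proof -
  have "partial_deriv b (\<lambda>x. f (c *\<^sub>R (x - y))) = (\<lambda>x. c * partial_deriv b f (c *\<^sub>R (x - y)))" for b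
    using smooth_on_differentiable[OF assms] by (intro ext partial_deriv_scale) auto
  moreover have "partial_deriv b (\<lambda>x. c * partial_deriv b f (c *\<^sub>R (x - y))) x
     = c\<^sup>2 * partial_deriv b (partial_deriv b f) (c *\<^sub>R (x - y))" if "b \<in> Basis" for b
  proof -
    have s: "smooth_on UNIV (partial_deriv b f)" using smooth_on_partial[OF assms that] .
    have d: "(\<lambda>x. partial_deriv b f (c *\<^sub>R (x - y))) differentiable (at x)"
      by (rule smooth_on_differentiable[OF smooth_on_scale[OF s] UNIV_I])
    show ?thesis
      using partial_deriv_cmult[OF d, of b c]
        partial_deriv_scale[OF smooth_on_differentiable[OF s UNIV_I], where b=b and c=c and x=x and y=y]
      by (simp add: power2_eq_square)
  qed
  ultimately show ?thesis by (simp add: laplacian_def sum_distrib_left)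
qed

lemma TF_scale:
  assumes "f \<in> TF" "c \<noteq> 0"
  shows "(\<lambda>x. f (c *\<^sub>R (x - y))) \<in> TF"
proof -
  obtain R where R: "R > 0" "\<forall>x. x \<notin> ball 0 R \<longrightarrow> f x = 0" using test_functions_D(4)[OF assms(1)] by blast
  show ?thesis
  proof (rule TF_I[of _ y "R / \<bar>c\<bar>"])
    fix x assume "x \<notin> cball y (R / \<bar>c\<bar>)"
    then have "R < \<bar>c\<bar> * norm (x - y)" using assms(2) by (simp add: dist_norm norm_minus_commute field_simps)
    then have "R < norm (c *\<^sub>R (x - y))" by simp
    with R show "f (c *\<^sub>R (x - y)) = 0" by auto
  qed (rule smooth_on_scale[OF test_functions_D(1)[OF assms(1)]])
qed

section \<open>Differentiation under the integral sign\<close>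

lemma integrable_mult_bounded:
  fixes w g :: "'w \<Rightarrow> real"
  assumes "integrable M w" "g \<in> borel_measurable M" "\<And>x. x \<in> space M \<Longrightarrow> \<bar>g x\<bar> \<le> C"
  shows "integrable M (\<lambda>x. w x * g x)"
proof (rule Bochner_Integration.integrable_bound[where f="\<lambda>x. C * w x"])
  show "AE x in M. norm (w x * g x) \<le> norm (C * w x)"
  proof (rule AE_I2)
    fix x assume "x \<in> space M"
    from assms(3)[OF this] have "\<bar>g x\<bar> \<le> \<bar>C\<bar>" by linarith
    then show "norm (w x * g x) \<le> norm (C * w x)" by (simp add: abs_mult mult.commute mult_right_mono)
  qed
qed (use assms in auto)

lemma TF_measurable: "f \<in> test_functions S \<Longrightarrow> f \<in> borel_measurable borel"
  by (rule borel_measurable_continuous_onI[OF test_functions_D(2)])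

text \<open>Convolutions with test functions and weighted means of their dilations are both integrals of
  \<open>\<theta> (c (x - y))\<close>, with \<open>c\<close> and \<open>y\<close> depending on the integration variable.\<close>

context
  fixes M :: "'w measure" and c :: "'w \<Rightarrow> real" and y :: "'w \<Rightarrow> 'a::euclidean_space" and C :: real
  assumes c: "c \<in> borel_measurable M" "\<And>\<omega>. \<bar>c \<omega>\<bar> \<le> C" and y: "y \<in> borel_measurable M"
begin

lemma param_integrable:
  assumes "\<theta> \<in> TF" "integrable M w"
  shows "integrable M (\<lambda>\<omega>. w \<omega> * \<theta> (c \<omega> *\<^sub>R (x - y \<omega>)))"
proof -
  obtain B where "\<forall>x. \<bar>\<theta> x\<bar> \<le> B" using TF_bounded[OF assms(1)] by blast
  moreover have "(\<lambda>\<omega>. \<theta> (c \<omega> *\<^sub>R (x - y \<omega>))) \<in> borel_measurable M"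
    using c y TF_measurable[OF assms(1)] by measurable
  ultimately show ?thesis using integrable_mult_bounded[OF assms(2)] by blast
qed

lemma inner_grad_scaleR:
  "w * (grad \<theta> z \<bullet> (s *\<^sub>R h)) = (\<Sum>b\<in>Basis. (h \<bullet> b) * ((w * s) * partial_deriv b \<theta> z))"
  for \<theta> :: "'a \<Rightarrow> real"
  unfolding grad_def inner_sum_left inner_scaleR_right inner_scaleR_left sum_distrib_left
  by (rule sum.cong) (simp_all add: inner_commute[of h])

text \<open>The remainder in the second-order Taylor estimate of \<open>\<theta>\<close> is uniform, so it can be integrated.\<close>

lemma param_has_derivative:
  assumes th: "\<theta> \<in> TF" and w: "integrable M w"
  shows "((\<lambda>x. \<integral>\<omega>. w \<omega> * \<theta> (c \<omega> *\<^sub>R (x - y \<omega>)) \<partial>M) has_derivative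
      (\<lambda>v. \<Sum>b\<in>Basis. (v \<bullet> b) * (\<integral>\<omega>. (w \<omega> * c \<omega>) * partial_deriv b \<theta> (c \<omega> *\<^sub>R (x - y \<omega>)) \<partial>M))) (at x)"
    (is "(?F has_derivative ?D) _")
proof -
  obtain B where B: "B > 0" "\<And>x y. \<bar>\<theta> x - \<theta> y - grad \<theta> y \<bullet> (x - y)\<bar> \<le> B * (norm (x - y))\<^sup>2"
    using TF_taylor[OF th] by blast
  have wc: "integrable M (\<lambda>\<omega>. w \<omega> * c \<omega>)" by (rule integrable_mult_bounded[OF w c(1)]) (use c in auto)
  have intd: "integrable M (\<lambda>\<omega>. (w \<omega> * c \<omega>) * partial_deriv b \<theta> (c \<omega> *\<^sub>R (x - y \<omega>)))" if "b \<in> Basis" for b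
    by (rule param_integrable[OF test_functions_partial[OF th that] wc])
  define K where "K = (\<integral>\<omega>. \<bar>w \<omega>\<bar> \<partial>M) * (B * C\<^sup>2)"
  have est: "\<bar>?F (x + h) - ?F x - ?D h\<bar> \<le> K * (norm h)\<^sup>2" for h
  proof -
    have D: "?D h = (\<integral>\<omega>. w \<omega> * (grad \<theta> (c \<omega> *\<^sub>R (x - y \<omega>)) \<bullet> (c \<omega> *\<^sub>R h)) \<partial>M)"
    proof -
      have "?D h = (\<integral>\<omega>. (\<Sum>b\<in>Basis. (h \<bullet> b) * ((w \<omega> * c \<omega>) * partial_deriv b \<theta> (c \<omega> *\<^sub>R (x - y \<omega>)))) \<partial>M)"
        using intd by (subst Bochner_Integration.integral_sum) auto
      also have "\<dots> = (\<integral>\<omega>. w \<omega> * (grad \<theta> (c \<omega> *\<^sub>R (x - y \<omega>)) \<bullet> (c \<omega> *\<^sub>R h)) \<partial>M)"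
        by (simp only: inner_grad_scaleR)
      finally show ?thesis .
    qed
    have i3: "integrable M (\<lambda>\<omega>. w \<omega> * (grad \<theta> (c \<omega> *\<^sub>R (x - y \<omega>)) \<bullet> (c \<omega> *\<^sub>R h)))"
    proof -
      have "integrable M (\<lambda>\<omega>. (\<Sum>b\<in>Basis. (h \<bullet> b) * ((w \<omega> * c \<omega>) * partial_deriv b \<theta> (c \<omega> *\<^sub>R (x - y \<omega>)))))"
        using intd by auto
      then show ?thesis by (simp only: inner_grad_scaleR)
    qed
    have "?F (x + h) - ?F x - ?D h = (\<integral>\<omega>. w \<omega> * (\<theta> (c \<omega> *\<^sub>R (x + h - y \<omega>)) - \<theta> (c \<omega> *\<^sub>R (x - y \<omega>))
          - grad \<theta> (c \<omega> *\<^sub>R (x - y \<omega>)) \<bullet> (c \<omega> *\<^sub>R h)) \<partial>M)"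
      unfolding D using i3 param_integrable[OF th w]
      by (simp add: right_diff_distrib)
    also have "\<bar>\<dots>\<bar> \<le> (\<integral>\<omega>. \<bar>w \<omega>\<bar> * (B * C\<^sup>2 * (norm h)\<^sup>2) \<partial>M)"
    proof (rule integral_abs_bound[THEN order_trans], rule integral_mono)
      show "integrable M (\<lambda>\<omega>. \<bar>w \<omega> * (\<theta> (c \<omega> *\<^sub>R (x + h - y \<omega>)) - \<theta> (c \<omega> *\<^sub>R (x - y \<omega>))
          - grad \<theta> (c \<omega> *\<^sub>R (x - y \<omega>)) \<bullet> (c \<omega> *\<^sub>R h))\<bar>)"
        using i3 param_integrable[OF th w] by (simp add: right_diff_distrib)
      fix \<omega>
      have "\<bar>\<theta> (c \<omega> *\<^sub>R (x + h - y \<omega>)) - \<theta> (c \<omega> *\<^sub>R (x - y \<omega>))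
          - grad \<theta> (c \<omega> *\<^sub>R (x - y \<omega>)) \<bullet> (c \<omega> *\<^sub>R h)\<bar> \<le> B * (norm (c \<omega> *\<^sub>R h))\<^sup>2"
        using B(2)[of "c \<omega> *\<^sub>R (x + h - y \<omega>)" "c \<omega> *\<^sub>R (x - y \<omega>)"] by (simp add: scaleR_diff_right[symmetric])
      also have "\<dots> \<le> B * C\<^sup>2 * (norm h)\<^sup>2"
      proof -
        have "(c \<omega>)\<^sup>2 \<le> C\<^sup>2" using c(2)[of \<omega>] by (metis abs_ge_zero power2_abs power_mono)
        then show ?thesis using B(1) by (simp add: power_mult_distrib mult_right_mono mult_left_mono)
      qed
      finally show "\<bar>w \<omega> * (\<theta> (c \<omega> *\<^sub>R (x + h - y \<omega>)) - \<theta> (c \<omega> *\<^sub>R (x - y \<omega>))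
          - grad \<theta> (c \<omega> *\<^sub>R (x - y \<omega>)) \<bullet> (c \<omega> *\<^sub>R h))\<bar> \<le> \<bar>w \<omega>\<bar> * (B * C\<^sup>2 * (norm h)\<^sup>2)"
        by (simp add: abs_mult mult_left_mono)
    qed (use w in auto)
    also have "\<dots> = K * (norm h)\<^sup>2" by (simp add: K_def)
    finally show ?thesis .
  qed
  have lin: "bounded_linear ?D"
    by (intro bounded_linear_sum bounded_linear_mult_const bounded_linear_inner_left)
  show ?thesis unfolding has_derivative_at
  proof (intro conjI lin)
    show "(\<lambda>h. norm (?F (x + h) - ?F x - ?D h) / norm h) \<midarrow>0\<rightarrow> 0"
    proof (rule Lim_null_comparison)
      show "\<forall>\<^sub>F h in at 0. norm (norm (?F (x + h) - ?F x - ?D h) / norm h) \<le> K * norm h"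
      proof (rule always_eventually, rule allI)
        fix h
        show "norm (norm (?F (x + h) - ?F x - ?D h) / norm h) \<le> K * norm h"
          using est[of h] by (cases "h = 0") (simp_all add: divide_le_eq power2_eq_square mult.assoc)
      qed
      show "((\<lambda>h. K * norm (h::'a)) \<longlongrightarrow> 0) (at 0)"
        by (intro tendsto_mult_right_zero tendsto_norm_zero tendsto_ident_at)
    qed
  qed
qed

lemma param_partial:
  assumes "\<theta> \<in> TF" "integrable M w" "b \<in> Basis"
  shows "partial_deriv b (\<lambda>x. \<integral>\<omega>. w \<omega> * \<theta> (c \<omega> *\<^sub>R (x - y \<omega>)) \<partial>M)
     = (\<lambda>x. \<integral>\<omega>. (w \<omega> * c \<omega>) * partial_deriv b \<theta> (c \<omega> *\<^sub>R (x - y \<omega>)) \<partial>M)"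
  by (rule ext, subst partial_deriv_eq[OF param_has_derivative[OF assms(1,2)]])
     (use assms(3) in \<open>simp add: inner_Basis if_distrib if_distribR cong: if_cong\<close>)

lemma param_weight_integrable: "integrable M w \<Longrightarrow> integrable M (\<lambda>\<omega>. w \<omega> * c \<omega>)"
  by (rule integrable_mult_bounded[OF _ c(1)]) (use c in auto)

lemma param_smooth:
  assumes "\<theta> \<in> TF" "integrable M w"
  shows "smooth_on UNIV (\<lambda>x. \<integral>\<omega>. w \<omega> * \<theta> (c \<omega> *\<^sub>R (x - y \<omega>)) \<partial>M)"
proof -
  have "Ck_on k UNIV (\<lambda>x. \<integral>\<omega>. w \<omega> * \<theta> (c \<omega> *\<^sub>R (x - y \<omega>)) \<partial>M)" for k
    using assms
  proof (induction k arbitrary: \<theta> w)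
    case 0
    have "(\<lambda>x. \<integral>\<omega>. w \<omega> * \<theta> (c \<omega> *\<^sub>R (x - y \<omega>)) \<partial>M) differentiable (at x)" for x
      using param_has_derivative[OF 0, THEN differentiableI] .
    then show ?case
      by (auto intro!: continuous_at_imp_continuous_on differentiable_imp_continuous_within)
  next
    case (Suc k)
    show ?case unfolding Ck_on.simps
      using param_has_derivative[OF Suc.prems, THEN differentiableI]
        Suc.IH[OF test_functions_partial[OF Suc.prems(1)] param_weight_integrable[OF Suc.prems(2)]]
      by (auto simp: param_partial[OF Suc.prems])
  qed
  then show ?thesis by (simp add: smooth_on_def)
qed

lemma param_laplacian:
  assumes "\<theta> \<in> TF" "integrable M w"
  shows "laplacian (\<lambda>x. \<integral>\<omega>. w \<omega> * \<theta> (c \<omega> *\<^sub>R (x - y \<omega>)) \<partial>M) x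
     = (\<integral>\<omega>. w \<omega> * (c \<omega>)\<^sup>2 * laplacian \<theta> (c \<omega> *\<^sub>R (x - y \<omega>)) \<partial>M)"
proof -
  note wc = param_weight_integrable[OF assms(2)]
  have "partial_deriv b (partial_deriv b (\<lambda>x. \<integral>\<omega>. w \<omega> * \<theta> (c \<omega> *\<^sub>R (x - y \<omega>)) \<partial>M)) x
     = (\<integral>\<omega>. (w \<omega> * c \<omega> * c \<omega>) * partial_deriv b (partial_deriv b \<theta>) (c \<omega> *\<^sub>R (x - y \<omega>)) \<partial>M)" if "b \<in> Basis" for b
    by (simp add: param_partial[OF assms that] param_partial[OF test_functions_partial[OF assms(1) that] wc that])
  then have "laplacian (\<lambda>x. \<integral>\<omega>. w \<omega> * \<theta> (c \<omega> *\<^sub>R (x - y \<omega>)) \<partial>M) x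
     = (\<Sum>b\<in>Basis. \<integral>\<omega>. (w \<omega> * c \<omega> * c \<omega>) * partial_deriv b (partial_deriv b \<theta>) (c \<omega> *\<^sub>R (x - y \<omega>)) \<partial>M)"
    by (simp add: laplacian_def)
  also have "\<dots> = (\<integral>\<omega>. (\<Sum>b\<in>Basis. (w \<omega> * c \<omega> * c \<omega>) * partial_deriv b (partial_deriv b \<theta>) (c \<omega> *\<^sub>R (x - y \<omega>))) \<partial>M)"
    by (rule Bochner_Integration.integral_sum[symmetric])
       (intro param_integrable[OF test_functions_partial[OF test_functions_partial[OF assms(1)]] param_weight_integrable[OF wc]])
  finally show ?thesis by (simp add: laplacian_def sum_distrib_left power2_eq_square mult_ac)
qed

end

section \<open>Cutoffs and integration by parts\<close>

text \<open>With \<open>E = bump_deriv 0\<close> and \<open>s\<close> growing from 0 to 1 between the radii \<open>r\<close> and \<open>R\<close>, the quantity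
  \<open>1 - e E(s)\<close> falls from 1 to 0, since \<open>E 1 = 1 / e\<close>; another application of \<open>E\<close> makes the function
  vanish outside the larger ball. Inside the smaller ball its value is \<open>1 / e\<close>.\<close>

definition cutoff :: "'a::euclidean_space \<Rightarrow> real \<Rightarrow> real \<Rightarrow> 'a \<Rightarrow> real" where
  "cutoff z r R x = bump_deriv 0 (1 - exp 1 * bump_deriv 0 (((norm (x - z))\<^sup>2 - r\<^sup>2) / (R\<^sup>2 - r\<^sup>2)))"

lemma smooth_cutoff: "smooth_on UNIV (cutoff z r R)"
proof -
  have "smooth_on UNIV (\<lambda>x. 1 - exp 1 * bump_deriv 0 (((norm (x - z))\<^sup>2 - r\<^sup>2) * (1 / (R\<^sup>2 - r\<^sup>2))))"
    by (intro smooth_on_diff smooth_on_mult smooth_on_const smooth_on_norm_square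
          smooth_on_compose[OF _ smooth_real_bump_deriv, of UNIV _ 0]) auto
  from smooth_on_compose[OF _ smooth_real_bump_deriv this, of 0] show ?thesis
    by (simp add: cutoff_def[abs_def])
qed

lemma cutoff_pos:
  assumes "0 \<le> r" "r < R" "norm (x - z) < R" shows "cutoff z r R x > 0"
proof -
  define s where "s = ((norm (x - z))\<^sup>2 - r\<^sup>2) / (R\<^sup>2 - r\<^sup>2)"
  have "r\<^sup>2 < R\<^sup>2" "(norm (x - z))\<^sup>2 < R\<^sup>2" using assms by (auto intro: power_strict_mono)
  then have s: "s < 1" by (simp add: s_def)
  have "exp 1 * bump_deriv 0 s < 1"
  proof (cases "s > 0")
    case True
    then have "exp 1 * exp (- (1 / s)) < (1::real)" using s by (simp add: exp_add[symmetric] del: exp_add)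
    then show ?thesis using True by (simp add: bump_0)
  qed (simp add: bump_0)
  then show ?thesis unfolding cutoff_def s_def[symmetric] by (intro bump_pos) simp
qed

lemma cutoff_eq_0:
  assumes "0 \<le> r" "r < R" "norm (x - z) \<ge> R" shows "cutoff z r R x = 0"
proof -
  define s where "s = ((norm (x - z))\<^sup>2 - r\<^sup>2) / (R\<^sup>2 - r\<^sup>2)"
  have "r\<^sup>2 < R\<^sup>2" using assms by (auto intro: power_strict_mono)
  moreover have "(norm (x - z))\<^sup>2 \<ge> R\<^sup>2" using assms by (intro power_mono) auto
  ultimately have s: "s \<ge> 1" by (simp add: s_def)
  then have "1 \<le> exp 1 * exp (- (1 / s))" by (simp add: exp_add[symmetric] del: exp_add)
  then have "1 \<le> exp 1 * bump_deriv 0 s" using s by (simp add: bump_0)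
  then show ?thesis unfolding cutoff_def s_def[symmetric] by (intro bump_eq_0) simp
qed

lemma cutoff_bounds: "0 \<le> cutoff z r R x" "cutoff z r R x \<le> 1"
  by (simp_all add: cutoff_def bump_bounds)

lemma cutoff_TF: assumes "0 \<le> r" "r < R" shows "cutoff z r R \<in> TF"
proof (rule TF_I[OF smooth_cutoff, of z R])
  fix x assume "x \<notin> cball z R"
  then have "R \<le> norm (x - z)" by (simp add: dist_norm norm_minus_commute)
  then show "cutoff z r R x = 0" by (rule cutoff_eq_0[OF assms])
qed

lemma cutoff_grad:
  assumes "0 \<le> r" "r < R" "norm (x - z) < r" shows "grad (cutoff z r R) x = 0"
proof -
  have eq: "cutoff z r R y = bump_deriv 0 1" if "y \<in> ball z r" for y
  proof -
    have "norm (y - z) < r" using that by (simp add: dist_norm norm_minus_commute)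
    then have "(norm (y - z))\<^sup>2 \<le> r\<^sup>2" "r\<^sup>2 < R\<^sup>2" using assms by (auto intro: power_strict_mono power_mono)
    then have "((norm (y - z))\<^sup>2 - r\<^sup>2) / (R\<^sup>2 - r\<^sup>2) \<le> 0" by (simp add: divide_nonpos_pos)
    then show ?thesis by (simp add: cutoff_def bump_eq_0)
  qed
  have "x \<in> ball z r" using assms by (simp add: dist_norm norm_minus_commute)
  then have "grad (cutoff z r R) x = grad (\<lambda>x. bump_deriv 0 1) x"
    by (intro grad_cong_open[of "ball z r"]) (auto simp: eq)
  also have "\<dots> = 0" by (rule grad_eqI) auto
  finally show ?thesis .
qed

lemma cutoff_support:
  assumes "0 \<le> r" "r < R" shows "closure {x. cutoff z r R x \<noteq> 0} \<subseteq> cball z R"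
  by (rule closure_minimal) (use cutoff_eq_0[OF assms] in \<open>force simp: dist_norm norm_minus_commute\<close>, simp)

lemma TF_integrable: assumes "f \<in> test_functions S" shows "integrable lborel f"
proof -
  obtain R where R: "R > 0" "\<forall>x. x \<notin> ball 0 R \<longrightarrow> f x = 0" using test_functions_D(4)[OF assms(1)] by blast
  obtain B where B: "\<forall>x. \<bar>f x\<bar> \<le> B" using TF_bounded[OF assms(1)] by blast
  have "integrable lborel (\<lambda>x. indicator (ball 0 R) x * f x)"
    by (rule integrable_mult_bounded[of _ _ _ B])
       (use B TF_measurable[OF assms] emeasure_bounded_finite[of "ball (0::'a) R"] in auto)
  moreover have "(\<lambda>x. indicator (ball 0 R) x * f x) = f"
    using R(2) by (intro ext) (auto split: split_indicator)
  ultimately show ?thesis by simp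
qed

lemma TF_integrable_lebesgue: "f \<in> test_functions S \<Longrightarrow> integrable lebesgue f"
  using TF_integrable[of f S] TF_measurable[of f S] by (simp add: integrable_completion)

lemma lborel_integral_affine:
  fixes f :: "'a::euclidean_space \<Rightarrow> real"
  assumes c: "c \<noteq> 0" and [measurable]: "f \<in> borel_measurable borel"
  shows "(\<integral>x. f x \<partial>lborel) = \<bar>c\<bar> ^ DIM('a) * (\<integral>x. f (t + c *\<^sub>R x) \<partial>lborel)"
proof -
  have "(\<integral>x. f x \<partial>lborel) = (\<integral>x. f x \<partial>density (distr lborel borel (\<lambda>x. t + c *\<^sub>R x)) (\<lambda>_. ennreal (\<bar>c\<bar> ^ DIM('a))))"
    using lborel_affine[OF c, of t] by simp
  also have "\<dots> = (\<integral>x. \<bar>c\<bar> ^ DIM('a) *\<^sub>R f x \<partial>distr lborel borel (\<lambda>x. t + c *\<^sub>R x))"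
    by (rule integral_density) auto
  also have "\<dots> = (\<integral>x. \<bar>c\<bar> ^ DIM('a) *\<^sub>R f (t + c *\<^sub>R x) \<partial>lborel)"
    by (rule integral_distr) auto
  finally show ?thesis by simp
qed

text \<open>The integral of a function over a large ball does not change when the function is translated a
  little. Differentiating with respect to the translation gives the claim.\<close>

lemma integral_partial_TF:
  assumes "f \<in> TF" "b \<in> Basis" shows "(\<integral>x. partial_deriv b f x \<partial>lborel) = 0"
proof -
  obtain R where R: "R > 0" "\<forall>x. x \<notin> ball 0 R \<longrightarrow> f x = 0" using test_functions_D(4)[OF assms(1)] by blast
  define w :: "'a \<Rightarrow> real" where "w = indicator (ball 0 (R + 1))"
  have w: "integrable lborel w" unfolding w_def
    using emeasure_bounded_finite[of "ball (0::'a) (R + 1)"] by auto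
  define F where "F x = (\<integral>y. w y * f (1 *\<^sub>R (x - y)) \<partial>lborel)" for x
  have R': "\<forall>x. x \<notin> ball 0 R \<longrightarrow> partial_deriv b f x = 0"
  proof (intro allI impI)
    fix x :: 'a assume x: "x \<notin> ball 0 R"
    show "partial_deriv b f x = 0"
    proof (rule ccontr)
      assume nz: "partial_deriv b f x \<noteq> 0"
      have "isCont (partial_deriv b f) x"
        using test_functions_D(2)[OF test_functions_partial[OF assms]] by (simp add: continuous_on_eq_continuous_at)
      then obtain d where d: "d > 0" "\<forall>y. dist x y < d \<longrightarrow> partial_deriv b f y \<noteq> 0"
        using continuous_at_avoid[of x "partial_deriv b f" 0] nz by blast
      define y where "y = (1 + d / (2 * norm x)) *\<^sub>R x"
      have nx: "norm x > 0" "norm x \<ge> R" using x R(1) by auto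
      have "dist x y = d / 2" using nx d(1) by (simp add: y_def dist_norm algebra_simps)
      then have "partial_deriv b f y \<noteq> 0" using d by simp
      moreover have "norm y = \<bar>1 + d / (2 * norm x)\<bar> * norm x" by (simp only: y_def norm_scaleR)
      then have "norm y = norm x + d / 2" using nx d(1) by (simp add: abs_of_pos add_pos_pos algebra_simps)
      then have y: "y \<in> - cball 0 R" using nx d(1) by simp
      have "partial_deriv b f y = partial_deriv b (\<lambda>x. 0) y"
        by (rule partial_deriv_cong_open[of "- cball 0 R"]) (use y R(2) in auto)
      ultimately show False using partial_deriv_eq[OF has_derivative_const[of 0 "at y"]] by simp
    qed
  qed
  have eq: "(\<integral>y. w y * h (x - y) \<partial>lborel) = (\<integral>y. h y \<partial>lborel)" 
    if h: "\<forall>x. x \<notin> ball 0 R \<longrightarrow> h x = 0" "h \<in> borel_measurable borel" and x: "norm x < 1" for h :: "'a \<Rightarrow> real" and x :: 'a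
  proof -
    have "w y * h (x - y) = h (x + (-1) *\<^sub>R y)" for y
    proof (cases "norm y < R + 1")
      case False
      then have "norm (x - y) \<ge> R" using norm_triangle_ineq2[of y x] x by (simp add: norm_minus_commute)
      then show ?thesis using h by simp
    qed (simp add: w_def)
    then have "(\<integral>y. w y * h (x - y) \<partial>lborel) = (\<integral>y. h (x + (-1) *\<^sub>R y) \<partial>lborel)" by (simp only:)
    then show ?thesis using lborel_integral_affine[of "-1" h x] h(2) by simp
  qed
  have "partial_deriv b F = (\<lambda>x. \<integral>y. (w y * 1) * partial_deriv b f (1 *\<^sub>R (x - y)) \<partial>lborel)"
    unfolding F_def by (rule param_partial[where C=1]) (use w assms in auto)
  then have "partial_deriv b F 0 = (\<integral>y. w y * partial_deriv b f (0 - y) \<partial>lborel)" by simp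
  also have "\<dots> = (\<integral>x. partial_deriv b f x \<partial>lborel)"
    by (rule eq[OF R']) (use TF_measurable[OF test_functions_partial[OF assms]] in auto)
  finally have "(\<integral>x. partial_deriv b f x \<partial>lborel) = partial_deriv b F 0" by simp
  also have "\<dots> = partial_deriv b (\<lambda>x. \<integral>y. f y \<partial>lborel) 0"
    by (rule partial_deriv_cong_open[of "ball 0 1"]) (use eq[OF R(2) TF_measurable[OF assms(1)]] in \<open>auto simp: F_def\<close>)
  also have "\<dots> = 0" by (subst partial_deriv_eq[OF has_derivative_const]) auto
  finally show ?thesis .
qed

lemma integration_by_parts:
  assumes psi: "smooth_on UNIV \<psi>" and th: "\<theta> \<in> TF"
  shows "integrable lborel (\<lambda>x. grad \<psi> x \<bullet> grad \<theta> x)" "integrable lborel (\<lambda>x. laplacian \<psi> x * \<theta> x)"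
    "(\<integral>x. grad \<psi> x \<bullet> grad \<theta> x \<partial>lborel) = - (\<integral>x. laplacian \<psi> x * \<theta> x \<partial>lborel)"
proof -
  have g: "grad \<psi> x \<bullet> grad \<theta> x = (\<Sum>b\<in>Basis. partial_deriv b \<psi> x * partial_deriv b \<theta> x)" for x
    by (subst euclidean_inner) (simp add: partial_deriv_inner_grad)
  have l: "laplacian \<psi> x * \<theta> x = (\<Sum>b\<in>Basis. partial_deriv b (partial_deriv b \<psi>) x * \<theta> x)" for x
    by (simp add: laplacian_def sum_distrib_right)
  have 1: "(\<lambda>x. partial_deriv b \<psi> x * partial_deriv b \<theta> x) \<in> TF" if "b \<in> Basis" for b
    by (rule TF_mult[OF test_functions_partial[OF th that] smooth_on_partial[OF psi that]])
  have 2: "(\<lambda>x. partial_deriv b (partial_deriv b \<psi>) x * \<theta> x) \<in> TF" if "b \<in> Basis" for b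
    by (rule TF_mult[OF th smooth_on_partial[OF smooth_on_partial[OF psi that] that]])
  show "integrable lborel (\<lambda>x. grad \<psi> x \<bullet> grad \<theta> x)" "integrable lborel (\<lambda>x. laplacian \<psi> x * \<theta> x)"
    unfolding g l using TF_integrable[OF 1] TF_integrable[OF 2] by auto
  have "(\<integral>x. partial_deriv b \<psi> x * partial_deriv b \<theta> x \<partial>lborel) = - (\<integral>x. partial_deriv b (partial_deriv b \<psi>) x * \<theta> x \<partial>lborel)"
    if b: "b \<in> Basis" for b
  proof -
    have 3: "(\<lambda>x. partial_deriv b \<psi> x * \<theta> x) \<in> TF"
      by (rule TF_mult[OF th smooth_on_partial[OF psi b]])
    have "0 = (\<integral>x. partial_deriv b (\<lambda>x. partial_deriv b \<psi> x * \<theta> x) x \<partial>lborel)"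
      by (rule integral_partial_TF[OF 3 b, symmetric])
    also have "\<dots> = (\<integral>x. partial_deriv b \<psi> x * partial_deriv b \<theta> x + partial_deriv b (partial_deriv b \<psi>) x * \<theta> x \<partial>lborel)"
      using smooth_on_differentiable[OF smooth_on_partial[OF psi b]] test_functions_D(3)[OF th]
      by (simp add: partial_deriv_mult)
    also have "\<dots> = (\<integral>x. partial_deriv b \<psi> x * partial_deriv b \<theta> x \<partial>lborel) + (\<integral>x. partial_deriv b (partial_deriv b \<psi>) x * \<theta> x \<partial>lborel)"
      using TF_integrable[OF 1[OF b]] TF_integrable[OF 2[OF b]] by simp
    finally show ?thesis by simp
  qed
  then show "(\<integral>x. grad \<psi> x \<bullet> grad \<theta> x \<partial>lborel) = - (\<integral>x. laplacian \<psi> x * \<theta> x \<partial>lborel)"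
    unfolding g l using TF_integrable[OF 1] TF_integrable[OF 2]
    by (simp add: Bochner_Integration.integral_sum sum_negf)
qed

section \<open>A mollifier and its dyadic kernel\<close>

definition moll_mass :: "'a::euclidean_space itself \<Rightarrow> real" where
  "moll_mass _ = (\<integral>z. bump_deriv 1 (1 - (norm (z::'a))\<^sup>2) \<partial>lborel)"

definition moll :: "'a::euclidean_space \<Rightarrow> real" where
  "moll z = bump_deriv 1 (1 - (norm z)\<^sup>2) / moll_mass TYPE('a)"

text \<open>The radial primitive of the mollifier: its gradient is \<open>- moll z *\<^sub>R z\<close>. Hence its Laplacian is minus
  the divergence of \<open>moll z *\<^sub>R z\<close>, which is how \<open>moll\<close> changes under mass-preserving dilations.\<close>

definition moll_prim :: "'a::euclidean_space \<Rightarrow> real" where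
  "moll_prim z = bump_deriv 0 (1 - (norm z)\<^sup>2) / (2 * moll_mass TYPE('a))"

lemma bump_radial_TF: "(\<lambda>z::'a::euclidean_space. bump_deriv n (1 - (norm z)\<^sup>2) * c) \<in> TF"
proof (rule TF_I[of _ 0 1])
  show "smooth_on UNIV (\<lambda>z::'a. bump_deriv n (1 - (norm z)\<^sup>2) * c)"
    using smooth_on_norm_square[of UNIV "0::'a"]
    by (intro smooth_on_mult smooth_on_const smooth_on_compose[OF _ smooth_real_bump_deriv] smooth_on_diff) auto
  fix x :: 'a assume "x \<notin> cball 0 1"
  then have "1 < (norm x)\<^sup>2" by (simp add: one_less_power)
  then show "bump_deriv n (1 - (norm x)\<^sup>2) * c = 0" by (simp add: bump_eq_0)
qed

lemma norm_sq_less_1: "(norm x)\<^sup>2 < 1 \<longleftrightarrow> norm x < 1"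
  by (metis abs_norm_cancel abs_square_less_1)

lemma moll_mass_pos: "moll_mass TYPE('a::euclidean_space) > 0"
proof -
  let ?f = "\<lambda>z::'a. bump_deriv 1 (1 - (norm z)\<^sup>2)"
  have i: "integrable lborel ?f" using TF_integrable[OF bump_radial_TF[of 1 1]] by simp
  have "moll_mass TYPE('a) \<ge> 0" unfolding moll_mass_def by (rule integral_nonneg_AE) (auto simp: bump_bounds simp del: One_nat_def)
  moreover have "moll_mass TYPE('a) \<noteq> 0"
  proof
    assume "moll_mass TYPE('a) = 0"
    then have "AE z in lborel. ?f z = 0"
      using integral_nonneg_eq_0_iff_AE[OF i] by (simp add: moll_mass_def bump_bounds del: One_nat_def)
    then have "AE z::'a in lborel. z \<notin> ball 0 1"
    proof eventually_elim
      case (elim z)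
      show ?case
      proof
        assume "z \<in> ball 0 1"
        then have "1 - (norm z)\<^sup>2 > 0" using norm_sq_less_1[of z] by simp
        with bump_pos(2)[OF this] elim show False by simp
      qed
    qed
    then have "emeasure lborel (ball (0::'a) 1) = 0"
      using AE_iff_null_sets[of "ball (0::'a) 1" lborel] by auto
    then show False using content_ball_pos[of 1 "0::'a"] by (simp add: measure_def)
  qed
  ultimately show ?thesis by simp
qed

lemma moll_TF: "(moll :: 'a::euclidean_space \<Rightarrow> real) \<in> TF"
  using bump_radial_TF[of 1 "1 / moll_mass TYPE('a)"] by (simp add: moll_def[abs_def] del: One_nat_def)

lemma moll_prim_TF: "(moll_prim :: 'a::euclidean_space \<Rightarrow> real) \<in> TF"
  using bump_radial_TF[of 0 "1 / (2 * moll_mass TYPE('a))"] by (simp add: moll_prim_def[abs_def] del: One_nat_def)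

lemma moll_nonneg: "moll (z::'a::euclidean_space) \<ge> 0"
  using moll_mass_pos[where 'a='a] by (simp add: moll_def bump_bounds less_imp_le del: One_nat_def)

lemma moll_pos: "norm (z::'a::euclidean_space) < 1 \<Longrightarrow> moll z > 0"
  using moll_mass_pos[where 'a='a] norm_sq_less_1[of z] by (simp add: moll_def bump_pos del: One_nat_def)

lemma moll_eq_0: "norm (z::'a::euclidean_space) \<ge> 1 \<Longrightarrow> moll z = 0" "norm z \<ge> 1 \<Longrightarrow> moll_prim z = 0"
  using norm_sq_less_1[of z] by (simp_all add: moll_def moll_prim_def bump_eq_0)

lemma moll_integral: "(\<integral>z. moll (z::'a::euclidean_space) \<partial>lborel) = 1"
  using moll_mass_pos[where 'a='a] by (simp add: moll_def) (simp add: moll_mass_def)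

lemma moll_minus: "moll (- z) = moll z" "moll_prim (- z) = moll_prim z"
  by (simp_all add: moll_def moll_prim_def)

lemma moll_prim_laplacian:
  "laplacian moll_prim (z::'a::euclidean_space) = 
     (2 * (norm z)\<^sup>2 * bump_deriv 2 (1 - (norm z)\<^sup>2) - real DIM('a) * bump_deriv 1 (1 - (norm z)\<^sup>2)) / moll_mass TYPE('a)"
proof -
  let ?J = "moll_mass TYPE('a)"
  have 1: "((\<lambda>s. bump_deriv 0 (1 - s) / (2 * ?J)) has_real_derivative - (bump_deriv 1 (1 - s) / (2 * ?J))) (at s)" for s
    by (rule DERIV_cong[OF DERIV_cdivide[OF DERIV_chain2[OF bump_deriv_DERIV DERIV_diff[OF DERIV_const DERIV_ident]]]]) simp
  have 2: "((\<lambda>s. - (bump_deriv 1 (1 - s) / (2 * ?J))) has_real_derivative bump_deriv 2 (1 - s) / (2 * ?J)) (at s)" for s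
    by (rule DERIV_cong[OF DERIV_minus[OF DERIV_cdivide[OF DERIV_chain2[OF bump_deriv_DERIV DERIV_diff[OF DERIV_const DERIV_ident]]]]])
       (simp add: numeral_2_eq_2)
  have "laplacian moll_prim z = laplacian (\<lambda>x::'a. bump_deriv 0 (1 - (norm (x - 0))\<^sup>2) / (2 * ?J)) z"
    by (simp add: moll_prim_def[abs_def])
  also have "\<dots> = 4 * (norm (z - 0))\<^sup>2 * (bump_deriv 2 (1 - (norm (z - 0))\<^sup>2) / (2 * ?J))
      + 2 * real DIM('a) * (- (bump_deriv 1 (1 - (norm (z - 0))\<^sup>2) / (2 * ?J)))"
    by (rule laplacian_radial[OF 1 2])
  finally show ?thesis using moll_mass_pos[where 'a='a] by (simp add: field_simps del: One_nat_def)
qed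

text \<open>The integral of \<open>t\<^bsup>1 - N\<^esup> moll_prim (z / t)\<close> over \<open>t\<close> in \<open>[1/2, 1]\<close>. The weight \<open>indicator {1/2..1} t / t\<close> stands
  for \<open>1 / t\<close>, so that it is bounded on the whole line.\<close>

definition moll_ker :: "'a::euclidean_space \<Rightarrow> real" where
  "moll_ker z = (\<integral>t. (indicator {1/2..1} t * (t / t ^ DIM('a))) 
       * moll_prim ((indicator {1/2..1} t / t) *\<^sub>R (z - 0)) \<partial>lborel)"

lemma ker_weights:
  "integrable lborel (\<lambda>t::real. indicator {1/2..1} t * (t / t ^ n))"
  "(\<lambda>t::real. indicator {1/2..1} t / t) \<in> borel_measurable lborel"
  "\<bar>indicator {1/2..1} t / t\<bar> \<le> (2::real)"
proof -
  have "continuous_on {1/2..1} (\<lambda>t::real. t / t ^ n)" by (intro continuous_intros) auto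
  from borel_integrable_atLeastAtMost'[OF this]
  show "integrable lborel (\<lambda>t::real. indicator {1/2..1} t * (t / t ^ n))"
    by (simp add: set_integrable_def)
  show "\<bar>indicator {1/2..1} t / t\<bar> \<le> (2::real)" by (auto simp: indicator_def field_simps)
qed measurable

lemma moll_ker_smooth: "smooth_on UNIV moll_ker"
  unfolding moll_ker_def[abs_def]
  by (rule param_smooth[OF ker_weights(2,3) _ moll_prim_TF ker_weights(1)]) auto

lemma moll_ker_eq_0: assumes "norm z \<ge> 1" shows "moll_ker z = 0"
proof -
  have "moll_prim ((indicator {1/2..1} t / t) *\<^sub>R (z - 0)) = 0" if "t \<in> {1/2..1}" for t :: real
  proof (rule moll_eq_0)
    have "1 \<le> 1 / t" using that by (simp add: field_simps)
    then have "1 * 1 \<le> (1 / t) * norm z" using assms that by (intro mult_mono) auto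
    then show "1 \<le> norm ((indicator {1/2..1} t / t) *\<^sub>R (z - 0))" using that by simp
  qed
  then have "(indicator {1/2..1} t * (t / t ^ DIM('a))) * moll_prim ((indicator {1/2..1} t / t) *\<^sub>R (z - 0)) = 0" for t :: real
    by (cases "t \<in> {1/2..1}") auto
  then show ?thesis unfolding moll_ker_def by (simp only: Bochner_Integration.integral_zero)
qed

lemma moll_ker_TF: "moll_ker \<in> TF"
  by (rule TF_I[OF moll_ker_smooth, of 0 1]) (auto simp: moll_ker_eq_0)

lemma moll_ker_minus: "moll_ker (- z) = moll_ker z"
proof -
  have "moll_prim ((indicator {1/2..1} t / t) *\<^sub>R (- z - 0)) = moll_prim ((indicator {1/2..1} t / t) *\<^sub>R (z - 0))" for t :: real
    using moll_minus(2)[of "(indicator {1/2..1} t / t) *\<^sub>R (z - 0)"] by simp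
  then show ?thesis unfolding moll_ker_def by (simp only:)
qed

text \<open>The derivative of \<open>t\<^bsup>- N\<^esup> moll (z / t)\<close> with respect to \<open>t\<close> is the Laplacian in \<open>z\<close> of
  \<open>t\<^bsup>1 - N\<^esup> moll_prim (z / t)\<close>. Integrating over \<open>t\<close> leaves the values at 1 and 1/2.\<close>

lemma moll_ker_laplacian:
  "laplacian moll_ker (z::'a::euclidean_space) = moll z - 2 ^ DIM('a) * moll (2 *\<^sub>R z)"
proof -
  let ?N = "DIM('a)" and ?J = "moll_mass TYPE('a)"
  define S where "S = (norm z)\<^sup>2"
  define F where "F t = bump_deriv 1 (1 - S * (1 / t)^2) * (1 / t) ^ ?N / ?J" for t
  define f where "f t = (1 / t) ^ (?N + 1) * (2 * (S * (1 / t)^2) * bump_deriv 2 (1 - S * (1 / t)^2)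
      - real ?N * bump_deriv 1 (1 - S * (1 / t)^2)) / ?J" for t
  have D: "(F has_real_derivative f t) (at t)" if "t > 0" for t
  proof -
    have i: "((\<lambda>t. 1 / t) has_real_derivative - ((1 / t)^2)) (at t)"
      using that by (auto intro!: derivative_eq_intros simp: power2_eq_square)
    have "((\<lambda>t. S * (1 / t)^2) has_real_derivative - (2 * S * (1 / t)^3)) (at t)"
      by (rule DERIV_cong[OF DERIV_cmult[OF DERIV_power[OF i]]]) (simp add: power2_eq_square power3_eq_cube)
    from DERIV_diff[OF DERIV_const this, of 1] have
      "((\<lambda>t. 1 - S * (1 / t)^2) has_real_derivative 2 * S * (1 / t)^3) (at t)" by simp
    from DERIV_chain2[OF bump_deriv_DERIV this, of 1] have
      b: "((\<lambda>t. bump_deriv 1 (1 - S * (1 / t)^2)) has_real_derivative bump_deriv 2 (1 - S * (1 / t)^2) * (2 * S * (1 / t)^3)) (at t)"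
      by (simp add: numeral_2_eq_2)
    have "?N - 1 + 2 = ?N + 1" using DIM_positive[where 'a='a] by simp
    then have pw: "(1 / t) ^ (?N - Suc 0) * (1 / t)\<^sup>2 = (1 / t) ^ (?N + 1)"
      unfolding power_add[symmetric] by simp
    have p: "((\<lambda>t. (1 / t)^?N) has_real_derivative - (real ?N * (1 / t)^(?N + 1))) (at t)"
      by (rule DERIV_cong[OF DERIV_power[OF i]]) (simp only: pw[symmetric], simp)
    have e: "(b2 * (2 * S * s^3) * s^n + - (m * s^(n+1)) * b1) / J = s^(n+1) * (2 * (S * s^2) * b2 - m * b1) / J"
      for s b1 b2 m J :: real and n
      by (simp add: power2_eq_square power3_eq_cube algebra_simps)
    show ?thesis unfolding F_def f_def
      by (rule DERIV_cong[OF DERIV_cdivide[OF DERIV_mult[OF b p]]], rule e)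
  qed
  have "continuous_on {0<..} f"
  proof -
    have "continuous_on {0<..} (\<lambda>t. bump_deriv n (1 - S * (1 / t)^2))" for n
      by (rule continuous_on_compose2[OF bump_continuous[of UNIV]]) (auto intro!: continuous_intros)
    then show ?thesis unfolding f_def using moll_mass_pos[where 'a='a]
      by (intro continuous_intros) auto
  qed
  then have cf: "isCont f t" if "t > 0" for t
    using that by (simp add: continuous_on_eq_continuous_at)
  have "laplacian moll_ker z = (\<integral>t. (indicator {1/2..1} t * (t / t ^ ?N)) * (indicator {1/2..1} t / t)\<^sup>2 
       * laplacian moll_prim ((indicator {1/2..1} t / t) *\<^sub>R (z - 0)) \<partial>lborel)"
    unfolding moll_ker_def[abs_def]
    by (rule param_laplacian[OF ker_weights(2,3) _ moll_prim_TF ker_weights(1)]) auto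
  also have "\<dots> = (\<integral>t. f t * indicator {1/2..1} t \<partial>lborel)"
  proof (rule Bochner_Integration.integral_cong[OF refl])
    fix t :: real
    show "(indicator {1/2..1} t * (t / t ^ ?N)) * (indicator {1/2..1} t / t)\<^sup>2 
       * laplacian moll_prim ((indicator {1/2..1} t / t) *\<^sub>R (z - 0)) = f t * indicator {1/2..1} t"
    proof (cases "t \<in> {1/2..1}")
      case True
      then have "t > 0" by simp
      have n: "(norm ((1 / t) *\<^sub>R z))\<^sup>2 = S * (1 / t)^2" by (simp add: S_def power_mult_distrib power_divide)
      have l: "laplacian moll_prim ((1 / t) *\<^sub>R z) = (2 * (S * (1 / t)^2) * bump_deriv 2 (1 - S * (1 / t)^2)
          - real ?N * bump_deriv 1 (1 - S * (1 / t)^2)) / ?J"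
        by (simp only: moll_prim_laplacian n)
      have "(t / t ^ ?N) * (1 / t)\<^sup>2 = (1 / t) ^ (?N + 1)"
        using \<open>t > 0\<close> by (simp add: power2_eq_square power_divide)
      then show ?thesis using True unfolding f_def
        by (simp add: l del: One_nat_def)
    qed simp
  qed
  also have "\<dots> = F 1 - F (1/2)"
    by (rule integral_FTC_Icc_real) (use D cf in auto)
  also have "\<dots> = moll z - 2 ^ ?N * moll (2 *\<^sub>R z)"
    by (simp add: F_def moll_def S_def power_mult_distrib mult.commute[of 4] del: One_nat_def)
  finally show ?thesis .
qed

section \<open>Convolution and mollification in the mean\<close>

definition phis :: "real \<Rightarrow> 'a::euclidean_space \<Rightarrow> real" where
  "phis \<tau> z = (1 / \<tau>) ^ DIM('a) * moll ((1 / \<tau>) *\<^sub>R z)"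

text \<open>The factor \<open>\<tau>\<^sup>2\<close> compensates for the two derivatives in \<open>kers_laplacian\<close>.\<close>

definition kers :: "real \<Rightarrow> 'a::euclidean_space \<Rightarrow> real" where
  "kers \<tau> z = \<tau>\<^sup>2 * (1 / \<tau>) ^ DIM('a) * moll_ker ((1 / \<tau>) *\<^sub>R z)"

text \<open>The integral is over the completed measure, because the data are only Lebesgue measurable.\<close>

definition conv :: "('a::euclidean_space \<Rightarrow> real) \<Rightarrow> ('a \<Rightarrow> real) \<Rightarrow> 'a \<Rightarrow> real" where
  "conv \<theta> h x = (\<integral>y. h y * \<theta> (x - y) \<partial>lebesgue)"

lemma TF_cmult: "f \<in> test_functions S \<Longrightarrow> (\<lambda>x. c * f x) \<in> test_functions S"
  by (rule TF_mult[OF _ smooth_on_const])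

lemma id_lebesgue_measurable: "(\<lambda>y::'a::euclidean_space. y) \<in> borel_measurable lebesgue"
  by (rule measurable_completion) simp

lemma phis_TF: "\<tau> > 0 \<Longrightarrow> phis \<tau> \<in> TF"
  using TF_cmult[OF TF_scale[OF moll_TF, of "1/\<tau>" 0], of "(1 / \<tau>) ^ DIM('a)"] by (simp add: phis_def[abs_def])

lemma kers_TF: "\<tau> > 0 \<Longrightarrow> (kers \<tau> :: 'a::euclidean_space \<Rightarrow> real) \<in> TF"
  using TF_cmult[OF TF_scale[OF moll_ker_TF, of "1/\<tau>" 0], of "\<tau>\<^sup>2 * (1 / \<tau>) ^ DIM('a)"] by (simp add: kers_def[abs_def])

lemma kers_laplacian:
  assumes "\<tau> > 0"
  shows "laplacian (kers \<tau>) z = phis \<tau> z - phis (\<tau> / 2) (z::'a::euclidean_space)"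
proof -
  let ?c = "\<tau>\<^sup>2 * (1 / \<tau>) ^ DIM('a)"
  have "laplacian (kers \<tau>) z = laplacian (\<lambda>x::'a. ?c * moll_ker ((1 / \<tau>) *\<^sub>R (x - 0))) z"
    by (simp add: kers_def[abs_def])
  also have "\<dots> = ?c * ((1 / \<tau>)\<^sup>2 * (moll ((1 / \<tau>) *\<^sub>R z) - 2 ^ DIM('a) * moll (2 *\<^sub>R (1 / \<tau>) *\<^sub>R z)))"
    by (subst laplacian_cmult[OF smooth_on_scale[OF moll_ker_smooth]])
       (simp only: laplacian_scale[OF moll_ker_smooth] moll_ker_laplacian, simp)
  also have "\<dots> = phis \<tau> z - phis (\<tau> / 2) z"
    using assms by (simp add: phis_def power_mult_distrib power_divide field_simps power2_eq_square)
  finally show ?thesis .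
qed

lemma phis_nonneg: "\<tau> > 0 \<Longrightarrow> phis \<tau> z \<ge> 0"
  by (simp add: phis_def moll_nonneg)

lemma norm_scale_ge: "\<tau> > 0 \<Longrightarrow> norm z \<ge> \<tau> \<Longrightarrow> 1 \<le> norm ((1 / \<tau>) *\<^sub>R z)"
  by (simp add: field_simps)

lemma phis_eq_0: "\<tau> > 0 \<Longrightarrow> norm z \<ge> \<tau> \<Longrightarrow> phis \<tau> z = 0"
  by (simp only: phis_def moll_eq_0(1)[OF norm_scale_ge] mult_zero_right)

lemma kers_eq_0: "\<tau> > 0 \<Longrightarrow> norm z \<ge> \<tau> \<Longrightarrow> kers \<tau> z = 0"
  by (simp only: kers_def moll_ker_eq_0[OF norm_scale_ge] mult_zero_right)

lemma phis_minus: "phis \<tau> (- z) = phis \<tau> z"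
  using moll_minus(1)[of "(1 / \<tau>) *\<^sub>R z"] by (simp add: phis_def)

lemma kers_minus: "kers \<tau> (- z) = kers \<tau> z"
  using moll_ker_minus[of "(1 / \<tau>) *\<^sub>R z"] by (simp add: kers_def)

lemma phis_integral: 
  assumes "\<tau> > 0" shows "(\<integral>y. phis \<tau> (x - y) \<partial>lborel) = 1"
proof -
  have "1 = (\<integral>z. moll (z::'a) \<partial>lborel)" by (simp add: moll_integral)
  also have "\<dots> = \<bar>- (1 / \<tau>)\<bar> ^ DIM('a) * (\<integral>y. moll ((1 / \<tau>) *\<^sub>R x + (- (1 / \<tau>)) *\<^sub>R (y::'a)) \<partial>lborel)"
    by (rule lborel_integral_affine) (use assms TF_measurable[OF moll_TF] in auto)
  also have "\<dots> = (\<integral>y. phis \<tau> (x - y) \<partial>lborel)"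
    using assms by (simp add: phis_def scaleR_diff_right)
  finally show ?thesis by simp
qed

lemma phis_integral_x: 
  assumes "\<tau> > 0" shows "(\<integral>x. phis \<tau> (x - y) \<partial>lborel) = 1"
proof -
  have "phis \<tau> (x - y) = phis \<tau> (y - x)" for x using phis_minus[of \<tau> "x - y"] by simp
  then show ?thesis using phis_integral[OF assms, of y] by simp
qed

lemma conv_integrable:
  assumes "\<theta> \<in> TF" "integrable lebesgue h"
  shows "integrable lebesgue (\<lambda>y. h y * \<theta> (x - y))"
  using param_integrable[of "\<lambda>_. 1" lebesgue 1 "\<lambda>y. y" \<theta> h x] assms id_lebesgue_measurable by simp

lemma conv_smooth:
  assumes "\<theta> \<in> TF" "integrable lebesgue h"
  shows "smooth_on UNIV (conv \<theta> h)" "laplacian (conv \<theta> h) x = conv (laplacian \<theta>) h x"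
    "b \<in> Basis \<Longrightarrow> partial_deriv b (conv \<theta> h) = conv (partial_deriv b \<theta>) h"
proof -
  note m = id_lebesgue_measurable
  show "smooth_on UNIV (conv \<theta> h)"
    using param_smooth[of "\<lambda>_. 1" lebesgue 1 "\<lambda>y. y", OF _ _ m assms] by (simp add: conv_def[abs_def])
  show "laplacian (conv \<theta> h) x = conv (laplacian \<theta>) h x"
    using param_laplacian[of "\<lambda>_. 1" lebesgue 1 "\<lambda>y. y", OF _ _ m assms, of x] by (simp add: conv_def[abs_def])
  show "b \<in> Basis \<Longrightarrow> partial_deriv b (conv \<theta> h) = conv (partial_deriv b \<theta>) h"
    using param_partial[of "\<lambda>_. 1" lebesgue 1 "\<lambda>y. y", OF _ _ m assms, of b] by (simp add: conv_def[abs_def])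
qed

lemma conv_kers_laplacian:
  assumes "\<tau> > 0" "integrable lebesgue h"
  shows "laplacian (conv (kers \<tau>) h) x = conv (phis \<tau>) h x - conv (phis (\<tau> / 2)) h x"
proof -
  have "\<tau> / 2 > 0" using assms by simp
  then show ?thesis
    unfolding conv_smooth(2)[OF kers_TF[OF assms(1)] assms(2)]
    using conv_integrable[OF phis_TF[OF assms(1)] assms(2), of x] conv_integrable[OF phis_TF assms(2), of "\<tau> / 2" x]
    by (simp add: conv_def kers_laplacian[OF assms(1)] right_diff_distrib)
qed

text \<open>The density \<open>h\<close> is only compared with \<open>W\<close> on the support of the kernel: the growth of \<open>W\<close> over small
  balls will turn this into decay in \<open>\<tau>\<close>.\<close>

lemma conv_bound:
  assumes th: "\<theta> \<in> TF" and h: "integrable lebesgue h" and B: "\<And>z. \<bar>\<theta> z\<bar> \<le> B"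
    and supp: "\<And>z. norm z \<ge> \<tau> \<Longrightarrow> \<theta> z = 0" and W: "integrable lebesgue W" "AE y in lebesgue. \<bar>h y\<bar> \<le> W y"
  shows "\<bar>conv \<theta> h x\<bar> \<le> B * (\<integral>y. indicator (ball x \<tau>) y * W y \<partial>lebesgue)"
proof -
  have "\<bar>conv \<theta> h x\<bar> \<le> (\<integral>y. \<bar>h y * \<theta> (x - y)\<bar> \<partial>lebesgue)" unfolding conv_def by (rule integral_abs_bound)
  also have "\<dots> \<le> (\<integral>y. B * (indicator (ball x \<tau>) y * W y) \<partial>lebesgue)"
  proof (rule integral_mono_AE)
    show "integrable lebesgue (\<lambda>y. \<bar>h y * \<theta> (x - y)\<bar>)" using conv_integrable[OF th h] by auto
    show "integrable lebesgue (\<lambda>y. B * (indicator (ball x \<tau>) y * W y))"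
      using integrable_mult_indicator[OF _ W(1), of "ball x \<tau>"] by simp
    show "AE y in lebesgue. \<bar>h y * \<theta> (x - y)\<bar> \<le> B * (indicator (ball x \<tau>) y * W y)"
      using W(2)
    proof eventually_elim
      case (elim y)
      show ?case
      proof (cases "y \<in> ball x \<tau>")
        case True
        have "\<bar>h y\<bar> * \<bar>\<theta> (x - y)\<bar> \<le> W y * B" using elim B by (intro mult_mono) auto
        then show ?thesis using True by (simp add: abs_mult mult.commute)
      next
        case False
        then show ?thesis using supp[of "x - y"] by (simp add: dist_norm)
      qed
    qed
  qed
  finally show ?thesis by simp
qed

lemma conv_lborel:
  assumes "\<theta> \<in> TF" "h \<in> borel_measurable borel"
  shows "conv \<theta> h x = (\<integral>y. h y * \<theta> (x - y) \<partial>lborel)"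
  unfolding conv_def by (rule integral_completion) (use assms TF_measurable[OF assms(1)] in measurable)

lemma conv_mean:
  assumes \<tau>: "\<tau> > 0" and h: "integrable lborel h"
  shows "integrable lborel (conv (phis \<tau>) h)" "(\<integral>x. conv (phis \<tau>) h x \<partial>lborel) = (\<integral>x. h x \<partial>lborel)"
proof -
  have [measurable]: "h \<in> borel_measurable borel" "phis \<tau> \<in> borel_measurable borel"
    using h TF_measurable[OF phis_TF[OF \<tau>]] by auto
  have 1: "(\<lambda>x. phis \<tau> (x - y)) \<in> TF" for y :: 'a
    using TF_scale[OF phis_TF[OF \<tau>], of 1 y] by simp
  have int: "integrable (lborel \<Otimes>\<^sub>M lborel) (\<lambda>(y, x). h y * phis \<tau> (x - y))"
  proof (rule lborel_pair.Fubini_integrable)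
    have "(\<integral>x. norm (case (y, x) of (y, x) \<Rightarrow> h y * phis \<tau> (x - y)) \<partial>lborel) = \<bar>h y\<bar>" for y
      using phis_integral_x[OF \<tau>, of y] by (simp add: abs_mult abs_of_nonneg[OF phis_nonneg[OF \<tau>]])
    then show "integrable lborel (\<lambda>y. \<integral>x. norm (case (y, x) of (y, x) \<Rightarrow> h y * phis \<tau> (x - y)) \<partial>lborel)"
      using h by simp
    show "AE y in lborel. integrable lborel (\<lambda>x. case (y, x) of (y, x) \<Rightarrow> h y * phis \<tau> (x - y))"
      using TF_integrable[OF 1] by simp
  qed measurable
  have c: "conv (phis \<tau>) h = (\<lambda>x. \<integral>y. h y * phis \<tau> (x - y) \<partial>lborel)"
    by (rule ext, rule conv_lborel) (use phis_TF[OF \<tau>] in auto)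
  show "integrable lborel (conv (phis \<tau>) h)"
    unfolding c by (rule lborel_pair.integrable_snd[OF int])
  have "(\<integral>x. (\<integral>y. h y * phis \<tau> (x - y) \<partial>lborel) \<partial>lborel) = (\<integral>y. (\<integral>x. h y * phis \<tau> (x - y) \<partial>lborel) \<partial>lborel)"
    by (rule lborel_pair.Fubini_integral[OF int])
  then show "(\<integral>x. conv (phis \<tau>) h x \<partial>lborel) = (\<integral>x. h x \<partial>lborel)"
    unfolding c by (simp add: phis_integral_x[OF \<tau>])
qed

lemma lborel_imp_lebesgue_integrable: "integrable lborel h \<Longrightarrow> integrable lebesgue h" for h :: "'a::euclidean_space \<Rightarrow> real"
  by (subst integrable_completion) auto

lemma conv_add:
  assumes "\<theta> \<in> TF" "integrable lebesgue f" "integrable lebesgue g"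
  shows "conv \<theta> (\<lambda>x. f x + g x) x = conv \<theta> f x + conv \<theta> g x"
  using conv_integrable[OF assms(1,2), of x] conv_integrable[OF assms(1,3), of x]
  by (simp add: conv_def distrib_right)

lemma conv_cmult: "conv \<theta> (\<lambda>x. c * f x) x = c * conv \<theta> f x"
  by (simp add: conv_def mult.assoc)

definition moll_gap :: "real \<Rightarrow> ('a::euclidean_space \<Rightarrow> real) \<Rightarrow> real" where
  "moll_gap \<tau> h = (\<integral>x. \<bar>conv (phis \<tau>) h x - h x\<bar> \<partial>lborel)"

lemma moll_gap_le:
  assumes \<tau>: "\<tau> > 0" and h: "integrable lborel h"
  shows "moll_gap \<tau> h \<le> 2 * (\<integral>x. \<bar>h x\<bar> \<partial>lborel)"
proof -
  have ih: "integrable lborel (\<lambda>x. \<bar>h x\<bar>)" using h by simp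
  note li = lborel_imp_lebesgue_integrable
  have le: "\<bar>conv (phis \<tau>) h x\<bar> \<le> conv (phis \<tau>) (\<lambda>x. \<bar>h x\<bar>) x" for x
    unfolding conv_def by (rule integral_abs_bound[THEN order_trans]) (simp add: abs_mult phis_nonneg[OF \<tau>])
  have "moll_gap \<tau> h \<le> (\<integral>x. conv (phis \<tau>) (\<lambda>x. \<bar>h x\<bar>) x + \<bar>h x\<bar> \<partial>lborel)"
    unfolding moll_gap_def
  proof (rule integral_mono)
    fix x show "\<bar>conv (phis \<tau>) h x - h x\<bar> \<le> conv (phis \<tau>) (\<lambda>x. \<bar>h x\<bar>) x + \<bar>h x\<bar>"
      using le[of x] by linarith
  qed (use conv_mean(1)[OF \<tau> h] conv_mean(1)[OF \<tau> ih] h ih in auto)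
  also have "\<dots> = 2 * (\<integral>x. \<bar>h x\<bar> \<partial>lborel)"
    using conv_mean[OF \<tau> ih] ih by simp
  finally show ?thesis .
qed

lemma moll_gap_add:
  assumes \<tau>: "\<tau> > 0" and f: "integrable lborel f" and g: "integrable lborel g"
  shows "moll_gap \<tau> (\<lambda>x. f x + g x) \<le> moll_gap \<tau> f + moll_gap \<tau> g"
proof -
  note li = lborel_imp_lebesgue_integrable
  have "moll_gap \<tau> (\<lambda>x. f x + g x) \<le> (\<integral>x. \<bar>conv (phis \<tau>) f x - f x\<bar> + \<bar>conv (phis \<tau>) g x - g x\<bar> \<partial>lborel)"
    unfolding moll_gap_def
  proof (rule integral_mono)
    show "integrable lborel (\<lambda>x. \<bar>conv (phis \<tau>) (\<lambda>x. f x + g x) x - (f x + g x)\<bar>)"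
      using conv_mean(1)[OF \<tau> Bochner_Integration.integrable_add[OF f g]] f g by auto
    show "integrable lborel (\<lambda>x. \<bar>conv (phis \<tau>) f x - f x\<bar> + \<bar>conv (phis \<tau>) g x - g x\<bar>)"
      using conv_mean(1)[OF \<tau> f] conv_mean(1)[OF \<tau> g] f g by auto
    fix x show "\<bar>conv (phis \<tau>) (\<lambda>x. f x + g x) x - (f x + g x)\<bar> \<le> \<bar>conv (phis \<tau>) f x - f x\<bar> + \<bar>conv (phis \<tau>) g x - g x\<bar>"
      unfolding conv_add[OF phis_TF[OF \<tau>] li[OF f] li[OF g]] by linarith
  qed
  also have "\<dots> = moll_gap \<tau> f + moll_gap \<tau> g"
    unfolding moll_gap_def using conv_mean(1)[OF \<tau> f] conv_mean(1)[OF \<tau> g] f g by (intro Bochner_Integration.integral_add) auto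
  finally show ?thesis .
qed

lemma moll_gap_nonneg: "moll_gap \<tau> h \<ge> 0"
  unfolding moll_gap_def by simp

lemma moll_gap_approx:
  assumes t: "\<And>n. t n > 0" and f: "integrable lborel f"
    and ap: "\<And>e. e > 0 \<Longrightarrow> \<exists>g. integrable lborel g \<and> (\<lambda>n. moll_gap (t n) g) \<longlonglongrightarrow> 0 \<and> (\<integral>x. \<bar>f x - g x\<bar> \<partial>lborel) < e"
  shows "(\<lambda>n. moll_gap (t n) f) \<longlonglongrightarrow> (0::real)"
proof (rule LIMSEQ_I)
  fix e :: real assume "e > 0"
  then obtain g where g: "integrable lborel g" "(\<lambda>n. moll_gap (t n) g) \<longlonglongrightarrow> 0" "(\<integral>x. \<bar>f x - g x\<bar> \<partial>lborel) < e / 4"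
    using ap[of "e / 4"] by auto
  from LIMSEQ_D[OF g(2), of "e / 2"] \<open>e > 0\<close> obtain n0 where n0: "\<And>n. n \<ge> n0 \<Longrightarrow> norm (moll_gap (t n) g - 0) < e / 2" by auto
  show "\<exists>n0. \<forall>n\<ge>n0. norm (moll_gap (t n) f - 0) < e"
  proof (intro exI allI impI)
    fix n assume n: "n \<ge> n0"
    have "moll_gap (t n) f = moll_gap (t n) (\<lambda>x. g x + (f x - g x))" by simp
    also have "\<dots> \<le> moll_gap (t n) g + moll_gap (t n) (\<lambda>x. f x - g x)"
      by (rule moll_gap_add[OF t]) (use f g in auto)
    also have "moll_gap (t n) (\<lambda>x. f x - g x) \<le> 2 * (\<integral>x. \<bar>f x - g x\<bar> \<partial>lborel)"
      by (rule moll_gap_le[OF t]) (use f g in auto)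
    finally show "norm (moll_gap (t n) f - 0) < e" using n0[OF n] g(3) moll_gap_nonneg[of "t n" f] by auto
  qed
qed

text \<open>The mollifications of the indicator of an open set are eventually 1 at each point of the set, and they
  have the same mass as the indicator. So the distance in the mean is twice the integral of the
  positive part of the deficit, which tends to 0 by dominated convergence.\<close>

lemma moll_gap_open:
  assumes t: "\<And>n. t n > 0" "t \<longlonglongrightarrow> 0" and U: "open U" "emeasure lborel U < \<infinity>"
  shows "(\<lambda>n. moll_gap (t n) (indicator U :: 'a::euclidean_space \<Rightarrow> real)) \<longlonglongrightarrow> 0"
proof -
  have iU: "integrable lborel (indicator U :: 'a \<Rightarrow> real)" using U by auto
  define c where "c n = conv (phis (t n)) (indicator U :: 'a \<Rightarrow> real)" for n
  have ic: "integrable lborel (c n)" "(\<integral>x. c n x \<partial>lborel) = (\<integral>x. indicator U x \<partial>lborel)" for n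
    unfolding c_def using conv_mean[OF t(1) iU] by auto
  have c0: "c n x \<ge> 0" for n x unfolding c_def conv_def 
    by (rule integral_nonneg_AE) (simp add: phis_nonneg t)
  have eq: "moll_gap (t n) (indicator U) = (\<integral>x. 2 * max 0 (indicator U x - c n x) \<partial>lborel)" for n
  proof -
    have "(\<integral>x. 2 * max 0 (indicator U x - c n x) \<partial>lborel) 
      = (\<integral>x. 2 * max 0 (indicator U x - c n x) \<partial>lborel) - ((\<integral>x. indicator U x \<partial>lborel) - (\<integral>x. c n x \<partial>lborel))"
      using ic(2)[of n] by simp
    also have "\<dots> = (\<integral>x. 2 * max 0 (indicator U x - c n x) - (indicator U x - c n x) \<partial>lborel)"
      using ic(1)[of n] iU by (subst Bochner_Integration.integral_diff) auto
    also have "\<dots> = (\<integral>x. \<bar>c n x - indicator U x\<bar> \<partial>lborel)"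
      by (rule Bochner_Integration.integral_cong) (auto simp: max_def abs_if)
    finally show ?thesis by (simp add: moll_gap_def c_def)
  qed
  have "(\<lambda>n. \<integral>x. 2 * max 0 (indicator U x - c n x) \<partial>lborel) \<longlonglongrightarrow> (\<integral>x. (0::real) \<partial>(lborel::'a measure))"
  proof (rule integral_dominated_convergence[where w="\<lambda>x. 2 * indicator U x"])
    show "AE x in lborel. (\<lambda>n. 2 * max 0 (indicator U x - c n x)) \<longlonglongrightarrow> 0"
    proof (rule AE_I2)
      fix x :: 'a
      show "(\<lambda>n. 2 * max 0 (indicator U x - c n x)) \<longlonglongrightarrow> 0"
      proof (cases "x \<in> U")
        case True
        then obtain e where e: "e > 0" "ball x e \<subseteq> U" using U(1) openE by blast
        from t(2) e(1) have "eventually (\<lambda>n. t n < e) sequentially" by (rule order_tendstoD)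
        then have "eventually (\<lambda>n. 2 * max 0 (indicator U x - c n x) = 0) sequentially"
        proof eventually_elim
          case (elim n)
          have "c n x = (\<integral>y. indicator U y * phis (t n) (x - y) \<partial>lborel)"
            unfolding c_def by (rule conv_lborel[OF phis_TF[OF t(1)]]) (use U in auto)
          also have "\<dots> = (\<integral>y. phis (t n) (x - y) \<partial>lborel)"
          proof (rule Bochner_Integration.integral_cong[OF refl])
            fix y show "indicator U y * phis (t n) (x - y) = phis (t n) (x - y)"
            proof (cases "y \<in> ball x e")
              case False
              then have "norm (x - y) \<ge> t n" using elim by (simp add: dist_norm)
              then show ?thesis by (simp add: phis_eq_0[OF t(1)])
            qed (use e in auto)
          qed
          also have "\<dots> = 1" by (rule phis_integral[OF t(1)])
          finally show ?case using True by simp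
        qed
        then show ?thesis by (rule tendsto_eventually)
      next
        case False
        then have "(\<lambda>n. 2 * max 0 (indicator U x - c n x)) = (\<lambda>n. 0)" using c0 by (auto simp: max_def order_antisym)
        then show ?thesis by simp
      qed
    qed
    show "AE x in lborel. norm (2 * max 0 (indicator U x - c n x)) \<le> 2 * indicator U x" for n
      by (rule AE_I2) (use c0 in \<open>auto split: split_indicator simp: max_def\<close>)
    show "(\<lambda>x. 2 * max 0 (indicator U x - c n x)) \<in> borel_measurable lborel" for n
    proof -
      have [measurable]: "c n \<in> borel_measurable borel" "U \<in> sets borel"
        using borel_measurable_integrable[OF ic(1)[of n]] U(1) by auto
      show ?thesis by measurable
    qed
  qed (use iU in auto)
  then show ?thesis by (simp add: eq)
qed

lemma moll_gap_cmult:
  assumes "\<tau> > 0" shows "moll_gap \<tau> (\<lambda>x. c * h x) = \<bar>c\<bar> * moll_gap \<tau> h"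
proof -
  have "\<bar>conv (phis \<tau>) (\<lambda>x. c * h x) x - c * h x\<bar> = \<bar>c\<bar> * \<bar>conv (phis \<tau>) h x - h x\<bar>" for x
    unfolding conv_cmult by (metis abs_mult right_diff_distrib)
  then show ?thesis by (simp add: moll_gap_def)
qed

text \<open>Integrable functions are limits in the mean of linear combinations of indicators of measurable sets,
  these of indicators of open sets by outer regularity, and mollification is a bounded operation in the
  mean.\<close>

lemma moll_gap_tendsto:
  assumes t: "\<And>n. t n > 0" "t \<longlonglongrightarrow> 0" and h: "integrable lborel (h :: 'a::euclidean_space \<Rightarrow> real)"
  shows "(\<lambda>n. moll_gap (t n) h) \<longlonglongrightarrow> 0"
  using h
proof (induction h rule: integrable_induct)
  case (base A c)
  have [measurable]: "A \<in> sets borel" using base by simp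
  have iA: "integrable lborel (indicator A :: 'a \<Rightarrow> real)" using base by auto
  have "(\<lambda>n. moll_gap (t n) (indicator A :: 'a \<Rightarrow> real)) \<longlonglongrightarrow> 0"
  proof (rule moll_gap_approx[OF t(1) iA])
    fix e :: real assume "e > 0"
    then obtain U where U: "open U" "A \<subseteq> U" "emeasure lborel (U - A) < e"
      using outer_regular_lborel[of A e] by auto
    have [measurable]: "U \<in> sets borel" using U by auto
    have UA: "emeasure lborel (U - A) < \<infinity>" using U(3) by (metis ennreal_less_top infinity_ennreal_def less_trans)
    have "emeasure lborel U = emeasure lborel (A \<union> (U - A))" using U(2) by (simp add: Un_absorb1)
    also have "\<dots> \<le> emeasure lborel A + emeasure lborel (U - A)" by (rule emeasure_subadditive) auto
    also have "\<dots> < \<infinity>" using base(2) UA by (simp add: ennreal_add_less_top)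
    finally have fU: "emeasure lborel U < \<infinity>" .
    have "(\<integral>x. \<bar>indicator A x - indicator U x\<bar> \<partial>lborel) = (\<integral>x. (indicator (U - A) x :: real) \<partial>lborel)"
      by (rule Bochner_Integration.integral_cong) (use U(2) in \<open>auto split: split_indicator\<close>)
    also have "\<dots> = measure lborel (U - A)" by simp
    also have "\<dots> < e" using U(3) UA \<open>e > 0\<close> unfolding measure_def
      by (metis enn2real_less_iff infinity_ennreal_def)
    finally show "\<exists>g. integrable lborel g \<and> (\<lambda>n. moll_gap (t n) g) \<longlonglongrightarrow> 0 \<and> (\<integral>x. \<bar>indicator A x - g x\<bar> \<partial>lborel) < e"
      using moll_gap_open[OF t U(1) fU] fU by (intro exI[of _ "indicator U"]) auto
  qed
  then have "(\<lambda>n. \<bar>c\<bar> * moll_gap (t n) (indicator A :: 'a \<Rightarrow> real)) \<longlonglongrightarrow> \<bar>c\<bar> * 0" by (intro tendsto_intros)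
  then show ?case using moll_gap_cmult[OF t(1), of _ c "indicator A"] by (simp add: mult.commute)
next
  case (add f g)
  have "(\<lambda>n. moll_gap (t n) f + moll_gap (t n) g) \<longlonglongrightarrow> 0 + 0" by (intro tendsto_add add)
  then show ?case
    by (intro Lim_null_comparison[of "\<lambda>n. moll_gap (t n) (\<lambda>x. f x + g x)" "\<lambda>n. moll_gap (t n) f + moll_gap (t n) g"])
       (use moll_gap_add[OF t(1) add(1,2)] in \<open>auto simp: moll_gap_nonneg\<close>)
next
  case (lim f s)
  show ?case
  proof (rule moll_gap_approx[OF t(1) lim(4)])
    fix e :: real assume "e > 0"
    have "(\<lambda>n. \<integral>x. \<bar>f x - s n x\<bar> \<partial>lborel) \<longlonglongrightarrow> (\<integral>x. (0::real) \<partial>(lborel::'a measure))"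
    proof (rule integral_dominated_convergence[where w="\<lambda>x. 3 * \<bar>f x\<bar>"])
      show "AE x in lborel. (\<lambda>n. \<bar>f x - s n x\<bar>) \<longlonglongrightarrow> 0"
      proof (rule AE_I2)
        fix x :: 'a
        have "(\<lambda>n. \<bar>f x - s n x\<bar>) \<longlonglongrightarrow> \<bar>f x - f x\<bar>" using lim(2)[of x] by (intro tendsto_intros) auto
        then show "(\<lambda>n. \<bar>f x - s n x\<bar>) \<longlonglongrightarrow> 0" by simp
      qed
      show "AE x in lborel. norm \<bar>f x - s n x\<bar> \<le> 3 * \<bar>f x\<bar>" for n
      proof (rule AE_I2)
        fix x :: 'a
        show "norm \<bar>f x - s n x\<bar> \<le> 3 * \<bar>f x\<bar>" using lim(3)[of x n] by (simp add: abs_triangle_ineq4[THEN order_trans])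
      qed
    qed (use lim in \<open>auto intro: borel_measurable_integrable\<close>)
    then have "eventually (\<lambda>n. (\<integral>x. \<bar>f x - s n x\<bar> \<partial>lborel) < e) sequentially"
      using \<open>e > 0\<close> by (intro order_tendstoD(2)) auto
    then obtain n where "(\<integral>x. \<bar>f x - s n x\<bar> \<partial>lborel) < e" by (meson eventually_sequentially order_refl)
    with lim(1) lim(5) show "\<exists>g. integrable lborel g \<and> (\<lambda>n. moll_gap (t n) g) \<longlonglongrightarrow> 0 \<and> (\<integral>x. \<bar>f x - g x\<bar> \<partial>lborel) < e"
      by blast
  qed
qed

lemma conv_cong_AE:
  assumes "AE x in lebesgue. h x = h' x" "h \<in> borel_measurable lebesgue" "h' \<in> borel_measurable lebesgue" "\<theta> \<in> TF"
  shows "conv \<theta> h x = conv \<theta> h' x"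
proof -
  have [measurable]: "\<theta> \<in> borel_measurable borel" using TF_measurable[OF assms(4)] .
  note [measurable] = id_lebesgue_measurable
  have [measurable]: "(\<lambda>y. \<theta> (x - y)) \<in> borel_measurable lebesgue" by measurable
  show ?thesis unfolding conv_def
    by (rule integral_cong_AE) (use assms in auto)
qed

lemma conv_tendsto_L1:
  assumes t: "\<And>n. t n > 0" "t \<longlonglongrightarrow> 0" and h: "integrable lebesgue (h :: 'a::euclidean_space \<Rightarrow> real)"
  shows "\<And>n. integrable lebesgue (\<lambda>x. conv (phis (t n)) h x - h x)"
    "(\<lambda>n. \<integral>x. \<bar>conv (phis (t n)) h x - h x\<bar> \<partial>lebesgue) \<longlonglongrightarrow> 0"
proof -
  obtain g where g: "g \<in> borel_measurable lborel" "AE x in lborel. h x = g x"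
    using completion_ex_borel_measurable_real[of h lborel] h by auto
  have ae: "AE x in lebesgue. h x = g x" using g(2) by (rule AE_completion)
  have gm: "g \<in> borel_measurable lebesgue" using g(1) by (rule measurable_completion)
  have gi: "integrable lebesgue g"
    by (rule integrable_cong_AE_imp[OF h gm]) (use ae in auto)
  then have gi': "integrable lborel g" using g(1) by (simp add: integrable_completion)
  have c: "conv (phis (t n)) h x = conv (phis (t n)) g x" for n x
    by (rule conv_cong_AE[OF ae _ gm phis_TF[OF t(1)]]) (use h in auto)
  show i: "integrable lebesgue (\<lambda>x. conv (phis (t n)) h x - h x)" for n
    unfolding c using lborel_imp_lebesgue_integrable[OF conv_mean(1)[OF t(1) gi']] h by auto
  have "(\<integral>x. \<bar>conv (phis (t n)) h x - h x\<bar> \<partial>lebesgue) = moll_gap (t n) g" for n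
  proof -
    have "(\<integral>x. \<bar>conv (phis (t n)) h x - h x\<bar> \<partial>lebesgue) = (\<integral>x. \<bar>conv (phis (t n)) g x - g x\<bar> \<partial>lebesgue)"
      by (rule integral_cong_AE)
         (use i[of n] lborel_imp_lebesgue_integrable[OF conv_mean(1)[OF t(1) gi'], of n] gi ae c in auto)
    also have "\<dots> = moll_gap (t n) g" unfolding moll_gap_def
      by (rule integral_completion) (use conv_mean(1)[OF t(1) gi', of n] gi' in auto)
    finally show ?thesis .
  qed
  then show "(\<lambda>n. \<integral>x. \<bar>conv (phis (t n)) h x - h x\<bar> \<partial>lebesgue) \<longlonglongrightarrow> 0"
    using moll_gap_tendsto[OF t gi'] by simp
qed

section \<open>Weak solutions and the comparison integral\<close>

text \<open>A function with zero boundary values that satisfies \<open>- \<Delta> u = g\<close>. The gradient \<open>G\<close> and the approximating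
  test functions are part of the notion, because comparison arguments test the equation with truncations
  of the approximations and pass to the limit. Both forms of the equation are recorded: the one with the
  Laplacian for mollification, the one with \<open>G\<close> for comparison.\<close>

definition weak_solution ::
  "'a::euclidean_space set \<Rightarrow> ('a \<Rightarrow> real) \<Rightarrow> ('a \<Rightarrow> real) \<Rightarrow> bool" where
  "weak_solution \<Omega> u g \<longleftrightarrow> u \<in> Lp_on 2 \<Omega> \<and> integrable (lebesgue_on \<Omega>) g \<and>
     (\<forall>\<theta>\<in>test_functions \<Omega>. (\<integral>x. u x * laplacian \<theta> x \<partial>lebesgue_on \<Omega>) = - (\<integral>x. g x * \<theta> x \<partial>lebesgue_on \<Omega>)) \<and>
     (\<exists>G\<in>Lp_on 2 \<Omega>. (\<forall>\<theta>\<in>test_functions \<Omega>. (\<integral>x. G x \<bullet> grad \<theta> x \<partial>lebesgue_on \<Omega>) = (\<integral>x. g x * \<theta> x \<partial>lebesgue_on \<Omega>)) \<and>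
       (\<exists>\<phi>. (\<forall>k::nat. \<phi> k \<in> test_functions \<Omega>) \<and>
         (\<lambda>k. (\<integral>x. (u x - \<phi> k x)\<^sup>2 \<partial>lebesgue_on \<Omega>) + (\<integral>x. (norm (G x - grad (\<phi> k) x))\<^sup>2 \<partial>lebesgue_on \<Omega>)) \<longlonglongrightarrow> 0))"

lemma Lp_on_2:
  assumes "u \<in> Lp_on 2 \<Omega>"
  shows "u \<in> borel_measurable (lebesgue_on \<Omega>)" "integrable (lebesgue_on \<Omega>) (\<lambda>x. (norm (u x))\<^sup>2)"
  using assms by (auto simp: Lp_on_def)

lemma finite_measure_bounded:
  assumes "open \<Omega>" "bounded \<Omega>"
  shows "finite_measure (lebesgue_on (\<Omega> :: 'a::euclidean_space set))"
proof
  have "emeasure (lebesgue_on \<Omega>) \<Omega> = emeasure lebesgue \<Omega>"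
    using assms(1) by (subst emeasure_restrict_space) auto
  also have "\<dots> < \<infinity>" using emeasure_bounded_finite[OF assms(2)] assms(1) by simp
  finally show "emeasure (lebesgue_on \<Omega>) (space (lebesgue_on \<Omega>)) \<noteq> \<infinity>" by (simp add: space_restrict_space)
qed

lemma continuous_measurable_on:
  fixes f :: "'a::euclidean_space \<Rightarrow> 'b::euclidean_space"
  assumes "continuous_on UNIV f"
  shows "f \<in> borel_measurable (lebesgue_on \<Omega>)"
  by (intro measurable_restrict_space1 measurable_completion)
     (use borel_measurable_continuous_onI[OF assms] in simp)

lemma continuous_bounded_on:
  fixes f :: "'a::euclidean_space \<Rightarrow> 'b::euclidean_space"
  assumes "continuous_on UNIV f" "bounded \<Omega>"
  shows "\<exists>B>0. \<forall>x\<in>\<Omega>. norm (f x) \<le> B"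
proof -
  have "compact (closure \<Omega>)" using assms(2) by simp
  then have "bounded (f ` closure \<Omega>)"
    using assms(1) by (intro compact_imp_bounded compact_continuous_image) (auto intro: continuous_on_subset)
  then obtain B where "B > 0" "\<forall>y\<in>f ` closure \<Omega>. norm y \<le> B" using bounded_pos by blast
  then show ?thesis using closure_subset[of \<Omega>] by (intro exI[of _ B]) auto
qed

lemma continuous_integrable_on:
  fixes f :: "'a::euclidean_space \<Rightarrow> real"
  assumes "continuous_on UNIV f" "open \<Omega>" "bounded \<Omega>"
  shows "integrable (lebesgue_on \<Omega>) f"
proof -
  interpret finite_measure "lebesgue_on \<Omega>" using finite_measure_bounded[OF assms(2,3)] .
  obtain B where "\<forall>x\<in>\<Omega>. norm (f x) \<le> B" using continuous_bounded_on[OF assms(1,3)] by blast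
  then show ?thesis
    by (intro integrable_const_bound[where B=B] continuous_measurable_on[OF assms(1)]) (auto simp: space_restrict_space)
qed

lemma smooth_grad_continuous:
  assumes "smooth_on UNIV f" shows "continuous_on UNIV (grad f)"
  unfolding grad_def[abs_def]
  by (intro continuous_intros smooth_on_continuous smooth_on_partial assms)

lemma smooth_laplacian_continuous:
  assumes "smooth_on UNIV f" shows "continuous_on UNIV (laplacian f)"
  unfolding laplacian_def[abs_def]
  by (intro continuous_intros smooth_on_continuous smooth_on_partial assms)

lemma test_functions_laplacian:
  assumes "\<theta> \<in> test_functions S" shows "(laplacian \<theta>) \<in> borel_measurable borel" "x \<notin> S \<Longrightarrow> laplacian \<theta> x = 0"
     "x \<notin> S \<Longrightarrow> grad \<theta> x = 0"
proof -
  show "(laplacian \<theta>) \<in> borel_measurable borel"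
    by (rule borel_measurable_continuous_onI[OF smooth_laplacian_continuous[OF test_functions_D(1)[OF assms]]])
  show "x \<notin> S \<Longrightarrow> laplacian \<theta> x = 0"
    by (auto simp: laplacian_def intro!: sum.neutral test_functions_D(5)[OF test_functions_partial[OF test_functions_partial[OF assms]]])
  show "x \<notin> S \<Longrightarrow> grad \<theta> x = 0"
    by (auto simp: grad_def intro!: sum.neutral test_functions_D(5)[OF test_functions_partial[OF assms]])
qed

lemma integral_lebesgue_on_full:
  fixes f :: "'a::euclidean_space \<Rightarrow> real"
  assumes "open \<Omega>" "\<And>x. x \<notin> \<Omega> \<Longrightarrow> f x = 0"
  shows "(\<integral>x. f x \<partial>lebesgue_on \<Omega>) = (\<integral>x. f x \<partial>lebesgue)"
    "integrable (lebesgue_on \<Omega>) f \<longleftrightarrow> integrable lebesgue f"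
proof -
  have eq: "indicator \<Omega> x * f x = f x" for x using assms(2)[of x] by (auto split: split_indicator)
  show "(\<integral>x. f x \<partial>lebesgue_on \<Omega>) = (\<integral>x. f x \<partial>lebesgue)"
    using assms(1) by (subst integral_restrict_space) (auto simp: eq)
  show "integrable (lebesgue_on \<Omega>) f \<longleftrightarrow> integrable lebesgue f"
    using assms(1) by (subst integrable_restrict_space) (auto simp: eq)
qed

lemma grad_diff:
  assumes "f differentiable (at x)" "g differentiable (at x)"
  shows "grad (\<lambda>x. f x - g x) x = grad f x - grad g x"
  by (rule grad_eqI)
     (use has_derivative_diff[OF has_derivative_grad[OF assms(1)] has_derivative_grad[OF assms(2)]]
       in \<open>simp add: inner_diff_left\<close>)

text \<open>Near a boundary point in the support of \<open>\<zeta>\<close> the function \<open>\<psi>\<close> is negative and \<open>\<phi>\<close> vanishes, so the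
  bump of \<open>\<psi> - \<phi>\<close> vanishes as well and extension by zero is smooth.\<close>

lemma truncated_test_function:
  fixes \<Omega> :: "'a::euclidean_space set"
  assumes O: "open \<Omega>" "bounded \<Omega>" and psi: "smooth_on UNIV \<psi>" and chi: "smooth_on UNIV \<zeta>"
    and phi: "\<phi> \<in> test_functions \<Omega>"
    and bd: "\<And>x. x \<in> frontier \<Omega> \<Longrightarrow> x \<in> closure {x. \<zeta> x \<noteq> 0} \<Longrightarrow> \<psi> x < 0"
  defines "\<theta> \<equiv> (\<lambda>x. if x \<in> \<Omega> then \<zeta> x * bump_deriv 0 (\<psi> x - \<phi> x) else 0)"
  shows "\<theta> \<in> test_functions \<Omega>"
    "x \<in> \<Omega> \<Longrightarrow> grad \<theta> x = bump_deriv 0 (\<psi> x - \<phi> x) *\<^sub>R grad \<zeta> x + (\<zeta> x * bump_deriv 1 (\<psi> x - \<phi> x)) *\<^sub>R (grad \<psi> x - grad \<phi> x)"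
proof -
  have phi_smooth: "smooth_on UNIV \<phi>" using test_functions_D(1)[OF phi] .
  have d: "smooth_on UNIV (\<lambda>x. \<psi> x - \<phi> x)" by (intro smooth_on_diff psi phi_smooth) simp
  have b: "smooth_on UNIV (\<lambda>x. bump_deriv 0 (\<psi> x - \<phi> x))"
    by (rule smooth_on_compose[OF _ smooth_real_bump_deriv d]) simp
  have sm: "smooth_on UNIV (\<lambda>x. \<zeta> x * bump_deriv 0 (\<psi> x - \<phi> x))"
    by (intro smooth_on_mult chi b) simp
  have out: "\<exists>U. open U \<and> x \<in> U \<and> (\<forall>y\<in>U. \<theta> y = 0)" if "x \<notin> \<Omega>" for x
  proof (cases "x \<in> closure \<Omega>")
    case False
    then show ?thesis using closure_subset[of \<Omega>] by (intro exI[of _ "- closure \<Omega>"]) (auto simp: \<theta>_def)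
  next
    case True
    with that O have fr: "x \<in> frontier \<Omega>" by (simp add: frontier_def interior_open)
    show ?thesis
    proof (cases "x \<in> closure {x. \<zeta> x \<noteq> 0}")
      case False
      then show ?thesis using closure_subset[of "{x. \<zeta> x \<noteq> 0}"]
        by (intro exI[of _ "- closure {x. \<zeta> x \<noteq> 0}"]) (auto simp: \<theta>_def)
    next
      case True
      have op: "open {y. \<psi> y < 0}"
        using smooth_on_continuous[OF psi] by (intro open_Collect_less) (auto intro: continuous_intros)
      have nin: "x \<notin> closure {x. \<phi> x \<noteq> 0}" using phi that by (auto simp: test_functions_def)
      have z: "\<phi> y = 0" if "y \<notin> closure {x. \<phi> x \<noteq> 0}" for y
        using closure_subset[of "{x. \<phi> x \<noteq> 0}"] that by auto
      show ?thesis
      proof (intro exI conjI ballI)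
        show "open ({y. \<psi> y < 0} \<inter> - closure {x. \<phi> x \<noteq> 0})" using op by (intro open_Int) auto
        show "x \<in> {y. \<psi> y < 0} \<inter> - closure {x. \<phi> x \<noteq> 0}" using bd[OF fr True] nin by simp
        fix y assume "y \<in> {y. \<psi> y < 0} \<inter> - closure {x. \<phi> x \<noteq> 0}"
        then show "\<theta> y = 0" using z[of y] by (simp add: \<theta>_def bump_eq_0)
      qed
    qed
  qed
  have th_smooth: "smooth_on UNIV \<theta>"
  proof (rule smooth_on_locally)
    fix x :: 'a
    show "\<exists>U h. open U \<and> x \<in> U \<and> (\<forall>y\<in>U. \<theta> y = h y) \<and> smooth_on U h"
    proof (cases "x \<in> \<Omega>")
      case True
      then show ?thesis using O smooth_on_subset[OF sm, of \<Omega>]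
        by (intro exI[of _ \<Omega>] exI[of _ "\<lambda>x. \<zeta> x * bump_deriv 0 (\<psi> x - \<phi> x)"]) (auto simp: \<theta>_def)
    next
      case False
      from out[OF this] obtain U where "open U" "x \<in> U" "\<forall>y\<in>U. \<theta> y = 0" by blast
      then show ?thesis by (intro exI[of _ U] exI[of _ "\<lambda>x. 0"]) (auto intro: smooth_on_const)
    qed
  qed
  have cl: "closure {x. \<theta> x \<noteq> 0} \<subseteq> \<Omega>"
  proof
    fix x assume x: "x \<in> closure {x. \<theta> x \<noteq> 0}"
    show "x \<in> \<Omega>"
    proof (rule ccontr)
      assume "x \<notin> \<Omega>"
      from out[OF this] obtain U where U: "open U" "x \<in> U" "\<forall>y\<in>U. \<theta> y = 0" by blast
      then have "U \<inter> {x. \<theta> x \<noteq> 0} = {}" by auto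
      then show False using open_Int_closure_eq_empty[OF U(1), of "{x. \<theta> x \<noteq> 0}"] x U(2) by auto
    qed
  qed
  moreover have "bounded (closure {x. \<theta> x \<noteq> 0})" using bounded_subset[OF O(2) cl] .
  ultimately show "\<theta> \<in> test_functions \<Omega>"
    using th_smooth by (simp add: test_functions_def compact_eq_bounded_closed)
  assume x: "x \<in> \<Omega>"
  have "grad \<theta> x = grad (\<lambda>x. \<zeta> x * bump_deriv 0 (\<psi> x - \<phi> x)) x"
    by (rule grad_cong_open[OF O(1) x]) (simp add: \<theta>_def)
  also have "\<dots> = \<zeta> x *\<^sub>R grad (\<lambda>x. bump_deriv 0 (\<psi> x - \<phi> x)) x + bump_deriv 0 (\<psi> x - \<phi> x) *\<^sub>R grad \<zeta> x"
    using smooth_on_differentiable[OF chi UNIV_I] smooth_on_differentiable[OF b UNIV_I] by (simp add: grad_mult)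
  also have "grad (\<lambda>x. bump_deriv 0 (\<psi> x - \<phi> x)) x = bump_deriv 1 (\<psi> x - \<phi> x) *\<^sub>R grad (\<lambda>x. \<psi> x - \<phi> x) x"
    using bump_deriv_DERIV[of 0] by (intro grad_chain smooth_on_differentiable[OF d UNIV_I]) simp
  also have "grad (\<lambda>x. \<psi> x - \<phi> x) x = grad \<psi> x - grad \<phi> x"
    by (rule grad_diff[OF smooth_on_differentiable[OF psi UNIV_I] smooth_on_differentiable[OF phi_smooth UNIV_I]])
  finally show "grad \<theta> x = bump_deriv 0 (\<psi> x - \<phi> x) *\<^sub>R grad \<zeta> x + (\<zeta> x * bump_deriv 1 (\<psi> x - \<phi> x)) *\<^sub>R (grad \<psi> x - grad \<phi> x)"
    by (simp add: algebra_simps)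
qed

text \<open>Test the equation with \<open>\<zeta> E (\<psi> - \<phi>\<^sub>k)\<close>, where \<open>E = bump_deriv 0\<close> and the \<open>\<phi>\<^sub>k\<close> approximate \<open>u\<close>. The part
  of the gradient that falls on \<open>E\<close> contributes \<open>A \<bullet> (A - B)\<close> with \<open>A = \<nabla> \<psi> - G\<close> and \<open>B = \<nabla> \<phi>\<^sub>k - G\<close>, which is at
  least \<open>- \<bar>B\<bar>\<^sup>2 / 4\<close> and hence nonnegative in the limit. The part that falls on \<open>\<zeta>\<close> tends to 0, since
  \<open>\<psi> \<le> u\<close> where \<open>\<nabla> \<zeta> \<noteq> 0\<close>.\<close>

lemma comparison_integral:
  fixes \<Omega> :: "'a::euclidean_space set"
  assumes O: "open \<Omega>" "bounded \<Omega>" and sol: "weak_solution \<Omega> u g" and psi: "smooth_on UNIV \<psi>"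
    and chi: "\<zeta> \<in> TF" "\<And>x. \<zeta> x \<ge> 0"
    and bd: "\<And>x. x \<in> frontier \<Omega> \<Longrightarrow> x \<in> closure {x. \<zeta> x \<noteq> 0} \<Longrightarrow> \<psi> x < 0"
    and ann: "AE x in lebesgue_on \<Omega>. grad \<zeta> x \<noteq> 0 \<longrightarrow> \<psi> x \<le> u x"
  shows "0 \<le> (\<integral>x. (- laplacian \<psi> x - g x) * (\<zeta> x * bump_deriv 0 (\<psi> x - u x)) \<partial>lebesgue_on \<Omega>)"
proof -
  let ?M = "lebesgue_on \<Omega>"
  interpret finite_measure ?M using finite_measure_bounded[OF O] .
  from sol obtain G \<phi> where u: "u \<in> Lp_on 2 \<Omega>" and g: "integrable ?M g" and G: "G \<in> Lp_on 2 \<Omega>"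
    and eq: "\<And>\<theta>. \<theta> \<in> test_functions \<Omega> \<Longrightarrow> (\<integral>x. G x \<bullet> grad \<theta> x \<partial>?M) = (\<integral>x. g x * \<theta> x \<partial>?M)"
    and phi: "\<And>k::nat. \<phi> k \<in> test_functions \<Omega>"
    and lim: "(\<lambda>k. (\<integral>x. (u x - \<phi> k x)\<^sup>2 \<partial>?M) + (\<integral>x. (norm (G x - grad (\<phi> k) x))\<^sup>2 \<partial>?M)) \<longlonglongrightarrow> 0"
    unfolding weak_solution_def by blast
  note [measurable] = Lp_on_2(1)[OF u] Lp_on_2(1)[OF G]
  have smphi: "smooth_on UNIV (\<phi> k)" for k using test_functions_D(1)[OF phi] .
  note smchi = test_functions_D(1)[OF chi(1)]
  have [measurable]: "\<phi> k \<in> borel_measurable ?M" "grad (\<phi> k) \<in> borel_measurable ?M" "\<psi> \<in> borel_measurable ?M"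
      "grad \<psi> \<in> borel_measurable ?M" "laplacian \<psi> \<in> borel_measurable ?M" "\<zeta> \<in> borel_measurable ?M"
      "grad \<zeta> \<in> borel_measurable ?M" for k
    by (intro continuous_measurable_on smooth_on_continuous smooth_grad_continuous smooth_laplacian_continuous smphi psi smchi)+
  define A where "A k = (\<integral>x. (u x - \<phi> k x)\<^sup>2 \<partial>?M)" for k
  define B where "B k = (\<integral>x. (norm (G x - grad (\<phi> k) x))\<^sup>2 \<partial>?M)" for k
  have nn: "A k \<ge> 0" "B k \<ge> 0" for k by (auto simp: A_def B_def)
  have AB: "A \<longlonglongrightarrow> 0" "B \<longlonglongrightarrow> 0"
  proof -
    have l: "(\<lambda>k. A k + B k) \<longlonglongrightarrow> 0" using lim by (simp add: A_def B_def)
    show "A \<longlonglongrightarrow> 0" by (rule Lim_null_comparison[OF _ l]) (use nn in auto)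
    show "B \<longlonglongrightarrow> 0" by (rule Lim_null_comparison[OF _ l]) (use nn in auto)
  qed
  have iA: "integrable ?M (\<lambda>x. (u x - \<phi> k x)\<^sup>2)" for k
  proof (rule Bochner_Integration.integrable_bound[where f="\<lambda>x. 2 * (norm (u x))\<^sup>2 + 2 * (\<phi> k x)\<^sup>2"])
    have "continuous_on UNIV (\<lambda>x. (\<phi> k x)\<^sup>2)" by (intro continuous_intros smooth_on_continuous smphi)
    then show "integrable ?M (\<lambda>x. 2 * (norm (u x))\<^sup>2 + 2 * (\<phi> k x)\<^sup>2)"
      using Lp_on_2(2)[OF u] continuous_integrable_on[OF _ O] by auto
    show "AE x in ?M. norm ((u x - \<phi> k x)\<^sup>2) \<le> norm (2 * (norm (u x))\<^sup>2 + 2 * (\<phi> k x)\<^sup>2)"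
    proof (rule AE_I2)
      fix x have "(u x - \<phi> k x)\<^sup>2 \<le> 2 * (u x)\<^sup>2 + 2 * (\<phi> k x)\<^sup>2"
        using zero_le_power2[of "u x + \<phi> k x"] by (simp add: power2_sum power2_diff)
      then show "norm ((u x - \<phi> k x)\<^sup>2) \<le> norm (2 * (norm (u x))\<^sup>2 + 2 * (\<phi> k x)\<^sup>2)" by simp
    qed
  qed measurable
  have iB: "integrable ?M (\<lambda>x. (norm (G x - grad (\<phi> k) x))\<^sup>2)" for k
  proof (rule Bochner_Integration.integrable_bound[where f="\<lambda>x. 2 * (norm (G x))\<^sup>2 + 2 * (norm (grad (\<phi> k) x))\<^sup>2"])
    have "continuous_on UNIV (\<lambda>x. (norm (grad (\<phi> k) x))\<^sup>2)" by (intro continuous_intros smooth_grad_continuous smphi)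
    then show "integrable ?M (\<lambda>x. 2 * (norm (G x))\<^sup>2 + 2 * (norm (grad (\<phi> k) x))\<^sup>2)"
      using Lp_on_2(2)[OF G] continuous_integrable_on[OF _ O] by auto
    show "AE x in ?M. norm ((norm (G x - grad (\<phi> k) x))\<^sup>2) \<le> norm (2 * (norm (G x))\<^sup>2 + 2 * (norm (grad (\<phi> k) x))\<^sup>2)"
    proof (rule AE_I2)
      fix x have "(norm (G x - grad (\<phi> k) x))\<^sup>2 \<le> 2 * (norm (G x))\<^sup>2 + 2 * (norm (grad (\<phi> k) x))\<^sup>2"
        using zero_le_power2[of "norm (G x + grad (\<phi> k) x)"]
        by (simp add: power2_norm_eq_inner inner_diff_left inner_diff_right inner_add_left inner_add_right inner_commute)
      then show "norm ((norm (G x - grad (\<phi> k) x))\<^sup>2) \<le> norm (2 * (norm (G x))\<^sup>2 + 2 * (norm (grad (\<phi> k) x))\<^sup>2)" by simp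
    qed
  qed measurable
  obtain r where r: "strict_mono r" "AE x in ?M. (\<lambda>k. (u x - \<phi> (r k) x)\<^sup>2) \<longlonglongrightarrow> 0"
  proof -
    have "(\<lambda>k. \<integral>x. norm ((u x - \<phi> k x)\<^sup>2) \<partial>?M) \<longlonglongrightarrow> 0" using AB(1) by (simp add: A_def[abs_def])
    from tendsto_L1_AE_subseq[OF iA this] that show ?thesis by blast
  qed
  have conv: "AE x in ?M. (\<lambda>k. \<phi> (r k) x) \<longlonglongrightarrow> u x"
    using r(2)
  proof eventually_elim
    case (elim x)
    have "(\<lambda>k. sqrt ((u x - \<phi> (r k) x)\<^sup>2)) \<longlonglongrightarrow> sqrt 0" using elim by (rule tendsto_real_sqrt)
    then have "(\<lambda>k. u x - \<phi> (r k) x) \<longlonglongrightarrow> 0" by (simp add: tendsto_rabs_zero_iff)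
    from tendsto_diff[OF tendsto_const[of "u x"] this] show ?case by simp
  qed
  define \<theta> where "\<theta> k x = (if x \<in> \<Omega> then \<zeta> x * bump_deriv 0 (\<psi> x - \<phi> k x) else 0)" for k x
  have th: "\<theta> k \<in> test_functions \<Omega>" for k
    using truncated_test_function(1)[OF O psi smchi phi bd] by (simp add: \<theta>_def[abs_def])
  have gth: "grad (\<theta> k) x = bump_deriv 0 (\<psi> x - \<phi> k x) *\<^sub>R grad \<zeta> x + (\<zeta> x * bump_deriv 1 (\<psi> x - \<phi> k x)) *\<^sub>R (grad \<psi> x - grad (\<phi> k) x)"
    if "x \<in> \<Omega>" for k x
    using truncated_test_function(2)[OF O psi smchi phi bd that] by (simp add: \<theta>_def[abs_def])
  have [measurable]: "\<theta> k \<in> borel_measurable ?M" "grad (\<theta> k) \<in> borel_measurable ?M" for k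
    by (intro continuous_measurable_on smooth_on_continuous smooth_grad_continuous test_functions_D(1)[OF th])+
  obtain CX where CX: "CX > 0" "\<And>x. \<bar>\<zeta> x\<bar> \<le> CX" using TF_bounded[OF chi(1)] by blast
  obtain CG where CG: "\<And>x. x \<in> \<Omega> \<Longrightarrow> norm (grad \<zeta> x) \<le> CG"
    using continuous_bounded_on[OF smooth_grad_continuous[OF smchi] O(2)] by blast
  obtain CP where CP: "\<And>x. x \<in> \<Omega> \<Longrightarrow> norm (grad \<psi> x) \<le> CP"
    using continuous_bounded_on[OF smooth_grad_continuous[OF psi] O(2)] by blast
  have iG: "integrable ?M (\<lambda>x. norm (G x))"
  proof (rule Bochner_Integration.integrable_bound[where f="\<lambda>x. 1 + (norm (G x))\<^sup>2"])
    show "AE x in ?M. norm (norm (G x)) \<le> norm (1 + (norm (G x))\<^sup>2)"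
    proof (rule AE_I2)
      fix x have "2 * norm (G x) \<le> 1 + (norm (G x))\<^sup>2"
        using zero_le_power2[of "norm (G x) - 1"] by (simp add: power2_diff)
      moreover have "0 \<le> norm (G x)" by simp
      ultimately have "norm (G x) \<le> 1 + (norm (G x))\<^sup>2" by linarith
      then show "norm (norm (G x)) \<le> norm (1 + (norm (G x))\<^sup>2)" by simp
    qed
  qed (use Lp_on_2(2)[OF G] in auto)
  define F where "F x = - laplacian \<psi> x - g x" for x
  have iF: "integrable ?M F"
    unfolding F_def using continuous_integrable_on[OF smooth_laplacian_continuous[OF psi] O] g by auto
  define R where "R k = (\<integral>x. F x * (\<zeta> x * bump_deriv 0 (\<psi> x - \<phi> (r k) x)) \<partial>?M)" for k
  define L where "L k = (\<integral>x. bump_deriv 0 (\<psi> x - \<phi> (r k) x) * ((grad \<psi> x - G x) \<bullet> grad \<zeta> x) \<partial>?M)" for k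
  have bL: "norm (bump_deriv 0 (\<psi> x - \<phi> (r k) x) * ((grad \<psi> x - G x) \<bullet> grad \<zeta> x)) \<le> (CP + norm (G x)) * CG"
    if "x \<in> \<Omega>" for x k
  proof -
    have "\<bar>(grad \<psi> x - G x) \<bullet> grad \<zeta> x\<bar> \<le> norm (grad \<psi> x - G x) * norm (grad \<zeta> x)" by (rule Cauchy_Schwarz_ineq2)
    also have "\<dots> \<le> (CP + norm (G x)) * CG"
    proof (rule mult_mono)
      show "norm (grad \<psi> x - G x) \<le> CP + norm (G x)"
        using CP[OF that] norm_triangle_ineq4[of "grad \<psi> x" "G x"] by linarith
      show "0 \<le> CP + norm (G x)" using CP[OF that] norm_ge_zero[of "grad \<psi> x"] norm_ge_zero[of "G x"] by linarith
    qed (use CG[OF that] in auto)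
    finally have "1 * \<bar>(grad \<psi> x - G x) \<bullet> grad \<zeta> x\<bar> \<le> (CP + norm (G x)) * CG" by simp
    moreover have "\<bar>bump_deriv 0 (\<psi> x - \<phi> (r k) x)\<bar> * \<bar>(grad \<psi> x - G x) \<bullet> grad \<zeta> x\<bar> \<le> 1 * \<bar>(grad \<psi> x - G x) \<bullet> grad \<zeta> x\<bar>"
      by (rule mult_right_mono) (auto simp: bump_bounds)
    ultimately show ?thesis by (simp add: abs_mult)
  qed
  have iL: "integrable ?M (\<lambda>x. bump_deriv 0 (\<psi> x - \<phi> (r k) x) * ((grad \<psi> x - G x) \<bullet> grad \<zeta> x))" for k
  proof (rule Bochner_Integration.integrable_bound[where f="\<lambda>x. (CP + norm (G x)) * CG"])
    show "AE x in ?M. norm (bump_deriv 0 (\<psi> x - \<phi> (r k) x) * ((grad \<psi> x - G x) \<bullet> grad \<zeta> x)) \<le> norm ((CP + norm (G x)) * CG)"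
    proof (rule AE_I2)
      fix x assume "x \<in> space ?M"
      then have "x \<in> \<Omega>" by (simp add: space_restrict_space)
      from bL[OF this] show "norm (bump_deriv 0 (\<psi> x - \<phi> (r k) x) * ((grad \<psi> x - G x) \<bullet> grad \<zeta> x)) \<le> norm ((CP + norm (G x)) * CG)"
        by (rule order_trans) simp
    qed
  qed (use iG in auto)
  have key: "L k - (CX / 2) * B (r k) \<le> R k" for k
  proof -
    let ?t = "\<theta> (r k)" and ?p = "\<phi> (r k)"
    note t = th[of "r k"]
    have tT: "?t \<in> TF" using test_functions_mono[OF t] by simp
    have 1: "(\<integral>x. grad \<psi> x \<bullet> grad ?t x \<partial>?M) = - (\<integral>x. laplacian \<psi> x * ?t x \<partial>?M)" 
      "integrable ?M (\<lambda>x. grad \<psi> x \<bullet> grad ?t x)" "integrable ?M (\<lambda>x. laplacian \<psi> x * ?t x)"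
    proof -
      note ibp = integration_by_parts[OF psi tT]
      have z1: "x \<notin> \<Omega> \<Longrightarrow> grad \<psi> x \<bullet> grad ?t x = 0" and z2: "x \<notin> \<Omega> \<Longrightarrow> laplacian \<psi> x * ?t x = 0" for x
        using test_functions_laplacian(3)[OF t] test_functions_D(5)[OF t] by auto
      show "integrable ?M (\<lambda>x. grad \<psi> x \<bullet> grad ?t x)" "integrable ?M (\<lambda>x. laplacian \<psi> x * ?t x)"
        using ibp(1,2) lborel_imp_lebesgue_integrable integral_lebesgue_on_full(2)[OF O(1) z1] integral_lebesgue_on_full(2)[OF O(1) z2] by auto
      show "(\<integral>x. grad \<psi> x \<bullet> grad ?t x \<partial>?M) = - (\<integral>x. laplacian \<psi> x * ?t x \<partial>?M)"
        using ibp integral_lebesgue_on_full(1)[OF O(1) z1] integral_lebesgue_on_full(1)[OF O(1) z2]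
        by (simp add: integral_completion borel_measurable_integrable)
    qed
    have tb: "\<bar>?t x\<bar> \<le> CX" for x
    proof -
      have "\<bar>\<zeta> x\<bar> * \<bar>bump_deriv 0 (\<psi> x - ?p x)\<bar> \<le> CX * 1"
        using CX by (intro mult_mono) (auto simp: bump_bounds)
      then show ?thesis using CX(1) by (simp add: \<theta>_def abs_mult)
    qed
    have igt: "integrable ?M (\<lambda>x. g x * ?t x)" by (rule integrable_mult_bounded[OF g _ tb]) simp
    obtain CT where CT: "\<And>x. x \<in> \<Omega> \<Longrightarrow> norm (grad ?t x) \<le> CT"
      using continuous_bounded_on[OF smooth_grad_continuous[OF test_functions_D(1)[OF t]] O(2)] by blast
    have iGt: "integrable ?M (\<lambda>x. G x \<bullet> grad ?t x)"
    proof (rule Bochner_Integration.integrable_bound[where f="\<lambda>x. norm (G x) * CT"])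
      show "AE x in ?M. norm (G x \<bullet> grad ?t x) \<le> norm (norm (G x) * CT)"
      proof (rule AE_I2)
        fix x assume "x \<in> space ?M"
        then have x: "x \<in> \<Omega>" by (simp add: space_restrict_space)
        have "\<bar>G x \<bullet> grad ?t x\<bar> \<le> norm (G x) * norm (grad ?t x)" by (rule Cauchy_Schwarz_ineq2)
        also have "\<dots> \<le> norm (G x) * CT" using CT[OF x] by (intro mult_left_mono) auto
        finally show "norm (G x \<bullet> grad ?t x) \<le> norm (norm (G x) * CT)" by simp
      qed
    qed (use iG in auto)
    have "L k - (CX / 2) * B (r k) = (\<integral>x. bump_deriv 0 (\<psi> x - ?p x) * ((grad \<psi> x - G x) \<bullet> grad \<zeta> x) - (CX / 2) * (norm (G x - grad ?p x))\<^sup>2 \<partial>?M)"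
      unfolding L_def B_def using iL iB by simp
    also have "\<dots> \<le> (\<integral>x. grad \<psi> x \<bullet> grad ?t x - G x \<bullet> grad ?t x \<partial>?M)"
    proof (rule integral_mono)
      fix x assume "x \<in> space ?M"
      then have x: "x \<in> \<Omega>" by (simp add: space_restrict_space)
      let ?s = "\<zeta> x * bump_deriv 1 (\<psi> x - ?p x)"
      let ?A = "grad \<psi> x - G x" and ?B = "grad ?p x - G x"
      have s: "0 \<le> ?s" "?s \<le> CX * 2"
        using chi(2)[of x] CX(2)[of x] bump_bounds(3,4)[of "\<psi> x - ?p x"] CX(1)
        by (auto intro!: mult_mono simp del: One_nat_def)
      have "grad \<psi> x \<bullet> grad ?t x - G x \<bullet> grad ?t x = bump_deriv 0 (\<psi> x - ?p x) * (?A \<bullet> grad \<zeta> x) + ?s * (?A \<bullet> (?A - ?B))"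
        unfolding gth[OF x] by (simp add: inner_diff_left inner_add_right algebra_simps del: One_nat_def)
      moreover have "?A \<bullet> (?A - ?B) \<ge> - (?B \<bullet> ?B) / 4"
      proof -
        have "0 \<le> (2 *\<^sub>R ?A - ?B) \<bullet> (2 *\<^sub>R ?A - ?B)" by simp
        then have "0 \<le> 4 * (?A \<bullet> ?A) - 4 * (?A \<bullet> ?B) + ?B \<bullet> ?B"
          unfolding inner_diff_left[of "2 *\<^sub>R ?A"] inner_diff_right[of _ "2 *\<^sub>R ?A"]
          by (simp add: inner_commute[of ?B ?A])
        then show ?thesis unfolding inner_diff_right[of ?A ?A ?B] by linarith
      qed
      then have "?s * (?A \<bullet> (?A - ?B)) \<ge> ?s * (- (?B \<bullet> ?B) / 4)" using s(1) by (rule mult_left_mono)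
      moreover have "?s * ((?B \<bullet> ?B) / 4) \<le> CX * 2 * ((?B \<bullet> ?B) / 4)" using s(2) by (rule mult_right_mono) simp
      moreover have "?B \<bullet> ?B = (norm (G x - grad ?p x))\<^sup>2" by (simp add: power2_norm_eq_inner[symmetric] norm_minus_commute)
      ultimately show "bump_deriv 0 (\<psi> x - ?p x) * (?A \<bullet> grad \<zeta> x) - (CX / 2) * (norm (G x - grad ?p x))\<^sup>2 \<le> grad \<psi> x \<bullet> grad ?t x - G x \<bullet> grad ?t x"
        by simp
    qed (use iL iB 1 iGt in auto)
    also have "\<dots> = (\<integral>x. F x * ?t x \<partial>?M)"
      using 1 iGt igt eq[OF t] by (simp add: F_def left_diff_distrib)
    also have "\<dots> = R k" unfolding R_def
      by (rule Bochner_Integration.integral_cong) (auto simp: \<theta>_def space_restrict_space)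
    finally show ?thesis .
  qed
  have bump_lim: "(\<lambda>k. bump_deriv 0 (\<psi> x - \<phi> (r k) x)) \<longlonglongrightarrow> bump_deriv 0 (\<psi> x - u x)" if "(\<lambda>k. \<phi> (r k) x) \<longlonglongrightarrow> u x" for x
    by (rule isCont_tendsto_compose[OF DERIV_isCont[OF bump_deriv_DERIV]]) (intro tendsto_intros that)
  have "L \<longlonglongrightarrow> (\<integral>x. 0 \<partial>?M)" unfolding L_def
  proof (rule integral_dominated_convergence[where w="\<lambda>x. (CP + norm (G x)) * CG"])
    show "AE x in ?M. (\<lambda>k. bump_deriv 0 (\<psi> x - \<phi> (r k) x) * ((grad \<psi> x - G x) \<bullet> grad \<zeta> x)) \<longlonglongrightarrow> 0"
      using conv ann
    proof eventually_elim
      case (elim x)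
      show ?case
      proof (cases "grad \<zeta> x = 0")
        case False
        with elim have "bump_deriv 0 (\<psi> x - u x) = 0" by (simp add: bump_eq_0)
        with bump_lim[OF elim(1)] show ?thesis by (intro tendsto_mult_left_zero) simp
      qed simp
    qed
    show "AE x in ?M. norm (bump_deriv 0 (\<psi> x - \<phi> (r k) x) * ((grad \<psi> x - G x) \<bullet> grad \<zeta> x)) \<le> (CP + norm (G x)) * CG" for k
      by (rule AE_I2) (use bL in \<open>simp add: space_restrict_space\<close>)
  qed (use iG iL in auto)
  moreover have "(\<lambda>k. (CX / 2) * B (r k)) \<longlonglongrightarrow> (CX / 2) * 0"
    using LIMSEQ_subseq_LIMSEQ[OF AB(2) r(1)] by (intro tendsto_intros) (simp add: o_def)
  ultimately have l1: "(\<lambda>k. L k - (CX / 2) * B (r k)) \<longlonglongrightarrow> 0 - (CX / 2) * 0"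
    by (intro tendsto_diff) auto
  have "R \<longlonglongrightarrow> (\<integral>x. F x * (\<zeta> x * bump_deriv 0 (\<psi> x - u x)) \<partial>?M)" unfolding R_def
  proof (rule integral_dominated_convergence[where w="\<lambda>x. \<bar>F x\<bar> * CX"])
    show "AE x in ?M. (\<lambda>k. F x * (\<zeta> x * bump_deriv 0 (\<psi> x - \<phi> (r k) x))) \<longlonglongrightarrow> F x * (\<zeta> x * bump_deriv 0 (\<psi> x - u x))"
      using conv by eventually_elim (intro tendsto_intros bump_lim)
    show "AE x in ?M. norm (F x * (\<zeta> x * bump_deriv 0 (\<psi> x - \<phi> (r k) x))) \<le> \<bar>F x\<bar> * CX" for k
    proof (rule AE_I2)
      fix x
      have "\<bar>\<zeta> x\<bar> * \<bar>bump_deriv 0 (\<psi> x - \<phi> (r k) x)\<bar> \<le> CX * 1"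
        using CX by (intro mult_mono) (auto simp: bump_bounds)
      then show "norm (F x * (\<zeta> x * bump_deriv 0 (\<psi> x - \<phi> (r k) x))) \<le> \<bar>F x\<bar> * CX"
        by (simp add: abs_mult mult_left_mono)
    qed
  qed (use iF borel_measurable_integrable[OF iF] in auto)
  from LIMSEQ_le[OF l1 this] key show ?thesis by (auto simp: F_def)
qed

section \<open>The potential of a density with Morrey growth\<close>

lemma cutoff_grad_outside:
  assumes "0 \<le> r" "r < R" "norm (x - z) > R" shows "grad (cutoff z r R) x = 0"
proof -
  have "x \<in> - cball z R" using assms by (simp add: dist_norm norm_minus_commute)
  then have "grad (cutoff z r R) x = grad (\<lambda>x. 0) x"
    by (intro grad_cong_open[of "- cball z R"]) (auto simp: dist_norm norm_minus_commute intro!: cutoff_eq_0[OF assms(1,2)])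
  also have "\<dots> = 0" by (rule grad_eqI) auto
  finally show ?thesis .
qed

lemma integrable_lebesgue_on:
  fixes f :: "'a::euclidean_space \<Rightarrow> real"
  assumes "open \<Omega>" "integrable lebesgue f" shows "integrable (lebesgue_on \<Omega>) f"
proof -
  have "integrable lebesgue (\<lambda>x. indicator \<Omega> x *\<^sub>R f x)"
    by (rule integrable_mult_indicator) (use assms in auto)
  then show ?thesis using assms(1) by (subst integrable_restrict_space) auto
qed

text \<open>The exponent \<open>N - 1 + 2 \<beta>\<close> of the growth bound is written with \<open>N = DIM('a)\<close> as a natural power.
  Radii up to 2 occur because a kernel supported in a closed ball of radius \<open>\<tau> \<le> 1\<close> is estimated over the
  open ball of radius \<open>2 \<tau>\<close>.\<close>

locale morrey =
  fixes W :: "'a::euclidean_space \<Rightarrow> real" and \<beta> CW :: real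
  assumes \<beta>: "0 < \<beta>" "\<beta> < 1/2" and CW: "CW > 0"
    and W_nonneg: "\<And>x. W x \<ge> 0" and W_int: "integrable lebesgue W"
    and growth: "\<And>x t. 0 < t \<Longrightarrow> t \<le> 2 \<Longrightarrow>
      (\<integral>y. indicator (ball x t) y * W y \<partial>lebesgue) \<le> CW * (t ^ DIM('a) * t powr (2 * \<beta> - 1))"
begin

lemma scaled_conv_bound:
  assumes th: "\<theta> \<in> TF" and supp: "\<And>z. norm z > 1 \<Longrightarrow> \<theta> z = 0"
  shows "\<exists>C>0. \<forall>\<tau> x h. 0 < \<tau> \<longrightarrow> \<tau> \<le> 1 \<longrightarrow> integrable lebesgue h \<longrightarrow> (AE y in lebesgue. \<bar>h y\<bar> \<le> W y) \<longrightarrow>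
     \<bar>conv (\<lambda>z. \<theta> ((1 / \<tau>) *\<^sub>R z)) h x\<bar> \<le> C * (\<tau> ^ DIM('a) * \<tau> powr (2 * \<beta> - 1))"
proof -
  obtain B where B: "B > 0" "\<And>z. \<bar>\<theta> z\<bar> \<le> B" using TF_bounded[OF th] by blast
  show ?thesis
  proof (intro exI[of _ "B * CW * 2 ^ DIM('a) * 2 powr (2 * \<beta> - 1)"] conjI allI impI)
    show "0 < B * CW * 2 ^ DIM('a) * 2 powr (2 * \<beta> - 1)" using B CW by simp
    fix \<tau> :: real and x :: 'a and h :: "'a \<Rightarrow> real"
    assume t: "0 < \<tau>" "\<tau> \<le> 1" and h: "integrable lebesgue h" "AE y in lebesgue. \<bar>h y\<bar> \<le> W y"
    have sTF: "(\<lambda>z. \<theta> ((1 / \<tau>) *\<^sub>R z)) \<in> TF" using TF_scale[OF th, of "1/\<tau>" 0] t by simp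
    have z: "\<theta> ((1 / \<tau>) *\<^sub>R z) = 0" if "norm z \<ge> 2 * \<tau>" for z
    proof (rule supp)
      have "norm z > \<tau>" using that t by simp
      then show "1 < norm ((1 / \<tau>) *\<^sub>R z)" using t by (simp add: field_simps)
    qed
    have "\<bar>conv (\<lambda>z. \<theta> ((1 / \<tau>) *\<^sub>R z)) h x\<bar> \<le> B * (\<integral>y. indicator (ball x (2 * \<tau>)) y * W y \<partial>lebesgue)"
      by (rule conv_bound[OF sTF h(1) _ _ W_int h(2)]) (use B z in auto)
    also have "\<dots> \<le> B * (CW * ((2 * \<tau>) ^ DIM('a) * (2 * \<tau>) powr (2 * \<beta> - 1)))"
      by (intro mult_left_mono growth) (use t B in auto)
    also have "\<dots> = B * CW * 2 ^ DIM('a) * 2 powr (2 * \<beta> - 1) * (\<tau> ^ DIM('a) * \<tau> powr (2 * \<beta> - 1))"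
      using t by (simp add: power_mult_distrib powr_mult)
    finally show "\<bar>conv (\<lambda>z. \<theta> ((1 / \<tau>) *\<^sub>R z)) h x\<bar>
       \<le> B * CW * 2 ^ DIM('a) * 2 powr (2 * \<beta> - 1) * (\<tau> ^ DIM('a) * \<tau> powr (2 * \<beta> - 1))" .
  qed
qed

lemma moll_ker_outside:
  fixes z :: 'a
  assumes "norm z > 1" 
  shows "moll_ker z = 0" "partial_deriv b moll_ker z = 0" "partial_deriv c (partial_deriv b moll_ker) z = 0"
proof -
  have o: "open (- cball (0::'a) 1)" "z \<in> - cball 0 1" using assms by auto
  show "moll_ker z = 0" using assms by (simp add: moll_ker_eq_0)
  have 1: "partial_deriv b moll_ker w = 0" if "w \<in> - cball 0 1" for w :: 'a and b
  proof -
    have "partial_deriv b moll_ker w = partial_deriv b (\<lambda>x. 0) w"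
      by (rule partial_deriv_cong_open[OF o(1) that]) (simp add: moll_ker_eq_0)
    then show ?thesis by (simp add: partial_deriv_eq[OF has_derivative_const])
  qed
  show "partial_deriv b moll_ker z = 0" by (rule 1[OF o(2)])
  have "partial_deriv c (partial_deriv b moll_ker) z = partial_deriv c (\<lambda>x. 0) z"
    by (rule partial_deriv_cong_open[OF o]) (simp add: 1)
  then show "partial_deriv c (partial_deriv b moll_ker) z = 0" by (simp add: partial_deriv_eq[OF has_derivative_const])
qed

text \<open>The part of the potential of \<open>W\<close> that comes from distances of order \<open>2\<^bsup>- j\<^esup>\<close>.\<close>

definition layer :: "nat \<Rightarrow> 'a \<Rightarrow> real" where
  "layer j = conv (kers ((1/2) ^ j)) W"

lemma kers_partials:
  assumes "\<tau> > 0" "b \<in> Basis" "c \<in> Basis"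
  shows "partial_deriv b (kers \<tau>) = (\<lambda>z::'a. \<tau> * (1 / \<tau>) ^ DIM('a) * partial_deriv b moll_ker ((1 / \<tau>) *\<^sub>R z))"
    "partial_deriv c (partial_deriv b (kers \<tau>)) = (\<lambda>z::'a. (1 / \<tau>) ^ DIM('a) * partial_deriv c (partial_deriv b moll_ker) ((1 / \<tau>) *\<^sub>R z))"
proof -
  have gen: "partial_deriv b (\<lambda>z::'a. k * f ((1 / \<tau>) *\<^sub>R z)) = (\<lambda>z. k * (1 / \<tau>) * partial_deriv b f ((1 / \<tau>) *\<^sub>R z))"
    if f: "smooth_on UNIV f" for k f b
  proof
    fix z
    have "partial_deriv b (\<lambda>z. k * f ((1 / \<tau>) *\<^sub>R (z - 0))) z = k * partial_deriv b (\<lambda>z. f ((1 / \<tau>) *\<^sub>R (z - 0))) z"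
      by (rule partial_deriv_cmult[OF smooth_on_differentiable[OF smooth_on_scale[OF f] UNIV_I]])
    also have "\<dots> = k * ((1 / \<tau>) * partial_deriv b f ((1 / \<tau>) *\<^sub>R (z - 0)))"
      by (subst partial_deriv_scale) (auto intro: smooth_on_differentiable[OF f])
    finally show "partial_deriv b (\<lambda>z. k * f ((1 / \<tau>) *\<^sub>R z)) z = k * (1 / \<tau>) * partial_deriv b f ((1 / \<tau>) *\<^sub>R z)" by simp
  qed
  have 1: "partial_deriv b (kers \<tau>) = (\<lambda>z::'a. \<tau>\<^sup>2 * (1 / \<tau>) ^ DIM('a) * (1 / \<tau>) * partial_deriv b moll_ker ((1 / \<tau>) *\<^sub>R z))"
    using gen[OF moll_ker_smooth] by (simp add: kers_def[abs_def])
  have e1: "\<tau>\<^sup>2 * (1 / \<tau>) ^ DIM('a) * (1 / \<tau>) = \<tau> * (1 / \<tau>) ^ DIM('a)" using assms by (simp add: power2_eq_square)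
  have e2: "\<tau> * (1 / \<tau>) ^ DIM('a) * (1 / \<tau>) = (1 / \<tau>) ^ DIM('a)" using assms by simp
  show 2: "partial_deriv b (kers \<tau>) = (\<lambda>z::'a. \<tau> * (1 / \<tau>) ^ DIM('a) * partial_deriv b moll_ker ((1 / \<tau>) *\<^sub>R z))"
    unfolding 1 e1 ..
  show "partial_deriv c (partial_deriv b (kers \<tau>)) = (\<lambda>z::'a. (1 / \<tau>) ^ DIM('a) * partial_deriv c (partial_deriv b moll_ker) ((1 / \<tau>) *\<^sub>R z))"
    unfolding 2 gen[OF smooth_on_partial[OF moll_ker_smooth assms(2)]] e2 ..
qed

lemma conv_scale_factor: "conv (\<lambda>z. k * \<theta> z) h x = k * conv \<theta> h x"
proof -
  have "h y * (k * \<theta> (x - y)) = k * (h y * \<theta> (x - y))" for y by simp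
  then show ?thesis by (simp only: conv_def Bochner_Integration.integral_mult_right_zero)
qed

lemma kers_conv_bound:
  "\<exists>C>0. \<forall>\<tau> x h. 0 < \<tau> \<longrightarrow> \<tau> \<le> 1 \<longrightarrow> integrable lebesgue h \<longrightarrow> (AE y in lebesgue. \<bar>h y\<bar> \<le> W y) \<longrightarrow>
     \<bar>conv (kers \<tau>) h x\<bar> \<le> C * \<tau> powr (1 + 2 * \<beta>)"
proof -
  obtain C where C: "C > 0" "\<And>\<tau> x h. 0 < \<tau> \<Longrightarrow> \<tau> \<le> 1 \<Longrightarrow> integrable lebesgue h \<Longrightarrow> (AE y in lebesgue. \<bar>h y\<bar> \<le> W y) \<Longrightarrow>
     \<bar>conv (\<lambda>z. moll_ker ((1 / \<tau>) *\<^sub>R z)) h x\<bar> \<le> C * (\<tau> ^ DIM('a) * \<tau> powr (2 * \<beta> - 1))"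
    using scaled_conv_bound[OF moll_ker_TF moll_ker_outside(1)] by blast
  show ?thesis
  proof (intro exI[of _ C] conjI allI impI C(1))
    fix \<tau> :: real and x :: 'a and h :: "'a \<Rightarrow> real"
    assume t: "0 < \<tau>" "\<tau> \<le> 1" and h: "integrable lebesgue h" "AE y in lebesgue. \<bar>h y\<bar> \<le> W y"
    have "\<bar>conv (kers \<tau>) h x\<bar> = (\<tau>\<^sup>2 * (1 / \<tau>) ^ DIM('a)) * \<bar>conv (\<lambda>z. moll_ker ((1 / \<tau>) *\<^sub>R z)) h x\<bar>"
      using t by (simp add: kers_def[abs_def] conv_scale_factor abs_mult)
    also have "\<dots> \<le> (\<tau>\<^sup>2 * (1 / \<tau>) ^ DIM('a)) * (C * (\<tau> ^ DIM('a) * \<tau> powr (2 * \<beta> - 1)))"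
      using t by (intro mult_left_mono C(2) h) auto
    also have "\<dots> = C * (\<tau> powr 2 * \<tau> powr (2 * \<beta> - 1))"
      using t by (simp add: power_divide)
    also have "\<tau> powr 2 * \<tau> powr (2 * \<beta> - 1) = \<tau> powr (1 + 2 * \<beta>)" by (simp only: powr_add[symmetric]) simp
    finally show "\<bar>conv (kers \<tau>) h x\<bar> \<le> C * \<tau> powr (1 + 2 * \<beta>)" .
  qed
qed

lemma W_AE: "AE y in lebesgue. \<bar>W y\<bar> \<le> W y" using W_nonneg by simp

lemma layer_smooth: "smooth_on UNIV (layer j)"
  unfolding layer_def by (rule conv_smooth(1)[OF kers_TF W_int]) simp

definition layer_bound :: "real \<Rightarrow> bool" where
  "layer_bound C \<longleftrightarrow> C > 0 \<and> (\<forall>j x. \<bar>layer j x\<bar> \<le> C * (1/2) ^ j) \<and> (\<forall>j x. norm (grad (layer j) x) \<le> C * ((1/2) powr \<beta>) ^ j)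
    \<and> (\<forall>j x a. \<bar>layer j x - layer j a - grad (layer j) a \<bullet> (x - a)\<bar> \<le> C * norm (x - a) powr (1 + \<beta>) * ((1/2) powr \<beta>) ^ j)"

lemma layer_boundD:
  assumes "layer_bound C"
  shows "C > 0" "\<bar>layer j x\<bar> \<le> C * (1/2) ^ j" "norm (grad (layer j) x) \<le> C * ((1/2) powr \<beta>) ^ j"
    "\<bar>layer j x - layer j a - grad (layer j) a \<bullet> (x - a)\<bar> \<le> C * norm (x - a) powr (1 + \<beta>) * ((1/2) powr \<beta>) ^ j"
  using assms by (simp_all add: layer_bound_def)

text \<open>The layer at scale \<open>\<tau> = 2\<^bsup>- j\<^esup>\<close> has size \<open>\<tau>\<^bsup>1 + 2 \<beta>\<^esup>\<close>, gradient of size \<open>\<tau>\<^bsup>2 \<beta>\<^esup>\<close> and second derivatives of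
  size \<open>\<tau>\<^bsup>2 \<beta> - 1\<^esup>\<close>. The remainder of the linear approximation is estimated by the second derivatives at
  distances below \<open>\<tau>\<close> and by the gradient at larger distances; in
  either case a factor \<open>\<tau>\<^sup>\<beta>\<close> remains, which is summable over \<open>j\<close>.\<close>

lemma layer_estimates: "\<exists>C. layer_bound C"
proof -
  obtain C0 where C0: "C0 > 0" "\<And>\<tau> x h. 0 < \<tau> \<Longrightarrow> \<tau> \<le> 1 \<Longrightarrow> integrable lebesgue h \<Longrightarrow> (AE y in lebesgue. \<bar>h y\<bar> \<le> W y) \<Longrightarrow>
     \<bar>conv (kers \<tau>) h x\<bar> \<le> C0 * \<tau> powr (1 + 2 * \<beta>)"
    using kers_conv_bound by blast
  define P1 where "P1 b C \<longleftrightarrow> C > 0 \<and> (\<forall>\<tau> x. 0 < \<tau> \<longrightarrow> \<tau> \<le> 1 \<longrightarrow>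
     \<bar>conv (\<lambda>z. partial_deriv b moll_ker ((1 / \<tau>) *\<^sub>R z)) W x\<bar> \<le> C * (\<tau> ^ DIM('a) * \<tau> powr (2 * \<beta> - 1)))" for b C
  define P2 where "P2 b c C \<longleftrightarrow> C > 0 \<and> (\<forall>\<tau> x. 0 < \<tau> \<longrightarrow> \<tau> \<le> 1 \<longrightarrow>
     \<bar>conv (\<lambda>z. partial_deriv c (partial_deriv b moll_ker) ((1 / \<tau>) *\<^sub>R z)) W x\<bar> \<le> C * (\<tau> ^ DIM('a) * \<tau> powr (2 * \<beta> - 1)))" for b c C
  have "\<exists>C. P1 b C" if "b \<in> Basis" for b
    using scaled_conv_bound[OF test_functions_partial[OF moll_ker_TF that] moll_ker_outside(2)] W_int W_AE
    unfolding P1_def by blast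
  then have "\<exists>C1. \<forall>b\<in>Basis. P1 b (C1 b)" by (intro bchoice) blast
  then obtain C1 where C1': "\<And>b. b \<in> Basis \<Longrightarrow> P1 b (C1 b)" by blast
  have "\<exists>C. P2 b c C" if "b \<in> Basis" "c \<in> Basis" for b c
    using scaled_conv_bound[OF test_functions_partial[OF test_functions_partial[OF moll_ker_TF that(1)] that(2)] moll_ker_outside(3)] W_int W_AE
    unfolding P2_def by blast
  then have "\<exists>f. \<forall>c\<in>Basis. P2 b c (f c)" if "b \<in> Basis" for b using that by (intro bchoice) blast
  then have "\<exists>C2. \<forall>b\<in>Basis. \<forall>c\<in>Basis. P2 b c (C2 b c)" by (intro bchoice) blast
  then obtain C2 where C2': "\<And>b c. b \<in> Basis \<Longrightarrow> c \<in> Basis \<Longrightarrow> P2 b c (C2 b c)" by blast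
  note C1 = C1'[unfolded P1_def, THEN conjunct1] C1'[unfolded P1_def, THEN conjunct2, rule_format]
  note C2 = C2'[unfolded P2_def, THEN conjunct1] C2'[unfolded P2_def, THEN conjunct2, rule_format]
  define S1 where "S1 = (\<Sum>b\<in>Basis. C1 b)"
  define S2 where "S2 = (\<Sum>b\<in>Basis. \<Sum>c\<in>Basis. C2 b c)"
  have S: "S1 > 0" "S2 > 0" unfolding S1_def S2_def using C1(1) C2(1) by (auto intro!: sum_pos)
  have g1: "norm (grad (layer j) x) \<le> S1 * ((1/2) ^ j) powr (2 * \<beta>)" for j x
  proof -
    define \<tau> :: real where "\<tau> = (1/2) ^ j"
    have t: "0 < \<tau>" "\<tau> \<le> 1" by (auto simp: \<tau>_def power_le_one)
    have "\<bar>partial_deriv b (layer j) x\<bar> \<le> C1 b * \<tau> powr (2 * \<beta>)" if b: "b \<in> Basis" for b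
    proof -
      have "partial_deriv b (layer j) x = \<tau> * (1 / \<tau>) ^ DIM('a) * conv (\<lambda>z. partial_deriv b moll_ker ((1 / \<tau>) *\<^sub>R z)) W x"
        unfolding layer_def \<tau>_def[symmetric] conv_smooth(3)[OF kers_TF[OF t(1)] W_int b] kers_partials(1)[OF t(1) b b]
        by (rule conv_scale_factor)
      then have "\<bar>partial_deriv b (layer j) x\<bar> = \<tau> * (1 / \<tau>) ^ DIM('a) * \<bar>conv (\<lambda>z. partial_deriv b moll_ker ((1 / \<tau>) *\<^sub>R z)) W x\<bar>"
        using t by (simp add: abs_mult)
      also have "\<dots> \<le> \<tau> * (1 / \<tau>) ^ DIM('a) * (C1 b * (\<tau> ^ DIM('a) * \<tau> powr (2 * \<beta> - 1)))"
        using t by (intro mult_left_mono C1(2) b) auto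
      also have "\<dots> = C1 b * (\<tau> powr 1 * \<tau> powr (2 * \<beta> - 1))" using t by (simp add: power_divide)
      also have "\<tau> powr 1 * \<tau> powr (2 * \<beta> - 1) = \<tau> powr (2 * \<beta>)" by (simp only: powr_add[symmetric]) simp
      finally show ?thesis .
    qed
    then have "(\<Sum>b\<in>Basis. \<bar>partial_deriv b (layer j) x\<bar>) \<le> (\<Sum>b\<in>Basis. C1 b * \<tau> powr (2 * \<beta>))" by (rule sum_mono)
    then show ?thesis using norm_grad_le[of "layer j" x] by (simp add: S1_def sum_distrib_right \<tau>_def)
  qed
  have g2: "norm (grad (layer j) x - grad (layer j) a) \<le> S2 * ((1/2) ^ j) powr (2 * \<beta> - 1) * norm (x - a)" for j x a
  proof -
    define \<tau> :: real where "\<tau> = (1/2) ^ j"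
    have t: "0 < \<tau>" "\<tau> \<le> 1" by (auto simp: \<tau>_def power_le_one)
    have p2: "\<bar>partial_deriv c (partial_deriv b (layer j)) x\<bar> \<le> C2 b c * \<tau> powr (2 * \<beta> - 1)" if b: "b \<in> Basis" and c: "c \<in> Basis" for b c x
    proof -
      have "partial_deriv c (partial_deriv b (layer j)) x = (1 / \<tau>) ^ DIM('a) * conv (\<lambda>z. partial_deriv c (partial_deriv b moll_ker) ((1 / \<tau>) *\<^sub>R z)) W x"
        unfolding layer_def \<tau>_def[symmetric] conv_smooth(3)[OF kers_TF[OF t(1)] W_int b] 
          conv_smooth(3)[OF test_functions_partial[OF kers_TF[OF t(1)] b] W_int c] kers_partials(2)[OF t(1) b c]
        by (rule conv_scale_factor)
      then have "\<bar>partial_deriv c (partial_deriv b (layer j)) x\<bar> = (1 / \<tau>) ^ DIM('a) * \<bar>conv (\<lambda>z. partial_deriv c (partial_deriv b moll_ker) ((1 / \<tau>) *\<^sub>R z)) W x\<bar>"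
        using t by (simp add: abs_mult)
      also have "\<dots> \<le> (1 / \<tau>) ^ DIM('a) * (C2 b c * (\<tau> ^ DIM('a) * \<tau> powr (2 * \<beta> - 1)))"
        using t by (intro mult_left_mono C2(2) b c) auto
      also have "\<dots> = C2 b c * \<tau> powr (2 * \<beta> - 1)" using t by (simp add: power_divide)
      finally show ?thesis .
    qed
    have sm: "smooth_on UNIV (partial_deriv b (layer j))" if "b \<in> Basis" for b
      by (rule smooth_on_partial[OF layer_smooth that])
    have "\<bar>partial_deriv b (layer j) x - partial_deriv b (layer j) a\<bar> \<le> (\<Sum>c\<in>Basis. C2 b c) * \<tau> powr (2 * \<beta> - 1) * norm (x - a)"
      if b: "b \<in> Basis" for b
    proof -
      have "norm (grad (partial_deriv b (layer j)) x) \<le> (\<Sum>c\<in>Basis. C2 b c) * \<tau> powr (2 * \<beta> - 1)" for x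
      proof -
        have "(\<Sum>c\<in>Basis. \<bar>partial_deriv c (partial_deriv b (layer j)) x\<bar>) \<le> (\<Sum>c\<in>Basis. C2 b c * \<tau> powr (2 * \<beta> - 1))"
          using p2[OF b] by (intro sum_mono)
        then show ?thesis using norm_grad_le[of "partial_deriv b (layer j)" x] by (simp add: sum_distrib_right)
      qed
      then show ?thesis
        using lipschitz_from_grad[of UNIV "partial_deriv b (layer j)" 0 _ x a] smooth_on_differentiable[OF sm[OF b]] by simp
    qed
    then have "(\<Sum>b\<in>Basis. \<bar>(grad (layer j) x - grad (layer j) a) \<bullet> b\<bar>) \<le> (\<Sum>b\<in>Basis. (\<Sum>c\<in>Basis. C2 b c) * \<tau> powr (2 * \<beta> - 1) * norm (x - a))"
      by (intro sum_mono) (simp add: inner_diff_left partial_deriv_inner_grad)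
    also have "\<dots> = S2 * \<tau> powr (2 * \<beta> - 1) * norm (x - a)" by (simp add: S2_def sum_distrib_right)
    finally show ?thesis using norm_le_l1[of "grad (layer j) x - grad (layer j) a"] by (simp add: \<tau>_def)
  qed
  have pw: "((1/2::real) ^ j) powr s = ((1/2) powr s) ^ j" for j s by (simp add: powr_power powr_realpow[symmetric] powr_powr mult.commute)
  define C where "C = C0 + 2 * S1 + S2"
  have "\<bar>layer j x\<bar> \<le> C * (1/2) ^ j" for j x
  proof -
    define \<tau> :: real where "\<tau> = (1/2) ^ j"
    have t: "0 < \<tau>" "\<tau> \<le> 1" by (auto simp: \<tau>_def power_le_one)
    have "\<bar>layer j x\<bar> \<le> C0 * \<tau> powr (1 + 2 * \<beta>)" unfolding layer_def \<tau>_def[symmetric] by (rule C0(2)[OF t W_int W_AE])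
    also have "\<tau> powr (1 + 2 * \<beta>) \<le> \<tau> powr 1" using t \<beta> by (intro powr_mono') auto
    then have "C0 * \<tau> powr (1 + 2 * \<beta>) \<le> C * \<tau>" unfolding C_def using C0(1) S t by (intro mult_mono) auto
    finally show ?thesis by (simp add: \<tau>_def)
  qed
  moreover have "norm (grad (layer j) x) \<le> C * ((1/2) powr \<beta>) ^ j" for j x
  proof -
    have "((1/2) ^ j) powr (2 * \<beta>) \<le> ((1/2::real) ^ j) powr \<beta>"
      using \<beta> by (intro powr_mono') (auto simp: power_le_one)
    then have "S1 * ((1/2) ^ j) powr (2 * \<beta>) \<le> C * ((1/2) ^ j) powr \<beta>" unfolding C_def using C0(1) S by (intro mult_mono) auto
    with g1[of j x] show ?thesis by (simp only: pw)
  qed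
  moreover have "\<bar>layer j x - layer j a - grad (layer j) a \<bullet> (x - a)\<bar> \<le> C * norm (x - a) powr (1 + \<beta>) * ((1/2) powr \<beta>) ^ j" for j x a
  proof (cases "x = a")
    case False
    define \<tau> :: real where "\<tau> = (1/2) ^ j"
    have t: "0 < \<tau>" "\<tau> \<le> 1" by (auto simp: \<tau>_def power_le_one)
    define d where "d = norm (x - a)"
    have d: "d > 0" using False by (simp add: d_def)
    have df: "layer j differentiable (at x)" for x using smooth_on_differentiable[OF layer_smooth] by simp
    have "\<bar>layer j x - layer j a - grad (layer j) a \<bullet> (x - a)\<bar> \<le> (2 * S1 + S2) * (d powr (1 + \<beta>) * \<tau> powr \<beta>)"
    proof (cases "d \<le> \<tau>")
      case True
      have "\<bar>layer j x - layer j a - grad (layer j) a \<bullet> (x - a)\<bar> \<le> (S2 * \<tau> powr (2 * \<beta> - 1) * d) * norm (x - a)"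
      proof (rule lipschitz_from_grad[of "cball a d"])
        fix y assume "y \<in> cball a d"
        then have "norm (y - a) \<le> d" by (simp add: dist_norm norm_minus_commute)
        then have "S2 * \<tau> powr (2 * \<beta> - 1) * norm (y - a) \<le> S2 * \<tau> powr (2 * \<beta> - 1) * d" using S by (intro mult_left_mono) auto
        with g2[of j y a] show "norm (grad (layer j) y - grad (layer j) a) \<le> S2 * \<tau> powr (2 * \<beta> - 1) * d" by (simp add: \<tau>_def)
      qed (use df d in \<open>auto simp: d_def dist_norm norm_minus_commute\<close>)
      also have "\<dots> = S2 * (d\<^sup>2 * \<tau> powr (2 * \<beta> - 1))" by (simp add: d_def power2_eq_square)
      also have "d\<^sup>2 = d powr (1 + \<beta>) * d powr (1 - \<beta>)" using d by (simp add: powr_add[symmetric])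
      also have "d powr (1 + \<beta>) * d powr (1 - \<beta>) * \<tau> powr (2 * \<beta> - 1) \<le> d powr (1 + \<beta>) * \<tau> powr (1 - \<beta>) * \<tau> powr (2 * \<beta> - 1)"
        using True d \<beta> by (intro mult_right_mono mult_left_mono powr_mono2) auto
      also have "\<dots> = d powr (1 + \<beta>) * \<tau> powr \<beta>" by (simp add: mult.assoc powr_add[symmetric])
      finally have "\<bar>layer j x - layer j a - grad (layer j) a \<bullet> (x - a)\<bar> \<le> S2 * (d powr (1 + \<beta>) * \<tau> powr \<beta>)"
        using S by simp
      also have "\<dots> \<le> (2 * S1 + S2) * (d powr (1 + \<beta>) * \<tau> powr \<beta>)" using S by (intro mult_right_mono) auto
      finally show ?thesis .
    next
      case False
      have "\<bar>layer j x - layer j a - grad (layer j) a \<bullet> (x - a)\<bar> \<le> (2 * S1 * \<tau> powr (2 * \<beta>)) * norm (x - a)"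
      proof (rule lipschitz_from_grad[of UNIV])
        fix y
        show "norm (grad (layer j) y - grad (layer j) a) \<le> 2 * S1 * \<tau> powr (2 * \<beta>)"
          using g1[of j y] g1[of j a] norm_triangle_ineq4[of "grad (layer j) y" "grad (layer j) a"] by (simp add: \<tau>_def)
      qed (use df in auto)
      also have "\<dots> = 2 * S1 * (d powr 1 * (\<tau> powr \<beta> * \<tau> powr \<beta>))" using d by (simp add: d_def powr_add[symmetric])
      also have "\<dots> \<le> 2 * S1 * (d powr 1 * (d powr \<beta> * \<tau> powr \<beta>))"
        using False t d \<beta> S by (intro mult_left_mono mult_right_mono powr_mono2) auto
      also have "\<dots> = 2 * S1 * (d powr (1 + \<beta>) * \<tau> powr \<beta>)" using d by (simp add: powr_add)
      also have "\<dots> \<le> (2 * S1 + S2) * (d powr (1 + \<beta>) * \<tau> powr \<beta>)" using S by (intro mult_right_mono) auto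
      finally show ?thesis .
    qed
    also have "\<dots> \<le> C * (d powr (1 + \<beta>) * \<tau> powr \<beta>)" unfolding C_def using C0(1) by (intro mult_right_mono) auto
    finally show ?thesis by (simp add: d_def \<tau>_def pw mult.assoc)
  qed simp
  moreover have "C > 0" using C0(1) S by (simp add: C_def)
  ultimately have "layer_bound C" by (simp add: layer_bound_def)
  then show ?thesis ..
qed

text \<open>Its Laplacian is \<open>conv (phis 1) W - W\<close> in the sense of the limit of \<open>partial_potential_laplacian\<close>.\<close>

definition potential :: "'a \<Rightarrow> real" where
  "potential x = (\<Sum>j. layer j x)"

definition partial_potential :: "nat \<Rightarrow> 'a \<Rightarrow> real" where
  "partial_potential n x = (\<Sum>j<n. layer j x)"

lemma half_powr: "0 < (1/2::real) powr \<beta>" "(1/2::real) powr \<beta> < 1"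
proof -
  have "(1/2::real) powr \<beta> < 1 powr \<beta>" using \<beta> by (intro powr_less_mono2) auto
  then show "(1/2::real) powr \<beta> < 1" by simp
qed simp

lemma layer_summable: "summable (\<lambda>j. layer j x)"
proof -
  obtain C where "layer_bound C" using layer_estimates by blast
  note C = layer_boundD[OF this]
  show ?thesis
    by (rule summable_comparison_test'[where g="\<lambda>j. C * (1/2) ^ j" and N=0])
       (use C(2) in \<open>auto intro!: summable_mult summable_geometric\<close>)
qed

lemma partial_potential_uniform: "uniform_limit UNIV partial_potential potential sequentially"
proof -
  obtain C where "layer_bound C" using layer_estimates by blast
  note C = layer_boundD[OF this]
  from C(2) have "uniform_limit UNIV (\<lambda>n x. \<Sum>j<n. layer j x) (\<lambda>x. \<Sum>j. layer j x) sequentially"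
    by (intro Weierstrass_m_test[where M="\<lambda>j. C * (1/2) ^ j"]) (auto intro!: summable_mult summable_geometric)
  then show ?thesis by (simp add: potential_def[abs_def] partial_potential_def[abs_def])
qed

lemma partial_potential_smooth: "smooth_on UNIV (partial_potential n)"
  unfolding partial_potential_def[abs_def] by (intro smooth_on_sum layer_smooth) simp

lemma partial_potential_laplacian:
  "laplacian (partial_potential n) x = conv (phis 1) W x - conv (phis ((1/2) ^ n)) W x"
proof -
  have l: "laplacian (layer j) x = conv (phis ((1/2) ^ j)) W x - conv (phis ((1/2) ^ Suc j)) W x" for j
    using conv_kers_laplacian[OF _ W_int, of "(1/2) ^ j" x] by (simp add: layer_def)
  have "laplacian (partial_potential n) x = (\<Sum>j<n. laplacian (layer j) x)"
    unfolding partial_potential_def[abs_def] by (intro laplacian_sum layer_smooth) simp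
  also have "\<dots> = conv (phis ((1/2) ^ 0)) W x - conv (phis ((1/2) ^ n)) W x"
    unfolding l by (rule sum_lessThan_telescope')
  finally show ?thesis by simp
qed

lemma potential_continuous: "continuous_on UNIV potential"
  by (rule uniform_limit_theorem[OF _ partial_potential_uniform])
     (auto intro!: always_eventually smooth_on_continuous partial_potential_smooth)

lemma potential_lipschitz: "\<exists>C>0. \<forall>x y. \<bar>potential x - potential y\<bar> \<le> C * norm (x - y)"
proof -
  obtain C where "layer_bound C" using layer_estimates by blast
  note C = layer_boundD[OF this]
  let ?r = "(1/2) powr \<beta>"
  show ?thesis
  proof (intro exI[of _ "C * (1 / (1 - ?r))"] conjI allI)
    show "0 < C * (1 / (1 - ?r))" using C half_powr by simp
    fix x y
    have l: "norm (layer j x - layer j y) \<le> C * norm (x - y) * ?r ^ j" for j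
      using lipschitz_from_grad[of UNIV "layer j" 0 "C * ?r ^ j" x y] C(3)[of j] smooth_on_differentiable[OF layer_smooth]
      by (simp add: mult_ac)
    have s: "summable (\<lambda>j. C * norm (x - y) * ?r ^ j)" using half_powr by (intro summable_mult summable_geometric) simp
    have "\<bar>potential x - potential y\<bar> = norm (\<Sum>j. layer j x - layer j y)"
      by (simp add: potential_def suminf_diff[OF layer_summable layer_summable])
    also have "\<dots> \<le> (\<Sum>j. C * norm (x - y) * ?r ^ j)"
      by (rule norm_suminf_le) (use l s in auto)
    also have "\<dots> = C * (1 / (1 - ?r)) * norm (x - y)"
      using half_powr by (subst suminf_mult) (auto simp: suminf_geometric intro!: summable_geometric)
    finally show "\<bar>potential x - potential y\<bar> \<le> C * (1 / (1 - ?r)) * norm (x - y)" .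
  qed
qed

lemma potential_taylor:
  "\<exists>C>0. \<forall>a. \<exists>L. \<forall>x. \<bar>potential x - potential a - L \<bullet> (x - a)\<bar> \<le> C * norm (x - a) powr (1 + \<beta>)"
proof -
  obtain C where "layer_bound C" using layer_estimates by blast
  note C = layer_boundD[OF this]
  let ?r = "(1/2) powr \<beta>"
  show ?thesis
  proof (intro exI[of _ "C * (1 / (1 - ?r))"] conjI allI)
    show "0 < C * (1 / (1 - ?r))" using C half_powr by simp
    fix a
    have sg: "summable (\<lambda>j. grad (layer j) a)"
      by (rule summable_comparison_test'[where g="\<lambda>j. C * ?r ^ j" and N=0])
         (use C(3) half_powr in \<open>auto intro!: summable_mult summable_geometric\<close>)
    show "\<exists>L. \<forall>x. \<bar>potential x - potential a - L \<bullet> (x - a)\<bar> \<le> C * (1 / (1 - ?r)) * norm (x - a) powr (1 + \<beta>)"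
    proof (intro exI[of _ "\<Sum>j. grad (layer j) a"] allI)
      fix x
      let ?L = "(\<Sum>j. grad (layer j) a) \<bullet> (x - a)"
      have si: "(\<lambda>j. grad (layer j) a \<bullet> (x - a)) sums ?L"
        by (rule bounded_linear.sums[OF bounded_linear_inner_left summable_sums[OF sg]])
      have "(\<lambda>j. layer j x - layer j a - grad (layer j) a \<bullet> (x - a)) sums (potential x - potential a - ?L)"
        unfolding potential_def by (intro sums_diff summable_sums layer_summable si)
      then have "\<bar>potential x - potential a - ?L\<bar> = norm (\<Sum>j. layer j x - layer j a - grad (layer j) a \<bullet> (x - a))"
        by (simp add: sums_iff)
      also have "\<dots> \<le> (\<Sum>j. C * norm (x - a) powr (1 + \<beta>) * ?r ^ j)"
        by (rule norm_suminf_le) (use C(4) half_powr in \<open>auto intro!: summable_mult summable_geometric\<close>)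
      also have "\<dots> = C * (1 / (1 - ?r)) * norm (x - a) powr (1 + \<beta>)"
        using half_powr by (subst suminf_mult) (auto simp: suminf_geometric intro!: summable_geometric)
      finally show "\<bar>potential x - potential a - ?L\<bar> \<le> C * (1 / (1 - ?r)) * norm (x - a) powr (1 + \<beta>)" .
    qed
  qed
qed

lemma smoothed_bounded: "\<exists>B>0. \<forall>x. \<bar>conv (phis 1) W x\<bar> \<le> B"
proof -
  obtain C where C: "C > 0" "\<And>z::'a. \<bar>phis 1 z\<bar> \<le> C" using TF_bounded[OF phis_TF[of 1]] by auto
  have "\<bar>conv (phis 1) W x\<bar> \<le> C * (CW * (1 ^ DIM('a) * 1 powr (2 * \<beta> - 1)))" for x
  proof (rule order_trans[OF conv_bound[OF phis_TF W_int C(2) _ W_int W_AE, of 1 x]])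
    show "C * (\<integral>y. indicator (ball x 1) y * W y \<partial>lebesgue) \<le> C * (CW * (1 ^ DIM('a) * 1 powr (2 * \<beta> - 1)))"
      by (intro mult_left_mono growth) (use C in auto)
  qed (auto simp: phis_eq_0)
  then show ?thesis using C CW by (intro exI[of _ "C * CW"]) auto
qed

text \<open>Formally \<open>\<Delta> (Q - p) = \<Delta> Q - conv (phis 1) W + W\<close>, where \<open>p\<close> is the potential, and this exceeds
  \<open>W \<ge> - g\<close> wherever \<open>Q - p > v\<close>. The partial potentials are smooth, so the comparison integral applies
  to them; the error in their Laplacians is the difference of \<open>W\<close> and its mollification, which tends to
  0 in the mean.\<close>

lemma barrier_comparison:
  fixes \<Omega> :: "'a set"
  assumes O: "open \<Omega>" "bounded \<Omega>" and sol: "weak_solution \<Omega> v g"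
    and super: "AE x in lebesgue_on \<Omega>. v x < 1 \<longrightarrow> g x \<ge> - W x"
    and K0: "\<And>x. \<bar>conv (phis 1) W x\<bar> \<le> K0"
    and Q: "smooth_on UNIV Q" and R: "0 \<le> R1" "R1 < R2"
    and le1: "\<And>x. x \<in> \<Omega> \<Longrightarrow> norm (x - z) < R2 \<Longrightarrow> Q x - potential x \<le> 1"
    and fr: "\<And>x. x \<in> frontier \<Omega> \<Longrightarrow> norm (x - z) \<le> R2 \<Longrightarrow> Q x - potential x \<le> 0"
    and ann: "AE x in lebesgue_on \<Omega>. R1 \<le> norm (x - z) \<longrightarrow> norm (x - z) \<le> R2 \<longrightarrow> Q x - potential x \<le> v x"
    and lap: "AE x in lebesgue_on \<Omega>. norm (x - z) < R2 \<longrightarrow> Q x - potential x \<le> v x \<or> laplacian Q x > K0"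
  shows "AE x in lebesgue_on \<Omega>. norm (x - z) < R2 \<longrightarrow> Q x - potential x \<le> v x"
proof -
  let ?M = "lebesgue_on \<Omega>" and ?\<zeta> = "cutoff z R1 R2"
  interpret finite_measure ?M using finite_measure_bounded[OF O] .
  from sol have u: "v \<in> Lp_on 2 \<Omega>" and g: "integrable ?M g" unfolding weak_solution_def by blast+
  have WO: "integrable ?M W" by (rule integrable_lebesgue_on[OF O(1) W_int])
  \<comment> \<open>Lowering the barrier by \<open>e\<close> leaves room for replacing the potential by a partial potential.\<close>
  have eps: "AE x in ?M. norm (x - z) < R2 \<longrightarrow> Q x - e - potential x \<le> v x" if e: "e > 0" for e
  proof -
    define F where "F x = - laplacian Q x + conv (phis 1) W x - W x - g x" for x
    have iF: "integrable ?M F"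
      unfolding F_def
      using continuous_integrable_on[OF smooth_laplacian_continuous[OF Q] O] g WO
        continuous_integrable_on[OF smooth_on_continuous[OF conv_smooth(1)[OF phis_TF[of 1] W_int]] O] by auto
    define c where "c n = conv (phis ((1/2) ^ n)) W" for n
    have ic: "integrable lebesgue (\<lambda>x. c n x - W x)" "(\<lambda>n. \<integral>x. \<bar>c n x - W x\<bar> \<partial>lebesgue) \<longlonglongrightarrow> 0" for n
    proof -
      have "(\<lambda>n. (1/2::real) ^ n) \<longlonglongrightarrow> 0" by (rule LIMSEQ_realpow_zero) auto
      from conv_tendsto_L1[OF _ this W_int] show "integrable lebesgue (\<lambda>x. c n x - W x)" "(\<lambda>n. \<integral>x. \<bar>c n x - W x\<bar> \<partial>lebesgue) \<longlonglongrightarrow> 0"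
        by (simp_all add: c_def)
    qed
    define I where "I n = (\<integral>x. F x * (?\<zeta> x * bump_deriv 0 (Q x - e - partial_potential n x - v x)) \<partial>?M)" for n
    have m1: "(\<lambda>x. ?\<zeta> x * bump_deriv 0 (Q x - e - partial_potential n x - v x)) \<in> borel_measurable ?M" for n
    proof -
      have [measurable]: "?\<zeta> \<in> borel_measurable ?M" "Q \<in> borel_measurable ?M" "partial_potential n \<in> borel_measurable ?M" "v \<in> borel_measurable ?M"
        using Lp_on_2(1)[OF u] by (auto intro!: continuous_measurable_on smooth_on_continuous smooth_cutoff Q partial_potential_smooth)
      show ?thesis by measurable
    qed
    have b1: "\<bar>?\<zeta> x * bump_deriv 0 s\<bar> \<le> 1" for x s
      using mult_mono[OF cutoff_bounds(2)[of z R1 R2 x] bump_bounds(2)[of s]] by (simp add: abs_mult cutoff_bounds bump_bounds)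
    have ge: "eventually (\<lambda>n. I n + (\<integral>x. \<bar>c n x - W x\<bar> \<partial>lebesgue) \<ge> 0) sequentially"
      using uniform_limitD[OF partial_potential_uniform e]
    proof eventually_elim
      case (elim n)
      have close: "\<bar>partial_potential n x - potential x\<bar> < e" for x using elim by (simp add: dist_real_def)
      let ?\<psi> = "\<lambda>x. Q x - e - partial_potential n x"
      have sm: "smooth_on UNIV ?\<psi>" by (intro smooth_on_diff Q smooth_on_const partial_potential_smooth) auto
      have lp: "laplacian ?\<psi> x = laplacian Q x - (conv (phis 1) W x - c n x)" for x
      proof -
        have "laplacian ?\<psi> x = laplacian (\<lambda>x. Q x - e) x - laplacian (partial_potential n) x"
          by (intro laplacian_diff smooth_on_diff Q smooth_on_const partial_potential_smooth) auto
        moreover have "laplacian (\<lambda>x. Q x - e) x = laplacian Q x - laplacian (\<lambda>x. e) x"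
          by (intro laplacian_diff Q smooth_on_const)
        ultimately show ?thesis by (simp add: partial_potential_laplacian c_def)
      qed
      have "0 \<le> (\<integral>x. (- laplacian ?\<psi> x - g x) * (?\<zeta> x * bump_deriv 0 (?\<psi> x - v x)) \<partial>?M)"
      proof (rule comparison_integral[OF O sol sm cutoff_TF[OF R] cutoff_bounds(1)])
        fix x assume x: "x \<in> frontier \<Omega>" "x \<in> closure {x. ?\<zeta> x \<noteq> 0}"
        then have "norm (x - z) \<le> R2" using subsetD[OF cutoff_support[OF R] x(2)] by (simp add: dist_norm norm_minus_commute)
        from fr[OF x(1) this] close[of x] show "?\<psi> x < 0" by linarith
      next
        show "AE x in ?M. grad ?\<zeta> x \<noteq> 0 \<longrightarrow> ?\<psi> x \<le> v x"
          using ann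
        proof eventually_elim
          case (elim x)
          show ?case
          proof
            assume nz: "grad ?\<zeta> x \<noteq> 0"
            have "R1 \<le> norm (x - z)" "norm (x - z) \<le> R2"
              using nz cutoff_grad[OF R, of x z] cutoff_grad_outside[OF R, of x z] by (meson not_le)+
            with elim close[of x] show "?\<psi> x \<le> v x" by auto
          qed
        qed
      qed
      also have "\<dots> = (\<integral>x. F x * (?\<zeta> x * bump_deriv 0 (?\<psi> x - v x)) + (W x - c n x) * (?\<zeta> x * bump_deriv 0 (?\<psi> x - v x)) \<partial>?M)"
      proof -
        have "- laplacian ?\<psi> x - g x = F x + (W x - c n x)" for x by (simp only: lp F_def)
        then show ?thesis by (simp only: distrib_right)
      qed
      also have "\<dots> = I n + (\<integral>x. (W x - c n x) * (?\<zeta> x * bump_deriv 0 (?\<psi> x - v x)) \<partial>?M)"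
        unfolding I_def
      proof (rule Bochner_Integration.integral_add)
        show "integrable ?M (\<lambda>x. F x * (?\<zeta> x * bump_deriv 0 (?\<psi> x - v x)))"
          by (rule integrable_mult_bounded[OF iF m1 b1])
        have "integrable ?M (\<lambda>x. c n x - W x)" 
          by (rule integrable_lebesgue_on[OF O(1) ic(1)])
        then have "integrable ?M (\<lambda>x. W x - c n x)" using integrable_minus[of ?M "\<lambda>x. c n x - W x"] by simp
        then show "integrable ?M (\<lambda>x. (W x - c n x) * (?\<zeta> x * bump_deriv 0 (?\<psi> x - v x)))"
          by (rule integrable_mult_bounded[OF _ m1 b1])
      qed
      also have "(\<integral>x. (W x - c n x) * (?\<zeta> x * bump_deriv 0 (?\<psi> x - v x)) \<partial>?M) \<le> (\<integral>x. \<bar>c n x - W x\<bar> \<partial>lebesgue)"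
      proof -
        have i: "integrable lebesgue (\<lambda>x. indicator \<Omega> x * \<bar>c n x - W x\<bar>)"
          using integrable_mult_indicator[of \<Omega> lebesgue "\<lambda>x. \<bar>c n x - W x\<bar>"] ic(1)[of n] O by simp
        have "(\<integral>x. (W x - c n x) * (?\<zeta> x * bump_deriv 0 (?\<psi> x - v x)) \<partial>?M) \<le> (\<integral>x. \<bar>c n x - W x\<bar> \<partial>?M)"
        proof (rule integral_mono')
          show "integrable ?M (\<lambda>x. \<bar>c n x - W x\<bar>)" using i O by (simp add: integrable_restrict_space)
          fix x
          have "\<bar>W x - c n x\<bar> * \<bar>?\<zeta> x * bump_deriv 0 (?\<psi> x - v x)\<bar> \<le> \<bar>W x - c n x\<bar> * 1" by (intro mult_left_mono b1) simp
          then show "(W x - c n x) * (?\<zeta> x * bump_deriv 0 (?\<psi> x - v x)) \<le> \<bar>c n x - W x\<bar>"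
            by (simp only: abs_mult[symmetric]) (simp add: abs_minus_commute)
        qed simp
        also have "\<dots> = (\<integral>x. indicator \<Omega> x * \<bar>c n x - W x\<bar> \<partial>lebesgue)" using O by (simp add: integral_restrict_space)
        also have "\<dots> \<le> (\<integral>x. \<bar>c n x - W x\<bar> \<partial>lebesgue)"
          by (rule integral_mono) (use i ic(1)[of n] in \<open>auto split: split_indicator\<close>)
        finally show ?thesis .
      qed
      finally show ?case by simp
    qed
    define J where "J x = F x * (?\<zeta> x * bump_deriv 0 (Q x - e - potential x - v x))" for x
    have m2: "(\<lambda>x. ?\<zeta> x * bump_deriv 0 (Q x - e - potential x - v x)) \<in> borel_measurable ?M"
    proof -
      have [measurable]: "?\<zeta> \<in> borel_measurable ?M" "Q \<in> borel_measurable ?M" "potential \<in> borel_measurable ?M" "v \<in> borel_measurable ?M"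
        using Lp_on_2(1)[OF u] by (auto intro!: continuous_measurable_on smooth_on_continuous smooth_cutoff Q potential_continuous)
      show ?thesis by measurable
    qed
    have iJ: "integrable ?M J" unfolding J_def by (rule integrable_mult_bounded[OF iF m2 b1])
    have "I \<longlonglongrightarrow> (\<integral>x. J x \<partial>?M)"
      unfolding I_def
    proof (rule integral_dominated_convergence[where w="\<lambda>x. \<bar>F x\<bar>"])
      show "J \<in> borel_measurable ?M" using iJ by auto
      show "(\<lambda>x. F x * (?\<zeta> x * bump_deriv 0 (Q x - e - partial_potential n x - v x))) \<in> borel_measurable ?M" for n
        by (rule borel_measurable_times[OF borel_measurable_integrable[OF iF] m1])
      show "AE x in ?M. (\<lambda>n. F x * (?\<zeta> x * bump_deriv 0 (Q x - e - partial_potential n x - v x))) \<longlonglongrightarrow> J x"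
      proof (rule AE_I2)
        fix x
        have "(\<lambda>n. partial_potential n x) \<longlonglongrightarrow> potential x"
          using tendsto_uniform_limitI[OF partial_potential_uniform, of x] by simp
        then show "(\<lambda>n. F x * (?\<zeta> x * bump_deriv 0 (Q x - e - partial_potential n x - v x))) \<longlonglongrightarrow> J x"
          unfolding J_def by (intro tendsto_intros isCont_tendsto_compose[OF DERIV_isCont[OF bump_deriv_DERIV]])
      qed
      show "AE x in ?M. norm (F x * (?\<zeta> x * bump_deriv 0 (Q x - e - partial_potential n x - v x))) \<le> \<bar>F x\<bar>" for n
      proof (rule AE_I2)
        fix x
        have "\<bar>F x\<bar> * \<bar>?\<zeta> x * bump_deriv 0 (Q x - e - partial_potential n x - v x)\<bar> \<le> \<bar>F x\<bar> * 1" by (intro mult_left_mono b1) simp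
        then show "norm (F x * (?\<zeta> x * bump_deriv 0 (Q x - e - partial_potential n x - v x))) \<le> \<bar>F x\<bar>"
          by (simp only: real_norm_def abs_mult mult_1_right)
      qed
    qed (use iF in auto)
    then have "(\<lambda>n. I n + (\<integral>x. \<bar>c n x - W x\<bar> \<partial>lebesgue)) \<longlonglongrightarrow> (\<integral>x. J x \<partial>?M) + 0" by (intro tendsto_add ic(2))
    then have J0: "0 \<le> (\<integral>x. J x \<partial>?M)" using tendsto_lowerbound[OF _ ge] by simp
    have neg: "AE x in ?M. J x \<le> 0 \<and> (norm (x - z) < R2 \<longrightarrow> Q x - e - potential x > v x \<longrightarrow> J x < 0)"
      using super lap AE_space
    proof eventually_elim
      case (elim x)
      then have x: "x \<in> \<Omega>" by (simp add: space_restrict_space)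
      show ?case
      proof (cases "norm (x - z) < R2 \<and> Q x - e - potential x > v x")
        case True
        then have "v x < 1" using le1[OF x] e by auto
        with elim have gx: "g x \<ge> - W x" by auto
        from True e elim have "laplacian Q x > K0" by auto
        with gx K0[of x] have "F x < 0" unfolding F_def by linarith
        moreover have "?\<zeta> x > 0" using cutoff_pos[OF R] True by blast
        moreover have "bump_deriv 0 (Q x - e - potential x - v x) > 0" using True by (intro bump_pos) simp
        ultimately have "J x < 0" unfolding J_def by (simp add: mult_neg_pos)
        then show ?thesis by simp
      next
        case False
        then have "J x = 0" unfolding J_def using cutoff_eq_0[OF R, of x z] bump_eq_0[of "Q x - e - potential x - v x" 0] by (cases "norm (x - z) < R2") auto
        with False show ?thesis by auto
      qed
    qed
    then have "AE x in ?M. - J x \<ge> 0" by eventually_elim auto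
    moreover have "(\<integral>x. - J x \<partial>?M) = 0"
    proof (rule antisym)
      show "(\<integral>x. - J x \<partial>?M) \<le> 0" using J0 by simp
      show "0 \<le> (\<integral>x. - J x \<partial>?M)" by (rule integral_nonneg_AE) fact
    qed
    ultimately have "AE x in ?M. - J x = 0"
      using integral_nonneg_eq_0_iff_AE[of ?M "\<lambda>x. - J x"] iJ by auto
    with neg show ?thesis by eventually_elim force
  qed
  have "AE x in ?M. \<forall>m::nat. norm (x - z) < R2 \<longrightarrow> Q x - 1 / (real m + 1) - potential x \<le> v x"
    unfolding AE_all_countable using eps by simp
  then show ?thesis
  proof eventually_elim
    case (elim x)
    show ?case
    proof
      assume n: "norm (x - z) < R2"
      show "Q x - potential x \<le> v x"
      proof (rule field_le_epsilon)
        fix e :: real assume "e > 0"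
        then obtain m where "inverse (real (Suc m)) < e" using reals_Archimedean by blast
        moreover have "Q x - 1 / (real m + 1) - potential x \<le> v x" using elim n by blast
        ultimately show "Q x - potential x \<le> v x + e" by (simp add: inverse_eq_divide add.commute)
      qed
    qed
  qed
qed

end

section \<open>Weak solutions and comparison with smooth functions\<close>

lemma L2_integrable:
  fixes u :: "'a::euclidean_space \<Rightarrow> 'b::euclidean_space"
  assumes "u \<in> Lp_on 2 \<Omega>" "open \<Omega>" "bounded \<Omega>"
  shows "integrable (lebesgue_on \<Omega>) u"
proof -
  interpret finite_measure "lebesgue_on \<Omega>" using finite_measure_bounded[OF assms(2,3)] .
  show ?thesis
  proof (rule Bochner_Integration.integrable_bound[where f="\<lambda>x. 1 + (norm (u x))\<^sup>2"])
    show "AE x in lebesgue_on \<Omega>. norm (u x) \<le> norm (1 + (norm (u x))\<^sup>2)"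
    proof (rule AE_I2)
      fix x have "2 * norm (u x) \<le> 1 + (norm (u x))\<^sup>2"
        using zero_le_power2[of "norm (u x) - 1"] by (simp add: power2_diff)
      moreover have "0 \<le> norm (u x)" by simp
      ultimately have "norm (u x) \<le> 1 + (norm (u x))\<^sup>2" by linarith
      then show "norm (u x) \<le> norm (1 + (norm (u x))\<^sup>2)" by simp
    qed
  qed (use Lp_on_2[OF assms(1)] in auto)
qed

text \<open>\<open>V u\<close> is integrable because \<open>2 \<bar>u\<bar> \<le> 1 + u\<^sup>2\<close> and \<open>V\<close>, \<open>V u\<^sup>2\<close> are. The gradient form of the equation is obtained
  from the distributional one by inserting the partial derivatives of a test function into the definition
  of the weak gradient.\<close>

lemma dirichlet_imp_weak_solution:
  fixes \<Omega> :: "'a::euclidean_space set"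
  assumes O: "open \<Omega>" "bounded \<Omega>" and V: "AE x in lebesgue_on \<Omega>. V x \<ge> 0" "integrable (lebesgue_on \<Omega>) V"
    and f: "f \<in> Linf_on \<Omega>" and sol: "dirichlet_solution \<Omega> V f u"
  shows "weak_solution \<Omega> u (\<lambda>x. f x - V x * u x)"
proof -
  let ?M = "lebesgue_on \<Omega>"
  interpret finite_measure ?M using finite_measure_bounded[OF O] .
  from sol obtain G \<phi> where u: "u \<in> Lp_on 2 \<Omega>" and G: "G \<in> Lp_on 2 \<Omega>" and wg: "is_weak_gradient \<Omega> u G"
    and phi: "\<forall>k::nat. \<phi> k \<in> test_functions \<Omega>"
    and lim: "(\<lambda>k. (\<integral>x. (u x - \<phi> k x)\<^sup>2 \<partial>?M) + (\<integral>x. (norm (G x - grad (\<phi> k) x))\<^sup>2 \<partial>?M)) \<longlonglongrightarrow> 0"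
    and uV: "integrable ?M (\<lambda>x. (u x)\<^sup>2 * V x)"
    and ds: "distributional_solution \<Omega> V f u"
    unfolding dirichlet_solution_def W12_0_def weighted_L2_on_def by blast
  note [measurable] = Lp_on_2(1)[OF u] Lp_on_2(1)[OF G] borel_measurable_integrable[OF V(2)]
  note iu = L2_integrable[OF u O] and iG = L2_integrable[OF G O]
  from f obtain F where F: "f \<in> borel_measurable ?M" "AE x in ?M. \<bar>f x\<bar> \<le> F" by (auto simp: Linf_on_def)
  have iF: "integrable ?M f" using F by (intro integrable_const_bound[where B=F]) auto
  have iVu: "integrable ?M (\<lambda>x. V x * u x)"
  proof (rule Bochner_Integration.integrable_bound[where f="\<lambda>x. \<bar>V x\<bar> + \<bar>(u x)\<^sup>2 * V x\<bar>"])
    show "AE x in ?M. norm (V x * u x) \<le> norm (\<bar>V x\<bar> + \<bar>(u x)\<^sup>2 * V x\<bar>)"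
    proof (rule AE_I2)
      fix x have "2 * \<bar>u x\<bar> \<le> 1 + (u x)\<^sup>2"
        using zero_le_power2[of "\<bar>u x\<bar> - 1"] by (simp add: power2_diff)
      then have "\<bar>u x\<bar> \<le> 1 + (u x)\<^sup>2" using abs_ge_zero[of "u x"] by linarith
      then have "\<bar>V x\<bar> * \<bar>u x\<bar> \<le> \<bar>V x\<bar> * (1 + (u x)\<^sup>2)" by (rule mult_left_mono) simp
      then show "norm (V x * u x) \<le> norm (\<bar>V x\<bar> + \<bar>(u x)\<^sup>2 * V x\<bar>)" by (simp add: abs_mult algebra_simps)
    qed
  qed (use V(2) uV in auto)
  have ig: "integrable ?M (\<lambda>x. f x - V x * u x)" using iF iVu by simp
  have e1: "(\<integral>x. u x * laplacian \<theta> x \<partial>?M) = - (\<integral>x. (f x - V x * u x) * \<theta> x \<partial>?M)"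
    if th: "\<theta> \<in> test_functions \<Omega>" for \<theta>
  proof -
    obtain B where B: "\<And>x. \<bar>\<theta> x\<bar> \<le> B" using TF_bounded[OF th] by blast
    have "\<theta> \<in> borel_measurable ?M" by (intro continuous_measurable_on test_functions_D(2)[OF th])
    then have "integrable ?M (\<lambda>x. f x * \<theta> x)" by (rule integrable_mult_bounded[OF iF _ B])
    then have "(\<integral>x. (f x - V x * u x) * \<theta> x \<partial>?M) = (\<integral>x. f x * \<theta> x \<partial>?M) - (\<integral>x. V x * u x * \<theta> x \<partial>?M)"
      using ds th by (simp add: left_diff_distrib distributional_solution_def)
    moreover have "- (\<integral>x. u x * laplacian \<theta> x \<partial>?M) + (\<integral>x. V x * u x * \<theta> x \<partial>?M) = (\<integral>x. f x * \<theta> x \<partial>?M)"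
      using ds th unfolding distributional_solution_def by blast
    ultimately show ?thesis by linarith
  qed
  have e2: "(\<integral>x. G x \<bullet> grad \<theta> x \<partial>?M) = (\<integral>x. (f x - V x * u x) * \<theta> x \<partial>?M)"
    if th: "\<theta> \<in> test_functions \<Omega>" for \<theta>
  proof -
    have p: "partial_deriv b \<theta> \<in> test_functions \<Omega>" if "b \<in> Basis" for b using test_functions_partial[OF th that] .
    have iGb: "integrable ?M (\<lambda>x. partial_deriv b \<theta> x *\<^sub>R G x)" and iub: "integrable ?M (\<lambda>x. u x *\<^sub>R grad (partial_deriv b \<theta>) x)"
      if b: "b \<in> Basis" for b
    proof -
      obtain B where B: "\<And>x. \<bar>partial_deriv b \<theta> x\<bar> \<le> B" using TF_bounded[OF p[OF b]] by blast
      have [measurable]: "partial_deriv b \<theta> \<in> borel_measurable ?M" by (intro continuous_measurable_on test_functions_D(2)[OF p[OF b]])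
      show "integrable ?M (\<lambda>x. partial_deriv b \<theta> x *\<^sub>R G x)"
      proof (rule Bochner_Integration.integrable_bound[where f="\<lambda>x. B * norm (G x)"])
        show "AE x in ?M. norm (partial_deriv b \<theta> x *\<^sub>R G x) \<le> norm (B * norm (G x))"
          by (rule AE_I2) (simp add: abs_mult mult_right_mono order_trans[OF B abs_ge_self])
      qed (use iG in auto)
      have sm: "smooth_on UNIV (partial_deriv b \<theta>)" using test_functions_D(1)[OF p[OF b]] .
      have [measurable]: "grad (partial_deriv b \<theta>) \<in> borel_measurable ?M" by (intro continuous_measurable_on smooth_grad_continuous sm)
      obtain B' where B': "\<And>x. x \<in> \<Omega> \<Longrightarrow> norm (grad (partial_deriv b \<theta>) x) \<le> B'"
        using continuous_bounded_on[OF smooth_grad_continuous[OF sm] O(2)] by blast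
      show "integrable ?M (\<lambda>x. u x *\<^sub>R grad (partial_deriv b \<theta>) x)"
      proof (rule Bochner_Integration.integrable_bound[where f="\<lambda>x. B' * u x"])
        show "AE x in ?M. norm (u x *\<^sub>R grad (partial_deriv b \<theta>) x) \<le> norm (B' * u x)"
        proof (rule AE_I2)
          fix x assume "x \<in> space ?M"
          then have "norm (grad (partial_deriv b \<theta>) x) \<le> \<bar>B'\<bar>" using B'[of x] by (simp add: space_restrict_space)
          then show "norm (u x *\<^sub>R grad (partial_deriv b \<theta>) x) \<le> norm (B' * u x)"
            using mult_left_mono[of _ _ "\<bar>u x\<bar>"] by (simp add: abs_mult mult.commute[of "\<bar>B'\<bar>"])
        qed
      qed (use iu in auto)
    qed
    have each: "(\<integral>x. u x * partial_deriv b (partial_deriv b \<theta>) x \<partial>?M) = - (\<integral>x. partial_deriv b \<theta> x * (G x \<bullet> b) \<partial>?M)"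
      "integrable ?M (\<lambda>x. u x * partial_deriv b (partial_deriv b \<theta>) x)" "integrable ?M (\<lambda>x. partial_deriv b \<theta> x * (G x \<bullet> b))"
      if b: "b \<in> Basis" for b
    proof -
      have "(\<integral>x. u x *\<^sub>R grad (partial_deriv b \<theta>) x \<partial>?M) \<bullet> b = - (\<integral>x. partial_deriv b \<theta> x *\<^sub>R G x \<partial>?M) \<bullet> b"
        using wg p[OF b] by (simp add: is_weak_gradient_def)
      then have "(\<integral>x. (u x *\<^sub>R grad (partial_deriv b \<theta>) x) \<bullet> b \<partial>?M) = - (\<integral>x. (partial_deriv b \<theta> x *\<^sub>R G x) \<bullet> b \<partial>?M)"
        using integral_inner_left[OF iub[OF b], of b] integral_inner_left[OF iGb[OF b], of b] by simp
      then show "(\<integral>x. u x * partial_deriv b (partial_deriv b \<theta>) x \<partial>?M) = - (\<integral>x. partial_deriv b \<theta> x * (G x \<bullet> b) \<partial>?M)"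
        by (simp add: partial_deriv_inner_grad[OF b])
      show "integrable ?M (\<lambda>x. u x * partial_deriv b (partial_deriv b \<theta>) x)"
        using integrable_inner_left[OF iub[OF b], of b] by (simp add: partial_deriv_inner_grad[OF b])
      show "integrable ?M (\<lambda>x. partial_deriv b \<theta> x * (G x \<bullet> b))"
        using integrable_inner_left[OF iGb[OF b], of b] by simp
    qed
    have "(\<integral>x. u x * laplacian \<theta> x \<partial>?M) = (\<Sum>b\<in>Basis. \<integral>x. u x * partial_deriv b (partial_deriv b \<theta>) x \<partial>?M)"
      unfolding laplacian_def sum_distrib_left by (rule Bochner_Integration.integral_sum) (rule each)
    also have "\<dots> = - (\<Sum>b\<in>Basis. \<integral>x. partial_deriv b \<theta> x * (G x \<bullet> b) \<partial>?M)" by (simp add: each sum_negf)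
    also have "(\<Sum>b\<in>Basis. \<integral>x. partial_deriv b \<theta> x * (G x \<bullet> b) \<partial>?M) = (\<integral>x. (\<Sum>b\<in>Basis. partial_deriv b \<theta> x * (G x \<bullet> b)) \<partial>?M)"
      by (rule Bochner_Integration.integral_sum[symmetric]) (rule each)
    also have "(\<lambda>x. \<Sum>b\<in>Basis. partial_deriv b \<theta> x * (G x \<bullet> b)) = (\<lambda>x. G x \<bullet> grad \<theta> x)"
      by (simp add: grad_def inner_sum_right)
    finally show ?thesis using e1[OF th] by simp
  qed
  show ?thesis unfolding weak_solution_def
    using u ig e1 e2 G phi lim by blast
qed

lemma weak_solution_scale:
  assumes O: "open \<Omega>" "bounded \<Omega>" and sol: "weak_solution \<Omega> u g"
  shows "weak_solution \<Omega> (\<lambda>x. c * u x) (\<lambda>x. c * g x)"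
proof -
  let ?M = "lebesgue_on \<Omega>"
  from sol obtain G \<phi> where u: "u \<in> Lp_on 2 \<Omega>" and g: "integrable ?M g" and G: "G \<in> Lp_on 2 \<Omega>"
    and e1: "\<And>\<theta>. \<theta> \<in> test_functions \<Omega> \<Longrightarrow> (\<integral>x. u x * laplacian \<theta> x \<partial>?M) = - (\<integral>x. g x * \<theta> x \<partial>?M)"
    and eq: "\<And>\<theta>. \<theta> \<in> test_functions \<Omega> \<Longrightarrow> (\<integral>x. G x \<bullet> grad \<theta> x \<partial>?M) = (\<integral>x. g x * \<theta> x \<partial>?M)"
    and phi: "\<And>k::nat. \<phi> k \<in> test_functions \<Omega>"
    and lim: "(\<lambda>k. (\<integral>x. (u x - \<phi> k x)\<^sup>2 \<partial>?M) + (\<integral>x. (norm (G x - grad (\<phi> k) x))\<^sup>2 \<partial>?M)) \<longlonglongrightarrow> 0"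
    unfolding weak_solution_def by blast
  have 1: "(\<lambda>x. c * u x) \<in> Lp_on 2 \<Omega>" using Lp_on_2[OF u] by (simp add: Lp_on_def abs_mult power_mult_distrib)
  have 2: "(\<lambda>x. c *\<^sub>R G x) \<in> Lp_on 2 \<Omega>" using Lp_on_2[OF G] by (simp add: Lp_on_def power_mult_distrib)
  have "(\<lambda>k. c\<^sup>2 * ((\<integral>x. (u x - \<phi> k x)\<^sup>2 \<partial>?M) + (\<integral>x. (norm (G x - grad (\<phi> k) x))\<^sup>2 \<partial>?M))) \<longlonglongrightarrow> c\<^sup>2 * 0"
    by (intro tendsto_intros lim)
  moreover have "c\<^sup>2 * ((\<integral>x. (u x - \<phi> k x)\<^sup>2 \<partial>?M) + (\<integral>x. (norm (G x - grad (\<phi> k) x))\<^sup>2 \<partial>?M))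
    = (\<integral>x. (c * u x - c * \<phi> k x)\<^sup>2 \<partial>?M) + (\<integral>x. (norm (c *\<^sub>R G x - grad (\<lambda>x. c * \<phi> k x) x))\<^sup>2 \<partial>?M)" for k
    by (simp add: grad_cmult[OF test_functions_D(3)[OF phi]] right_diff_distrib[symmetric] scaleR_diff_right[symmetric]
          power_mult_distrib distrib_left del: right_diff_distrib)
  ultimately have l: "(\<lambda>k. (\<integral>x. (c * u x - c * \<phi> k x)\<^sup>2 \<partial>?M) + (\<integral>x. (norm (c *\<^sub>R G x - grad (\<lambda>x. c * \<phi> k x) x))\<^sup>2 \<partial>?M)) \<longlonglongrightarrow> 0"
    by simp
  show ?thesis unfolding weak_solution_def
  proof (intro conjI ballI bexI[of _ "\<lambda>x. c *\<^sub>R G x"] exI[of _ "\<lambda>k x. c * \<phi> k x"] allI)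
    fix \<theta> assume th: "\<theta> \<in> test_functions \<Omega>"
    show "(\<integral>x. c * u x * laplacian \<theta> x \<partial>?M) = - (\<integral>x. c * g x * \<theta> x \<partial>?M)" 
      using e1[OF th] by (simp add: mult.assoc)
    show "(\<integral>x. c *\<^sub>R G x \<bullet> grad \<theta> x \<partial>?M) = (\<integral>x. c * g x * \<theta> x \<partial>?M)"
      using eq[OF th] by (simp add: mult.assoc)
  next
    fix k show "(\<lambda>x. c * \<phi> k x) \<in> test_functions \<Omega>" by (rule TF_cmult[OF phi])
  qed (use 1 2 g l in auto)
qed

lemma weak_solution_cong_AE:
  assumes "weak_solution \<Omega> u g" "AE x in lebesgue_on \<Omega>. u x = v x" "v \<in> borel_measurable (lebesgue_on \<Omega>)"
  shows "weak_solution \<Omega> v g"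
proof -
  let ?M = "lebesgue_on \<Omega>"
  from assms(1) obtain G \<phi> where u: "u \<in> Lp_on 2 \<Omega>" and g: "integrable ?M g" and G: "G \<in> Lp_on 2 \<Omega>"
    and e1: "\<And>\<theta>. \<theta> \<in> test_functions \<Omega> \<Longrightarrow> (\<integral>x. u x * laplacian \<theta> x \<partial>?M) = - (\<integral>x. g x * \<theta> x \<partial>?M)"
    and eq: "\<And>\<theta>. \<theta> \<in> test_functions \<Omega> \<Longrightarrow> (\<integral>x. G x \<bullet> grad \<theta> x \<partial>?M) = (\<integral>x. g x * \<theta> x \<partial>?M)"
    and phi: "\<And>k::nat. \<phi> k \<in> test_functions \<Omega>"
    and lim: "(\<lambda>k. (\<integral>x. (u x - \<phi> k x)\<^sup>2 \<partial>?M) + (\<integral>x. (norm (G x - grad (\<phi> k) x))\<^sup>2 \<partial>?M)) \<longlonglongrightarrow> 0"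
    unfolding weak_solution_def by blast
  note [measurable] = Lp_on_2(1)[OF u] assms(3)
  have 1: "v \<in> Lp_on 2 \<Omega>"
  proof -
    have "AE x in ?M. (norm (u x))\<^sup>2 = (norm (v x))\<^sup>2" using assms(2) by eventually_elim simp
    from integrable_cong_AE_imp[OF Lp_on_2(2)[OF u] _ this] assms(3) show ?thesis by (simp add: Lp_on_def)
  qed
  have 2: "(\<integral>x. v x * laplacian \<theta> x \<partial>?M) = (\<integral>x. u x * laplacian \<theta> x \<partial>?M)" if th: "\<theta> \<in> test_functions \<Omega>" for \<theta>
  proof -
    have [measurable]: "laplacian \<theta> \<in> borel_measurable ?M"
      by (intro continuous_measurable_on smooth_laplacian_continuous test_functions_D(1)[OF th])
    show ?thesis by (rule integral_cong_AE) (use assms(2) in auto)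
  qed
  have 3: "(\<integral>x. (v x - \<phi> k x)\<^sup>2 \<partial>?M) = (\<integral>x. (u x - \<phi> k x)\<^sup>2 \<partial>?M)" for k
  proof -
    have [measurable]: "\<phi> k \<in> borel_measurable ?M"
      by (intro continuous_measurable_on test_functions_D(2)[OF phi])
    show ?thesis by (rule integral_cong_AE) (use assms(2) in auto)
  qed
  show ?thesis unfolding weak_solution_def
  proof (intro conjI ballI bexI[of _ G] exI[of _ \<phi>] allI 1 g eq G phi)
    fix \<theta> assume th: "\<theta> \<in> test_functions \<Omega>"
    show "(\<integral>x. v x * laplacian \<theta> x \<partial>?M) = - (\<integral>x. g x * \<theta> x \<partial>?M)" using 2[OF th] e1[OF th] by simp
  qed (use lim 3 in auto)
qed

text \<open>The comparison integral for \<open>\<psi> - e\<close>, with a spatial cutoff that is constant on \<open>\<Omega>\<close>, is nonnegative,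
  while its integrand is negative wherever \<open>\<psi> - e > v\<close>.\<close>

lemma smooth_comparison:
  fixes \<Omega> :: "'a::euclidean_space set"
  assumes O: "open \<Omega>" "bounded \<Omega>" and sol: "weak_solution \<Omega> v g" and psi: "smooth_on UNIV \<psi>"
    and fr: "\<And>x. x \<in> frontier \<Omega> \<Longrightarrow> \<psi> x \<le> 0"
    and strict: "AE x in lebesgue_on \<Omega>. v x < \<psi> x \<longrightarrow> - laplacian \<psi> x < g x"
  shows "AE x in lebesgue_on \<Omega>. \<psi> x \<le> v x"
proof -
  let ?M = "lebesgue_on \<Omega>"
  interpret finite_measure ?M using finite_measure_bounded[OF O] .
  obtain R where R: "R > 0" "\<And>x. x \<in> \<Omega> \<Longrightarrow> norm x < R" using O(2) bounded_pos_less by blast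
  define \<zeta> :: "'a \<Rightarrow> real" where "\<zeta> = cutoff 0 R (R + 1)"
  have R': "0 \<le> R" "R < R + 1" using R by auto
  from sol have u: "v \<in> Lp_on 2 \<Omega>" and g: "integrable ?M g" unfolding weak_solution_def by blast+
  have eps: "AE x in ?M. \<psi> x - e \<le> v x" if e: "e > 0" for e
  proof -
    define J where "J x = (- laplacian \<psi> x - g x) * (\<zeta> x * bump_deriv 0 (\<psi> x - e - v x))" for x
    have sm: "smooth_on UNIV (\<lambda>x. \<psi> x - e)" by (intro smooth_on_diff psi smooth_on_const) simp
    have lp: "laplacian (\<lambda>x. \<psi> x - e) x = laplacian \<psi> x" for x
      using laplacian_diff[OF psi smooth_on_const] by simp
    have "0 \<le> (\<integral>x. (- laplacian (\<lambda>x. \<psi> x - e) x - g x) * (\<zeta> x * bump_deriv 0 ((\<psi> x - e) - v x)) \<partial>?M)"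
    proof (rule comparison_integral[OF O sol sm])
      show "\<zeta> \<in> TF" "\<zeta> x \<ge> 0" for x using cutoff_TF[OF R'] cutoff_bounds by (auto simp: \<zeta>_def)
      show "AE x in ?M. grad \<zeta> x \<noteq> 0 \<longrightarrow> \<psi> x - e \<le> v x"
        by (rule AE_I2) (use cutoff_grad[OF R', of _ 0] R in \<open>auto simp: \<zeta>_def space_restrict_space\<close>)
      show "x \<in> frontier \<Omega> \<Longrightarrow> \<psi> x - e < 0" for x using fr[of x] e by linarith
    qed
    then have J0: "0 \<le> (\<integral>x. J x \<partial>?M)" by (simp add: lp J_def)
    have iJ: "integrable ?M J" unfolding J_def
    proof (rule integrable_mult_bounded)
      show "integrable ?M (\<lambda>x. - laplacian \<psi> x - g x)"
        using continuous_integrable_on[OF smooth_laplacian_continuous[OF psi] O] g by auto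
      have [measurable]: "\<zeta> \<in> borel_measurable ?M" "\<psi> \<in> borel_measurable ?M" "v \<in> borel_measurable ?M"
        using Lp_on_2(1)[OF u] by (auto simp: \<zeta>_def intro!: continuous_measurable_on smooth_on_continuous smooth_cutoff psi)
      show "(\<lambda>x. \<zeta> x * bump_deriv 0 (\<psi> x - e - v x)) \<in> borel_measurable ?M" by measurable
      show "\<bar>\<zeta> x * bump_deriv 0 (\<psi> x - e - v x)\<bar> \<le> 1" for x
        using mult_mono[OF cutoff_bounds(2)[of 0 R "R+1" x] bump_bounds(2)[of "\<psi> x - e - v x"]] by (simp add: \<zeta>_def abs_mult cutoff_bounds bump_bounds)
    qed
    have neg: "AE x in ?M. J x \<le> 0 \<and> (\<psi> x - e > v x \<longrightarrow> J x < 0)"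
      using strict AE_space
    proof eventually_elim
      case (elim x)
      then have x: "x \<in> \<Omega>" by (simp add: space_restrict_space)
      have z: "\<zeta> x > 0" unfolding \<zeta>_def by (rule cutoff_pos[OF R']) (use R(2)[OF x] in simp)
      show ?case
      proof (cases "\<psi> x - e > v x")
        case True
        then have "- laplacian \<psi> x - g x < 0" using elim e by auto
        moreover have "bump_deriv 0 (\<psi> x - e - v x) > 0" using True by (intro bump_pos) simp
        ultimately have "J x < 0" unfolding J_def using z by (simp add: mult_neg_pos)
        then show ?thesis by simp
      next
        case False
        then have "J x = 0" unfolding J_def using bump_eq_0[of "\<psi> x - e - v x" 0] by simp
        with False show ?thesis by auto
      qed
    qed
    then have "AE x in ?M. - J x \<ge> 0" by eventually_elim auto
    moreover have "(\<integral>x. - J x \<partial>?M) = 0"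
    proof (rule antisym)
      show "(\<integral>x. - J x \<partial>?M) \<le> 0" using J0 by simp
      show "0 \<le> (\<integral>x. - J x \<partial>?M)" by (rule integral_nonneg_AE) fact
    qed
    ultimately have "AE x in ?M. - J x = 0"
      using integral_nonneg_eq_0_iff_AE[of ?M "\<lambda>x. - J x"] iJ by auto
    with neg show ?thesis by eventually_elim force
  qed
  have "AE x in ?M. \<forall>m::nat. \<psi> x - 1 / (real m + 1) \<le> v x"
    unfolding AE_all_countable using eps by simp
  then show ?thesis
  proof eventually_elim
    case (elim x)
    show ?case
    proof (rule field_le_epsilon)
      fix e :: real assume "e > 0"
      then obtain m where "inverse (real (Suc m)) < e" using reals_Archimedean by blast
      moreover have "\<psi> x - 1 / (real m + 1) \<le> v x" using elim by blast
      ultimately show "\<psi> x \<le> v x + e" by (simp add: inverse_eq_divide add.commute)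
    qed
  qed
qed

lemma laplacian_norm_square: "laplacian (\<lambda>x::'a::euclidean_space. c * ((norm (x - a))\<^sup>2 - d)) x = 2 * c * real DIM('a)"
proof -
  have 1: "((\<lambda>s. c * (s - d)) has_real_derivative c) (at s)" for s
    by (rule DERIV_cong[OF DERIV_cmult[OF DERIV_diff[OF DERIV_ident DERIV_const]]]) simp
  have 2: "((\<lambda>s. c) has_real_derivative 0) (at s)" for s :: real by (rule DERIV_const)
  have "laplacian (\<lambda>x::'a. (\<lambda>s. c * (s - d)) ((norm (x - a))\<^sup>2)) x
      = 4 * (norm (x - a))\<^sup>2 * (\<lambda>_. 0) ((norm (x - a))\<^sup>2) + 2 * real DIM('a) * (\<lambda>_. c) ((norm (x - a))\<^sup>2)"
    by (rule laplacian_radial, rule 1, rule 2)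
  then show ?thesis by (simp add: mult.commute)
qed

text \<open>Comparison with \<open>\<epsilon> (\<bar>x\<bar>\<^sup>2 - R\<^sup>2)\<close>, which is strictly subharmonic and not positive on \<open>\<Omega>\<close>.\<close>

lemma solution_nonneg:
  fixes \<Omega> :: "'a::euclidean_space set"
  assumes O: "open \<Omega>" "bounded \<Omega>" and sol: "weak_solution \<Omega> u g"
    and g: "AE x in lebesgue_on \<Omega>. u x < 0 \<longrightarrow> g x \<ge> 0"
  shows "AE x in lebesgue_on \<Omega>. u x \<ge> 0"
proof -
  obtain R where R: "R > 0" "\<And>x. x \<in> closure \<Omega> \<Longrightarrow> norm x \<le> R"
    using bounded_closure[OF O(2)] unfolding bounded_pos by blast
  have "AE x in lebesgue_on \<Omega>. (1 / (real m + 1)) * ((norm (x - 0))\<^sup>2 - R\<^sup>2) \<le> u x" for m :: nat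
  proof (rule smooth_comparison[OF O sol])
    let ?\<psi> = "\<lambda>x::'a. (1 / (real m + 1)) * ((norm (x - 0))\<^sup>2 - R\<^sup>2)"
    show "smooth_on UNIV ?\<psi>"
      by (intro smooth_on_mult smooth_on_diff smooth_on_const smooth_on_norm_square) auto
    have np: "?\<psi> x \<le> 0" if "x \<in> closure \<Omega>" for x
      using R(2)[OF that] power_mono[of "norm x" R 2] by (intro mult_nonneg_nonpos) auto
    show "x \<in> frontier \<Omega> \<Longrightarrow> ?\<psi> x \<le> 0" for x using np by (simp add: frontier_def)
    show "AE x in lebesgue_on \<Omega>. u x < ?\<psi> x \<longrightarrow> - laplacian ?\<psi> x < g x"
      using g AE_space
    proof eventually_elim
      case (elim x)
      then have "x \<in> closure \<Omega>" using closure_subset[of \<Omega>] by (auto simp: space_restrict_space)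
      from np[OF this] elim have "u x < ?\<psi> x \<longrightarrow> g x \<ge> 0" by linarith
      moreover have "- laplacian ?\<psi> x < 0" unfolding laplacian_norm_square by simp
      ultimately show ?case by linarith
    qed
  qed
  then have "AE x in lebesgue_on \<Omega>. \<forall>m::nat. (1 / (real m + 1)) * ((norm (x - 0))\<^sup>2 - R\<^sup>2) \<le> u x"
    unfolding AE_all_countable by blast
  then show ?thesis
  proof eventually_elim
    case (elim x)
    have "(\<lambda>m. (1 / (real m + 1)) * ((norm (x - 0))\<^sup>2 - R\<^sup>2)) \<longlonglongrightarrow> 0"
      using LIMSEQ_inverse_real_of_nat by (intro tendsto_mult_left_zero) (simp add: inverse_eq_divide add.commute)
    then show ?case by (rule LIMSEQ_le_const2) (use elim in auto)
  qed
qed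

lemma solution_upper_bound:
  fixes \<Omega> :: "'a::euclidean_space set"
  assumes O: "open \<Omega>" "bounded \<Omega>" and sol: "weak_solution \<Omega> u g"
    and g: "AE x in lebesgue_on \<Omega>. g x \<le> F" and w: "smooth_on UNIV w" "\<And>x. x \<in> frontier \<Omega> \<Longrightarrow> w x \<ge> 0"
    "\<And>x. x \<in> \<Omega> \<Longrightarrow> laplacian w x < - F"
  shows "AE x in lebesgue_on \<Omega>. u x \<le> w x"
proof -
  have "AE x in lebesgue_on \<Omega>. - w x \<le> (-1) * u x"
  proof (rule smooth_comparison[OF O weak_solution_scale[OF O sol, of "-1"] smooth_on_minus[OF open_UNIV w(1)]])
    have l: "laplacian (\<lambda>x. - w x) x = - laplacian w x" for x using laplacian_cmult[OF w(1), of "-1"] by simp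
    show "AE x in lebesgue_on \<Omega>. - 1 * u x < - w x \<longrightarrow> - laplacian (\<lambda>x. - w x) x < - 1 * g x"
      using g AE_space
    proof eventually_elim
      case (elim x)
      then have "laplacian w x < - F" using w(3) by (simp add: space_restrict_space)
      with elim show ?case unfolding l by linarith
    qed
    show "x \<in> frontier \<Omega> \<Longrightarrow> - w x \<le> 0" for x using w(2)[of x] by simp
  qed
  then show ?thesis by eventually_elim simp
qed

lemma Lp_bounded_integrable:
  fixes V :: "'a::euclidean_space \<Rightarrow> real"
  assumes O: "open \<Omega>" "bounded \<Omega>" and V: "V \<in> Lp_on q \<Omega>" "q \<ge> 1"
  shows "integrable (lebesgue_on \<Omega>) V"
proof -
  interpret finite_measure "lebesgue_on \<Omega>" using finite_measure_bounded[OF O] .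
  from V(1) have m: "V \<in> borel_measurable (lebesgue_on \<Omega>)" and i: "integrable (lebesgue_on \<Omega>) (\<lambda>x. norm (V x) powr q)"
    by (auto simp: Lp_on_def)
  show ?thesis
  proof (rule Bochner_Integration.integrable_bound[where f="\<lambda>x. 1 + norm (V x) powr q"])
    show "AE x in lebesgue_on \<Omega>. norm (V x) \<le> norm (1 + norm (V x) powr q)"
    proof (rule AE_I2)
      fix x
      have "norm (V x) \<le> 1 + norm (V x) powr q"
      proof (cases "norm (V x) \<le> 1")
        case True
        then show ?thesis by (smt (verit) powr_ge_zero)
      next
        case False
        then have "norm (V x) powr 1 \<le> norm (V x) powr q" using V(2) by (intro powr_mono) auto
        with False show ?thesis by simp
      qed
      then show "norm (V x) \<le> norm (1 + norm (V x) powr q)" by simp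
    qed
  qed (use m i in auto)
qed

text \<open>For \<open>l \<ge> 1/2\<close>, distinguishing \<open>V \<le> l\<close> from \<open>V > l\<close> gives \<open>W \<le> 3 l + l\<^bsup>1 - q\<^esup> \<bar>V\<bar>\<^sup>q\<close>. On a ball of radius \<open>t\<close> the two terms balance
  for \<open>l = t\<^bsup>- N / q\<^esup>\<close> and give the growth exponent \<open>N - N / q\<close>, which is larger than \<open>N - 1\<close> since
  \<open>q > N\<close>.\<close>

lemma morrey_of_Lp:
  fixes V :: "'a::euclidean_space \<Rightarrow> real"
  assumes O: "open \<Omega>" "bounded \<Omega>" and V: "V \<in> Lp_on q \<Omega>" and q: "q > real DIM('a)"
  shows "\<exists>CW. morrey (\<lambda>x. if x \<in> \<Omega> then 1 + max 0 (V x) else 0) ((1 - real DIM('a) / q) / 2) CW"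
proof -
  let ?N = "real DIM('a)" and ?W = "\<lambda>x. if x \<in> \<Omega> then 1 + max 0 (V x) else 0"
  have N: "?N \<ge> 1" using DIM_positive[where 'a='a] by simp
  then have q1: "q \<ge> 1" "q > 0" using q by linarith+
  from V have m: "V \<in> borel_measurable (lebesgue_on \<Omega>)" and i: "integrable (lebesgue_on \<Omega>) (\<lambda>x. norm (V x) powr q)"
    by (auto simp: Lp_on_def)
  interpret finite_measure "lebesgue_on \<Omega>" using finite_measure_bounded[OF O] .
  have W_eq: "?W = (\<lambda>x. indicator \<Omega> x *\<^sub>R (1 + max 0 (V x)))" by (auto split: split_indicator)
  have Wi: "integrable lebesgue ?W"
  proof -
    have "integrable (lebesgue_on \<Omega>) (\<lambda>x. max 0 (V x))"
      using Lp_bounded_integrable[OF O V q1(1)] by simp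
    then have "integrable (lebesgue_on \<Omega>) (\<lambda>x. 1 + max 0 (V x))" by simp
    then show ?thesis unfolding W_eq using O(1) by (subst (asm) integrable_restrict_space) auto
  qed
  define P where "P x = indicator \<Omega> x *\<^sub>R (norm (V x) powr q)" for x
  have P: "integrable lebesgue P" "\<And>x. P x \<ge> 0"
    using i O(1) by (auto simp: P_def[abs_def] integrable_restrict_space)
  define I where "I = (\<integral>x. P x \<partial>lebesgue)"
  have I: "I \<ge> 0" using P(2) by (simp add: I_def)
  define \<omega> where "\<omega> = measure lborel (ball (0::'a) 1)"
  have om: "\<omega> > 0" unfolding \<omega>_def by (rule content_ball_pos) simp
  have growth: "(\<integral>y. indicator (ball x t) y * ?W y \<partial>lebesgue) \<le> (3 * \<omega> + I) * (t ^ DIM('a) * t powr (2 * ((1 - ?N / q) / 2) - 1))"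
    if t: "0 < t" "t \<le> 2" for x and t :: real
  proof -
    define l where "l = t powr (- ?N / q)"
    have l0: "l > 0" using t by (simp add: l_def)
    have l1: "1 \<le> 2 * l"
    proof -
      have "(1/2) * 1 \<le> (2::real) powr (- ?N / q)"
      proof -
        have "(2::real) powr (-1) \<le> 2 powr (- ?N / q)" using q q1 by (intro powr_mono) (auto simp: field_simps)
        then show ?thesis by (simp add: powr_minus)
      qed
      also have "\<dots> \<le> l" unfolding l_def using t q1 N by (intro powr_mono2') (auto simp: divide_nonneg_pos)
      finally show ?thesis by simp
    qed
    have pt: "indicator (ball x t) y * ?W y \<le> 3 * l * indicator (ball x t) y + l powr (1 - q) * P y" for y
    proof (cases "y \<in> ball x t \<and> y \<in> \<Omega>")
      case True
      have "max 0 (V y) \<le> l + l powr (1 - q) * norm (V y) powr q"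
      proof (cases "V y \<le> l")
        case True
        moreover have "0 \<le> l powr (1 - q) * norm (V y) powr q" by simp
        ultimately show ?thesis using l0 by linarith
      next
        case False
        then have vy: "V y > l" by simp
        have "1 \<le> (V y / l) powr (q - 1)" using vy l0 q1 by (intro ge_one_powr_ge_zero) auto
        then have "V y * 1 \<le> V y * (V y / l) powr (q - 1)" using vy l0 by (intro mult_left_mono) auto
        also have "\<dots> = l powr (1 - q) * V y powr q"
        proof -
          have "V y * (V y / l) powr (q - 1) = (V y powr 1 * V y powr (q - 1)) * (1 / l powr (q - 1))"
            using vy l0 by (simp add: powr_divide)
          also have "V y powr 1 * V y powr (q - 1) = V y powr q" by (simp only: powr_add[symmetric]) simp
          also have "1 / l powr (q - 1) = l powr (1 - q)" using powr_minus_divide[of l "q - 1"] by simp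
          finally show ?thesis by simp
        qed
        finally show ?thesis using vy l0 by simp
      qed
      then have "1 + max 0 (V y) \<le> 3 * l + l powr (1 - q) * norm (V y) powr q" using l1 by linarith
      then show ?thesis using True by (simp add: P_def)
    next
      case False
      then have "indicator (ball x t) y * ?W y = 0" by (auto split: split_indicator)
      moreover have "0 \<le> 3 * l * indicator (ball x t) y + l powr (1 - q) * P y" using l0 P(2)[of y] by (auto split: split_indicator)
      ultimately show ?thesis by linarith
    qed
    have ib: "integrable lebesgue (indicator (ball x t) :: 'a \<Rightarrow> real)" 
      using emeasure_bounded_finite[of "ball x t"] by auto
    have "(\<integral>y. indicator (ball x t) y * ?W y \<partial>lebesgue) \<le> (\<integral>y. 3 * l * indicator (ball x t) y + l powr (1 - q) * P y \<partial>lebesgue)"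
    proof (rule integral_mono)
      show "integrable lebesgue (\<lambda>y. indicator (ball x t) y * ?W y)"
        using integrable_mult_indicator[OF _ Wi, of "ball x t"] by simp
    qed (use pt ib P(1) in auto)
    also have "\<dots> = 3 * l * measure lborel (ball x t) + l powr (1 - q) * I"
      using ib P(1) by (simp add: I_def)
    also have "measure lborel (ball x t) = \<omega> * t ^ DIM('a)"
      using t by (simp add: content_ball \<omega>_def)
    also have "l powr (1 - q) = t ^ DIM('a) * l"
    proof -
      have "l powr (1 - q) = t powr ((- ?N / q) * (1 - q))" by (simp add: l_def powr_powr)
      also have "(- ?N / q) * (1 - q) = ?N + (- ?N / q)" using q1 by (simp add: field_simps)
      also have "t powr (?N + (- ?N / q)) = t ^ DIM('a) * l" using t by (simp only: powr_add l_def powr_realpow)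
      finally show ?thesis .
    qed
    also have "3 * l * (\<omega> * t ^ DIM('a)) + t ^ DIM('a) * l * I = (3 * \<omega> + I) * (t ^ DIM('a) * l)" by (simp add: algebra_simps)
    also have "l = t powr (2 * ((1 - ?N / q) / 2) - 1)"
    proof -
      have e: "2 * ((1 - ?N / q) / 2) - 1 = - ?N / q" by (simp add: diff_divide_distrib)
      show ?thesis unfolding e l_def ..
    qed
    finally show ?thesis .
  qed
  have "?N / q < 1" using q q1 by simp
  moreover have "?N / q > 0" using N q1 by simp
  moreover have "0 < (1 - X) / 2 \<and> (1 - X) / 2 < 1 / 2" if "X < 1" "X > 0" for X :: real using that by simp
  ultimately have b: "0 < (1 - ?N / q) / 2" "(1 - ?N / q) / 2 < 1 / 2" by blast+
  have "morrey ?W ((1 - ?N / q) / 2) (3 * \<omega> + I)"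
  proof (rule morrey.intro[OF b])
    show "0 < 3 * \<omega> + I" using om I by simp
  qed (use growth Wi in auto)
  then show ?thesis by blast
qed

section \<open>The continuous representative\<close>

lemma AE_lebesgue_on: "open \<Omega> \<Longrightarrow> (AE x in lebesgue_on \<Omega>. P x) \<longleftrightarrow> (AE x in lebesgue. x \<in> \<Omega> \<longrightarrow> P x)"
  for \<Omega> :: "'a::euclidean_space set"
  by (subst AE_restrict_space_iff) auto

lemma precise_representative_eq:
  fixes \<Omega> :: "'a::euclidean_space set"
  assumes O: "open \<Omega>" and x: "x \<in> \<Omega>" and w: "continuous_on \<Omega> w"
    and u: "u \<in> borel_measurable (lebesgue_on \<Omega>)" "AE y in lebesgue_on \<Omega>. u y = w y"
  shows "precise_representative u x = w x"
proof -
  have "((\<lambda>r. (\<integral>y. u y \<partial>lebesgue_on (ball x r)) / measure lebesgue (ball x r)) \<longlongrightarrow> w x) (at_right 0)"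
  proof (rule tendstoI)
    fix e :: real assume e: "e > 0"
    have "isCont w x" using w x O by (simp add: continuous_on_eq_continuous_at)
    then obtain d1 where d1: "d1 > 0" "\<And>y. dist y x < d1 \<Longrightarrow> dist (w y) (w x) < e / 2"
      using e unfolding continuous_at_eps_delta by (metis dist_commute half_gt_zero)
    obtain d2 where d2: "d2 > 0" "ball x d2 \<subseteq> \<Omega>" using O x openE by blast
    have "eventually (\<lambda>r. 0 < r \<and> r < min d1 d2) (at_right (0::real))"
      using d1 d2 by (intro eventually_conj eventually_at_right_less) (auto simp: eventually_at_right_field intro!: exI[of _ "min d1 d2"])
    then show "eventually (\<lambda>r. dist ((\<integral>y. u y \<partial>lebesgue_on (ball x r)) / measure lebesgue (ball x r)) (w x) < e) (at_right 0)"
    proof eventually_elim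
      case (elim r)
      let ?B = "lebesgue_on (ball x r)"
      interpret finite_measure ?B by (rule finite_measure_bounded) auto
      have sub: "ball x r \<subseteq> \<Omega>" using elim d2 by auto
      have um: "u \<in> borel_measurable ?B" by (rule measurable_restrict_mono[OF u(1) sub])
      have wm: "w \<in> borel_measurable ?B"
        by (rule continuous_imp_measurable_on_sets_lebesgue[OF continuous_on_subset[OF w sub]]) auto
      have ae: "AE y in ?B. u y = w y"
        using u(2) sub by (simp add: AE_lebesgue_on O) (auto elim!: eventually_mono)
      have close: "\<bar>w y - w x\<bar> \<le> e / 2" if "y \<in> space ?B" for y
        using that elim d1(2)[of y] by (simp add: space_restrict_space dist_real_def dist_commute)
      have iw: "integrable ?B (\<lambda>y. w y - w x)"
        by (rule integrable_const_bound[where B="e/2"]) (use close wm in \<open>auto intro!: AE_I2\<close>)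
      define m where "m = measure lebesgue (ball x r)"
      have m: "m > 0" unfolding m_def using content_ball_pos[of r x] elim by simp
      have mB: "measure ?B (ball x r) = m" unfolding m_def by (simp add: measure_restrict_space)
      have "(\<integral>y. u y \<partial>?B) = (\<integral>y. w y \<partial>?B)" by (rule integral_cong_AE[OF um wm ae])
      also have "\<dots> = (\<integral>y. (w y - w x) + w x \<partial>?B)" by simp
      also have "\<dots> = (\<integral>y. w y - w x \<partial>?B) + w x * m"
        using iw by (subst Bochner_Integration.integral_add) (auto simp: mB)
      finally have "(\<integral>y. u y \<partial>?B) / m - w x = (\<integral>y. w y - w x \<partial>?B) / m" using m by (simp add: field_simps)
      moreover have "\<bar>\<integral>y. w y - w x \<partial>?B\<bar> \<le> (e / 2) * m"
      proof -
        have "\<bar>\<integral>y. w y - w x \<partial>?B\<bar> \<le> (\<integral>y. \<bar>w y - w x\<bar> \<partial>?B)" by (rule integral_abs_bound)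
        also have "\<dots> \<le> (\<integral>y. e / 2 \<partial>?B)" by (rule integral_mono) (use iw close in auto)
        also have "\<dots> = (e / 2) * m" by (simp add: mB)
        finally show ?thesis .
      qed
      ultimately have "\<bar>(\<integral>y. u y \<partial>?B) / m - w x\<bar> \<le> e / 2" using m by (simp add: abs_divide divide_le_eq)
      then show ?case using e by (simp add: dist_real_def m_def)
    qed
  qed
  then show ?thesis unfolding precise_representative_def by (intro tendsto_Lim) auto
qed

lemma phis_lebesgue: 
  assumes "\<tau> > 0" 
  shows "integrable lebesgue (\<lambda>y. phis \<tau> (x - y))" "(\<integral>y. phis \<tau> (x - y) \<partial>lebesgue) = 1"
proof -
  have eq: "(\<lambda>y. phis \<tau> (x - y)) = (\<lambda>y. phis \<tau> (1 *\<^sub>R (y - x)))"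
    using phis_minus[of \<tau> "y - x" for y] by auto
  have t: "(\<lambda>y. phis \<tau> (1 *\<^sub>R (y - x))) \<in> TF" by (rule TF_scale[OF phis_TF[OF assms]]) simp
  show "integrable lebesgue (\<lambda>y. phis \<tau> (x - y))" unfolding eq by (rule TF_integrable_lebesgue[OF t])
  have "(\<integral>y. phis \<tau> (x - y) \<partial>lebesgue) = (\<integral>y. phis \<tau> (x - y) \<partial>lborel)"
    unfolding eq by (rule integral_completion) (use TF_measurable[OF t] in simp)
  then show "(\<integral>y. phis \<tau> (x - y) \<partial>lebesgue) = 1" using phis_integral[OF assms] by simp
qed

text \<open>In the application \<open>u\<close> is a bounded solution with potential \<open>V\<close>, and \<open>g = f - V u\<close> is dominated by
  \<open>W = 1 + V\<^sup>+\<close>.\<close>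

locale bounded_solution = morrey W \<beta> CW for W :: "'a::euclidean_space \<Rightarrow> real" and \<beta> CW :: real +
  fixes \<Omega> :: "'a set" and u g :: "'a \<Rightarrow> real" and M :: real
  assumes open_O: "open \<Omega>" and bounded_O: "bounded \<Omega>" and sol: "weak_solution \<Omega> u g"
    and M: "M > 0" and g_le: "AE x in lebesgue_on \<Omega>. \<bar>g x\<bar> \<le> M * W x"
begin

definition u0 :: "'a \<Rightarrow> real" where "u0 x = indicator \<Omega> x * u x"
definition g0 :: "'a \<Rightarrow> real" where "g0 x = indicator \<Omega> x * g x"

lemma u0_integrable: "integrable lebesgue u0" and g0_integrable: "integrable lebesgue g0"
proof -
  have "u \<in> Lp_on 2 \<Omega>" "integrable (lebesgue_on \<Omega>) g" using sol by (auto simp: weak_solution_def)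
  then show "integrable lebesgue u0" "integrable lebesgue g0"
    using L2_integrable[OF _ open_O bounded_O, of u] open_O
    by (auto simp: u0_def[abs_def] g0_def[abs_def] integrable_restrict_space)
qed

text \<open>Test the equation with the kernel centred at \<open>x\<close>, whose Laplacian is the difference of the mollifiers
  at two consecutive scales.\<close>

lemma scale_step:
  assumes t: "0 < \<tau>" and sub: "cball x \<tau> \<subseteq> \<Omega>"
  shows "conv (phis \<tau>) u0 x - conv (phis (\<tau> / 2)) u0 x = - conv (kers \<tau>) g0 x"
proof -
  define \<theta> where "\<theta> = (\<lambda>y. kers \<tau> (1 *\<^sub>R (y - x)))"
  have th_eq: "\<theta> y = kers \<tau> (x - y)" for y using kers_minus[of \<tau> "y - x"] by (simp add: \<theta>_def)
  have TF: "\<theta> \<in> TF" unfolding \<theta>_def by (rule TF_scale[OF kers_TF[OF t]]) simp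
  have "closure {y. \<theta> y \<noteq> 0} \<subseteq> cball x \<tau>"
  proof (rule closure_minimal)
    show "{y. \<theta> y \<noteq> 0} \<subseteq> cball x \<tau>"
    proof
      fix y assume "y \<in> {y. \<theta> y \<noteq> 0}"
      then have "\<not> norm (x - y) \<ge> \<tau>" using kers_eq_0[OF t, of "x - y"] by (auto simp: th_eq)
      then show "y \<in> cball x \<tau>" by (simp add: dist_norm)
    qed
  qed simp
  then have th: "\<theta> \<in> test_functions \<Omega>" using TF sub by (auto simp: test_functions_def)
  have lap: "laplacian \<theta> y = phis \<tau> (x - y) - phis (\<tau> / 2) (x - y)" for y
    unfolding \<theta>_def laplacian_scale[OF test_functions_D(1)[OF kers_TF[OF t]]]
    using kers_laplacian[OF t, of "y - x"] phis_minus[of \<tau> "y - x"] phis_minus[of "\<tau> / 2" "y - x"] by simp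
  have "(\<integral>y. u y * laplacian \<theta> y \<partial>lebesgue_on \<Omega>) = - (\<integral>y. g y * \<theta> y \<partial>lebesgue_on \<Omega>)"
    using sol th by (simp add: weak_solution_def)
  moreover have "(\<integral>y. u y * laplacian \<theta> y \<partial>lebesgue_on \<Omega>) = (\<integral>y. u0 y * laplacian \<theta> y \<partial>lebesgue)"
    using open_O by (simp add: integral_restrict_space u0_def mult.assoc)
  moreover have "(\<integral>y. u0 y * laplacian \<theta> y \<partial>lebesgue) = conv (phis \<tau>) u0 x - conv (phis (\<tau> / 2)) u0 x"
    using conv_integrable[OF phis_TF[OF t] u0_integrable, of x] conv_integrable[OF phis_TF u0_integrable, of "\<tau> / 2" x] t
    by (simp add: lap right_diff_distrib conv_def)
  moreover have "(\<integral>y. g y * \<theta> y \<partial>lebesgue_on \<Omega>) = conv (kers \<tau>) g0 x"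
    using open_O by (simp add: integral_restrict_space g0_def conv_def th_eq mult.assoc)
  ultimately show ?thesis by simp
qed

lemma scale_step_bound:
  "\<exists>C>0. \<forall>x \<tau>. 0 < \<tau> \<longrightarrow> \<tau> \<le> 1 \<longrightarrow> cball x \<tau> \<subseteq> \<Omega> \<longrightarrow>
     \<bar>conv (phis \<tau>) u0 x - conv (phis (\<tau> / 2)) u0 x\<bar> \<le> C * \<tau> powr (1 + 2 * \<beta>)"
proof -
  obtain C where C: "C > 0" "\<And>\<tau> x h. 0 < \<tau> \<Longrightarrow> \<tau> \<le> 1 \<Longrightarrow> integrable lebesgue h \<Longrightarrow> (AE y in lebesgue. \<bar>h y\<bar> \<le> W y) \<Longrightarrow>
     \<bar>conv (kers \<tau>) h x\<bar> \<le> C * \<tau> powr (1 + 2 * \<beta>)"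
    using kers_conv_bound by blast
  have i: "integrable lebesgue (\<lambda>y. (1 / M) * g0 y)" using g0_integrable by simp
  have ae: "AE y in lebesgue. \<bar>(1 / M) * g0 y\<bar> \<le> W y"
    using g_le[unfolded AE_lebesgue_on[OF open_O]]
  proof eventually_elim
    case (elim y)
    then show ?case using M W_nonneg[of y] by (cases "y \<in> \<Omega>") (auto simp: g0_def abs_mult divide_le_eq mult.commute)
  qed
  show ?thesis
  proof (intro exI[of _ "M * C"] conjI allI impI)
    show "0 < M * C" using M C by simp
    fix x \<tau> assume t: "0 < \<tau>" "\<tau> \<le> 1" and sub: "cball x \<tau> \<subseteq> \<Omega>"
    have "\<bar>conv (phis \<tau>) u0 x - conv (phis (\<tau> / 2)) u0 x\<bar> = M * \<bar>conv (kers \<tau>) (\<lambda>y. (1 / M) * g0 y) x\<bar>"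
      unfolding scale_step[OF t(1) sub] conv_cmult using M by (simp add: abs_mult)
    also have "\<dots> \<le> M * (C * \<tau> powr (1 + 2 * \<beta>))" using M by (intro mult_left_mono C(2) t i ae) simp
    finally show "\<bar>conv (phis \<tau>) u0 x - conv (phis (\<tau> / 2)) u0 x\<bar> \<le> M * C * \<tau> powr (1 + 2 * \<beta>)" by simp
  qed
qed

text \<open>By \<open>scale_step_bound\<close> the mollifications form a Cauchy sequence, locally uniformly in \<open>\<Omega>\<close>, so the limit
  exists there and is continuous.\<close>

definition cont_rep :: "'a \<Rightarrow> real" where
  "cont_rep x = lim (\<lambda>n. conv (phis ((1/2) ^ n)) u0 x)"

lemma conv_phis_continuous: "0 < \<tau> \<Longrightarrow> continuous_on S (conv (phis \<tau>) u0)"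
  by (rule continuous_on_subset[OF smooth_on_continuous[OF conv_smooth(1)[OF phis_TF u0_integrable]]]) auto

lemma cont_rep_local:
  assumes x0: "x0 \<in> \<Omega>"
  shows "\<exists>d>0. ball x0 d \<subseteq> \<Omega> \<and> continuous_on (ball x0 d) cont_rep \<and>
    (\<forall>x\<in>ball x0 d. (\<lambda>n. conv (phis ((1/2) ^ n)) u0 x) \<longlonglongrightarrow> cont_rep x)"
proof -
  obtain C where C: "C > 0" "\<And>x \<tau>. 0 < \<tau> \<Longrightarrow> \<tau> \<le> 1 \<Longrightarrow> cball x \<tau> \<subseteq> \<Omega> \<Longrightarrow>
     \<bar>conv (phis \<tau>) u0 x - conv (phis (\<tau> / 2)) u0 x\<bar> \<le> C * \<tau> powr (1 + 2 * \<beta>)"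
    using scale_step_bound by blast
  obtain e where e: "e > 0" "ball x0 e \<subseteq> \<Omega>" using open_O x0 openE by blast
  obtain n0 where n0: "(1/2) ^ n0 < e / 2" using real_arch_pow_inv[of "e / 2" "1/2"] e by auto
  define A where "A n x = conv (phis ((1/2) ^ n)) u0 x" for n x
  define D where "D j x = A (n0 + Suc j) x - A (n0 + j) x" for j x
  have Db: "norm (D j x) \<le> C * (1/2) ^ j" if x: "x \<in> ball x0 (e / 2)" for j x
  proof -
    let ?t = "(1/2::real) ^ (n0 + j)"
    have t: "0 < ?t" "?t \<le> 1" by (auto simp: power_le_one)
    have "?t \<le> (1/2) ^ n0" by (rule power_decreasing) auto
    then have "cball x ?t \<subseteq> ball x0 e"
    proof (intro subsetI)
      fix y assume "y \<in> cball x ?t"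
      then have "dist x y \<le> (1/2) ^ n0" using \<open>?t \<le> (1/2) ^ n0\<close> by (simp only: mem_cball)
      moreover have "dist x0 x < e / 2" using x by simp
      ultimately have "dist x0 y < e" using n0 dist_triangle[of x0 y x] by linarith
      then show "y \<in> ball x0 e" by simp
    qed
    then have sub: "cball x ?t \<subseteq> \<Omega>" using e by auto
    have half: "?t / 2 = (1/2) ^ (n0 + Suc j)" by simp
    have "norm (D j x) \<le> C * ?t powr (1 + 2 * \<beta>)"
      using C(2)[OF t sub] unfolding half by (simp add: D_def A_def abs_minus_commute)
    also have "?t powr (1 + 2 * \<beta>) \<le> ?t powr 1" using t \<beta> by (intro powr_mono') auto
    also have "?t powr 1 \<le> (1/2) ^ j" using t by (simp add: power_add mult_left_le_one_le power_le_one)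
    finally show ?thesis using C(1) by simp
  qed
  have ul: "uniform_limit (ball x0 (e/2)) (\<lambda>k x. \<Sum>j<k. D j x) (\<lambda>x. \<Sum>j. D j x) sequentially"
    by (rule Weierstrass_m_test[where M="\<lambda>j. C * (1/2) ^ j"]) (use Db in \<open>auto intro!: summable_mult summable_geometric\<close>)
  have sumD: "(\<Sum>j<k. D j x) = A (n0 + k) x - A n0 x" for k x
    unfolding D_def by (induction k) auto
  have lim: "(\<lambda>n. A n x) \<longlonglongrightarrow> A n0 x + (\<Sum>j. D j x)" if x: "x \<in> ball x0 (e/2)" for x
  proof -
    have "(\<lambda>k. A (n0 + k) x - A n0 x) \<longlonglongrightarrow> (\<Sum>j. D j x)"
      using tendsto_uniform_limitI[OF ul x] by (simp add: sumD)
    from tendsto_add[OF tendsto_const[of "A n0 x"] this]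
    have "(\<lambda>k. A (k + n0) x) \<longlonglongrightarrow> A n0 x + (\<Sum>j. D j x)" by (simp add: add.commute)
    then show ?thesis by (rule LIMSEQ_offset)
  qed
  then have rep: "cont_rep x = A n0 x + (\<Sum>j. D j x)" if "x \<in> ball x0 (e/2)" for x
    unfolding cont_rep_def using limI[OF lim[OF that]] by (simp add: A_def)
  have cA: "continuous_on S (A n)" for n S unfolding A_def by (rule conv_phis_continuous) simp
  have "continuous_on (ball x0 (e/2)) (\<lambda>x. \<Sum>j. D j x)"
    by (rule uniform_limit_theorem[OF _ ul]) (auto simp: D_def intro!: always_eventually continuous_intros cA)
  then have "continuous_on (ball x0 (e/2)) (\<lambda>x. A n0 x + (\<Sum>j. D j x))" by (intro continuous_on_add cA)
  then have "continuous_on (ball x0 (e/2)) cont_rep"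
    by (rule continuous_on_cong[THEN iffD1, rotated -1]) (use rep in auto)
  moreover have "ball x0 (e/2) \<subseteq> \<Omega>" using e by auto
  moreover have "(\<lambda>n. conv (phis ((1/2) ^ n)) u0 x) \<longlonglongrightarrow> cont_rep x" if "x \<in> ball x0 (e/2)" for x
    using lim[OF that] rep[OF that] by (simp add: A_def)
  ultimately show ?thesis using e by (intro exI[of _ "e/2"]) auto
qed

lemma cont_rep_continuous: "continuous_on \<Omega> cont_rep"
proof (rule continuous_at_imp_continuous_on, rule ballI)
  fix x assume "x \<in> \<Omega>"
  from cont_rep_local[OF this] obtain d where "d > 0" "continuous_on (ball x d) cont_rep" by blast
  then show "isCont cont_rep x" by (simp add: continuous_on_eq_continuous_at)
qed

lemma cont_rep_AE: "AE x in lebesgue_on \<Omega>. u x = cont_rep x"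
proof -
  have "(\<lambda>n. (1/2::real) ^ n) \<longlonglongrightarrow> 0" by (rule LIMSEQ_realpow_zero) auto
  note L = conv_tendsto_L1[OF _ this u0_integrable]
  obtain r where r: "strict_mono r" "AE x in lebesgue. (\<lambda>n. conv (phis ((1/2) ^ r n)) u0 x - u0 x) \<longlonglongrightarrow> 0"
  proof -
    have i: "integrable lebesgue (\<lambda>x. conv (phis ((1/2) ^ n)) u0 x - u0 x)" for n using L(1) by simp
    have "(\<lambda>n. \<integral>x. norm (conv (phis ((1/2) ^ n)) u0 x - u0 x) \<partial>lebesgue) \<longlonglongrightarrow> 0" using L(2) by simp
    from tendsto_L1_AE_subseq[OF i this] that show ?thesis by blast
  qed
  have "AE x in lebesgue. x \<in> \<Omega> \<longrightarrow> u x = cont_rep x"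
    using r(2)
  proof eventually_elim
    case (elim x)
    show ?case
    proof
      assume x: "x \<in> \<Omega>"
      then have "(\<lambda>n. conv (phis ((1/2) ^ n)) u0 x) \<longlonglongrightarrow> cont_rep x" using cont_rep_local[OF x] centre_in_ball by blast
      from LIMSEQ_subseq_LIMSEQ[OF this r(1)] have 1: "(\<lambda>n. conv (phis ((1/2) ^ r n)) u0 x) \<longlonglongrightarrow> cont_rep x" by (simp add: o_def)
      from tendsto_add[OF elim tendsto_const[of "u0 x"]] have "(\<lambda>n. conv (phis ((1/2) ^ r n)) u0 x) \<longlonglongrightarrow> u0 x" by simp
      from LIMSEQ_unique[OF this 1] x show "u x = cont_rep x" by (simp add: u0_def)
    qed
  qed
  then show ?thesis by (simp add: AE_lebesgue_on[OF open_O])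
qed

text \<open>The differences between consecutive dyadic scales below \<open>\<tau>\<close> form a geometric series.\<close>

lemma mean_value_estimate:
  assumes cont: "continuous_on \<Omega> u"
  shows "\<exists>C>0. \<forall>x \<tau>. 0 < \<tau> \<longrightarrow> \<tau> \<le> 1 \<longrightarrow> cball x \<tau> \<subseteq> \<Omega> \<longrightarrow>
     \<bar>u x - conv (phis \<tau>) u0 x\<bar> \<le> C * \<tau> powr (1 + 2 * \<beta>)"
proof -
  obtain C where C: "C > 0" "\<And>x \<tau>. 0 < \<tau> \<Longrightarrow> \<tau> \<le> 1 \<Longrightarrow> cball x \<tau> \<subseteq> \<Omega> \<Longrightarrow>
     \<bar>conv (phis \<tau>) u0 x - conv (phis (\<tau> / 2)) u0 x\<bar> \<le> C * \<tau> powr (1 + 2 * \<beta>)"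
    using scale_step_bound by blast
  show ?thesis
  proof (intro exI[of _ "2 * C"] conjI allI impI)
    show "0 < 2 * C" using C by simp
    fix x \<tau> assume t: "0 < \<tau>" "\<tau> \<le> 1" and sub: "cball x \<tau> \<subseteq> \<Omega>"
    have x: "x \<in> \<Omega>" using sub t by auto
    define D where "D n = conv (phis (\<tau> * (1/2) ^ n)) u0 x" for n
    have step: "\<bar>D j - D (Suc j)\<bar> \<le> C * \<tau> powr (1 + 2 * \<beta>) * (1/2) ^ j" for j
    proof -
      let ?s = "\<tau> * (1/2) ^ j"
      have s: "0 < ?s" "?s \<le> \<tau>" using t by (auto simp: mult_left_le power_le_one)
      have "cball x ?s \<subseteq> \<Omega>" using s sub by auto
      from C(2)[OF s(1) _ this] s t have "\<bar>D j - D (Suc j)\<bar> \<le> C * ?s powr (1 + 2 * \<beta>)" by (simp add: D_def)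
      also have "?s powr (1 + 2 * \<beta>) = \<tau> powr (1 + 2 * \<beta>) * ((1/2) ^ j) powr (1 + 2 * \<beta>)" using t by (simp add: powr_mult)
      also have "\<dots> \<le> \<tau> powr (1 + 2 * \<beta>) * ((1/2) ^ j) powr 1"
        using \<beta> by (intro mult_left_mono powr_mono') (auto simp: power_le_one)
      finally show ?thesis using C(1) by simp
    qed
    have tele: "\<bar>D 0 - D k\<bar> \<le> C * \<tau> powr (1 + 2 * \<beta>) * 2" for k
    proof -
      have "\<bar>D 0 - D k\<bar> = \<bar>\<Sum>j<k. D j - D (Suc j)\<bar>" by (simp add: sum_lessThan_telescope')
      also have "\<dots> \<le> (\<Sum>j<k. \<bar>D j - D (Suc j)\<bar>)" by (rule sum_abs)
      also have "\<dots> \<le> (\<Sum>j<k. C * \<tau> powr (1 + 2 * \<beta>) * (1/2) ^ j)" by (rule sum_mono) (rule step)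
      also have "\<dots> = C * \<tau> powr (1 + 2 * \<beta>) * (\<Sum>j<k. (1/2) ^ j)" by (simp add: sum_distrib_left)
      also have "(\<Sum>j<k. (1/2::real) ^ j) \<le> 2" by (subst geometric_sum) (auto simp: field_simps)
      finally show ?thesis using C(1) by (simp add: mult_left_mono)
    qed
    have "D \<longlonglongrightarrow> u x"
    proof (rule LIMSEQ_I)
      fix e :: real assume e: "e > 0"
      have "isCont u x" using cont x open_O by (simp add: continuous_on_eq_continuous_at)
      then obtain d1 where d1: "d1 > 0" "\<And>y. dist y x < d1 \<Longrightarrow> dist (u y) (u x) < e / 2"
        using e unfolding continuous_at_eps_delta by (metis dist_commute half_gt_zero)
      obtain n0 where n0: "(1/2::real) ^ n0 < d1" using real_arch_pow_inv[of d1 "1/2"] d1 by auto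
      show "\<exists>n0. \<forall>n\<ge>n0. norm (D n - u x) < e"
      proof (intro exI[of _ n0] allI impI)
        fix n assume n: "n \<ge> n0"
        let ?s = "\<tau> * (1/2) ^ n"
        have s: "0 < ?s" "?s \<le> \<tau>" "?s \<le> (1/2) ^ n" using t by (auto simp: mult_left_le power_le_one mult_left_le_one_le)
        have "(1/2::real) ^ n \<le> (1/2) ^ n0" using n by (intro power_decreasing) auto
        with s n0 have sd: "?s < d1" by linarith
        have "D n - u x = (\<integral>y. u0 y * phis ?s (x - y) \<partial>lebesgue) - (\<integral>y. u x * phis ?s (x - y) \<partial>lebesgue)"
          using phis_lebesgue[OF s(1), of x] by (simp add: D_def conv_def)
        also have "\<dots> = (\<integral>y. (u0 y - u x) * phis ?s (x - y) \<partial>lebesgue)"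
          using conv_integrable[OF phis_TF[OF s(1)] u0_integrable, of x] phis_lebesgue[OF s(1), of x]
          by (simp add: left_diff_distrib)
        also have "\<bar>\<dots>\<bar> \<le> (\<integral>y. \<bar>(u0 y - u x) * phis ?s (x - y)\<bar> \<partial>lebesgue)" by (rule integral_abs_bound)
        also have "\<dots> \<le> (\<integral>y. (e / 2) * phis ?s (x - y) \<partial>lebesgue)"
        proof (rule integral_mono)
          show "integrable lebesgue (\<lambda>y. \<bar>(u0 y - u x) * phis ?s (x - y)\<bar>)"
            using conv_integrable[OF phis_TF[OF s(1)] u0_integrable, of x] phis_lebesgue[OF s(1), of x]
            by (simp add: left_diff_distrib)
          fix y
          show "\<bar>(u0 y - u x) * phis ?s (x - y)\<bar> \<le> (e / 2) * phis ?s (x - y)"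
          proof (cases "norm (x - y) < ?s")
            case True
            then have "y \<in> cball x \<tau>" using s by (simp add: dist_norm)
            then have y: "y \<in> \<Omega>" using sub by auto
            have "dist y x < d1" using True sd by (simp add: dist_norm norm_minus_commute)
            from d1(2)[OF this] y have "\<bar>u0 y - u x\<bar> \<le> e / 2" by (simp add: u0_def dist_real_def)
            from mult_right_mono[OF this phis_nonneg[OF s(1), of "x - y"]] show ?thesis
              using phis_nonneg[OF s(1), of "x - y"] by (simp only: abs_mult abs_of_nonneg)
          next
            case False
            then show ?thesis using phis_eq_0[OF s(1), of "x - y"] by simp
          qed
        qed (use phis_lebesgue[OF s(1), of x] in auto)
        also have "\<dots> = e / 2" using phis_lebesgue[OF s(1), of x] by simp
        finally show "norm (D n - u x) < e" using e by simp
      qed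
    qed
    then have "(\<lambda>k. \<bar>D 0 - D k\<bar>) \<longlonglongrightarrow> \<bar>D 0 - u x\<bar>" by (intro tendsto_intros)
    then have "\<bar>D 0 - u x\<bar> \<le> C * \<tau> powr (1 + 2 * \<beta>) * 2" by (rule LIMSEQ_le_const2) (use tele in auto)
    then show "\<bar>u x - conv (phis \<tau>) u0 x\<bar> \<le> 2 * C * \<tau> powr (1 + 2 * \<beta>)"
      by (simp add: D_def abs_minus_commute mult_ac)
  qed
qed

end

section \<open>Barriers at a boundary point\<close>

lemma AE_imp_everywhere:
  fixes S \<Omega> :: "'a::euclidean_space set"
  assumes "open \<Omega>" "open S" "S \<subseteq> \<Omega>" "continuous_on S f" "continuous_on S g"
    "AE x in lebesgue_on \<Omega>. x \<in> S \<longrightarrow> f x \<le> (g x :: real)" "x \<in> S"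
  shows "f x \<le> g x"
proof (rule ccontr)
  assume "\<not> f x \<le> g x"
  define T where "T = {y \<in> S. g y < f y}"
  have "continuous_on S (\<lambda>y. f y - g y)" using assms by (intro continuous_intros)
  then have "open (S \<inter> (\<lambda>y. f y - g y) -` {0<..})" by (rule continuous_open_preimage[OF _ assms(2) open_greaterThan])
  moreover have "T = S \<inter> (\<lambda>y. f y - g y) -` {0<..}" by (auto simp: T_def)
  ultimately have T: "open T" "x \<in> T" using assms(7) \<open>\<not> f x \<le> g x\<close> by (auto simp: T_def)
  then obtain e where e: "e > 0" "ball x e \<subseteq> T" using openE by blast
  have "AE y in lebesgue. y \<notin> ball x e"
    using assms(6)[unfolded AE_lebesgue_on[OF assms(1)]]
  proof eventually_elim
    case (elim y)
    then show ?case using e(2) assms(3) by (auto simp: T_def)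
  qed
  then have "emeasure lebesgue (ball x e) = 0"
    using AE_iff_null_sets[of "ball x e" lebesgue] by auto
  then show False using content_ball_pos[OF e(1), of x] by (simp add: measure_def)
qed

text \<open>The inequality for \<open>g\<close> is required only where \<open>v < 1\<close>. Thus every positive multiple of a
  continuous nonnegative solution of
  \<open>- \<Delta> u + V u = f \<ge> 0\<close> with \<open>V \<le> W\<close> qualifies, and barriers apply at every height.\<close>

definition supersolution :: "('a::euclidean_space \<Rightarrow> real) \<Rightarrow> 'a set \<Rightarrow> ('a \<Rightarrow> real) \<Rightarrow> bool" where
  "supersolution W \<Omega> v \<longleftrightarrow> continuous_on \<Omega> v \<and> (\<forall>x\<in>\<Omega>. 0 \<le> v x) \<and>
     (\<exists>g. weak_solution \<Omega> v g \<and> (AE x in lebesgue_on \<Omega>. v x < 1 \<longrightarrow> g x \<ge> - W x))"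

lemma (in morrey) barrier_pointwise:
  fixes \<Omega> :: "'a set"
  assumes O: "open \<Omega>" "bounded \<Omega>" and v: "supersolution W \<Omega> v"
    and K0: "\<And>x. \<bar>conv (phis 1) W x\<bar> \<le> K0"
    and Q: "smooth_on UNIV Q" and R: "0 \<le> R1" "R1 < R2"
    and le1: "\<And>x. x \<in> \<Omega> \<Longrightarrow> norm (x - z) < R2 \<Longrightarrow> Q x - potential x \<le> 1"
    and fr: "\<And>x. x \<in> frontier \<Omega> \<Longrightarrow> norm (x - z) \<le> R2 \<Longrightarrow> Q x - potential x \<le> 0"
    and ann: "\<And>x. x \<in> \<Omega> \<Longrightarrow> R1 \<le> norm (x - z) \<Longrightarrow> norm (x - z) \<le> R2 \<Longrightarrow> Q x - potential x \<le> v x"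
    and lap: "\<And>x. x \<in> \<Omega> \<Longrightarrow> norm (x - z) < R2 \<Longrightarrow> Q x - potential x \<le> v x \<or> laplacian Q x > K0"
    and x: "x \<in> \<Omega>" "norm (x - z) < R2"
  shows "Q x - potential x \<le> v x"
proof -
  from v obtain g where g: "continuous_on \<Omega> v" "weak_solution \<Omega> v g" "AE x in lebesgue_on \<Omega>. v x < 1 \<longrightarrow> g x \<ge> - W x"
    unfolding supersolution_def by blast
  have sp: "AE x in lebesgue_on \<Omega>. x \<in> \<Omega>" using AE_space by eventually_elim (simp add: space_restrict_space)
  have "AE x in lebesgue_on \<Omega>. norm (x - z) < R2 \<longrightarrow> Q x - potential x \<le> v x"
  proof (rule barrier_comparison[OF O g(2,3) K0 Q R le1 fr])
    show "AE x in lebesgue_on \<Omega>. R1 \<le> norm (x - z) \<longrightarrow> norm (x - z) \<le> R2 \<longrightarrow> Q x - potential x \<le> v x"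
      using sp by eventually_elim (use ann in blast)
    show "AE x in lebesgue_on \<Omega>. norm (x - z) < R2 \<longrightarrow> Q x - potential x \<le> v x \<or> laplacian Q x > K0"
      using sp by eventually_elim (use lap in blast)
  qed
  then have ae: "AE x in lebesgue_on \<Omega>. x \<in> \<Omega> \<inter> ball z R2 \<longrightarrow> Q x - potential x \<le> v x"
    by eventually_elim (simp add: dist_norm norm_minus_commute)
  show ?thesis
  proof (rule AE_imp_everywhere[OF O(1) _ _ _ _ ae])
    show "continuous_on (\<Omega> \<inter> ball z R2) (\<lambda>x. Q x - potential x)"
      by (intro continuous_on_diff continuous_on_subset[OF smooth_on_continuous[OF Q]] continuous_on_subset[OF potential_continuous]) auto
    show "continuous_on (\<Omega> \<inter> ball z R2) v" by (rule continuous_on_subset[OF g(1)]) auto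
  qed (use O x in \<open>auto simp: dist_norm norm_minus_commute\<close>)
qed

definition gauss :: "real \<Rightarrow> 'a::euclidean_space \<Rightarrow> 'a \<Rightarrow> real" where
  "gauss k z x = exp (- k * (norm (x - z))\<^sup>2)"

lemma gauss_smooth: "smooth_on UNIV (gauss k z)"
proof -
  have "smooth_real (\<lambda>s. exp (- k * s))"
    unfolding smooth_real_def
  proof (intro exI[of _ "\<lambda>n s. (- k) ^ n * exp (- k * s)"] conjI allI)
    fix n s show "((\<lambda>s. (- k) ^ n * exp (- k * s)) has_real_derivative (- k) ^ Suc n * exp (- k * s)) (at s)"
      by (auto intro!: derivative_eq_intros)
  qed auto
  from smooth_on_compose[OF open_UNIV this smooth_on_norm_square] show ?thesis by (simp add: gauss_def[abs_def])
qed

lemma gauss_laplacian: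
  "laplacian (gauss k z) (x::'a::euclidean_space) = 2 * k * (2 * k * (norm (x - z))\<^sup>2 - real DIM('a)) * gauss k z x"
proof -
  have 1: "((\<lambda>s. exp (- k * s)) has_real_derivative (\<lambda>s. - k * exp (- k * s)) s) (at s)" for s
    by (auto intro!: derivative_eq_intros)
  have 2: "((\<lambda>s. - k * exp (- k * s)) has_real_derivative (\<lambda>s. k * k * exp (- k * s)) s) (at s)" for s
    by (auto intro!: derivative_eq_intros)
  have "laplacian (\<lambda>x::'a. (\<lambda>s. exp (- k * s)) ((norm (x - z))\<^sup>2)) x
      = 4 * (norm (x - z))\<^sup>2 * (\<lambda>s. k * k * exp (- k * s)) ((norm (x - z))\<^sup>2) + 2 * real DIM('a) * (\<lambda>s. - k * exp (- k * s)) ((norm (x - z))\<^sup>2)"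
    by (rule laplacian_radial, rule 1, rule 2)
  then show ?thesis by (simp add: gauss_def[abs_def] algebra_simps)
qed

lemma gauss_laplacian_nonneg:
  "k \<ge> 0 \<Longrightarrow> 2 * k * (norm (x - z))\<^sup>2 \<ge> real DIM('a) \<Longrightarrow> laplacian (gauss k z) (x::'a::euclidean_space) \<ge> 0"
  unfolding gauss_laplacian by (intro mult_nonneg_nonneg) (auto simp: gauss_def)

text \<open>Near \<open>a\<close> the boundary of \<open>\<Omega>\<close> lies between two paraboloids with axis \<open>n\<close>. The vector \<open>L\<close> is the gradient
  of the potential at \<open>a\<close>.\<close>

locale boundary_point = morrey W \<beta> CW for W :: "'a::euclidean_space \<Rightarrow> real" and \<beta> CW :: real +
  fixes \<Omega> :: "'a set" and a n L :: 'a and K r0 K0 C0 :: real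
  assumes open_O: "open \<Omega>" and bounded_O: "bounded \<Omega>" and n: "norm n = 1"
    and K: "K > 0" and r0: "0 < r0" and K0: "K0 > 0" and C0: "C0 > 0"
    and inside: "\<And>x. norm (x - a) < r0 \<Longrightarrow> (x - a) \<bullet> n > K * (norm (x - a))\<^sup>2 \<Longrightarrow> x \<in> \<Omega>"
    and outside: "\<And>x. norm (x - a) < r0 \<Longrightarrow> x \<in> \<Omega> \<Longrightarrow> (x - a) \<bullet> n \<ge> - (K * (norm (x - a))\<^sup>2)"
    and smoothed_le: "\<And>x. \<bar>conv (phis 1) W x\<bar> \<le> K0"
    and taylor: "\<And>x. \<bar>potential x - potential a - L \<bullet> (x - a)\<bar> \<le> C0 * norm (x - a) powr (1 + \<beta>)"
begin

definition \<xi> :: "'a \<Rightarrow> real" where "\<xi> x = (x - a) \<bullet> n"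

lemma \<xi>_le: "\<bar>\<xi> x\<bar> \<le> norm (x - a)"
  using Cauchy_Schwarz_ineq2[of "x - a" n] n by (simp add: \<xi>_def)

lemma \<xi>_continuous: "continuous_on S \<xi>"
  unfolding \<xi>_def by (intro continuous_intros)

lemma frontier_\<xi>:
  assumes "x \<in> frontier \<Omega>" "norm (x - a) < r0"
  shows "\<bar>\<xi> x\<bar> \<le> K * (norm (x - a))\<^sup>2"
proof -
  have x: "x \<notin> \<Omega>" "x \<in> closure \<Omega>" using assms(1) open_O by (auto simp: frontier_def interior_open)
  have "\<xi> x \<le> K * (norm (x - a))\<^sup>2" using inside[OF assms(2)] x(1) unfolding \<xi>_def by (meson not_le)
  moreover have "\<not> \<xi> x < - (K * (norm (x - a))\<^sup>2)"
  proof
    assume lt: "\<xi> x < - (K * (norm (x - a))\<^sup>2)"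
    define U where "U = {y. norm (y - a) < r0} \<inter> {y. \<xi> y < - (K * (norm (y - a))\<^sup>2)}"
    have "open U" unfolding U_def
      by (intro open_Int open_Collect_less continuous_intros \<xi>_continuous)
    moreover have "x \<in> U" using lt assms(2) by (simp add: U_def)
    moreover have "U \<inter> \<Omega> = {}" using outside by (force simp: U_def \<xi>_def)
    ultimately show False using x(2) open_Int_closure_eq_empty[of U \<Omega>] by blast
  qed
  ultimately show ?thesis by linarith
qed

text \<open>The gain in slope per unit of \<open>\<delta>\<close> in \<open>one_step\<close>: \<open>r\<close> times the slope at \<open>a\<close> of the Gaussian used
  there.\<close>

definition cB :: real where "cB = exp (- (8 * real DIM('a))) * (64 * real DIM('a))"

lemma cB: "cB > 0" using DIM_positive[where 'a='a] by (simp add: cB_def)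

text \<open>The barrier is \<open>Q - p\<close> with \<open>Q = m \<xi> - E r b + \<delta> r h - \<tau>\<close> plus the linear part of the potential \<open>p\<close> at
  \<open>a\<close>, so that only the remainder of order \<open>r\<^bsup>1 + \<beta>\<^esup>\<close> of \<open>p\<close> matters. The summand \<open>- E r b\<close> pushes the barrier below
  \<open>m \<xi> - e r\<close> at distance at least \<open>r / 2\<close> from \<open>a\<close> and provides a positive Laplacian that beats \<open>K0\<close>. The
  summand \<open>\<delta> r h\<close> is positive only in the ball of radius \<open>r / 4\<close> around \<open>a + (r / 4) n\<close>, which touches the
  tangent plane at \<open>a\<close>; it is subharmonic where the larger lower bound is not available. The
  constant \<open>\<tau>\<close> makes the barrier nonpositive on the boundary.\<close>

lemma one_step:
  assumes v: "supersolution W \<Omega> v" and r: "0 < r" "r < r0" "r \<le> 1" "K * r \<le> 1"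
    and e: "0 \<le> e" and m: "0 \<le> m" and d: "0 \<le> \<delta>" "(m + \<delta>) * r \<le> 1"
    and H1: "\<And>x. x \<in> \<Omega> \<Longrightarrow> norm (x - a) < r \<Longrightarrow> m * \<xi> x - e * r \<le> v x"
    and H2: "\<delta> = 0 \<or> (\<forall>x. norm (x - (a + (r / 4) *\<^sub>R n)) \<le> r / 16 \<longrightarrow> m * \<xi> x + \<delta> * r \<le> v x)"
    and x: "x \<in> \<Omega>" "norm (x - a) < r / 2"
  shows "v x \<ge> (m + cB * \<delta> - 8 * (real DIM('a) + 1) * (e + K0 * r)) * \<xi> x
     - 8 * (real DIM('a) + 1) * (e + K0 * r) * K * r\<^sup>2 - (4 * (e + K0 * r) + 2 * cB * \<delta>) * (norm (x - a))\<^sup>2 / r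
     - 2 * C0 * r powr (1 + \<beta>) - m * K * r\<^sup>2"
proof -
  define E where "E = e + K0 * r"
  define A where "A = real DIM('a) + 1"
  define x1 where "x1 = a + (r / 4) *\<^sub>R n"
  \<comment> \<open>With this concentration the Gaussian is subharmonic at distance \<open>r / 16\<close> or more from \<open>x1\<close>.\<close>
  define k where "k = 128 * real DIM('a) / r\<^sup>2"
  \<comment> \<open>\<open>\<xi> + K r\<^sup>2\<close> is nonnegative on \<open>\<Omega>\<close> near \<open>a\<close>. The term linear in it keeps \<open>b\<close> above \<open>4 \<bar>x - a\<bar>\<^sup>2 / r\<^sup>2\<close> there,
    and the quadratic term makes the Laplacian of \<open>b\<close> equal to \<open>- 8 / r\<^sup>2\<close>.\<close>
  define b where "b x = (4 / r\<^sup>2) * (((norm (x - a))\<^sup>2 - A * (\<xi> x + K * r\<^sup>2)\<^sup>2) + 2 * r * A * (\<xi> x + K * r\<^sup>2))" for x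
  define h where "h x = gauss k x1 x - exp (- (8 * real DIM('a)))" for x
  define \<tau> where "\<tau> = C0 * r powr (1 + \<beta>) + m * K * r\<^sup>2"
  define Q where "Q x = m * \<xi> x - E * r * b x + \<delta> * r * h x - \<tau> + (potential a + L \<bullet> (x - a))" for x
  have E: "E > 0" "e \<le> E" using e K0 r by (auto simp: E_def add_nonneg_pos)
  have N1: "real DIM('a) \<ge> 1" using DIM_positive[where 'a='a] by simp
  have A: "A > 0" using N1 by (simp add: A_def)
  have kpos: "k > 0" using N1 r by (simp add: k_def)
  have pt: "\<bar>potential x - potential a - L \<bullet> (x - a)\<bar> \<le> C0 * r powr (1 + \<beta>)" if "norm (x - a) \<le> r" for x
  proof -
    have "norm (x - a) powr (1 + \<beta>) \<le> r powr (1 + \<beta>)" using that \<beta> by (intro powr_mono2) auto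
    then show ?thesis using taylor[of x] C0 by (smt (verit) mult_left_mono)
  qed
  have psi_le: "Q x - potential x \<le> m * \<xi> x - E * r * b x + \<delta> * r * h x - m * K * r\<^sup>2" if "norm (x - a) \<le> r" for x
    using pt[OF that] by (simp add: Q_def \<tau>_def abs_le_iff)
  have psi_ge: "Q x - potential x \<ge> m * \<xi> x - E * r * b x + \<delta> * r * h x - m * K * r\<^sup>2 - 2 * C0 * r powr (1 + \<beta>)" if "norm (x - a) \<le> r" for x
    using pt[OF that] by (simp add: Q_def \<tau>_def abs_le_iff)
  have Kr2: "K * r\<^sup>2 \<le> r" using mult_right_mono[OF r(4), of r] r(1) by (simp add: power2_eq_square mult.assoc)
  have low: "\<xi> x \<ge> - (K * r\<^sup>2)" if "x \<in> \<Omega> \<or> x \<in> frontier \<Omega>" "norm (x - a) \<le> 3 / 4 * r" for x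
  proof -
    have nr: "norm (x - a) < r0" "norm (x - a) \<le> r" using that(2) r by auto
    have "(norm (x - a))\<^sup>2 \<le> r\<^sup>2" using nr(2) by (intro power_mono) auto
    then have "K * (norm (x - a))\<^sup>2 \<le> K * r\<^sup>2" using K by (intro mult_left_mono) auto
    moreover have "\<xi> x \<ge> - (K * (norm (x - a))\<^sup>2)"
      using that(1) outside[OF nr(1)] frontier_\<xi>[OF _ nr(1)] by (auto simp: \<xi>_def)
    ultimately show ?thesis by linarith
  qed
  have b_ge: "b x \<ge> 4 * (norm (x - a))\<^sup>2 / r\<^sup>2" if "x \<in> \<Omega> \<or> x \<in> frontier \<Omega>" "norm (x - a) \<le> 3 / 4 * r" for x
  proof -
    let ?s = "\<xi> x + K * r\<^sup>2"
    have s: "0 \<le> ?s" "?s \<le> 2 * r" using low[OF that] \<xi>_le[of x] that(2) Kr2 r by auto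
    have "A * ?s\<^sup>2 \<le> A * (2 * r * ?s)" using s A by (intro mult_left_mono) (auto simp: power2_eq_square mult_right_mono)
    then have "(norm (x - a))\<^sup>2 \<le> ((norm (x - a))\<^sup>2 - A * ?s\<^sup>2) + 2 * r * A * ?s" by (simp add: mult_ac)
    then have "(4 / r\<^sup>2) * (norm (x - a))\<^sup>2 \<le> b x" unfolding b_def by (rule mult_left_mono) simp
    then show ?thesis by simp
  qed
  have b0: "b x \<ge> 0" if "x \<in> \<Omega> \<or> x \<in> frontier \<Omega>" "norm (x - a) \<le> 3 / 4 * r" for x
    using b_ge[OF that] by (smt (verit) divide_nonneg_nonneg zero_le_power2)
  have x1a: "norm (x1 - a) = r / 4" using r n by (simp add: x1_def)
  have expk: "k * (r / 4)\<^sup>2 = 8 * real DIM('a)" using r by (simp add: k_def power_divide)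
  have h_le1: "h x \<le> 1" for x
  proof -
    have "gauss k x1 x \<le> 1" using kpos by (simp add: gauss_def)
    moreover have "exp (- (8 * real DIM('a))) > 0" by simp
    ultimately show ?thesis unfolding h_def by linarith
  qed
  have h_neg: "h x \<le> 0" if "norm (x - x1) \<ge> r / 4" for x
  proof -
    have "(r / 4)\<^sup>2 \<le> (norm (x - x1))\<^sup>2" using that r by (intro power_mono) auto
    then have "k * (r / 4)\<^sup>2 \<le> k * (norm (x - x1))\<^sup>2" using kpos by (intro mult_left_mono) auto
    then show ?thesis unfolding h_def gauss_def using expk by simp
  qed
  have sq: "(norm (x - x1))\<^sup>2 = (norm (x - a))\<^sup>2 - (r / 2) * \<xi> x + (r / 4)\<^sup>2" for x
  proof -
    have "x - x1 = (x - a) - (r / 4) *\<^sub>R n" by (simp add: x1_def)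
    moreover have "(norm (y - s *\<^sub>R n))\<^sup>2 = (norm y)\<^sup>2 - 2 * s * (y \<bullet> n) + s\<^sup>2" for y s
      unfolding power2_norm_eq_inner
      using n by (simp add: inner_diff_left inner_diff_right inner_commute norm_eq_1 power2_eq_square algebra_simps)
    ultimately show ?thesis by (simp only: \<xi>_def)
  qed
  have sm: "smooth_on UNIV Q"
  proof -
    have "smooth_on UNIV \<xi>" unfolding \<xi>_def by (rule smooth_on_inner)
    moreover have "smooth_on UNIV (\<lambda>x. L \<bullet> (x - a))" using smooth_on_inner[of UNIV a L] by (simp add: inner_commute)
    ultimately show ?thesis
      unfolding Q_def b_def h_def power2_eq_square[of "\<xi> _ + _"]
      by (intro smooth_on_add smooth_on_diff smooth_on_mult smooth_on_const smooth_on_norm_square gauss_smooth open_UNIV)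
  qed
  have lapQ: "laplacian Q x = 8 * E / r + \<delta> * r * laplacian (gauss k x1) x" for x
  proof -
    have s\<xi>: "smooth_on UNIV \<xi>" unfolding \<xi>_def by (rule smooth_on_inner)
    have sL: "smooth_on UNIV (\<lambda>x. L \<bullet> (x - a))" using smooth_on_inner[of UNIV a L] by (simp add: inner_commute)
    have sx2: "smooth_on UNIV (\<lambda>x. (\<xi> x + K * r\<^sup>2)\<^sup>2)" unfolding power2_eq_square
      by (intro smooth_on_mult smooth_on_add smooth_on_const s\<xi>) auto
    note sms = smooth_on_add smooth_on_diff smooth_on_mult smooth_on_const smooth_on_norm_square gauss_smooth open_UNIV s\<xi> sL sx2
    have l\<xi>: "laplacian \<xi> x = 0" unfolding \<xi>_def by simp
    have lL: "laplacian (\<lambda>x. L \<bullet> (x - a)) x = 0" using laplacian_inner[of a L x] by (simp add: inner_commute)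
    have l2: "laplacian (\<lambda>x. (\<xi> x + K * r\<^sup>2)\<^sup>2) x = 2" unfolding \<xi>_def laplacian_coordinate_square using n by (simp add: norm_eq_1)
    have l1: "laplacian (\<lambda>x. (norm (x - a))\<^sup>2) x = 2 * real DIM('a)" using laplacian_norm_square[of 1 a 0 x] by simp
    have lb: "laplacian b x = (4 / r\<^sup>2) * (2 * real DIM('a) - A * 2)"
    proof -
      have "laplacian b x = (4 / r\<^sup>2) * laplacian (\<lambda>x. ((norm (x - a))\<^sup>2 - A * (\<xi> x + K * r\<^sup>2)\<^sup>2) + 2 * r * A * (\<xi> x + K * r\<^sup>2)) x"
        unfolding b_def by (intro laplacian_cmult sms)
      also have "laplacian (\<lambda>x. ((norm (x - a))\<^sup>2 - A * (\<xi> x + K * r\<^sup>2)\<^sup>2) + 2 * r * A * (\<xi> x + K * r\<^sup>2)) x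
         = laplacian (\<lambda>x. (norm (x - a))\<^sup>2 - A * (\<xi> x + K * r\<^sup>2)\<^sup>2) x + laplacian (\<lambda>x. 2 * r * A * (\<xi> x + K * r\<^sup>2)) x"
        by (intro laplacian_add sms)
      also have "laplacian (\<lambda>x. 2 * r * A * (\<xi> x + K * r\<^sup>2)) x = 2 * r * A * laplacian (\<lambda>x. \<xi> x + K * r\<^sup>2) x"
        by (intro laplacian_cmult sms)
      also have "laplacian (\<lambda>x. \<xi> x + K * r\<^sup>2) x = laplacian \<xi> x + laplacian (\<lambda>x. K * r\<^sup>2) x"
        by (intro laplacian_add sms)
      also have "laplacian (\<lambda>x. (norm (x - a))\<^sup>2 - A * (\<xi> x + K * r\<^sup>2)\<^sup>2) x
         = laplacian (\<lambda>x. (norm (x - a))\<^sup>2) x - laplacian (\<lambda>x. A * (\<xi> x + K * r\<^sup>2)\<^sup>2) x"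
        by (intro laplacian_diff sms)
      also have "laplacian (\<lambda>x. A * (\<xi> x + K * r\<^sup>2)\<^sup>2) x = A * laplacian (\<lambda>x. (\<xi> x + K * r\<^sup>2)\<^sup>2) x"
        by (intro laplacian_cmult sms)
      finally show ?thesis by (simp add: l\<xi> l1 l2)
    qed
    have sb: "smooth_on UNIV b" unfolding b_def by (intro sms)
    have sh: "smooth_on UNIV h" unfolding h_def by (intro sms)
    have lh: "laplacian h x = laplacian (gauss k x1) x"
      unfolding h_def using laplacian_diff[OF gauss_smooth smooth_on_const] by simp
    have "laplacian Q x = laplacian (\<lambda>x. m * \<xi> x - E * r * b x + \<delta> * r * h x - \<tau>) x + laplacian (\<lambda>x. potential a + L \<bullet> (x - a)) x"
      unfolding Q_def by (intro laplacian_add sms sb sh)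
    also have "laplacian (\<lambda>x. potential a + L \<bullet> (x - a)) x = laplacian (\<lambda>x. potential a) x + laplacian (\<lambda>x. L \<bullet> (x - a)) x"
      by (intro laplacian_add sms)
    also have "laplacian (\<lambda>x. m * \<xi> x - E * r * b x + \<delta> * r * h x - \<tau>) x = laplacian (\<lambda>x. m * \<xi> x - E * r * b x + \<delta> * r * h x) x - laplacian (\<lambda>x. \<tau>) x"
      by (intro laplacian_diff sms sb sh)
    also have "laplacian (\<lambda>x. m * \<xi> x - E * r * b x + \<delta> * r * h x) x = laplacian (\<lambda>x. m * \<xi> x - E * r * b x) x + laplacian (\<lambda>x. \<delta> * r * h x) x"
      by (intro laplacian_add sms sb sh)
    also have "laplacian (\<lambda>x. \<delta> * r * h x) x = \<delta> * r * laplacian h x" by (intro laplacian_cmult sh)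
    also have "laplacian (\<lambda>x. m * \<xi> x - E * r * b x) x = laplacian (\<lambda>x. m * \<xi> x) x - laplacian (\<lambda>x. E * r * b x) x"
      by (intro laplacian_diff sms sb)
    also have "laplacian (\<lambda>x. m * \<xi> x) x = m * laplacian \<xi> x" by (intro laplacian_cmult sms)
    also have "laplacian (\<lambda>x. E * r * b x) x = E * r * laplacian b x" by (intro laplacian_cmult sb)
    finally show ?thesis using r by (simp add: l\<xi> lL lh lb A_def field_simps power2_eq_square)
  qed
  have "Q x - potential x \<le> v x"
  proof (rule barrier_pointwise[OF open_O bounded_O v smoothed_le sm, where ?R1.0="r / 2" and ?R2.0="3 / 4 * r" and z=a])
    show "0 \<le> r / 2" "r / 2 < 3 / 4 * r" using r by auto
    show "x \<in> \<Omega>" "norm (x - a) < 3 / 4 * r" using x r by auto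
  next
    fix x assume x: "x \<in> \<Omega>" "norm (x - a) < 3 / 4 * r"
    then have nr: "norm (x - a) \<le> r" "norm (x - a) \<le> 3 / 4 * r" using r by auto
    have "Q x - potential x \<le> m * \<xi> x - E * r * b x + \<delta> * r * h x - m * K * r\<^sup>2" by (rule psi_le[OF nr(1)])
    also have "\<dots> \<le> m * r - 0 + \<delta> * r * 1 - 0"
    proof (intro diff_mono add_mono mult_left_mono)
      show "\<xi> x \<le> r" using \<xi>_le[of x] nr by linarith
      show "0 \<le> E * r * b x" using b0[OF disjI1[OF x(1)] nr(2)] E r by simp
    qed (use m d r K h_le1 in auto)
    also have "\<dots> \<le> 1" using d by (simp add: algebra_simps)
    finally show "Q x - potential x \<le> 1" .
    show "Q x - potential x \<le> v x \<or> laplacian Q x > K0"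
    proof (cases "\<delta> = 0 \<or> norm (x - x1) > r / 16")
      case True
      have "\<delta> * r * laplacian (gauss k x1) x \<ge> 0"
      proof (cases "\<delta> = 0")
        case False
        with True have "r / 16 < norm (x - x1)" by simp
        then have "(r / 16)\<^sup>2 \<le> (norm (x - x1))\<^sup>2" using r by (intro power_mono) auto
        then have "2 * k * (r / 16)\<^sup>2 \<le> 2 * k * (norm (x - x1))\<^sup>2" using kpos by (intro mult_left_mono) auto
        moreover have "2 * k * (r / 16)\<^sup>2 = real DIM('a)" using r by (simp add: k_def power_divide)
        ultimately have "laplacian (gauss k x1) x \<ge> 0" using kpos by (intro gauss_laplacian_nonneg) auto
        then show ?thesis using d r by simp
      qed simp
      moreover have "8 * E / r > K0"
      proof -
        have "K0 * r < 8 * E" using e K0 r unfolding E_def by (smt (verit) mult_pos_pos)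
        then show ?thesis using r by (simp add: field_simps)
      qed
      ultimately show ?thesis unfolding lapQ by linarith
    next
      case False
      have "Q x - potential x \<le> m * \<xi> x - E * r * b x + \<delta> * r * h x - m * K * r\<^sup>2" by (rule psi_le[OF nr(1)])
      also have "\<dots> \<le> m * \<xi> x - 0 + \<delta> * r * 1 - 0"
        using b0[OF disjI1[OF x(1)] nr(2)] E r m d K h_le1[of x] by (intro diff_mono add_mono mult_left_mono) auto
      also have "\<dots> \<le> v x" using H2 False by (auto simp: x1_def)
      finally show ?thesis by simp
    qed
  next
    fix x assume x: "x \<in> frontier \<Omega>" "norm (x - a) \<le> 3 / 4 * r"
    then have nr: "norm (x - a) \<le> r" "norm (x - a) < r0" using r by auto
    have fx: "\<xi> x \<le> K * (norm (x - a))\<^sup>2" using frontier_\<xi>[OF x(1) nr(2)] by linarith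
    have "(norm (x - a))\<^sup>2 \<le> r\<^sup>2" using nr(1) by (intro power_mono) auto
    then have "K * (norm (x - a))\<^sup>2 \<le> K * r\<^sup>2" using K by (intro mult_left_mono) auto
    then have "m * \<xi> x \<le> m * (K * r\<^sup>2)" using fx m by (intro mult_left_mono) auto
    moreover have "h x \<le> 0"
    proof (rule h_neg)
      have "(r / 2) * \<xi> x \<le> (r / 2) * (K * (norm (x - a))\<^sup>2)" using fx r by (intro mult_left_mono) auto
      also have "\<dots> = (K * r) * ((norm (x - a))\<^sup>2 / 2)" by simp
      also have "\<dots> \<le> 1 * ((norm (x - a))\<^sup>2 / 2)" using r by (intro mult_right_mono) auto
      finally have "(r / 4)\<^sup>2 \<le> (norm (x - x1))\<^sup>2" 
        unfolding sq using zero_le_power2[of "norm (x - a)"] by linarith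
      then show "r / 4 \<le> norm (x - x1)" by (rule power2_le_imp_le) simp
    qed
    then have "\<delta> * r * h x \<le> 0" using d r by (simp add: mult_nonneg_nonpos)
    moreover have "0 \<le> E * r * b x" using b0[OF disjI2[OF x(1)] x(2)] E r by simp
    ultimately show "Q x - potential x \<le> 0" using psi_le[OF nr(1)] by (simp add: mult.assoc)
  next
    fix x assume x: "x \<in> \<Omega>" "r / 2 \<le> norm (x - a)" "norm (x - a) \<le> 3 / 4 * r"
    then have nr: "norm (x - a) \<le> r" "norm (x - a) < r" using r by auto
    have "(r / 2)\<^sup>2 \<le> (norm (x - a))\<^sup>2" using x r by (intro power_mono) auto
    then have "1 \<le> 4 * (norm (x - a))\<^sup>2 / r\<^sup>2" using r by (simp add: field_simps power_divide)
    then have "1 \<le> b x" using b_ge[OF disjI1[OF x(1)] x(3)] by linarith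
    then have "E * r * 1 \<le> E * r * b x" using E r by (intro mult_left_mono) auto
    moreover have "e * r \<le> E * r" using E r by (intro mult_right_mono) auto
    moreover have "h x \<le> 0"
    proof (rule h_neg)
      show "r / 4 \<le> norm (x - x1)" using x(2) x1a norm_triangle_ineq2[of "x - a" "x1 - a"] by simp
    qed
    then have "\<delta> * r * h x \<le> 0" using d r by (simp add: mult_nonneg_nonpos)
    moreover have "0 \<le> m * K * r\<^sup>2" using m K by simp
    ultimately show "Q x - potential x \<le> v x" using psi_le[OF nr(1)] H1[OF x(1) nr(2)] by linarith
  qed
  moreover have "Q x - potential x \<ge> m * \<xi> x - E * r * b x + \<delta> * r * h x - m * K * r\<^sup>2 - 2 * C0 * r powr (1 + \<beta>)"
    using x r by (intro psi_ge) auto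
  moreover have "E * r * b x \<le> 4 * E * (norm (x - a))\<^sup>2 / r + 8 * A * E * (\<xi> x + K * r\<^sup>2)"
  proof -
    have "b x \<le> (4 / r\<^sup>2) * ((norm (x - a))\<^sup>2 + 2 * r * A * (\<xi> x + K * r\<^sup>2))"
      unfolding b_def using A by (intro mult_left_mono) auto
    then have "E * r * b x \<le> E * r * ((4 / r\<^sup>2) * ((norm (x - a))\<^sup>2 + 2 * r * A * (\<xi> x + K * r\<^sup>2)))"
      using E r by (intro mult_left_mono) auto
    also have "\<dots> = 4 * E * (norm (x - a))\<^sup>2 / r + 8 * A * E * (\<xi> x + K * r\<^sup>2)"
      using r by (simp add: field_simps power2_eq_square)
    finally show ?thesis .
  qed
  moreover have "\<delta> * r * h x \<ge> cB * \<delta> * \<xi> x - 2 * cB * \<delta> * (norm (x - a))\<^sup>2 / r"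
  proof -
    define z where "z = k * ((r / 2) * \<xi> x - (norm (x - a))\<^sup>2)"
    have g: "gauss k x1 x = exp (- (8 * real DIM('a)) + z)" unfolding gauss_def sq z_def using expk by (simp add: algebra_simps)
    have "h x = exp (- (8 * real DIM('a))) * (exp z - 1)"
      unfolding h_def g exp_add by (simp only: right_diff_distrib mult_1_right)
    moreover have "exp z - 1 \<ge> z" using exp_ge_add_one_self[of z] by linarith
    ultimately have "h x \<ge> exp (- (8 * real DIM('a))) * z" by (simp add: mult_left_mono)
    then have "\<delta> * r * (exp (- (8 * real DIM('a))) * z) \<le> \<delta> * r * h x" using d r by (intro mult_left_mono) auto
    moreover have "\<delta> * r * (exp (- (8 * real DIM('a))) * z) = cB * \<delta> * \<xi> x - 2 * cB * \<delta> * (norm (x - a))\<^sup>2 / r"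
      using r by (simp add: z_def k_def cB_def field_simps power2_eq_square)
    ultimately show ?thesis by linarith
  qed
  ultimately have "v x \<ge> m * \<xi> x - (4 * E * (norm (x - a))\<^sup>2 / r + 8 * A * E * (\<xi> x + K * r\<^sup>2))
    + (cB * \<delta> * \<xi> x - 2 * cB * \<delta> * (norm (x - a))\<^sup>2 / r) - m * K * r\<^sup>2 - 2 * C0 * r powr (1 + \<beta>)" by linarith
  moreover have "m * \<xi> x - (4 * E * (norm (x - a))\<^sup>2 / r + 8 * A * E * (\<xi> x + K * r\<^sup>2))
    + (cB * \<delta> * \<xi> x - 2 * cB * \<delta> * (norm (x - a))\<^sup>2 / r) - m * K * r\<^sup>2 - 2 * C0 * r powr (1 + \<beta>)
    = (m + cB * \<delta> - 8 * A * E) * \<xi> x - 8 * A * E * K * r\<^sup>2 - (4 * E + 2 * cB * \<delta>) * (norm (x - a))\<^sup>2 / r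
     - 2 * C0 * r powr (1 + \<beta>) - m * K * r\<^sup>2"
    by (simp add: algebra_simps add_divide_distrib)
  ultimately show ?thesis by (simp add: E_def A_def)
qed

end

context boundary_point
begin

section \<open>Admissible slopes\<close>

text \<open>\<open>m\<close> is a lower bound for the slope of \<open>v\<close> at \<open>a\<close>, in all directions at once: \<open>v \<ge> m \<xi> - o(\<bar>x - a\<bar>)\<close>.\<close>

definition admissible :: "('a \<Rightarrow> real) \<Rightarrow> real \<Rightarrow> bool" where
  "admissible v m \<longleftrightarrow> m \<ge> 0 \<and>
     (\<forall>\<epsilon>>0. \<exists>s>0. \<forall>x\<in>\<Omega>. norm (x - a) < s \<longrightarrow> m * \<xi> x - \<epsilon> * norm (x - a) \<le> v x)"

text \<open>Constants of the iteration: \<open>C2\<close> bounds the error that one flattening step adds, \<open>geo\<close> is the sum of the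
  geometric series with ratio \<open>16\<^bsup>- \<beta>\<^esup>\<close>, and \<open>C4\<close> bounds the total loss of slope.\<close>

definition cA :: real where "cA = real DIM('a) + 1"
definition C2 :: real where "C2 = K0 + 32 * C0 + 16 * K"
definition geo :: real where "geo = 1 / (1 - (1/16) powr \<beta>)"
definition C4 :: real where "C4 = 8 * cA * (2 + 2 * C2 * geo + K0 * geo)"

lemma sixteenth: "0 < (1/16::real) powr \<beta>" "(1/16::real) powr \<beta> < 1"
proof -
  have "(1/16::real) powr \<beta> < 1 powr \<beta>" using \<beta> by (intro powr_less_mono2) auto
  then show "(1/16::real) powr \<beta> < 1" by simp
qed simp

lemma consts_pos: "cA > 0" "C2 > 0" "geo > 0" "C4 > 0"
proof -
  show 1: "cA > 0" by (simp add: cA_def add_nonneg_pos)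
  show 2: "C2 > 0" using K0 C0 K by (simp add: C2_def)
  show 3: "geo > 0" using sixteenth by (simp add: geo_def)
  have "2 * C2 * geo > 0" "K0 * geo > 0" using 2 3 K0 by simp_all
  then have "2 + 2 * C2 * geo + K0 * geo > 0" by linarith
  then show "C4 > 0" unfolding C4_def using 1 by simp
qed

lemma r_le_powr: "0 < r \<Longrightarrow> r \<le> 1 \<Longrightarrow> r \<le> r powr \<beta>"
  using powr_mono'[of \<beta> 1 r] \<beta> by simp

text \<open>Apart from the loss of slope, the error terms of \<open>one_step\<close> with \<open>\<delta> = 0\<close> that contain \<open>e\<close> are quadratic in the radius. Passing from
  radius \<open>r\<close> to \<open>r / 16\<close> therefore halves the relative error \<open>e\<close>, up to a contribution of order \<open>r\<^sup>\<beta>\<close>.\<close>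

lemma flattening_step:
  assumes v: "supersolution W \<Omega> v" and r: "0 < r" "r < r0" "r \<le> 1" "512 * cA * K * r \<le> 1"
    and e: "0 \<le> e" and m: "0 \<le> m" "m * r \<le> 1"
    and H1: "\<And>x. x \<in> \<Omega> \<Longrightarrow> norm (x - a) < r \<Longrightarrow> m * \<xi> x - e * r \<le> v x"
    and x: "x \<in> \<Omega>" "norm (x - a) < r / 16"
  shows "(m - 8 * cA * (e + K0 * r)) * \<xi> x - (e / 2 + C2 * (1 + m) * r powr \<beta>) * (r / 16) \<le> v x"
proof -
  define E where "E = e + K0 * r"
  define d where "d = norm (x - a)"
  have E: "E \<ge> 0" using e K0 r by (simp add: E_def)
  have "1 * (K * r) \<le> (512 * cA) * (K * r)" using K r by (intro mult_right_mono) (auto simp: cA_def)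
  then have Kr: "K * r \<le> 1" using r(4) by (simp add: mult.assoc)
  have "v x \<ge> (m + cB * 0 - 8 * (real DIM('a) + 1) * (e + K0 * r)) * \<xi> x
     - 8 * (real DIM('a) + 1) * (e + K0 * r) * K * r\<^sup>2 - (4 * (e + K0 * r) + 2 * cB * 0) * (norm (x - a))\<^sup>2 / r
     - 2 * C0 * r powr (1 + \<beta>) - m * K * r\<^sup>2"
    by (rule one_step[OF v r(1-3) Kr e m(1) order_refl _ H1]) (use m x r in auto)
  then have 1: "v x \<ge> (m - 8 * cA * E) * \<xi> x - (8 * cA * E * K * r\<^sup>2 + 4 * E * d\<^sup>2 / r + 2 * C0 * r powr (1 + \<beta>) + m * K * r\<^sup>2)"
    by (simp add: E_def d_def cA_def)
  have a1: "8 * cA * E * K * r\<^sup>2 \<le> E * r / 64"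
  proof -
    have "(E * r / 64) * (512 * cA * K * r) \<le> (E * r / 64) * 1" using E r by (intro mult_left_mono) auto
    then show ?thesis by (simp add: power2_eq_square mult_ac)
  qed
  have a2: "4 * E * d\<^sup>2 / r \<le> E * r / 64"
  proof -
    have "d\<^sup>2 \<le> (r / 16)\<^sup>2" using x by (intro power_mono) (auto simp: d_def)
    then have "(4 * E) * d\<^sup>2 \<le> (4 * E) * (r / 16)\<^sup>2" using E by (intro mult_left_mono) auto
    then have "4 * E * d\<^sup>2 / r \<le> (4 * E) * (r / 16)\<^sup>2 / r" using r by (intro divide_right_mono) auto
    also have "\<dots> = E * r / 64" using r by (simp add: power2_eq_square)
    finally show ?thesis .
  qed
  have rp: "r powr (1 + \<beta>) = r * r powr \<beta>" using r by (simp add: powr_add)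
  have a3: "r\<^sup>2 \<le> r * r powr \<beta>" using r_le_powr[OF r(1,3)] r by (simp add: power2_eq_square)
  have "E * r / 32 = (e / 2) * (r / 16) + K0 / 32 * r\<^sup>2" by (simp add: E_def power2_eq_square algebra_simps)
  moreover have "K0 / 32 * r\<^sup>2 \<le> K0 / 16 * (r * r powr \<beta>)" using a3 K0 by (intro mult_mono) auto
  moreover have "m * K * r\<^sup>2 \<le> m * K * (r * r powr \<beta>)" using a3 m K by (intro mult_left_mono) auto
  ultimately have "8 * cA * E * K * r\<^sup>2 + 4 * E * d\<^sup>2 / r + 2 * C0 * r powr (1 + \<beta>) + m * K * r\<^sup>2
     \<le> (e / 2) * (r / 16) + (K0 / 16 * (r * r powr \<beta>) + 2 * C0 * (r * r powr \<beta>) + m * K * (r * r powr \<beta>))"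
    using a1 a2 by (simp add: rp)
  also have "\<dots> = (e / 2) * (r / 16) + (K0 + 32 * C0 + 16 * K * m) * (r powr \<beta> * (r / 16))" by (simp add: algebra_simps)
  also have "\<dots> \<le> (e / 2) * (r / 16) + (C2 * (1 + m)) * (r powr \<beta> * (r / 16))"
  proof -
    have "0 \<le> (K0 + 32 * C0) * m + 16 * K" using K0 C0 K m by (intro add_nonneg_nonneg mult_nonneg_nonneg) auto
    then have "K0 + 32 * C0 + 16 * K * m \<le> C2 * (1 + m)" by (simp add: C2_def algebra_simps)
    then have "(K0 + 32 * C0 + 16 * K * m) * (r powr \<beta> * (r / 16)) \<le> (C2 * (1 + m)) * (r powr \<beta> * (r / 16))"
      using r by (intro mult_right_mono) auto
    then show ?thesis by simp
  qed
  also have "\<dots> = (e / 2 + C2 * (1 + m) * r powr \<beta>) * (r / 16)" by (simp add: algebra_simps)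
  finally show ?thesis using 1 unfolding E_def[symmetric] by linarith
qed

text \<open>Repeat the flattening step on the radii \<open>r / 16\<^sup>k\<close>. The relative errors satisfy a contracting recursion
  with geometrically decaying inhomogeneity, so they are summable. The slope loses a multiple of each
  error, hence a finite amount in total.\<close>

lemma iteration:
  assumes v: "supersolution W \<Omega> v" and r: "0 < r" "r < r0" "r \<le> 1" "512 * cA * K * r \<le> 1"
    and e: "0 \<le> e" and m: "0 \<le> m" "m * r \<le> 1"
    and H1: "\<And>x. x \<in> \<Omega> \<Longrightarrow> norm (x - a) < r \<Longrightarrow> m * \<xi> x - e * r \<le> v x"
    and pos: "m - C4 * (e + (1 + m) * r powr \<beta>) \<ge> 0"
  shows "admissible v (m - C4 * (e + (1 + m) * r powr \<beta>))"
proof -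
  define q where "q = (1/16::real) powr \<beta>"
  have q: "0 < q" "q < 1" using sixteenth by (auto simp: q_def)
  define rk where "rk k = r * (1/16) ^ k" for k :: nat
  have rk: "0 < rk k" "rk k \<le> r" "rk 0 = r" "rk (Suc k) = rk k / 16" for k
    using r by (auto simp: rk_def mult_left_le power_le_one)
  have rkp: "rk k powr \<beta> = r powr \<beta> * q ^ k" for k
    using r by (simp add: rk_def q_def powr_mult powr_power powr_realpow[symmetric] powr_powr mult.commute)
  define X where "X = C2 * (1 + m) * r powr \<beta>"
  have X: "X \<ge> 0" using consts_pos m by (simp add: X_def)
  \<comment> \<open>the relative error at radius \<open>rk k\<close>\<close>
  define ee where "ee = rec_nat e (\<lambda>k z. z / 2 + X * q ^ k)"
  have ee: "ee 0 = e" "ee (Suc k) = ee k / 2 + X * q ^ k" for k by (simp_all add: ee_def)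
  have ee0: "ee k \<ge> 0" for k by (induction k) (use e X q in \<open>auto simp: ee\<close>)
  have gs: "(\<Sum>j<k. q ^ j) \<le> geo" for k
  proof -
    have "(\<Sum>j<k. q ^ j) \<le> (\<Sum>j. q ^ j)" using q by (intro sum_le_suminf summable_geometric) auto
    then show ?thesis using q by (simp add: suminf_geometric geo_def q_def)
  qed
  have ge: "(\<Sum>j<k. ee j) \<le> 2 * e + 2 * X * geo" for k
  proof (induction k)
    case (Suc k)
    have "(\<Sum>j<Suc k. ee j) = ee 0 + (\<Sum>j<k. ee (Suc j))" by (rule sum.lessThan_Suc_shift)
    also have "\<dots> = e + ((\<Sum>j<k. ee j) / 2 + X * (\<Sum>j<k. q ^ j))"
      by (simp add: ee sum.distrib sum_divide_distrib sum_distrib_left)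
    also have "\<dots> \<le> e + ((2 * e + 2 * X * geo) / 2 + X * geo)"
      using Suc gs[of k] X by (intro add_left_mono add_mono divide_right_mono mult_left_mono) auto
    also have "\<dots> = 2 * e + 2 * X * geo" by (simp add: field_simps)
    finally show ?case .
  qed (use e X consts_pos in auto)
  \<comment> \<open>the slope at radius \<open>rk k\<close>\<close>
  define mm where "mm k = m - 8 * cA * (\<Sum>j<k. ee j + K0 * rk j)" for k
  define m' where "m' = m - C4 * (e + (1 + m) * r powr \<beta>)"
  have mm_le: "mm k \<le> m" for k
  proof -
    have "0 \<le> (\<Sum>j<k. ee j + K0 * rk j)" using ee0 K0 rk(1) by (intro sum_nonneg add_nonneg_nonneg mult_nonneg_nonneg) (auto simp: less_imp_le)
    then show ?thesis using consts_pos by (simp add: mm_def)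
  qed
  have mm_ge: "m' \<le> mm k" for k
  proof -
    have "rk j \<le> r powr \<beta> * q ^ j" for j
      using r_le_powr[OF rk(1)[of j]] rk(2)[of j] r by (simp add: rkp[symmetric])
    then have "(\<Sum>j<k. K0 * rk j) \<le> (\<Sum>j<k. K0 * (r powr \<beta> * q ^ j))" using K0 by (intro sum_mono mult_left_mono) auto
    also have "\<dots> = K0 * r powr \<beta> * (\<Sum>j<k. q ^ j)" by (simp add: sum_distrib_left mult.assoc)
    also have "\<dots> \<le> K0 * r powr \<beta> * geo" using gs[of k] K0 by (intro mult_left_mono) auto
    finally have "(\<Sum>j<k. ee j + K0 * rk j) \<le> 2 * e + 2 * X * geo + K0 * r powr \<beta> * geo"
      using ge[of k] by (simp add: sum.distrib)
    also have "\<dots> \<le> (2 + 2 * C2 * geo + K0 * geo) * (e + (1 + m) * r powr \<beta>)"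
    proof -
      have "0 \<le> (2 * C2 * geo + K0 * geo) * e + 2 * ((1 + m) * r powr \<beta>) + K0 * geo * (m * r powr \<beta>)"
        using consts_pos K0 e m by (intro add_nonneg_nonneg mult_nonneg_nonneg) (auto simp: less_imp_le)
      then show ?thesis by (simp add: X_def algebra_simps)
    qed
    finally have "8 * cA * (\<Sum>j<k. ee j + K0 * rk j) \<le> C4 * (e + (1 + m) * r powr \<beta>)"
      unfolding C4_def mult.assoc[of "8 * cA"] using consts_pos by (intro mult_left_mono) auto
    then show ?thesis by (simp add: mm_def m'_def)
  qed
  have m'0: "m' \<ge> 0" using pos by (simp add: m'_def)
  have level: "\<forall>x\<in>\<Omega>. norm (x - a) < rk k \<longrightarrow> mm k * \<xi> x - ee k * rk k \<le> v x" for k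
  proof (induction k)
    case 0
    then show ?case using H1 by (simp add: mm_def ee rk)
  next
    case (Suc k)
    show ?case
    proof (intro ballI impI)
      fix x assume x: "x \<in> \<Omega>" "norm (x - a) < rk (Suc k)"
      have m0: "0 \<le> mm k" using mm_ge[of k] m'0 by linarith
      have m1: "mm k * rk k \<le> 1" using mult_mono[OF mm_le[of k] rk(2)[of k]] m rk(1)[of k] by auto
      have r4: "512 * cA * K * rk k \<le> 1"
      proof -
        have "512 * cA * K * rk k \<le> 512 * cA * K * r" using consts_pos K by (intro mult_left_mono rk(2)) auto
        then show ?thesis using r(4) by linarith
      qed
      have "(mm k - 8 * cA * (ee k + K0 * rk k)) * \<xi> x - (ee k / 2 + C2 * (1 + mm k) * rk k powr \<beta>) * (rk k / 16) \<le> v x"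
        by (rule flattening_step[OF v rk(1) _ _ r4 ee0 m0 m1]) (use Suc x rk r in \<open>auto intro: le_less_trans[OF rk(2)] order_trans[OF rk(2)]\<close>)
      moreover have "mm (Suc k) = mm k - 8 * cA * (ee k + K0 * rk k)" by (simp add: mm_def algebra_simps)
      moreover have "(ee k / 2 + C2 * (1 + mm k) * rk k powr \<beta>) * (rk k / 16) \<le> ee (Suc k) * rk (Suc k)"
      proof -
        have "C2 * (1 + mm k) * rk k powr \<beta> \<le> C2 * (1 + m) * rk k powr \<beta>"
          using mm_le[of k] consts_pos by (intro mult_right_mono mult_left_mono) auto
        then have "ee k / 2 + C2 * (1 + mm k) * rk k powr \<beta> \<le> ee (Suc k)" by (simp add: ee X_def rkp mult.assoc)
        then show ?thesis unfolding rk(4) using rk(1)[of k] by (intro mult_right_mono) auto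
      qed
      ultimately show "mm (Suc k) * \<xi> x - ee (Suc k) * rk (Suc k) \<le> v x" by simp
    qed
  qed
  have ee_lim: "ee \<longlonglongrightarrow> 0"
    by (rule summable_LIMSEQ_zero, rule summableI_nonneg_bounded[of _ "2 * e + 2 * X * geo"]) (use ee0 ge in auto)
  have "\<exists>s>0. \<forall>x\<in>\<Omega>. norm (x - a) < s \<longrightarrow> m' * \<xi> x - \<epsilon> * norm (x - a) \<le> v x" if eps: "\<epsilon> > 0" for \<epsilon>
  proof -
    have "eventually (\<lambda>k. ee k < \<epsilon> / 32) sequentially" using ee_lim eps by (intro order_tendstoD(2)) auto
    then obtain k0 where k0: "\<And>k. k \<ge> k0 \<Longrightarrow> ee k < \<epsilon> / 32" by (auto simp: eventually_sequentially)
    define s where "s = min (rk k0) (\<epsilon> / (2 * (m * K + 1)))"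
    have mK: "m * K + 1 > 0" using m K by (simp add: add_nonneg_pos)
    have s: "s > 0" using rk(1)[of k0] eps mK by (simp add: s_def)
    have "m' * \<xi> x - \<epsilon> * norm (x - a) \<le> v x" if x: "x \<in> \<Omega>" "norm (x - a) < s" for x
    proof (cases "x = a")
      case True
      then show ?thesis using v x by (simp add: \<xi>_def supersolution_def)
    next
      case False
      define d where "d = norm (x - a)"
      have d: "d > 0" "d < rk k0" "d < \<epsilon> / (2 * (m * K + 1))" using False x by (auto simp: d_def s_def)
      have dr: "d < r" using d(2) rk(2)[of k0] by linarith
      obtain j where "(1/16) ^ j < d / r" using real_arch_pow_inv[of "d / r" "1/16::real"] d r by auto
      then have "rk j \<le> d" using r by (simp add: rk_def field_simps)
      moreover have "rk (Suc j) \<le> rk j" using rk(1)[of j] by (simp add: rk(4))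
      ultimately have ex: "\<exists>j. rk (Suc j) \<le> d" by (intro exI[of _ j]) linarith
      define k where "k = (LEAST j. rk (Suc j) \<le> d)"
      have k1: "rk (Suc k) \<le> d" unfolding k_def by (rule LeastI_ex[OF ex])
      have k2: "d < rk k"
      proof (cases k)
        case 0
        then show ?thesis using dr rk(3) by simp
      next
        case (Suc i)
        have "\<not> rk (Suc i) \<le> d" using not_less_Least[of i "\<lambda>j. rk (Suc j) \<le> d"] Suc by (simp add: k_def)
        then show ?thesis using Suc by simp
      qed
      have "k \<ge> k0"
      proof (rule ccontr)
        assume "\<not> k \<ge> k0"
        then have "(1/16::real) ^ k0 \<le> (1/16) ^ Suc k" by (intro power_decreasing) auto
        then have "rk k0 \<le> rk (Suc k)" unfolding rk_def using r by (intro mult_left_mono) auto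
        then show False using k1 d by linarith
      qed
      then have ek: "ee k * rk k \<le> \<epsilon> / 2 * d"
      proof -
        have "rk k \<le> 16 * d" using k1 by (simp add: rk(4))
        moreover have "ee k \<le> \<epsilon> / 32" using k0[OF \<open>k \<ge> k0\<close>] by simp
        ultimately have "ee k * rk k \<le> \<epsilon> / 32 * (16 * d)" using ee0 rk(1)[of k] eps by (intro mult_mono) auto
        then show ?thesis by simp
      qed
      have "mm k * \<xi> x \<ge> m' * \<xi> x - m * K * d\<^sup>2"
      proof -
        have "\<xi> x \<ge> - (K * d\<^sup>2)" using outside[of x] x dr r by (simp add: d_def \<xi>_def)
        then have "(mm k - m') * \<xi> x \<ge> (mm k - m') * - (K * d\<^sup>2)" using mm_ge[of k] by (intro mult_left_mono) auto
        moreover have "(mm k - m') * (K * d\<^sup>2) \<le> m * (K * d\<^sup>2)" using mm_le[of k] m'0 K by (intro mult_right_mono) auto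
        ultimately show ?thesis by (simp add: algebra_simps)
      qed
      moreover have "m * K * d\<^sup>2 \<le> \<epsilon> / 2 * d"
      proof -
        have "(m * K) * d \<le> (m * K + 1) * d" using d by simp
        also have "\<dots> \<le> (m * K + 1) * (\<epsilon> / (2 * (m * K + 1)))" using d mK by (intro mult_left_mono) auto
        also have "\<dots> = \<epsilon> / 2"
        proof -
          have "D * (\<epsilon> / (2 * D)) = \<epsilon> / 2" if "D > 0" for D using that by simp
          from this[OF mK] show ?thesis .
        qed
        finally have "(m * K * d) * d \<le> \<epsilon> / 2 * d" using d by (intro mult_right_mono) auto
        then show ?thesis by (simp add: power2_eq_square mult.assoc)
      qed
      moreover have "mm k * \<xi> x - ee k * rk k \<le> v x" using level[of k] x k2 by (simp add: d_def)
      moreover have "\<epsilon> * d = \<epsilon> / 2 * d + \<epsilon> / 2 * d" by simp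
      ultimately show ?thesis using ek unfolding d_def[symmetric] by linarith
    qed
    with s show ?thesis by blast
  qed
  then show ?thesis using m'0 unfolding admissible_def m'_def by blast
qed

text \<open>The slope and the relative error with which \<open>one_step\<close>, read off on the ball of radius \<open>\<theta> r\<close>, starts
  the iteration. The terms of \<open>error1\<close> that do not vanish with \<open>r\<close> carry a factor \<open>\<theta>\<close>.\<close>

definition slope1 :: "real \<Rightarrow> real \<Rightarrow> real \<Rightarrow> real \<Rightarrow> real" where
  "slope1 r e m \<delta> = m + cB * \<delta> - 8 * cA * (e + K0 * r)"

definition error1 :: "real \<Rightarrow> real \<Rightarrow> real \<Rightarrow> real \<Rightarrow> real \<Rightarrow> real" where
  "error1 \<theta> r e m \<delta> = (8 * cA * (e + K0 * r) * K * r + 2 * C0 * r powr \<beta> + m * K * r) / \<theta> + (4 * (e + K0 * r) + 2 * cB * \<delta>) * \<theta>"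

lemma improved_slope:
  assumes v: "supersolution W \<Omega> v" and r: "0 < r" "r < r0" "r \<le> 1" "512 * cA * K * r \<le> 1"
    and e: "0 \<le> e" and m: "0 \<le> m" and d: "0 \<le> \<delta>" "(m + \<delta>) * r \<le> 1"
    and H1: "\<And>x. x \<in> \<Omega> \<Longrightarrow> norm (x - a) < r \<Longrightarrow> m * \<xi> x - e * r \<le> v x"
    and H2: "\<And>x. norm (x - (a + (r / 4) *\<^sub>R n)) \<le> r / 16 \<Longrightarrow> m * \<xi> x + \<delta> * r \<le> v x"
    and th: "0 < \<theta>" "\<theta> \<le> 1/2" and s: "0 \<le> slope1 r e m \<delta>" "slope1 r e m \<delta> * (\<theta> * r) \<le> 1"
    and pos: "slope1 r e m \<delta> - C4 * (error1 \<theta> r e m \<delta> + (1 + slope1 r e m \<delta>) * (\<theta> * r) powr \<beta>) \<ge> 0"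
  shows "admissible v (slope1 r e m \<delta> - C4 * (error1 \<theta> r e m \<delta> + (1 + slope1 r e m \<delta>) * (\<theta> * r) powr \<beta>))"
proof (rule iteration[OF v _ _ _ _ _ s _ pos])
  define E where "E = e + K0 * r"
  have E: "E \<ge> 0" using e K0 r by (simp add: E_def)
  have "1 * (K * r) \<le> (512 * cA) * (K * r)" using K r by (intro mult_right_mono) (auto simp: cA_def)
  then have Kr: "K * r \<le> 1" using r(4) by (simp add: mult.assoc)
  have thr: "\<theta> * r \<le> r / 2" using th r by simp
  show "0 < \<theta> * r" using th r by simp
  show "\<theta> * r < r0" "\<theta> * r \<le> 1" using thr r by linarith+
  have "512 * cA * K * (\<theta> * r) \<le> 512 * cA * K * r" using thr r consts_pos K by (intro mult_left_mono) auto
  then show "512 * cA * K * (\<theta> * r) \<le> 1" using r(4) by linarith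
  show "0 \<le> error1 \<theta> r e m \<delta>"
    unfolding error1_def E_def[symmetric] using E r th consts_pos K C0 m d cB
    by (intro add_nonneg_nonneg mult_nonneg_nonneg divide_nonneg_pos) auto
  fix x assume x: "x \<in> \<Omega>" "norm (x - a) < \<theta> * r"
  have "v x \<ge> (m + cB * \<delta> - 8 * (real DIM('a) + 1) * (e + K0 * r)) * \<xi> x
     - 8 * (real DIM('a) + 1) * (e + K0 * r) * K * r\<^sup>2 - (4 * (e + K0 * r) + 2 * cB * \<delta>) * (norm (x - a))\<^sup>2 / r
     - 2 * C0 * r powr (1 + \<beta>) - m * K * r\<^sup>2"
    by (rule one_step[OF v r(1-3) Kr e m d H1]) (use H2 x thr in auto)
  then have 1: "v x \<ge> slope1 r e m \<delta> * \<xi> x - 8 * cA * E * K * r\<^sup>2 - (4 * E + 2 * cB * \<delta>) * (norm (x - a))\<^sup>2 / r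
     - 2 * C0 * r powr (1 + \<beta>) - m * K * r\<^sup>2"
    by (simp add: slope1_def E_def cA_def)
  have "(4 * E + 2 * cB * \<delta>) * (norm (x - a))\<^sup>2 / r \<le> (4 * E + 2 * cB * \<delta>) * (\<theta> * r)\<^sup>2 / r"
    using E d cB r x by (intro divide_right_mono mult_left_mono power_mono) auto
  also have "\<dots> = (4 * E + 2 * cB * \<delta>) * \<theta> * (\<theta> * r)" using r by (simp add: power2_eq_square)
  finally have 2: "(4 * E + 2 * cB * \<delta>) * (norm (x - a))\<^sup>2 / r \<le> (4 * E + 2 * cB * \<delta>) * \<theta> * (\<theta> * r)" .
  have "error1 \<theta> r e m \<delta> * (\<theta> * r) = 8 * cA * E * K * r\<^sup>2 + 2 * C0 * r powr (1 + \<beta>) + m * K * r\<^sup>2 + (4 * E + 2 * cB * \<delta>) * \<theta> * (\<theta> * r)"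
    using th r by (simp add: error1_def E_def[symmetric] powr_add field_simps power2_eq_square)
  with 1 2 show "slope1 r e m \<delta> * \<xi> x - error1 \<theta> r e m \<delta> * (\<theta> * r) \<le> v x" by linarith
qed

lemma powr_at_right_0: "\<theta> > 0 \<Longrightarrow> ((\<lambda>r. (\<theta> * r) powr \<beta>) \<longlongrightarrow> 0) (at_right 0)"
proof (rule tendsto_zero_powrI[where b=\<beta>])
  show "((\<lambda>r. \<theta> * r) \<longlongrightarrow> 0) (at_right 0)" by (intro tendsto_mult_right_zero tendsto_ident_at)
  show "\<theta> > 0 \<Longrightarrow> \<forall>\<^sub>F r in at_right 0. 0 \<le> \<theta> * r" using eventually_at_right_less[of "0::real"] by eventually_elim simp
qed (use \<beta> in auto)

lemma small_radius:
  "eventually (\<lambda>r. 0 < r \<and> r < r0 \<and> r \<le> 1 \<and> 512 * cA * K * r \<le> 1) (at_right 0)"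
proof -
  have c: "512 * cA * K > 0" using consts_pos K by simp
  have "eventually (\<lambda>r. r < min r0 (min 1 (1 / (512 * cA * K)))) (at_right 0)"
    using r0 c by (intro order_tendstoD(2)[OF tendsto_ident_at]) auto
  then show ?thesis using eventually_at_right_less[of "0::real"]
  proof eventually_elim
    case (elim r)
    then have "r < 1 / (512 * cA * K)" by simp
    then have "512 * cA * K * r < 1" using c by (simp add: field_simps)
    with elim show ?case by auto
  qed
qed

text \<open>Take \<open>m = 0\<close>, \<open>e = 0\<close> and \<open>\<delta> = 1 / r\<close> in \<open>improved_slope\<close>. The gain \<open>cB / r\<close> dominates all losses once \<open>\<theta>\<close>
  and then \<open>r\<close> are small.\<close>

lemma hopf:
  "\<exists>r1>0. \<forall>r v. 0 < r \<longrightarrow> r < r1 \<longrightarrow> supersolution W \<Omega> v \<longrightarrow>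
     (\<forall>x. norm (x - (a + (r / 4) *\<^sub>R n)) \<le> r / 16 \<longrightarrow> 1 \<le> v x) \<longrightarrow> (\<exists>m>0. admissible v m)"
proof -
  define \<theta> where "\<theta> = min (1/2) (min (1 / (4 * C4)) (1 / cB))"
  have th: "0 < \<theta>" "\<theta> \<le> 1/2" "\<theta> \<le> 1 / (4 * C4)" "\<theta> \<le> 1 / cB" using consts_pos cB by (auto simp: \<theta>_def)
  have tC: "C4 * (2 * cB * \<theta>) \<le> cB / 2" 
  proof -
    have "C4 * (2 * cB * \<theta>) \<le> C4 * (2 * cB * (1 / (4 * C4)))" using th consts_pos cB by (intro mult_left_mono) auto
    then show ?thesis using consts_pos by simp
  qed
  \<comment> \<open>\<open>r\<close> times the slope that the iteration leaves; it stays positive as \<open>r\<close> tends to 0.\<close>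
  define f where "f r = cB - 8 * cA * K0 * r * r - C4 * ((8 * cA * K0 * r * K * r * r + 2 * C0 * (1 * r) powr \<beta> * r) / \<theta> + (4 * K0 * r * r + 2 * cB) * \<theta>
     + (r + (cB - 8 * cA * K0 * r * r)) * (\<theta> * r) powr \<beta>)" for r
  have "(f \<longlongrightarrow> cB - 8 * cA * K0 * 0 * 0 - C4 * ((8 * cA * K0 * 0 * K * 0 * 0 + 2 * C0 * 0 * 0) / \<theta> + (4 * K0 * 0 * 0 + 2 * cB) * \<theta>
     + (0 + (cB - 8 * cA * K0 * 0 * 0)) * 0)) (at_right 0)"
    unfolding f_def by (intro tendsto_intros tendsto_ident_at powr_at_right_0 th zero_less_one) (use th in simp)
  moreover have "0 < cB - 8 * cA * K0 * 0 * 0 - C4 * ((8 * cA * K0 * 0 * K * 0 * 0 + 2 * C0 * 0 * 0) / \<theta> + (4 * K0 * 0 * 0 + 2 * cB) * \<theta>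
     + (0 + (cB - 8 * cA * K0 * 0 * 0)) * 0)" using tC cB by simp
  ultimately have ev1: "eventually (\<lambda>r. f r > 0) (at_right 0)" by (rule order_tendstoD(1))
  have "((\<lambda>r. cB - 8 * cA * K0 * r * r) \<longlongrightarrow> cB - 8 * cA * K0 * 0 * 0) (at_right 0)"
    by (intro tendsto_intros tendsto_ident_at)
  then have ev2: "eventually (\<lambda>r. cB - 8 * cA * K0 * r * r > 0) (at_right 0)" by (rule order_tendstoD(1)) (use cB in simp)
  from ev1 ev2 small_radius have "eventually (\<lambda>r. f r > 0 \<and> cB - 8 * cA * K0 * r * r > 0 \<and> 0 < r \<and> r < r0 \<and> r \<le> 1 \<and> 512 * cA * K * r \<le> 1) (at_right 0)"
    by eventually_elim auto
  then obtain r1 where r1: "r1 > 0" "\<And>r. 0 < r \<Longrightarrow> r < r1 \<Longrightarrow> f r > 0 \<and> cB - 8 * cA * K0 * r * r > 0 \<and> 0 < r \<and> r < r0 \<and> r \<le> 1 \<and> 512 * cA * K * r \<le> 1"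
    unfolding eventually_at_right_field by auto
  show ?thesis
  proof (rule exI[of _ r1], intro conjI allI impI r1(1))
    fix r v assume r: "0 < r" "r < r1" and v: "supersolution W \<Omega> v"
      and one: "\<forall>x. norm (x - (a + (r / 4) *\<^sub>R n)) \<le> r / 16 \<longrightarrow> 1 \<le> v x"
    note R = r1(2)[OF r]
    let ?S = "slope1 r 0 0 (1 / r)" and ?E = "error1 \<theta> r 0 0 (1 / r)"
    have S: "?S = (cB - 8 * cA * K0 * r * r) / r" using r by (simp add: slope1_def field_simps)
    define t where "t = (\<theta> * r) powr \<beta>"
    define p where "p = r powr \<beta>"
    have fr: "?S - C4 * (?E + (1 + ?S) * (\<theta> * r) powr \<beta>) = f r / r"
      unfolding S error1_def f_def t_def[symmetric] mult_1 p_def[symmetric] using r th by (simp add: field_simps)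
    have pos: "?S - C4 * (?E + (1 + ?S) * (\<theta> * r) powr \<beta>) > 0" unfolding fr using R r by simp
    have "admissible v (?S - C4 * (?E + (1 + ?S) * (\<theta> * r) powr \<beta>))"
    proof (rule improved_slope[OF v])
      show "?S \<ge> 0" unfolding S using R r by simp
      have "?S * (\<theta> * r) = \<theta> * (cB - 8 * cA * K0 * r * r)" unfolding S using r by simp
      also have "\<dots> \<le> (1 / cB) * cB"
        using th cB R consts_pos K0 r by (intro mult_mono) auto
      finally show "?S * (\<theta> * r) \<le> 1" using cB by simp
      show "0 * \<xi> x + 1 / r * r \<le> v x" if "norm (x - (a + (r / 4) *\<^sub>R n)) \<le> r / 16" for x using one that r by simp
      show "0 * \<xi> x - 0 * r \<le> v x" if "x \<in> \<Omega>" for x using v that by (simp add: supersolution_def)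
    qed (use R r th pos in auto)
    with pos show "\<exists>m>0. admissible v m" by blast
  qed
qed

text \<open>The relative error \<open>\<epsilon>\<close> of an admissible slope can be made as small as desired on small balls, so the
  gain \<open>cB \<delta>\<close> from the excess \<open>\<delta>\<close> outweighs all losses.\<close>

lemma growth_of_slope:
  assumes v: "supersolution W \<Omega> v" and m: "admissible v m" and d: "\<delta> > 0"
    and freq: "\<And>s. s > 0 \<Longrightarrow> \<exists>r. 0 < r \<and> r < s \<and> (\<forall>x. norm (x - (a + (r / 4) *\<^sub>R n)) \<le> r / 16 \<longrightarrow> m * \<xi> x + \<delta> * r \<le> v x)"
  shows "\<exists>m'>m. admissible v m'"
proof -
  define \<theta> where "\<theta> = min (1/2) (1 / (8 * C4))"
  have th: "0 < \<theta>" "\<theta> \<le> 1/2" "\<theta> \<le> 1 / (8 * C4)" using consts_pos by (auto simp: \<theta>_def)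
  have tC: "C4 * (2 * cB * \<delta> * \<theta>) \<le> cB * \<delta> / 4" 
  proof -
    have "C4 * (2 * cB * \<delta> * \<theta>) \<le> C4 * (2 * cB * \<delta> * (1 / (8 * C4)))" using th consts_pos cB d by (intro mult_left_mono) auto
    then show ?thesis using consts_pos by (simp add: mult_ac)
  qed
  define \<epsilon> where "\<epsilon> = (cB * \<delta> / 4) / (8 * cA + 4 * C4 * \<theta>)"
  have den: "8 * cA + 4 * C4 * \<theta> > 0" using consts_pos th by (simp add: add_pos_pos)
  have eps: "\<epsilon> > 0" "8 * cA * \<epsilon> + 4 * C4 * \<theta> * \<epsilon> = cB * \<delta> / 4"
  proof -
    show "\<epsilon> > 0" using den cB d by (simp add: \<epsilon>_def)
    have "8 * cA * \<epsilon> + 4 * C4 * \<theta> * \<epsilon> = (8 * cA + 4 * C4 * \<theta>) * \<epsilon>" by (simp add: algebra_simps)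
    also have "\<dots> = cB * \<delta> / 4" 
    proof -
      have "D * (X / D) = X" if "D > 0" for D X :: real using that by simp
      from this[OF den] show ?thesis unfolding \<epsilon>_def .
    qed
    finally show "8 * cA * \<epsilon> + 4 * C4 * \<theta> * \<epsilon> = cB * \<delta> / 4" .
  qed
  have eps2: "8 * cA * \<epsilon> \<le> cB * \<delta> / 4" using eps consts_pos th by (smt (verit) mult_nonneg_nonneg less_imp_le)
  have m0: "m \<ge> 0" using m by (simp add: admissible_def)
  have cd: "cB * \<delta> > 0" using cB d by simp
  obtain s where s: "s > 0" "\<And>x. x \<in> \<Omega> \<Longrightarrow> norm (x - a) < s \<Longrightarrow> m * \<xi> x - \<epsilon> * norm (x - a) \<le> v x"
    using m eps(1) unfolding admissible_def by blast
  \<comment> \<open>the growth of the slope after the iteration that starts at radius \<open>\<theta> r\<close>\<close>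
  define f where "f r = cB * \<delta> - 8 * cA * (\<epsilon> + K0 * r) - C4 * ((8 * cA * (\<epsilon> + K0 * r) * K * r + 2 * C0 * (1 * r) powr \<beta> + m * K * r) / \<theta>
     + (4 * (\<epsilon> + K0 * r) + 2 * cB * \<delta>) * \<theta> + (1 + (m + cB * \<delta> - 8 * cA * (\<epsilon> + K0 * r))) * (\<theta> * r) powr \<beta>)" for r
  let ?l = "cB * \<delta> - 8 * cA * (\<epsilon> + K0 * 0) - C4 * ((8 * cA * (\<epsilon> + K0 * 0) * K * 0 + 2 * C0 * 0 + m * K * 0) / \<theta>
     + (4 * (\<epsilon> + K0 * 0) + 2 * cB * \<delta>) * \<theta> + (1 + (m + cB * \<delta> - 8 * cA * (\<epsilon> + K0 * 0))) * 0)"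
  have "(f \<longlongrightarrow> ?l) (at_right 0)"
    unfolding f_def by (intro tendsto_intros tendsto_ident_at powr_at_right_0 th zero_less_one) (use th in simp)
  moreover have "?l > 0"
  proof -
    have "?l = cB * \<delta> - (8 * cA * \<epsilon> + 4 * C4 * \<theta> * \<epsilon>) - C4 * (2 * cB * \<delta> * \<theta>)" by (simp add: algebra_simps)
    then show ?thesis using eps(2) tC cd by linarith
  qed
  ultimately have ev1: "eventually (\<lambda>r. f r > 0) (at_right 0)" by (rule order_tendstoD(1))
  have "((\<lambda>r. cB * \<delta> - 8 * cA * (\<epsilon> + K0 * r)) \<longlongrightarrow> cB * \<delta> - 8 * cA * (\<epsilon> + K0 * 0)) (at_right 0)"
    by (intro tendsto_intros tendsto_ident_at)
  then have ev2: "eventually (\<lambda>r. cB * \<delta> - 8 * cA * (\<epsilon> + K0 * r) > 0) (at_right 0)" 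
    by (rule order_tendstoD(1)) (use cd eps2 in simp)
  have "((\<lambda>r. (m + \<delta>) * r) \<longlongrightarrow> (m + \<delta>) * 0) (at_right 0)" by (intro tendsto_intros tendsto_ident_at)
  then have ev3: "eventually (\<lambda>r. (m + \<delta>) * r < 1) (at_right 0)" by (rule order_tendstoD(2)) simp
  have "((\<lambda>r. (m + cB * \<delta>) * (\<theta> * r)) \<longlongrightarrow> (m + cB * \<delta>) * (\<theta> * 0)) (at_right 0)" by (intro tendsto_intros tendsto_ident_at)
  then have ev4: "eventually (\<lambda>r. (m + cB * \<delta>) * (\<theta> * r) < 1) (at_right 0)" by (rule order_tendstoD(2)) simp
  have ev5: "eventually (\<lambda>r. r < s) (at_right 0)" using s(1) by (intro order_tendstoD(2)[OF tendsto_ident_at])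
  from ev1 ev2 ev3 ev4 ev5 small_radius have "eventually (\<lambda>r. f r > 0 \<and> cB * \<delta> - 8 * cA * (\<epsilon> + K0 * r) > 0 \<and> (m + \<delta>) * r < 1
     \<and> (m + cB * \<delta>) * (\<theta> * r) < 1 \<and> r < s \<and> 0 < r \<and> r < r0 \<and> r \<le> 1 \<and> 512 * cA * K * r \<le> 1) (at_right 0)"
    by eventually_elim auto
  then obtain r1 where r1: "r1 > 0" "\<And>r. 0 < r \<Longrightarrow> r < r1 \<Longrightarrow> f r > 0 \<and> cB * \<delta> - 8 * cA * (\<epsilon> + K0 * r) > 0 \<and> (m + \<delta>) * r < 1
     \<and> (m + cB * \<delta>) * (\<theta> * r) < 1 \<and> r < s \<and> 0 < r \<and> r < r0 \<and> r \<le> 1 \<and> 512 * cA * K * r \<le> 1"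
    unfolding eventually_at_right_field by auto
  obtain r where r: "0 < r" "r < r1" "\<And>x. norm (x - (a + (r / 4) *\<^sub>R n)) \<le> r / 16 \<Longrightarrow> m * \<xi> x + \<delta> * r \<le> v x"
    using freq[OF r1(1)] by blast
  note R = r1(2)[OF r(1,2)]
  let ?S = "slope1 r \<epsilon> m \<delta>" and ?E = "error1 \<theta> r \<epsilon> m \<delta>"
  have fr: "?S - C4 * (?E + (1 + ?S) * (\<theta> * r) powr \<beta>) = m + f r" by (simp add: slope1_def error1_def f_def)
  have "admissible v (?S - C4 * (?E + (1 + ?S) * (\<theta> * r) powr \<beta>))"
  proof (rule improved_slope[OF v])
    show "?S \<ge> 0" using R m0 by (simp add: slope1_def)
    have "?S \<le> m + cB * \<delta>" using consts_pos eps K0 r by (simp add: slope1_def)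
    then have "?S * (\<theta> * r) \<le> (m + cB * \<delta>) * (\<theta> * r)" using th r by (intro mult_right_mono) auto
    then show "?S * (\<theta> * r) \<le> 1" using R by linarith
    show "?S - C4 * (?E + (1 + ?S) * (\<theta> * r) powr \<beta>) \<ge> 0" unfolding fr using R m0 by linarith
    show "m * \<xi> x - \<epsilon> * r \<le> v x" if "x \<in> \<Omega>" "norm (x - a) < r" for x
    proof -
      have "\<epsilon> * norm (x - a) \<le> \<epsilon> * r" using that eps by (intro mult_left_mono) auto
      moreover have "norm (x - a) < s" using that R by linarith
      ultimately show ?thesis using s(2)[OF that(1)] by linarith
    qed
  qed (use R r th eps m0 d in auto)
  moreover have "?S - C4 * (?E + (1 + ?S) * (\<theta> * r) powr \<beta>) > m" unfolding fr using R by linarith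
  ultimately show ?thesis by blast
qed

end

section \<open>The strong maximum principle\<close>

text \<open>The barrier is a Gaussian around \<open>y\<close>, lowered to be nonpositive at distance \<open>4 s\<close>. On the
  ball of radius \<open>s\<close> it is at most 1, and outside it is subharmonic with Laplacian of order \<open>s\<^bsup>- 2\<^esup>\<close>. The
  potential is Lipschitz continuous, so its oscillation is negligible for small \<open>s\<close>.\<close>

lemma (in morrey) doubling:
  fixes \<Omega> :: "'a set"
  assumes O: "open \<Omega>" "bounded \<Omega>"
  shows "\<exists>s0>0. \<forall>s y v. 0 < s \<longrightarrow> s \<le> s0 \<longrightarrow> cball y (5 * s) \<subseteq> \<Omega> \<longrightarrow> supersolution W \<Omega> v \<longrightarrow>
    (\<forall>x. norm (x - y) \<le> s \<longrightarrow> 1 \<le> v x) \<longrightarrow> (\<exists>c>0. \<forall>x. norm (x - y) \<le> 2 * s \<longrightarrow> c \<le> v x)"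
proof -
  let ?N = "real DIM('a)"
  obtain K0 where K0: "K0 > 0" "\<And>x. \<bar>conv (phis 1) W x\<bar> \<le> K0" using smoothed_bounded by blast
  obtain CL where CL: "CL > 0" "\<And>x y. \<bar>potential x - potential y\<bar> \<le> CL * norm (x - y)" using potential_lipschitz by blast
  have N1: "?N \<ge> 1" using DIM_positive[where 'a='a] by simp
  define gap where "gap = exp (- (4 * ?N)) - exp (- (16 * ?N))"
  have gap: "gap > 0" using N1 by (simp add: gap_def)
  define s0 where "s0 = min (gap / (20 * CL)) (min 1 (?N\<^sup>2 * exp (- (25 * ?N)) / K0))"
  show ?thesis
  proof (rule exI[of _ s0], intro conjI allI impI)
    show "s0 > 0" using gap CL K0 N1 by (simp add: s0_def)
    fix s y v
    assume s: "0 < s" "s \<le> s0" and sub: "cball y (5 * s) \<subseteq> \<Omega>" and v: "supersolution W \<Omega> v"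
      and one: "\<forall>x. norm (x - y) \<le> s \<longrightarrow> 1 \<le> v x"
    have s1: "s \<le> 1" "20 * CL * s \<le> gap" "K0 * s \<le> ?N\<^sup>2 * exp (- (25 * ?N))"
      using s CL K0 by (auto simp: s0_def field_simps)
    define k where "k = ?N / s\<^sup>2"
    have k: "k > 0" using N1 s by (simp add: k_def)
    define Q where "Q x = gauss k y x - (exp (- (16 * ?N)) + 5 * CL * s - potential y)" for x
    have sm: "smooth_on UNIV Q" unfolding Q_def by (intro smooth_on_diff gauss_smooth smooth_on_const open_UNIV)
    have lap: "laplacian Q x = laplacian (gauss k y) x" for x
      unfolding Q_def using laplacian_diff[OF gauss_smooth smooth_on_const] by simp
    have near: "\<bar>potential x - potential y\<bar> \<le> 5 * CL * s" if "norm (x - y) \<le> 5 * s" for x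
    proof -
      have "CL * norm (x - y) \<le> CL * (5 * s)" using that CL(1) by (intro mult_left_mono) auto
      then show ?thesis using CL(2)[of x y] by (simp add: mult_ac)
    qed
    have g_ge: "gauss k y x \<ge> exp (- (c\<^sup>2 * ?N))" if "norm (x - y) \<le> c * s" for x c
    proof -
      have "(norm (x - y))\<^sup>2 \<le> (c * s)\<^sup>2" using that by (intro power_mono) auto
      then have "k * (norm (x - y))\<^sup>2 \<le> k * (c * s)\<^sup>2" using k by (intro mult_left_mono) auto
      also have "k * (c * s)\<^sup>2 = c\<^sup>2 * ?N" using s by (simp add: k_def power_mult_distrib)
      finally show ?thesis by (simp add: gauss_def)
    qed
    have bound: "Q x - potential x \<le> v x" if x: "x \<in> \<Omega>" "norm (x - y) < 5 * s" for x
    proof (rule barrier_pointwise[OF O v K0(2) sm, where ?R1.0="4 * s" and ?R2.0="5 * s" and z=y])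
      show "0 \<le> 4 * s" "4 * s < 5 * s" using s by auto
      show "x \<in> \<Omega>" "norm (x - y) < 5 * s" using x by auto
    next
      fix x assume "x \<in> frontier \<Omega>" "norm (x - y) \<le> 5 * s"
      then have "x \<in> cball y (5 * s)" "x \<notin> \<Omega>" using O(1) by (auto simp: frontier_def interior_open dist_norm norm_minus_commute)
      then have False using sub by blast
      then show "Q x - potential x \<le> 0" ..
    next
      fix x assume x: "x \<in> \<Omega>" "4 * s \<le> norm (x - y)" "norm (x - y) \<le> 5 * s"
      have "(4 * s)\<^sup>2 \<le> (norm (x - y))\<^sup>2" using x s by (intro power_mono) auto
      then have "k * (4 * s)\<^sup>2 \<le> k * (norm (x - y))\<^sup>2" using k by (intro mult_left_mono) auto
      moreover have "k * (4 * s)\<^sup>2 = 16 * ?N" using s by (simp add: k_def power_mult_distrib)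
      ultimately have "gauss k y x \<le> exp (- (16 * ?N))" by (simp add: gauss_def)
      then have "Q x - potential x \<le> 0" using near[OF x(3)] by (simp add: Q_def abs_le_iff)
      then show "Q x - potential x \<le> v x" using v x by (force simp: supersolution_def)
    next
      fix x assume x: "x \<in> \<Omega>" "norm (x - y) < 5 * s"
      have "gauss k y x \<le> 1" using k by (simp add: gauss_def)
      moreover have "exp (- (16 * ?N)) > 0" by simp
      ultimately have le1: "Q x - potential x \<le> 1" using near[OF less_imp_le[OF x(2)]] unfolding Q_def by linarith
      then show "Q x - potential x \<le> 1" .
      show "Q x - potential x \<le> v x \<or> laplacian Q x > K0"
      proof (cases "norm (x - y) \<le> s")
        case True
        then show ?thesis using one le1 by force
      next
        case False
        have "s\<^sup>2 \<le> (norm (x - y))\<^sup>2" using False s by (intro power_mono) auto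
        then have "2 * k * s\<^sup>2 \<le> 2 * k * (norm (x - y))\<^sup>2" using k by (intro mult_left_mono) auto
        moreover have "2 * k * s\<^sup>2 = 2 * ?N" using s by (simp add: k_def)
        ultimately have 1: "?N \<le> 2 * k * (norm (x - y))\<^sup>2 - ?N" by linarith
        have "2 * k * ?N * exp (- (25 * ?N)) \<le> 2 * k * (2 * k * (norm (x - y))\<^sup>2 - ?N) * gauss k y x"
          using 1 k N1 g_ge[of x 5] x by (intro mult_mono mult_left_mono) auto
        then have 2: "2 * k * ?N * exp (- (25 * ?N)) \<le> laplacian Q x" unfolding lap gauss_laplacian .
        have "K0 * s\<^sup>2 \<le> K0 * s" using s1 s K0 by (simp add: power2_eq_square mult_left_le)
        also have "\<dots> < 2 * (?N\<^sup>2 * exp (- (25 * ?N)))" using s1(3) N1 by (smt (verit) exp_gt_zero mult_pos_pos zero_less_power)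
        finally have "K0 < 2 * (?N\<^sup>2 * exp (- (25 * ?N))) / s\<^sup>2" using s by (simp add: field_simps)
        also have "\<dots> = 2 * k * ?N * exp (- (25 * ?N))" by (simp add: k_def power2_eq_square)
        finally show ?thesis using 2 by simp
      qed
    qed
    show "\<exists>c>0. \<forall>x. norm (x - y) \<le> 2 * s \<longrightarrow> c \<le> v x"
    proof (rule exI[of _ "gap / 2"], intro conjI allI impI)
      show "gap / 2 > 0" using gap by simp
      fix x assume x: "norm (x - y) \<le> 2 * s"
      then have n5: "norm (x - y) < 5 * s" using s by linarith
      then have xO: "x \<in> \<Omega>" using sub by (auto simp: dist_norm norm_minus_commute)
      have "exp (- (4 * ?N)) \<le> gauss k y x" using g_ge[OF x] by simp
      then have "gap - 10 * CL * s \<le> Q x - potential x" using near[of x] n5 by (simp add: Q_def gap_def abs_le_iff)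
      then show "gap / 2 \<le> v x" using bound[OF xO n5] s1(2) by linarith
    qed
  qed
qed

text \<open>If \<open>u > 0\<close> at a point \<open>y\<close> close to \<open>x\<close>, then a lower bound near \<open>y\<close> doubles its radius until the
  ball contains \<open>x\<close>. So the set where \<open>u\<close> vanishes is open.\<close>

lemma (in morrey) strong_maximum_principle:
  fixes \<Omega> :: "'a set"
  assumes O: "open \<Omega>" "bounded \<Omega>" "connected \<Omega>"
    and u: "continuous_on \<Omega> u" "\<And>x. x \<in> \<Omega> \<Longrightarrow> 0 \<le> u x" "\<And>c. c > 0 \<Longrightarrow> supersolution W \<Omega> (\<lambda>x. (1 / c) * u x)"
    and pos: "x0 \<in> \<Omega>" "u x0 > 0" and x: "x \<in> \<Omega>"
  shows "u x > 0"
proof -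
  obtain s0 where s0: "s0 > 0" "\<And>s y v. 0 < s \<Longrightarrow> s \<le> s0 \<Longrightarrow> cball y (5 * s) \<subseteq> \<Omega> \<Longrightarrow> supersolution W \<Omega> v \<Longrightarrow>
    (\<forall>x. norm (x - y) \<le> s \<longrightarrow> 1 \<le> v x) \<Longrightarrow> (\<exists>c>0. \<forall>x. norm (x - y) \<le> 2 * s \<longrightarrow> c \<le> v x)"
    using doubling[OF O(1,2)] by blast
  have local: "\<exists>\<rho>>0. ball x \<rho> \<subseteq> \<Omega> \<and> (\<forall>y\<in>ball x \<rho>. u y > 0 \<longrightarrow> u x > 0)" if x: "x \<in> \<Omega>" for x
  proof -
    obtain e where e: "e > 0" "ball x e \<subseteq> \<Omega>" using O(1) x openE by blast
    define S where "S = min s0 (e / 12)"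
    have S: "S > 0" "S \<le> s0" "12 * S \<le> e" using s0 e by (auto simp: S_def)
    have sub: "cball y (5 * s) \<subseteq> \<Omega>" if "dist x y < S" "s \<le> S" for y s
    proof (rule subset_trans[OF _ e(2)], rule subsetI)
      fix z assume "z \<in> cball y (5 * s)"
      then have "dist y z \<le> 5 * S" using that by (simp only: mem_cball)
      with that(1) S dist_triangle[of x z y] show "z \<in> ball x e" by (simp only: mem_ball)
    qed
    have "u x > 0" if y: "y \<in> ball x S" "u y > 0" for y
    proof -
      have yd: "dist x y < S" using y by simp
      have yO: "y \<in> \<Omega>" using sub[OF yd order_refl] S by auto
      have "isCont u y" using u(1) yO O(1) by (simp add: continuous_on_eq_continuous_at)
      then obtain d where d: "d > 0" "\<And>z. dist z y < d \<Longrightarrow> dist (u z) (u y) < u y / 2"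
        using y(2) unfolding continuous_at_eps_delta by (metis dist_commute half_gt_zero)
      define s where "s = min (d / 2) (S / 2)"
      have s: "s > 0" "s < S" "s < d" using d S by (auto simp: s_def)
      have level: "2 ^ j * s \<le> 2 * S \<Longrightarrow> \<exists>c>0. \<forall>z. norm (z - y) \<le> 2 ^ j * s \<longrightarrow> c \<le> u z" for j :: nat
      proof (induction j)
        case 0
        have "u y / 2 \<le> u z" if "norm (z - y) \<le> s" for z
        proof -
          have "dist z y < d" using that s by (simp add: dist_norm)
          from d(2)[OF this] have "\<bar>u z - u y\<bar> < u y / 2" by (simp only: dist_real_def)
          then show ?thesis by linarith
        qed
        then show ?case using y(2) by (intro exI[of _ "u y / 2"]) auto
      next
        case (Suc j)
        then have le: "2 ^ j * s \<le> S" by simp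
        then have "2 ^ j * s \<le> 2 * S" using S(1) by linarith
        from Suc.IH[OF this] obtain c where c: "c > 0" "\<And>z. norm (z - y) \<le> 2 ^ j * s \<Longrightarrow> c \<le> u z" by blast
        have "\<exists>c'>0. \<forall>z. norm (z - y) \<le> 2 * (2 ^ j * s) \<longrightarrow> c' \<le> (1 / c) * u z"
        proof (rule s0(2)[OF _ _ sub[OF yd le] u(3)[OF c(1)]])
          show "0 < 2 ^ j * s" using s by simp
          show "2 ^ j * s \<le> s0" using le S by linarith
          show "\<forall>z. norm (z - y) \<le> 2 ^ j * s \<longrightarrow> 1 \<le> 1 / c * u z" using c by (simp add: field_simps)
        qed
        then obtain c' where c': "c' > 0" "\<And>z. norm (z - y) \<le> 2 * (2 ^ j * s) \<Longrightarrow> c' \<le> (1 / c) * u z" by blast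
        have "c * c' \<le> u z" if "norm (z - y) \<le> 2 ^ Suc j * s" for z
          using c'(2)[of z] that c(1) by (simp add: field_simps)
        then show ?case using c(1) c'(1) by (intro exI[of _ "c * c'"]) auto
      qed
      obtain j0 where "S / s < 2 ^ j0" using real_arch_pow[of 2 "S / s"] by auto
      then have ex: "\<exists>j. S < 2 ^ j * s" using s by (intro exI[of _ j0]) (simp add: field_simps)
      define J where "J = (LEAST j. S < 2 ^ j * s)"
      have J1: "S < 2 ^ J * s" unfolding J_def by (rule LeastI_ex[OF ex])
      have "J \<noteq> 0"
      proof
        assume "J = 0"
        then show False using J1 s by simp
      qed
      then obtain i where i: "J = Suc i" using not0_implies_Suc by blast
      have "\<not> S < 2 ^ i * s" using not_less_Least[of i "\<lambda>j. S < 2 ^ j * s"] i by (simp add: J_def)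
      then have "2 ^ J * s \<le> 2 * S" using i by simp
      from level[OF this] obtain c where c: "c > 0" "\<And>z. norm (z - y) \<le> 2 ^ J * s \<Longrightarrow> c \<le> u z" by blast
      have "norm (x - y) \<le> 2 ^ J * s" using yd J1 by (simp add: dist_norm)
      from c(2)[OF this] c(1) show ?thesis by linarith
    qed
    moreover have "ball x S \<subseteq> \<Omega>" using e S by auto
    ultimately show ?thesis using S(1) by blast
  qed
  define P where "P = {x \<in> \<Omega>. u x > 0}"
  define Z where "Z = {x \<in> \<Omega>. \<not> u x > 0}"
  have "open P"
  proof -
    have "open (\<Omega> \<inter> u -` {0<..})" by (rule continuous_open_preimage[OF u(1) O(1) open_greaterThan])
    moreover have "P = \<Omega> \<inter> u -` {0<..}" by (auto simp: P_def)
    ultimately show ?thesis by simp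
  qed
  moreover have "open Z"
    unfolding open_contains_ball
  proof
    fix x assume "x \<in> Z"
    then have x: "x \<in> \<Omega>" "\<not> u x > 0" by (auto simp: Z_def)
    from local[OF x(1)] obtain \<rho> where "\<rho> > 0" "ball x \<rho> \<subseteq> \<Omega>" "\<forall>y\<in>ball x \<rho>. u y > 0 \<longrightarrow> u x > 0" by blast
    then show "\<exists>e>0. ball x e \<subseteq> Z" using x(2) by (intro exI[of _ \<rho>]) (auto simp: Z_def)
  qed
  moreover have "P \<inter> Z \<inter> \<Omega> = {}" "\<Omega> \<subseteq> P \<union> Z" by (auto simp: P_def Z_def)
  ultimately have "P \<inter> \<Omega> = {} \<or> Z \<inter> \<Omega> = {}" using connectedD[OF O(3)] by blast
  moreover have "x0 \<in> P" using pos by (simp add: P_def)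
  ultimately have "Z \<inter> \<Omega> = {}" using pos(1) by blast
  then show ?thesis using x by (auto simp: Z_def)
qed

section \<open>A Harnack inequality and existence of the slope\<close>

lemma phis_coordinate_mean:
  fixes x a n :: "'a::euclidean_space"
  assumes t: "\<tau> > 0"
  shows "integrable lebesgue (\<lambda>y. ((y - a) \<bullet> n) * phis \<tau> (x - y))"
    "(\<integral>y. ((y - a) \<bullet> n) * phis \<tau> (x - y) \<partial>lebesgue) = (x - a) \<bullet> n"
proof -
  have eq: "phis \<tau> (x - y) = phis \<tau> (1 *\<^sub>R (y - x))" for y using phis_minus[of \<tau> "y - x"] by simp
  have T: "(\<lambda>y. phis \<tau> (x - y)) \<in> TF" unfolding eq by (rule TF_scale[OF phis_TF[OF t]]) simp
  have gen: "(\<lambda>y. ((y - c) \<bullet> n) * phis \<tau> (x - y)) \<in> TF" for c by (rule TF_mult[OF T smooth_on_inner])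
  show 1: "integrable lebesgue (\<lambda>y. ((y - a) \<bullet> n) * phis \<tau> (x - y))" by (rule TF_integrable_lebesgue[OF gen])
  define h where "h y = ((y - x) \<bullet> n) * phis \<tau> (x - y)" for y
  have hT: "h \<in> TF" unfolding h_def by (rule gen)
  have "(\<integral>y. h y \<partial>lborel) = (\<integral>y. h (2 *\<^sub>R x + (-1) *\<^sub>R y) \<partial>lborel)"
    using lborel_integral_affine[of "-1" h "2 *\<^sub>R x"] TF_measurable[OF hT] by simp
  also have "(\<lambda>y. h (2 *\<^sub>R x + (-1) *\<^sub>R y)) = (\<lambda>y. - h y)"
  proof
    fix y
    have "2 *\<^sub>R x + (-1) *\<^sub>R y - x = - (y - x)" "x - (2 *\<^sub>R x + (-1) *\<^sub>R y) = - (x - y)" by (simp_all add: scaleR_2)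
    then show "h (2 *\<^sub>R x + (-1) *\<^sub>R y) = - h y" by (simp only: h_def phis_minus inner_minus_left)
  qed
  finally have h0: "(\<integral>y. h y \<partial>lborel) = 0" by simp
  have hl: "integrable lebesgue h" "(\<integral>y. h y \<partial>lebesgue) = 0"
    using TF_integrable_lebesgue[OF hT] h0 TF_measurable[OF hT] by (auto simp: integral_completion)
  have "(\<integral>y. ((y - a) \<bullet> n) * phis \<tau> (x - y) \<partial>lebesgue) = (\<integral>y. h y + ((x - a) \<bullet> n) * phis \<tau> (x - y) \<partial>lebesgue)"
    by (rule Bochner_Integration.integral_cong) (auto simp: h_def inner_diff_left algebra_simps)
  also have "\<dots> = (x - a) \<bullet> n"
    using hl phis_lebesgue[OF t, of x] by simp
  finally show "(\<integral>y. ((y - a) \<bullet> n) * phis \<tau> (x - y) \<partial>lebesgue) = (x - a) \<bullet> n" .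
qed

text \<open>The mollifier has a positive minimum over a compact part of its open support. Since \<open>z'\<close> is arbitrary,
  a mean of a nonnegative function dominates means with other centres.\<close>

lemma phis_compare: "\<exists>c>0. \<forall>t (z::'a::euclidean_space) (z'::'a). t > 0 \<longrightarrow> norm z \<le> 3 / 4 * t \<longrightarrow> c * phis (t / 4) z' \<le> phis t z"
proof -
  obtain B where B: "B > 0" "\<And>z::'a. \<bar>moll z\<bar> \<le> B" using TF_bounded[OF moll_TF] by blast
  have "\<exists>z\<in>cball (0::'a) (3/4). \<forall>y\<in>cball (0::'a) (3/4). moll z \<le> moll y"
    by (rule continuous_attains_inf[OF compact_cball _ continuous_on_subset[OF test_functions_D(2)[OF moll_TF] subset_UNIV]]) simp
  then obtain z0 :: 'a where z0: "norm z0 \<le> 3/4" "\<And>y::'a. norm y \<le> 3/4 \<Longrightarrow> moll z0 \<le> moll y" by auto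
  define \<mu> where "\<mu> = moll z0"
  have mu: "\<mu> > 0" unfolding \<mu>_def by (rule moll_pos) (use z0 in simp)
  show ?thesis
  proof (rule exI[of _ "\<mu> / (4 ^ DIM('a) * B)"], intro conjI allI impI)
    show "0 < \<mu> / (4 ^ DIM('a) * B)" using mu B by simp
    fix t :: real and z z' :: 'a assume t: "t > 0" "norm z \<le> 3 / 4 * t"
    have "norm ((1 / t) *\<^sub>R z) \<le> 3 / 4" using t by (simp add: field_simps)
    then have 1: "\<mu> \<le> moll ((1 / t) *\<^sub>R z)" unfolding \<mu>_def by (rule z0(2))
    have "\<mu> / (4 ^ DIM('a) * B) * phis (t / 4) z' \<le> \<mu> / (4 ^ DIM('a) * B) * ((1 / (t / 4)) ^ DIM('a) * B)"
      unfolding phis_def using mu B t abs_le_D1[OF B(2)] by (intro mult_left_mono) auto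
    also have "\<dots> = (1 / t) ^ DIM('a) * \<mu>" using B t by (simp add: field_simps power_divide power_mult_distrib)
    also have "\<dots> \<le> phis t z" unfolding phis_def using 1 t by (intro mult_left_mono) auto
    finally show "\<mu> / (4 ^ DIM('a) * B) * phis (t / 4) z' \<le> phis t z" .
  qed
qed

context boundary_point
begin

lemma axis_point:
  assumes "0 < r" "r < r0" "K * r \<le> 1" "norm (x - (a + (r / 4) *\<^sub>R n)) < r / 4"
  shows "x \<in> \<Omega>" "norm (x - a) < r"
proof -
  define y where "y = x - a"
  have yn: "x - (a + (r / 4) *\<^sub>R n) = y - (r / 4) *\<^sub>R n" by (simp add: y_def)
  have nn: "n \<bullet> n = 1" using n by (simp add: norm_eq_1)
  have "norm y \<le> norm (y - (r / 4) *\<^sub>R n) + norm ((r / 4) *\<^sub>R n)" using norm_triangle_ineq[of "y - (r / 4) *\<^sub>R n" "(r / 4) *\<^sub>R n"] by simp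
  then have y2: "norm y < r / 2" using assms(1,4) n unfolding yn by simp
  then show "norm (x - a) < r" using assms(1) by (simp add: y_def)
  have "(norm (y - (r / 4) *\<^sub>R n))\<^sup>2 < (r / 4)\<^sup>2" using assms unfolding yn by (intro power_strict_mono) auto
  moreover have "(norm (y - (r / 4) *\<^sub>R n))\<^sup>2 = (norm y)\<^sup>2 - 2 * (r / 4) * (y \<bullet> n) + (r / 4)\<^sup>2"
    unfolding power2_norm_eq_inner using nn
    by (simp add: inner_diff_left inner_diff_right inner_commute power2_eq_square algebra_simps)
  ultimately have 1: "(norm y)\<^sup>2 < (r / 2) * (y \<bullet> n)" by simp
  have "K * r * (norm y)\<^sup>2 \<le> 1 * (norm y)\<^sup>2" using assms by (intro mult_right_mono) auto
  then have "r * (K * (norm y)\<^sup>2) < r * ((y \<bullet> n) / 2)" using 1 by (simp add: mult_ac)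
  then have "K * (norm y)\<^sup>2 < (y \<bullet> n) / 2" using assms(1) by simp
  moreover have "0 \<le> K * (norm y)\<^sup>2" using K by simp
  ultimately have "K * (norm y)\<^sup>2 < y \<bullet> n" by linarith
  then show "x \<in> \<Omega>" using y2 assms by (intro inside) (auto simp: y_def)
qed

lemma axis_in_domain:
  assumes "0 < t" "4 * t < r0" "K * (4 * t) \<le> 1" shows "a + t *\<^sub>R n \<in> \<Omega>"
  using axis_point(1)[of "4 * t" "a + t *\<^sub>R n"] assms by simp

lemma axis_\<xi>: "\<xi> (a + t *\<^sub>R n) = t"
  using n by (simp add: \<xi>_def norm_eq_1)

text \<open>The function \<open>w = u - m \<xi> + e r\<close> is nonnegative near \<open>x1 = a + (r / 4) n\<close>. Its mean around \<open>x\<close> at scale \<open>r / 8\<close>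
  is at least \<open>c\<close> times its mean around \<open>x1\<close> at scale \<open>r / 32\<close>, since the first kernel dominates \<open>c\<close> times
  the second one. Affine functions equal their means, and \<open>u\<close> differs from its means by \<open>O(r\<^bsup>1 + 2 \<beta>\<^esup>)\<close>.\<close>

lemma harnack_at_boundary:
  assumes iu: "integrable lebesgue (\<lambda>x. indicator \<Omega> x * u x)"
    and mv: "\<And>x \<tau>. 0 < \<tau> \<Longrightarrow> \<tau> \<le> 1 \<Longrightarrow> cball x \<tau> \<subseteq> \<Omega> \<Longrightarrow>
       \<bar>u x - conv (phis \<tau>) (\<lambda>x. indicator \<Omega> x * u x) x\<bar> \<le> Cm * \<tau> powr (1 + 2 * \<beta>)" and Cm: "Cm > 0"
    and c: "c > 0" "\<And>t z z'. t > 0 \<Longrightarrow> norm z \<le> 3 / 4 * t \<Longrightarrow> c * phis (t / 4) (z'::'a) \<le> phis t (z::'a)"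
    and r: "0 < r" "r < r0" "r \<le> 1" "K * r \<le> 1"
    and H1: "\<And>x. x \<in> \<Omega> \<Longrightarrow> norm (x - a) < r \<Longrightarrow> m * \<xi> x - e * r \<le> u x"
    and top: "u (a + (r / 4) *\<^sub>R n) \<ge> (m + \<eta>) * (r / 4)"  and e: "e \<ge> 0"
    and x: "norm (x - (a + (r / 4) *\<^sub>R n)) \<le> r / 16"
  shows "u x \<ge> m * \<xi> x - e * r + c * \<eta> * r / 4 - (1 + c) * Cm * r powr (1 + 2 * \<beta>)"
proof -
  let ?u0 = "\<lambda>x. indicator \<Omega> x * u x"
  define x1 where "x1 = a + (r / 4) *\<^sub>R n"
  define T where "T = r / 8"
  have T: "0 < T" "T \<le> 1" "T / 4 \<le> 1" "0 < T / 4" using r by (auto simp: T_def)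
  have inside_ball: "y \<in> \<Omega> \<and> norm (y - a) < r" if "norm (y - x1) < r / 4" for y
    using axis_point[OF r(1,2,4)] that by (simp add: x1_def)
  have sub1: "cball x1 (T / 4) \<subseteq> \<Omega>"
  proof
    fix y assume "y \<in> cball x1 (T / 4)"
    then have "norm (y - x1) < r / 4" using r by (simp add: dist_norm norm_minus_commute T_def)
    then show "y \<in> \<Omega>" using inside_ball by blast
  qed
  have close: "norm (y - x1) < r / 4" if "norm (x - y) \<le> T" for y
  proof -
    have "norm (y - x1) \<le> norm (y - x) + norm (x - x1)" using norm_triangle_ineq[of "y - x" "x - x1"] by simp
    then show ?thesis using that x r by (simp add: norm_minus_commute x1_def T_def)
  qed
  have sub2: "cball x T \<subseteq> \<Omega>"
  proof
    fix y assume "y \<in> cball x T"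
    then have "norm (x - y) \<le> T" by (simp add: dist_norm)
    then show "y \<in> \<Omega>" using inside_ball close by blast
  qed
  define w where "w y = ?u0 y - m * \<xi> y + e * r" for y
  have w0: "w y \<ge> 0" if "norm (y - x1) < r / 4" for y
    using inside_ball[OF that] H1[of y] by (simp add: w_def)
  have mean: "integrable lebesgue (\<lambda>y. w y * phis t (z - y))"
    "(\<integral>y. w y * phis t (z - y) \<partial>lebesgue) = conv (phis t) ?u0 z - m * \<xi> z + e * r" if t: "t > 0" for t z
  proof -
    have i1: "integrable lebesgue (\<lambda>y. ?u0 y * phis t (z - y))" by (rule conv_integrable[OF phis_TF[OF t] iu])
    note i2 = phis_coordinate_mean[OF t, of a n z]
    note i3 = phis_lebesgue[OF t, of z]
    have eq: "w y * phis t (z - y) = ?u0 y * phis t (z - y) - m * (((y - a) \<bullet> n) * phis t (z - y)) + e * r * phis t (z - y)" for y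
      by (simp add: w_def \<xi>_def algebra_simps)
    show "integrable lebesgue (\<lambda>y. w y * phis t (z - y))" unfolding eq
      by (intro Bochner_Integration.integrable_add Bochner_Integration.integrable_diff i1 integrable_mult_right i2(1) i3(1))
    have "(\<integral>y. w y * phis t (z - y) \<partial>lebesgue) = (\<integral>y. ?u0 y * phis t (z - y) \<partial>lebesgue)
       - (\<integral>y. m * (((y - a) \<bullet> n) * phis t (z - y)) \<partial>lebesgue) + (\<integral>y. e * r * phis t (z - y) \<partial>lebesgue)"
      unfolding eq by (subst Bochner_Integration.integral_add, intro Bochner_Integration.integrable_diff i1 integrable_mult_right i2(1), intro integrable_mult_right i3(1),
          subst Bochner_Integration.integral_diff, intro i1, intro integrable_mult_right i2(1), rule refl)
    also have "(\<integral>y. m * (((y - a) \<bullet> n) * phis t (z - y)) \<partial>lebesgue) = m * \<xi> z"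
      unfolding \<xi>_def using i2(2) by (simp only: Bochner_Integration.integral_mult_right_zero)
    also have "(\<integral>y. e * r * phis t (z - y) \<partial>lebesgue) = e * r" using i3(2) by (simp only: Bochner_Integration.integral_mult_right_zero)
    finally show "(\<integral>y. w y * phis t (z - y) \<partial>lebesgue) = conv (phis t) ?u0 z - m * \<xi> z + e * r" by (simp add: conv_def)
  qed
  have "c * (\<integral>y. w y * phis (T / 4) (x1 - y) \<partial>lebesgue) = (\<integral>y. c * (w y * phis (T / 4) (x1 - y)) \<partial>lebesgue)" by simp
  also have "\<dots> \<le> (\<integral>y. w y * phis T (x - y) \<partial>lebesgue)"
  proof (rule integral_mono)
    show "integrable lebesgue (\<lambda>y. c * (w y * phis (T / 4) (x1 - y)))" by (intro integrable_mult_right mean(1) T)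
    show "integrable lebesgue (\<lambda>y. w y * phis T (x - y))" by (rule mean(1)[OF T(1)])
    fix y
    show "c * (w y * phis (T / 4) (x1 - y)) \<le> w y * phis T (x - y)"
    proof (cases "norm (x1 - y) < T / 4")
      case True
      have "norm (x - y) \<le> norm (x - x1) + norm (x1 - y)" using norm_triangle_ineq[of "x - x1" "x1 - y"] by simp
      then have n1: "norm (x - y) \<le> 3 / 4 * T" using x True by (simp add: x1_def T_def)
      have "w y \<ge> 0" using w0[OF close] n1 T by simp
      from mult_left_mono[OF c(2)[OF T(1) n1] this]
      have "w y * (c * phis (T / 4) (x1 - y)) \<le> w y * phis T (x - y)" .
      then show ?thesis by (simp add: mult_ac)
    next
      case False
      then have z: "phis (T / 4) (x1 - y) = 0" by (intro phis_eq_0 T) simp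
      have "0 \<le> w y * phis T (x - y)"
      proof (cases "norm (x - y) < T")
        case True
        show ?thesis by (rule mult_nonneg_nonneg[OF w0[OF close[OF less_imp_le[OF True]]] phis_nonneg[OF T(1)]])
      next
        case False
        then show ?thesis using phis_eq_0[OF T(1), of "x - y"] by simp
      qed
      then show ?thesis using z by simp
    qed
  qed
  finally have 1: "c * (conv (phis (T / 4)) ?u0 x1 - m * \<xi> x1 + e * r) \<le> conv (phis T) ?u0 x - m * \<xi> x + e * r"
    unfolding mean(2)[OF T(1)] mean(2)[OF T(4)] .
  have pw: "t powr (1 + 2 * \<beta>) \<le> r powr (1 + 2 * \<beta>)" if "0 < t" "t \<le> r" for t
    using that \<beta> by (intro powr_mono2) auto
  have 2: "conv (phis T) ?u0 x \<le> u x + Cm * r powr (1 + 2 * \<beta>)"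
  proof -
    have "T powr (1 + 2 * \<beta>) \<le> r powr (1 + 2 * \<beta>)" using T r by (intro pw) (auto simp: T_def)
    then have "Cm * T powr (1 + 2 * \<beta>) \<le> Cm * r powr (1 + 2 * \<beta>)" using Cm by (intro mult_left_mono) auto
    then show ?thesis using mv[OF T(1,2) sub2] by linarith
  qed
  have 3: "conv (phis (T / 4)) ?u0 x1 \<ge> u x1 - Cm * r powr (1 + 2 * \<beta>)"
  proof -
    have "(T / 4) powr (1 + 2 * \<beta>) \<le> r powr (1 + 2 * \<beta>)" using T r by (intro pw) (auto simp: T_def)
    then have "Cm * (T / 4) powr (1 + 2 * \<beta>) \<le> Cm * r powr (1 + 2 * \<beta>)" using Cm by (intro mult_left_mono) auto
    then show ?thesis using mv[OF T(4,3) sub1] by linarith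
  qed
  have "\<xi> x1 = r / 4" unfolding x1_def by (rule axis_\<xi>)
  then have "conv (phis (T / 4)) ?u0 x1 - m * \<xi> x1 + e * r \<ge> (m + \<eta>) * (r / 4) - Cm * r powr (1 + 2 * \<beta>) - m * (r / 4)"
  proof -
    assume xi: "\<xi> x1 = r / 4"
    have "0 \<le> e * r" using e r by simp
    moreover have "(m + \<eta>) * (r / 4) \<le> u x1" using top by (simp only: x1_def)
    ultimately show ?thesis unfolding xi using 3 by linarith
  qed
  then have "c * ((m + \<eta>) * (r / 4) - Cm * r powr (1 + 2 * \<beta>) - m * (r / 4)) \<le> c * (conv (phis (T / 4)) ?u0 x1 - m * \<xi> x1 + e * r)"
    using c(1) by (intro mult_left_mono) auto
  moreover have "c * ((m + \<eta>) * (r / 4) - Cm * r powr (1 + 2 * \<beta>) - m * (r / 4)) = c * \<eta> * r / 4 - c * Cm * r powr (1 + 2 * \<beta>)"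
    by (simp add: algebra_simps)
  moreover have "(1 + c) * Cm * r powr (1 + 2 * \<beta>) = Cm * r powr (1 + 2 * \<beta>) + c * Cm * r powr (1 + 2 * \<beta>)" by (simp add: algebra_simps)
  ultimately show ?thesis using 1 2 by linarith
qed

text \<open>The limit is the largest admissible slope. A larger upper limit would contradict maximality by
  \<open>harnack_at_boundary\<close> and \<open>growth_of_slope\<close>.\<close>

lemma normal_slope_exists:
  assumes super: "supersolution W \<Omega> u" and iu: "integrable lebesgue (\<lambda>x. indicator \<Omega> x * u x)"
    and mv: "\<And>x \<tau>. 0 < \<tau> \<Longrightarrow> \<tau> \<le> 1 \<Longrightarrow> cball x \<tau> \<subseteq> \<Omega> \<Longrightarrow>
       \<bar>u x - conv (phis \<tau>) (\<lambda>x. indicator \<Omega> x * u x) x\<bar> \<le> Cm * \<tau> powr (1 + 2 * \<beta>)" and Cm: "Cm > 0"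
    and upper: "t0 > 0" "\<And>t. 0 < t \<Longrightarrow> t < t0 \<Longrightarrow> a + t *\<^sub>R n \<in> \<Omega> \<Longrightarrow> u (a + t *\<^sub>R n) \<le> C * t"
  shows "\<exists>D. ((\<lambda>t. u (a + t *\<^sub>R n) / t) \<longlongrightarrow> D) (at_right 0) \<and> (\<forall>m. admissible u m \<longrightarrow> m \<le> D)"
proof -
  obtain c where c: "c > 0" "\<And>t z z'. t > 0 \<Longrightarrow> norm z \<le> 3 / 4 * t \<Longrightarrow> c * phis (t / 4) (z'::'a) \<le> phis t (z::'a)"
    using phis_compare by blast
  have ax: "eventually (\<lambda>t. 0 < t \<and> t < s \<and> 4 * t < r0 \<and> 4 * t \<le> 1 \<and> K * (4 * t) \<le> 1 \<and> a + t *\<^sub>R n \<in> \<Omega>) (at_right 0)" if "s > 0" for s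
  proof -
    have "eventually (\<lambda>t. t < min s (min (r0 / 4) (min (1/4) (1 / (4 * K))))) (at_right 0)"
      using that r0 K by (intro order_tendstoD(2)[OF tendsto_ident_at]) auto
    then show ?thesis using eventually_at_right_less[of "0::real"]
    proof eventually_elim
      case (elim t)
      then have 1: "0 < t" "4 * t < r0" "4 * t \<le> 1" by auto
      have "K * (4 * t) \<le> 1" using elim K by (simp add: field_simps)
      with 1 axis_in_domain[of t] elim show ?case by auto
    qed
  qed
  have nax: "norm (a + t *\<^sub>R n - a) = t" if "t > 0" for t using n that by simp
  define S where "S = {m. admissible u m}"
  have "admissible u 0"
    using super unfolding admissible_def supersolution_def by (auto intro!: exI[of _ 1] simp: order_trans[of "- _" 0])
  then have S0: "0 \<in> S" by (simp add: S_def)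
  have bdd: "m \<le> C + 1" if adm: "admissible u m" for m
  proof -
    obtain s where s: "s > 0" "\<And>x. x \<in> \<Omega> \<Longrightarrow> norm (x - a) < s \<Longrightarrow> m * \<xi> x - 1 * norm (x - a) \<le> u x"
      using adm[unfolded admissible_def, THEN conjunct2, THEN spec[of _ "1::real"]] by auto
    have "eventually (\<lambda>t. m \<le> C + 1) (at_right (0::real))"
      using ax[of "min s t0"] s(1) upper(1)
    proof -
      have "eventually (\<lambda>t. 0 < t \<and> t < min s t0 \<and> 4 * t < r0 \<and> 4 * t \<le> 1 \<and> K * (4 * t) \<le> 1 \<and> a + t *\<^sub>R n \<in> \<Omega>) (at_right 0)"
        by (rule ax) (use s(1) upper(1) in simp)
      then show ?thesis
      proof eventually_elim
        case (elim t)
        have "m * t - 1 * t \<le> u (a + t *\<^sub>R n)" using s(2)[of "a + t *\<^sub>R n"] elim n by (simp add: axis_\<xi>)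
        also have "\<dots> \<le> C * t" using upper(2) elim by simp
        finally have "m * t \<le> (C + 1) * t" by (simp add: algebra_simps)
        then show ?case using elim by simp
      qed
    qed
    then show ?thesis by simp
  qed
  then have bS: "bdd_above S" by (auto simp: S_def bdd_above_def)
  define m0 where "m0 = Sup S"
  have m0_ge: "m \<le> m0" if "admissible u m" for m
    unfolding m0_def by (rule cSup_upper[OF _ bS]) (use that in \<open>simp add: S_def\<close>)
  have m00: "m0 \<ge> 0" using m0_ge \<open>admissible u 0\<close> by blast
  have adm0: "admissible u m0"
    unfolding admissible_def
  proof (intro conjI m00 allI impI)
    fix \<epsilon> :: real assume eps: "\<epsilon> > 0"
    have "m0 - \<epsilon> / 2 < Sup S" using eps by (simp add: m0_def)
    then obtain m where m: "m \<in> S" "m0 - \<epsilon> / 2 < m" using less_cSup_iff[of S "m0 - \<epsilon> / 2"] S0 bS by blast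
    then obtain s where s: "s > 0" "\<And>x. x \<in> \<Omega> \<Longrightarrow> norm (x - a) < s \<Longrightarrow> m * \<xi> x - (\<epsilon> / 2) * norm (x - a) \<le> u x"
      using m(1)[unfolded S_def mem_Collect_eq admissible_def, THEN conjunct2, THEN spec[of _ "\<epsilon> / 2"]] eps by auto
    show "\<exists>s>0. \<forall>x\<in>\<Omega>. norm (x - a) < s \<longrightarrow> m0 * \<xi> x - \<epsilon> * norm (x - a) \<le> u x"
    proof (rule exI[of _ s], intro conjI s(1) ballI impI)
      fix x assume x: "x \<in> \<Omega>" "norm (x - a) < s"
      have "m \<le> m0" using m(1) m0_ge by (simp add: S_def)
      have "(m0 - m) * \<xi> x \<le> (m0 - m) * norm (x - a)" using \<open>m \<le> m0\<close> \<xi>_le[of x] by (intro mult_left_mono) auto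
      also have "\<dots> \<le> (\<epsilon> / 2) * norm (x - a)" using m(2) by (intro mult_right_mono) auto
      finally show "m0 * \<xi> x - \<epsilon> * norm (x - a) \<le> u x" using s(2)[OF x] by (simp add: algebra_simps)
    qed
  qed
  have lower: "eventually (\<lambda>t. m0 - \<eta> < u (a + t *\<^sub>R n) / t) (at_right 0)" if eta: "\<eta> > 0" for \<eta>
  proof -
    have "\<eta> / 2 > 0" using eta by simp
    then obtain s where s: "s > 0" "\<And>x. x \<in> \<Omega> \<Longrightarrow> norm (x - a) < s \<Longrightarrow> m0 * \<xi> x - (\<eta> / 2) * norm (x - a) \<le> u x"
      using adm0 unfolding admissible_def by blast
    show ?thesis using ax[OF s(1)]
    proof eventually_elim
      case (elim t)
      have "m0 * t - (\<eta> / 2) * t \<le> u (a + t *\<^sub>R n)" using s(2)[of "a + t *\<^sub>R n"] elim n by (simp add: axis_\<xi>)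
      moreover have "(m0 - \<eta>) * t < m0 * t - (\<eta> / 2) * t" using elim eta by (simp add: algebra_simps)
      ultimately have "(m0 - \<eta>) * t < u (a + t *\<^sub>R n)" by linarith
      then show ?case using elim by (simp add: less_divide_eq)
    qed
  qed
  have upper': "eventually (\<lambda>t. u (a + t *\<^sub>R n) / t < m0 + \<eta>) (at_right 0)" if eta: "\<eta> > 0" for \<eta>
  proof (rule ccontr)
    assume neg: "\<not> eventually (\<lambda>t. u (a + t *\<^sub>R n) / t < m0 + \<eta>) (at_right 0)"
    \<comment> \<open>The Harnack inequality yields an excess \<open>c \<eta> r / 4\<close>; half of it absorbs the two error terms.\<close>
    define \<delta> where "\<delta> = c * \<eta> / 8"
    have d: "\<delta> > 0" using c eta by (simp add: \<delta>_def)
    have e2: "c * \<eta> / 16 > 0" using c eta by simp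
    then obtain s1 where s1: "s1 > 0" "\<And>x. x \<in> \<Omega> \<Longrightarrow> norm (x - a) < s1 \<Longrightarrow> m0 * \<xi> x - (c * \<eta> / 16) * norm (x - a) \<le> u x"
      using adm0 unfolding admissible_def by blast
    have "((\<lambda>r. (1 + c) * Cm * r powr (2 * \<beta>)) \<longlongrightarrow> (1 + c) * Cm * 0) (at_right 0)"
      using \<beta> eventually_at_right_less[of "0::real"]
      by (intro tendsto_intros tendsto_zero_powrI[where b="2 * \<beta>"] tendsto_ident_at) (auto elim: eventually_mono)
    then have "eventually (\<lambda>r. (1 + c) * Cm * r powr (2 * \<beta>) < c * \<eta> / 16) (at_right 0)"
      by (rule order_tendstoD(2)) (use e2 in simp)
    then obtain s2 where s2: "s2 > 0" "\<And>r. 0 < r \<Longrightarrow> r < s2 \<Longrightarrow> (1 + c) * Cm * r powr (2 * \<beta>) < c * \<eta> / 16"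
      unfolding eventually_at_right_field by auto
    have "\<exists>m'>m0. admissible u m'"
    proof (rule growth_of_slope[OF super adm0 d])
      fix s :: real assume s: "s > 0"
      define s3 where "s3 = min (s / 4) (min (s1 / 4) (s2 / 4))"
      have s3: "s3 > 0" using s s1 s2 by (simp add: s3_def)
      have "\<exists>t. (0 < t \<and> t < s3 \<and> 4 * t < r0 \<and> 4 * t \<le> 1 \<and> K * (4 * t) \<le> 1 \<and> a + t *\<^sub>R n \<in> \<Omega>) \<and> \<not> u (a + t *\<^sub>R n) / t < m0 + \<eta>"
      proof (rule ccontr)
        assume "\<not> ?thesis"
        then have "eventually (\<lambda>t. u (a + t *\<^sub>R n) / t < m0 + \<eta>) (at_right 0)"
          by (intro eventually_mono[OF ax[OF s3]]) blast
        with neg show False ..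
      qed
      then obtain t where t: "0 < t" "t < s3" "4 * t < r0" "4 * t \<le> 1" "K * (4 * t) \<le> 1" "\<not> u (a + t *\<^sub>R n) / t < m0 + \<eta>" by blast
      \<comment> \<open>The point \<open>a + t n\<close> is then the centre of the ball in \<open>growth_of_slope\<close>.\<close>
      define r where "r = 4 * t"
      have r: "0 < r" "r < r0" "r \<le> 1" "K * r \<le> 1" "r < s" "r < s1" "r < s2" using t by (auto simp: r_def s3_def)
      show "\<exists>r. 0 < r \<and> r < s \<and> (\<forall>x. norm (x - (a + (r / 4) *\<^sub>R n)) \<le> r / 16 \<longrightarrow> m0 * \<xi> x + \<delta> * r \<le> u x)"
      proof (rule exI[of _ r], intro conjI r allI impI)
        fix x assume x: "norm (x - (a + (r / 4) *\<^sub>R n)) \<le> r / 16"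
        have "u x \<ge> m0 * \<xi> x - (c * \<eta> / 16) * r + c * \<eta> * r / 4 - (1 + c) * Cm * r powr (1 + 2 * \<beta>)"
        proof (rule harnack_at_boundary[OF iu mv Cm c r(1-4) _ _ _ x])
          fix y assume y: "y \<in> \<Omega>" "norm (y - a) < r"
          have "(c * \<eta> / 16) * norm (y - a) \<le> (c * \<eta> / 16) * r" using y e2 by (intro mult_left_mono) auto
          then show "m0 * \<xi> y - (c * \<eta> / 16) * r \<le> u y" using s1(2)[OF y(1)] y(2) r by linarith
        next
          show "(m0 + \<eta>) * (r / 4) \<le> u (a + (r / 4) *\<^sub>R n)" using t by (simp add: r_def not_less le_divide_eq)
        qed (use e2 in auto)
        moreover have "(1 + c) * Cm * r powr (1 + 2 * \<beta>) \<le> (c * \<eta> / 16) * r"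
        proof -
          have "(1 + c) * Cm * r powr (1 + 2 * \<beta>) = ((1 + c) * Cm * r powr (2 * \<beta>)) * r" using r by (simp add: powr_add)
          also have "\<dots> \<le> (c * \<eta> / 16) * r" using s2(2)[OF r(1,7)] r by (intro mult_right_mono) auto
          finally show ?thesis .
        qed
        moreover have "\<delta> * r = c * \<eta> * r / 4 - (c * \<eta> / 16) * r - (c * \<eta> / 16) * r" by (simp add: \<delta>_def)
        ultimately show "m0 * \<xi> x + \<delta> * r \<le> u x" by linarith
      qed
    qed
    then show False using m0_ge by force
  qed
  have "((\<lambda>t. u (a + t *\<^sub>R n) / t) \<longlongrightarrow> m0) (at_right 0)"
  proof (rule tendstoI)
    fix e :: real assume "e > 0"
    from lower[OF this] upper'[OF this] show "eventually (\<lambda>t. dist (u (a + t *\<^sub>R n) / t) m0 < e) (at_right 0)"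
      by eventually_elim (simp add: dist_real_def abs_less_iff)
  qed
  then show ?thesis using m0_ge by blast
qed

end

section \<open>The smooth boundary and the upper bound\<close>

text \<open>The defining function differs from its linear part at \<open>a\<close> by a quadratic term, since its partial
  derivatives are differentiable at \<open>a\<close>.\<close>

lemma boundary_quadratic:
  fixes a :: "'a::euclidean_space"
  assumes ld: "local_defining_function \<Omega> a U \<rho>" and a: "a \<in> frontier \<Omega>" "open \<Omega>"
  shows "\<exists>K>0. \<exists>r>0. \<forall>x. norm (x - a) < r \<longrightarrow>
      ((x - a) \<bullet> sgn (grad \<rho> a) > K * (norm (x - a))\<^sup>2 \<longrightarrow> x \<in> \<Omega>) \<and>
      (x \<in> \<Omega> \<longrightarrow> (x - a) \<bullet> sgn (grad \<rho> a) \<ge> - (K * (norm (x - a))\<^sup>2))"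
proof -
  have U: "open U" "a \<in> U" "smooth_on U \<rho>" "grad \<rho> a \<noteq> 0" and eq: "\<Omega> \<inter> U = {x\<in>U. \<rho> x > 0}"
    using ld by (auto simp: local_defining_function_def)
  have r0: "\<rho> a = 0" by (rule local_defining_function_props(2)[OF ld a])
  let ?D = "\<lambda>b x. \<bar>partial_deriv b \<rho> x - partial_deriv b \<rho> a\<bar>"
  have one: "\<exists>B. \<exists>d>0. \<forall>x. norm (x - a) < d \<longrightarrow> ?D b x \<le> B * norm (x - a)" if b: "b \<in> Basis" for b
  proof -
    have "partial_deriv b \<rho> differentiable (at a)"
      by (rule smooth_on_differentiable[OF smooth_on_partial[OF U(3) b] U(2)])
    then obtain T where T: "(partial_deriv b \<rho> has_derivative T) (at a)" unfolding differentiable_def by blast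
    then have lin: "bounded_linear T" by (rule has_derivative_bounded_linear)
    from T obtain d where d: "d > 0" "\<And>x. norm (x - a) < d \<Longrightarrow>
        norm (partial_deriv b \<rho> x - partial_deriv b \<rho> a - T (x - a)) \<le> 1 * norm (x - a)"
      unfolding has_derivative_at_alt by (meson zero_less_one)
    have "?D b x \<le> (1 + onorm T) * norm (x - a)" if "norm (x - a) < d" for x
    proof -
      have "?D b x \<le> norm (partial_deriv b \<rho> x - partial_deriv b \<rho> a - T (x - a)) + norm (T (x - a))" by simp
      also have "\<dots> \<le> 1 * norm (x - a) + onorm T * norm (x - a)" by (rule add_mono[OF d(2)[OF that] onorm[OF lin]])
      finally show ?thesis by (simp add: algebra_simps)
    qed
    with d(1) show ?thesis by blast
  qed
  then obtain B d where Bd: "\<And>b. b \<in> Basis \<Longrightarrow> d b > 0 \<and> (\<forall>x. norm (x - a) < d b \<longrightarrow> ?D b x \<le> B b * norm (x - a))"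
    by metis
  obtain e where e: "e > 0" "ball a e \<subseteq> U" using U(1,2) openE by blast
  define r where "r = min e (Min (d ` Basis))"
  have r: "r > 0" "r \<le> e" "\<And>b. b \<in> Basis \<Longrightarrow> r \<le> d b" using e Bd by (auto simp: r_def min.coboundedI2)
  define C where "C = (\<Sum>b\<in>(Basis::'a set). \<bar>B b\<bar>)"
  have taylor: "\<bar>\<rho> x - grad \<rho> a \<bullet> (x - a)\<bar> \<le> C * (norm (x - a))\<^sup>2" if x: "norm (x - a) < r" for x
  proof -
    have "\<bar>\<rho> x - \<rho> a - grad \<rho> a \<bullet> (x - a)\<bar> \<le> C * norm (x - a) * norm (x - a)"
    proof (rule lipschitz_from_grad[where S="cball a (norm (x - a))"])
      fix y assume y: "y \<in> cball a (norm (x - a))"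
      then have ny: "norm (y - a) \<le> norm (x - a)" by (simp add: dist_norm norm_minus_commute)
      with x have nr: "norm (y - a) < r" by simp
      with r(2) e(2) have "y \<in> U" by (auto simp: dist_norm norm_minus_commute)
      then show "\<rho> differentiable (at y)" using U(3) smooth_on_differentiable by blast
      have "norm (grad \<rho> y - grad \<rho> a) \<le> (\<Sum>b\<in>Basis. \<bar>(grad \<rho> y - grad \<rho> a) \<bullet> b\<bar>)" by (rule norm_le_l1)
      also have "\<dots> = (\<Sum>b\<in>Basis. ?D b y)" by (intro sum.cong refl) (simp add: inner_diff_left partial_deriv_inner_grad)
      also have "\<dots> \<le> (\<Sum>b\<in>(Basis::'a set). \<bar>B b\<bar> * norm (x - a))"
      proof (rule sum_mono)
        fix b :: 'a assume b: "b \<in> Basis"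
        have "?D b y \<le> B b * norm (y - a)" using Bd[OF b] r(3)[OF b] nr by force
        also have "\<dots> \<le> \<bar>B b\<bar> * norm (x - a)" using ny by (intro mult_mono) auto
        finally show "?D b y \<le> \<bar>B b\<bar> * norm (x - a)" .
      qed
      finally show "norm (grad \<rho> y - grad \<rho> a) \<le> C * norm (x - a)" by (simp add: C_def sum_distrib_right)
    qed (auto simp: dist_norm norm_minus_commute)
    then show ?thesis by (simp add: r0 power2_eq_square mult.assoc)
  qed
  define s where "s = norm (grad \<rho> a)"
  have s: "s > 0" using U by (simp add: s_def)
  have C0: "C \<ge> 0" unfolding C_def by (intro sum_nonneg) simp
  define K where "K = (C + 1) / s"
  have Kpos: "K > 0" using C0 s by (simp add: K_def)
  have sg: "s * ((x - a) \<bullet> sgn (grad \<rho> a)) = grad \<rho> a \<bullet> (x - a)" for x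
    using s by (simp add: s_def sgn_div_norm inner_commute)
  have sK: "C * (norm (x - a))\<^sup>2 \<le> s * (K * (norm (x - a))\<^sup>2)" for x
    using s by (simp add: K_def distrib_right)
  have main: "((x - a) \<bullet> sgn (grad \<rho> a) > K * (norm (x - a))\<^sup>2 \<longrightarrow> x \<in> \<Omega>) \<and>
      (x \<in> \<Omega> \<longrightarrow> (x - a) \<bullet> sgn (grad \<rho> a) \<ge> - (K * (norm (x - a))\<^sup>2))" if x: "norm (x - a) < r" for x
  proof (intro conjI impI)
    have xU: "x \<in> U" using x r(2) e(2) by (auto simp: dist_norm norm_minus_commute)
    {
      assume "(x - a) \<bullet> sgn (grad \<rho> a) > K * (norm (x - a))\<^sup>2"
      from mult_strict_left_mono[OF this s] have "\<rho> x > 0" using taylor[OF x] sK[of x] by (simp only: sg abs_le_iff) linarith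
      then show "x \<in> \<Omega>" using xU eq by blast
    next
      assume "x \<in> \<Omega>"
      then have "\<rho> x > 0" using xU eq by blast
      then have "s * - (K * (norm (x - a))\<^sup>2) \<le> s * ((x - a) \<bullet> sgn (grad \<rho> a))"
        using taylor[OF x] sK[of x] by (simp only: sg abs_le_iff mult_minus_right) linarith
      then show "(x - a) \<bullet> sgn (grad \<rho> a) \<ge> - (K * (norm (x - a))\<^sup>2)" using s by (simp only: mult_le_cancel_left_pos)
    }
  qed
  with Kpos r(1) show ?thesis by blast
qed

text \<open>The ball of a small radius \<open>R\<close> around \<open>z = a - R n\<close> does not meet \<open>\<Omega>\<close>. A Gaussian around \<open>z\<close> is strictly
  subharmonic outside this ball, so a large multiple of its value on the sphere minus the Gaussian
  is an upper barrier. It vanishes at \<open>a\<close> and grows linearly along \<open>n\<close>.\<close>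

lemma exterior_ball_barrier:
  fixes a n :: "'a::euclidean_space"
  assumes O: "open \<Omega>" "bounded \<Omega>" and sol: "weak_solution \<Omega> u g" and g: "AE x in lebesgue_on \<Omega>. g x \<le> F"
    and n: "norm n = 1" and K: "K > 0" "r0 > 0"
    and outside: "\<And>x. norm (x - a) < r0 \<Longrightarrow> x \<in> \<Omega> \<Longrightarrow> (x - a) \<bullet> n \<ge> - (K * (norm (x - a))\<^sup>2)"
  shows "\<exists>w C. continuous_on UNIV w \<and> C > 0 \<and> (AE x in lebesgue_on \<Omega>. u x \<le> w x) \<and> (\<forall>x. w x \<le> C) \<and>
     (\<forall>t. 0 \<le> t \<longrightarrow> t \<le> 1 \<longrightarrow> w (a + t *\<^sub>R n) \<le> C * t)"
proof -
  let ?N = "real DIM('a)"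
  have N1: "?N \<ge> 1" using DIM_positive[where 'a='a] by simp
  have nn: "n \<bullet> n = 1" using n by (simp add: norm_eq_1)
  define R where "R = min (1 / (2 * K)) (r0 / 4)"
  have R: "R > 0" "4 * R \<le> r0" using K by (auto simp: R_def)
  have "R \<le> 1 / (2 * K)" by (simp add: R_def)
  with K have KR: "2 * K * R \<le> 1" by (simp add: field_simps)
  define z where "z = a - R *\<^sub>R n"
  have "ball z R \<inter> \<Omega> = {}"
  proof (rule ccontr)
    assume "ball z R \<inter> \<Omega> \<noteq> {}"
    then obtain x where x: "norm (x - z) < R" "x \<in> \<Omega>" by (auto simp: dist_norm norm_minus_commute)
    define y where "y = x - a"
    have xz: "x - z = y + R *\<^sub>R n" by (simp add: y_def z_def)
    have "norm y \<le> norm (y + R *\<^sub>R n) + norm (R *\<^sub>R n)" using norm_triangle_ineq4[of "y + R *\<^sub>R n" "R *\<^sub>R n"] by simp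
    also have "\<dots> < 2 * R" using x(1) R n unfolding xz by simp
    finally have y2: "norm y < r0" using R by linarith
    have "(norm (y + R *\<^sub>R n))\<^sup>2 < R\<^sup>2" using x R unfolding xz by (intro power_strict_mono) auto
    moreover have "(norm (y + R *\<^sub>R n))\<^sup>2 = (norm y)\<^sup>2 + 2 * R * (y \<bullet> n) + R\<^sup>2"
      unfolding power2_norm_eq_inner using nn
      by (simp add: inner_add_left inner_add_right inner_commute power2_eq_square algebra_simps)
    ultimately have 1: "(norm y)\<^sup>2 + 2 * R * (y \<bullet> n) < 0" by simp
    have "- (K * (norm y)\<^sup>2) \<le> y \<bullet> n" using outside[of x] y2 x(2) by (simp add: y_def)
    then have "2 * R * - (K * (norm y)\<^sup>2) \<le> 2 * R * (y \<bullet> n)" using R by (intro mult_left_mono) auto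
    moreover have "2 * K * R * (norm y)\<^sup>2 \<le> 1 * (norm y)\<^sup>2" using KR by (rule mult_right_mono) simp
    moreover have "2 * R * - (K * (norm y)\<^sup>2) = - (2 * K * R * (norm y)\<^sup>2)" by simp
    ultimately show False using 1 by linarith
  qed
  then have "ball z R \<inter> closure \<Omega> = {}" by (simp only: open_Int_closure_eq_empty[OF open_ball])
  then have far: "R \<le> norm (x - z)" if "x \<in> closure \<Omega>" for x
    using that by (force simp: dist_norm norm_minus_commute)
  obtain P where P: "\<And>x. x \<in> \<Omega> \<Longrightarrow> norm (x - z) \<le> P"
    using O(2) unfolding bounded_any_center[where a=z] by (auto simp: dist_norm norm_minus_commute)
  define k where "k = ?N / R\<^sup>2"
  have k: "k > 0" "k * R\<^sup>2 = ?N" using N1 R by (auto simp: k_def)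
  define \<mu> where "\<mu> = 2 * k * ?N * exp (- k * P\<^sup>2)"
  have mu: "\<mu> > 0" using k N1 by (simp add: \<mu>_def)
  define D where "D = (\<bar>F\<bar> + 1) / \<mu>"
  have D: "D > 0" "D * \<mu> = \<bar>F\<bar> + 1" using mu by (auto simp: D_def)
  define w where "w x = D * (exp (- k * R\<^sup>2) - gauss k z x)" for x
  have sm: "smooth_on UNIV w"
    unfolding w_def by (intro smooth_on_mult smooth_on_diff smooth_on_const gauss_smooth open_UNIV)
  have lap: "laplacian w x = - (D * laplacian (gauss k z) x)" for x
    unfolding w_def
    by (subst laplacian_cmult[OF smooth_on_diff[OF open_UNIV smooth_on_const gauss_smooth]])
      (simp add: laplacian_diff[OF smooth_on_const gauss_smooth])
  have le: "AE x in lebesgue_on \<Omega>. u x \<le> w x"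
  proof (rule solution_upper_bound[OF O sol g sm])
    fix x assume "x \<in> frontier \<Omega>"
    then have "R \<le> norm (x - z)" using far by (simp add: frontier_def)
    then have "k * R\<^sup>2 \<le> k * (norm (x - z))\<^sup>2" using k R by (intro mult_left_mono power_mono) auto
    then show "0 \<le> w x" using D by (simp add: w_def gauss_def)
  next
    fix x assume x: "x \<in> \<Omega>"
    then have f: "R \<le> norm (x - z)" using far closure_subset by blast
    have "k * R\<^sup>2 \<le> k * (norm (x - z))\<^sup>2" using k f R by (intro mult_left_mono power_mono) auto
    then have 1: "?N \<le> 2 * k * (norm (x - z))\<^sup>2 - ?N" using k(2) by linarith
    have "k * (norm (x - z))\<^sup>2 \<le> k * P\<^sup>2" using k P[OF x] by (intro mult_left_mono power_mono) auto
    then have 2: "exp (- k * P\<^sup>2) \<le> gauss k z x" by (simp add: gauss_def)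
    have "\<mu> \<le> laplacian (gauss k z) x" unfolding \<mu>_def gauss_laplacian
      using 1 2 k N1 by (intro mult_mono mult_left_mono) auto
    then have "D * \<mu> \<le> D * laplacian (gauss k z) x" using D by (intro mult_left_mono) auto
    then show "laplacian w x < - F" unfolding lap using D(2) by linarith
  qed
  define C where "C = D * (1 + k * (2 * R + 1))"
  have "0 < D * (k * (2 * R + 1))" using D k R by simp
  then have C: "C > 0" "D \<le> C" "D * (k * (2 * R + 1)) \<le> C" using D by (auto simp: C_def distrib_left)
  have wC: "w x \<le> C" for x
  proof -
    have "exp (- k * R\<^sup>2) - gauss k z x \<le> 1" using k by (smt (verit) exp_le_one_iff exp_ge_zero gauss_def mult_minus_left mult_nonneg_nonneg zero_le_power2)
    then have "w x \<le> D * 1" unfolding w_def using D by (intro mult_left_mono) auto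
    then show ?thesis using C by simp
  qed
  have wt: "w (a + t *\<^sub>R n) \<le> C * t" if t: "0 \<le> t" "t \<le> 1" for t
  proof -
    have "a + t *\<^sub>R n - z = (t + R) *\<^sub>R n" by (simp add: z_def algebra_simps)
    then have nz: "norm (a + t *\<^sub>R n - z) = t + R" using n t R by simp
    define s where "s = k * ((t + R)\<^sup>2 - R\<^sup>2)"
    have "(t + R)\<^sup>2 - R\<^sup>2 = t * (2 * R + t)" by (simp add: power2_eq_square algebra_simps)
    also have "\<dots> \<le> t * (2 * R + 1)" using t by (intro mult_left_mono) auto
    finally have s1: "s \<le> k * (2 * R + 1) * t" unfolding s_def using k by (simp add: mult_ac)
    have s0: "s \<ge> 0" unfolding s_def using k t R by (intro mult_nonneg_nonneg) (auto intro!: power_mono)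
    have "gauss k z (a + t *\<^sub>R n) = exp (- k * R\<^sup>2) * exp (- s)"
      unfolding gauss_def nz s_def by (simp add: exp_add[symmetric] algebra_simps del: exp_add)
    then have "exp (- k * R\<^sup>2) - gauss k z (a + t *\<^sub>R n) = exp (- k * R\<^sup>2) * (1 - exp (- s))" by (simp add: algebra_simps)
    also have "\<dots> \<le> 1 * s"
    proof (rule mult_mono)
      show "1 - exp (- s) \<le> s" using exp_ge_add_one_self[of "- s"] by linarith
    qed (use k s0 in auto)
    finally have "w (a + t *\<^sub>R n) \<le> D * s" unfolding w_def using D by (intro mult_left_mono) auto
    also have "\<dots> \<le> D * (k * (2 * R + 1) * t)" using s1 D by (intro mult_left_mono) auto
    also have "\<dots> = D * (k * (2 * R + 1)) * t" by (simp only: mult_ac)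
    also have "\<dots> \<le> C * t" using C(3) t(1) by (rule mult_right_mono)
    finally show ?thesis .
  qed
  show ?thesis using smooth_on_continuous[OF sm] C(1) le wC wt by blast
qed

text \<open>Testing with cutoffs around the points of \<open>\<Omega>\<close> shows that the nonnegative datum vanishes near every
  point, and countably many of these neighbourhoods cover \<open>\<Omega>\<close>.\<close>

lemma zero_solution_imp_zero_datum:
  fixes \<Omega> :: "'a::euclidean_space set"
  assumes O: "open \<Omega>" and sol: "weak_solution \<Omega> u g" and u: "AE x in lebesgue_on \<Omega>. u x = 0"
    and g: "AE x in lebesgue_on \<Omega>. g x \<ge> 0"
  shows "AE x in lebesgue_on \<Omega>. g x = 0"
proof -
  have gint: "integrable (lebesgue_on \<Omega>) g" and eq: "\<And>\<theta>. \<theta> \<in> test_functions \<Omega> \<Longrightarrow>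
      (\<integral>x. u x * laplacian \<theta> x \<partial>lebesgue_on \<Omega>) = - (\<integral>x. g x * \<theta> x \<partial>lebesgue_on \<Omega>)"
    using sol by (auto simp: weak_solution_def)
  have "\<exists>r>0. AE y in lebesgue_on \<Omega>. y \<in> ball x r \<longrightarrow> g y = 0" if x: "x \<in> \<Omega>" for x
  proof -
    obtain r where r: "r > 0" "cball x r \<subseteq> \<Omega>" using O x open_contains_cball by blast
    define \<theta> where "\<theta> = cutoff x (r / 2) r"
    have T: "\<theta> \<in> TF" unfolding \<theta>_def by (rule cutoff_TF) (use r in auto)
    have "closure {y. \<theta> y \<noteq> 0} \<subseteq> cball x r"
    proof (rule closure_minimal[OF _ closed_cball], rule subsetI)
      fix y assume "y \<in> {y. \<theta> y \<noteq> 0}"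
      then show "y \<in> cball x r" using cutoff_eq_0[of "r / 2" r y x] r
        by (force simp: \<theta>_def dist_norm norm_minus_commute)
    qed
    then have TO: "\<theta> \<in> test_functions \<Omega>" using T r(2) by (auto simp: test_functions_def)
    have nn: "AE y in lebesgue_on \<Omega>. 0 \<le> g y * \<theta> y"
      using g by eventually_elim (auto simp: \<theta>_def cutoff_bounds)
    have "(\<integral>y. u y * laplacian \<theta> y \<partial>lebesgue_on \<Omega>) = (\<integral>y. 0 \<partial>lebesgue_on \<Omega>)"
    proof (rule integral_cong_AE)
      show "(\<lambda>y. u y * laplacian \<theta> y) \<in> borel_measurable (lebesgue_on \<Omega>)"
      proof (intro borel_measurable_times)
        show "u \<in> borel_measurable (lebesgue_on \<Omega>)" using sol by (auto simp: weak_solution_def Lp_on_def)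
        show "laplacian \<theta> \<in> borel_measurable (lebesgue_on \<Omega>)"
          by (intro continuous_measurable_on smooth_laplacian_continuous test_functions_D(1)[OF T])
      qed
      show "AE y in lebesgue_on \<Omega>. u y * laplacian \<theta> y = 0" using u by eventually_elim simp
    qed simp
    then have "(\<integral>y. g y * \<theta> y \<partial>lebesgue_on \<Omega>) = 0" using eq[OF TO] by simp
    moreover have "integrable (lebesgue_on \<Omega>) (\<lambda>y. g y * \<theta> y)"
    proof (rule Bochner_Integration.integrable_bound[OF gint])
      show "(\<lambda>y. g y * \<theta> y) \<in> borel_measurable (lebesgue_on \<Omega>)"
        using gint by (intro borel_measurable_times borel_measurable_integrable continuous_measurable_on test_functions_D(2)[OF T])
      have "\<bar>g y\<bar> * \<bar>\<theta> y\<bar> \<le> \<bar>g y\<bar> * 1" for y using cutoff_bounds[of x "r/2" r y] by (intro mult_left_mono) (auto simp: \<theta>_def)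
      then show "AE y in lebesgue_on \<Omega>. norm (g y * \<theta> y) \<le> norm (g y)" by (simp add: abs_mult)
    qed
    ultimately have "AE y in lebesgue_on \<Omega>. g y * \<theta> y = 0"
      using integral_nonneg_eq_0_iff_AE[OF _ nn] by simp
    then have "AE y in lebesgue_on \<Omega>. y \<in> ball x r \<longrightarrow> g y = 0"
    proof eventually_elim
      case (elim y)
      show ?case
      proof
        assume "y \<in> ball x r"
        then have "\<theta> y > 0" unfolding \<theta>_def using r by (intro cutoff_pos) (auto simp: dist_norm norm_minus_commute)
        with elim show "g y = 0" by simp
      qed
    qed
    with r(1) show ?thesis by blast
  qed
  then obtain r where r: "\<And>x. x \<in> \<Omega> \<Longrightarrow> r x > 0 \<and> (AE y in lebesgue_on \<Omega>. y \<in> ball x (r x) \<longrightarrow> g y = 0)" by metis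
  obtain F' where F': "F' \<subseteq> (\<lambda>x. ball x (r x)) ` \<Omega>" "countable F'" "\<Union>F' = \<Union>((\<lambda>x. ball x (r x)) ` \<Omega>)"
    by (rule Lindelof[of "(\<lambda>x. ball x (r x)) ` \<Omega>"]) auto
  have "AE y in lebesgue_on \<Omega>. \<forall>S\<in>F'. y \<in> S \<longrightarrow> g y = 0"
    unfolding AE_ball_countable[OF F'(2)] using F'(1) r by blast
  moreover have "AE y in lebesgue_on \<Omega>. y \<in> \<Omega>" by (rule AE_I2) simp
  ultimately show ?thesis
  proof eventually_elim
    case (elim y)
    then have "y \<in> ball y (r y)" using r[of y] by simp
    then have "y \<in> \<Union>F'" unfolding F'(3) using elim by blast
    with elim show ?case by blast
  qed
qed

section \<open>Positivity of the normal derivative\<close>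

text \<open>Divided by its minimum over a ball near \<open>a\<close>, the solution is at least 1 on that ball, so \<open>hopf\<close>
  provides a positive admissible slope, and the limit is at least as large.\<close>

lemma (in bounded_solution) normal_slope_positive:
  assumes conn: "connected \<Omega>" and cont: "continuous_on \<Omega> u" and nonneg: "\<And>x. x \<in> \<Omega> \<Longrightarrow> 0 \<le> u x"
    and super: "\<And>c. c > 0 \<Longrightarrow> supersolution W \<Omega> (\<lambda>x. (1 / c) * u x)"
    and x0: "x0 \<in> \<Omega>" "u x0 > 0"
    and n: "norm n = 1" and K: "K > 0" and r0: "r0 > 0"
    and inside: "\<And>x. norm (x - a) < r0 \<Longrightarrow> (x - a) \<bullet> n > K * (norm (x - a))\<^sup>2 \<Longrightarrow> x \<in> \<Omega>"
    and outside: "\<And>x. norm (x - a) < r0 \<Longrightarrow> x \<in> \<Omega> \<Longrightarrow> (x - a) \<bullet> n \<ge> - (K * (norm (x - a))\<^sup>2)"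
    and upper: "\<And>t. 0 < t \<Longrightarrow> t < 1 \<Longrightarrow> a + t *\<^sub>R n \<in> \<Omega> \<Longrightarrow> u (a + t *\<^sub>R n) \<le> C * t"
  shows "\<exists>D>0. ((\<lambda>t. u (a + t *\<^sub>R n) / t) \<longlongrightarrow> D) (at_right 0)"
    "eventually (\<lambda>t. a + t *\<^sub>R n \<in> \<Omega>) (at_right 0)"
proof -
  obtain K0 where K0: "K0 > 0" "\<And>x. \<bar>conv (phis 1) W x\<bar> \<le> K0" using smoothed_bounded by blast
  obtain C0 where C0: "C0 > 0" "\<And>a. \<exists>L. \<forall>x. \<bar>potential x - potential a - L \<bullet> (x - a)\<bar> \<le> C0 * norm (x - a) powr (1 + \<beta>)"
    using potential_taylor by blast
  obtain L where L: "\<And>x. \<bar>potential x - potential a - L \<bullet> (x - a)\<bar> \<le> C0 * norm (x - a) powr (1 + \<beta>)" using C0(2) by blast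
  interpret B: boundary_point W \<beta> CW \<Omega> a n L K r0 K0 C0
    by (unfold_locales) (use open_O bounded_O n K r0 K0 C0 inside outside L in blast)+
  have pos: "u x > 0" if "x \<in> \<Omega>" for x
    by (rule strong_maximum_principle[OF open_O bounded_O conn cont nonneg super x0 that])
  obtain r1 where r1: "r1 > 0" "\<And>r v. 0 < r \<Longrightarrow> r < r1 \<Longrightarrow> supersolution W \<Omega> v \<Longrightarrow>
     (\<forall>x. norm (x - (a + (r / 4) *\<^sub>R n)) \<le> r / 16 \<longrightarrow> 1 \<le> v x) \<Longrightarrow> (\<exists>m>0. B.admissible v m)"
    using B.hopf by blast
  define r where "r = min (r1 / 2) (min (r0 / 2) (1 / K))"
  have "r \<le> r1 / 2" "r \<le> r0 / 2" "r \<le> 1 / K" "0 < r" using r1 r0 K by (auto simp: r_def)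
  with r1(1) r0 K have r: "0 < r" "r < r1" "r < r0" "K * r \<le> 1" by (auto simp: field_simps)
  let ?S = "cball (a + (r / 4) *\<^sub>R n) (r / 16)"
  have S: "?S \<subseteq> \<Omega>"
  proof
    fix x assume "x \<in> ?S"
    then have "norm (x - (a + (r / 4) *\<^sub>R n)) < r / 4" using r(1) by (simp add: dist_norm norm_minus_commute)
    then show "x \<in> \<Omega>" by (rule B.axis_point(1)[OF r(1,3,4)])
  qed
  have "?S \<noteq> {}" using r(1) by simp
  from continuous_attains_inf[OF compact_cball this continuous_on_subset[OF cont S]]
  obtain y where y: "y \<in> ?S" "\<forall>x\<in>?S. u y \<le> u x" by blast
  have uy: "u y > 0" using y(1) S pos by blast
  have "\<forall>x. norm (x - (a + (r / 4) *\<^sub>R n)) \<le> r / 16 \<longrightarrow> 1 \<le> (1 / u y) * u x"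
    using y(2) uy by (auto simp: dist_norm norm_minus_commute)
  from r1(2)[OF r(1,2) super[OF uy] this] obtain m where m: "m > 0" "B.admissible (\<lambda>x. (1 / u y) * u x) m" by blast
  have adm: "B.admissible u (u y * m)"
    unfolding B.admissible_def
  proof (intro conjI allI impI)
    show "0 \<le> u y * m" using uy m by simp
    fix \<epsilon> :: real assume "\<epsilon> > 0"
    then have "\<epsilon> / u y > 0" using uy by simp
    then obtain s where s: "s > 0" "\<And>x. x \<in> \<Omega> \<Longrightarrow> norm (x - a) < s \<Longrightarrow> m * B.\<xi> x - \<epsilon> / u y * norm (x - a) \<le> (1 / u y) * u x"
      using m(2) unfolding B.admissible_def by blast
    have "u y * m * B.\<xi> x - \<epsilon> * norm (x - a) \<le> u x" if "x \<in> \<Omega>" "norm (x - a) < s" for x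
      using mult_left_mono[OF s(2)[OF that] less_imp_le[OF uy]] uy by (simp add: right_diff_distrib mult.assoc)
    with s(1) show "\<exists>s>0. \<forall>x\<in>\<Omega>. norm (x - a) < s \<longrightarrow> u y * m * B.\<xi> x - \<epsilon> * norm (x - a) \<le> u x" by blast
  qed
  have u0: "u0 = (\<lambda>x. indicator \<Omega> x * u x)" by (rule ext) (rule u0_def)
  obtain Cm where Cm: "Cm > 0" "\<And>x \<tau>. 0 < \<tau> \<Longrightarrow> \<tau> \<le> 1 \<Longrightarrow> cball x \<tau> \<subseteq> \<Omega> \<Longrightarrow>
     \<bar>u x - conv (phis \<tau>) u0 x\<bar> \<le> Cm * \<tau> powr (1 + 2 * \<beta>)" using mean_value_estimate[OF cont] by blast
  have "supersolution W \<Omega> u" using super[of 1] by simp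
  from B.normal_slope_exists[OF this u0_integrable[unfolded u0] Cm(2)[unfolded u0] Cm(1) zero_less_one upper]
  obtain D where D: "((\<lambda>t. u (a + t *\<^sub>R n) / t) \<longlongrightarrow> D) (at_right 0)" "\<forall>m. B.admissible u m \<longrightarrow> m \<le> D" by blast
  have "0 < u y * m" using uy m by simp
  also have "\<dots> \<le> D" using D(2) adm by blast
  finally show "\<exists>D>0. ((\<lambda>t. u (a + t *\<^sub>R n) / t) \<longlongrightarrow> D) (at_right 0)" using D(1) by blast
  have "eventually (\<lambda>t. t < min (r0 / 4) (1 / (4 * K))) (at_right 0)"
    using r0 K by (intro order_tendstoD(2)[OF tendsto_ident_at]) auto
  then show "eventually (\<lambda>t. a + t *\<^sub>R n \<in> \<Omega>) (at_right 0)" using eventually_at_right_less[of "0::real"]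
    by eventually_elim (use K in \<open>auto intro!: B.axis_in_domain simp: field_simps\<close>)
qed

theorem corollary7p2:
  fixes \<Omega> :: "'a::euclidean_space set" and V :: "'a \<Rightarrow> real" and q :: real
  assumes "open \<Omega>" and "bounded \<Omega>" and "connected \<Omega>" and "smooth_boundary \<Omega>"
    and "AE x in lebesgue_on \<Omega>. V x \<ge> 0"
    and "q > real DIM('a)" and "V \<in> Lp_on q \<Omega>"
  shows "\<forall>f u. f \<in> Linf_on \<Omega> \<and> (AE x in lebesgue_on \<Omega>. f x \<ge> 0) \<and>
           \<not> (AE x in lebesgue_on \<Omega>. f x = 0) \<and> dirichlet_solution \<Omega> V f u \<longrightarrow>
         (\<forall>a\<in>frontier \<Omega>. \<exists>D. has_normal_derivative \<Omega> (precise_representative u) a D \<and> D > 0)"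
proof (intro allI impI ballI, elim conjE)
  fix f u a
  assume f: "f \<in> Linf_on \<Omega>" "AE x in lebesgue_on \<Omega>. f x \<ge> 0" "\<not> (AE x in lebesgue_on \<Omega>. f x = 0)"
    and u: "dirichlet_solution \<Omega> V f u" and a: "a \<in> frontier \<Omega>"
  note O = assms(1,2) and V = assms(5)
  have N1: "real DIM('a) \<ge> 1" using DIM_positive[where 'a='a] by simp
  have Vint: "integrable (lebesgue_on \<Omega>) V" by (rule Lp_bounded_integrable[OF O assms(7)]) (use assms(6) N1 in linarith)
  obtain U \<rho> where ld: "local_defining_function \<Omega> a U \<rho>" using assms(4) a by (auto simp: smooth_boundary_def)
  define n where "n = sgn (grad \<rho> a)"
  have ne: "inward_unit_normal \<Omega> a = n" unfolding n_def by (rule inward_unit_normal_eq[OF ld a assms(1)])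
  have "grad \<rho> a \<noteq> 0" using ld by (auto simp: local_defining_function_def)
  then have n: "norm n = 1" by (simp add: n_def norm_sgn)
  from boundary_quadratic[OF ld a assms(1), folded n_def]
  obtain K r0 where K: "K > 0" "r0 > 0"
    and inside: "\<And>x. norm (x - a) < r0 \<Longrightarrow> (x - a) \<bullet> n > K * (norm (x - a))\<^sup>2 \<Longrightarrow> x \<in> \<Omega>"
    and outside: "\<And>x. norm (x - a) < r0 \<Longrightarrow> x \<in> \<Omega> \<Longrightarrow> (x - a) \<bullet> n \<ge> - (K * (norm (x - a))\<^sup>2)" by blast
  define g where "g x = f x - V x * u x" for x
  have sol: "weak_solution \<Omega> u g" unfolding g_def by (rule dirichlet_imp_weak_solution[OF O V Vint f(1) u])
  obtain F where F: "AE x in lebesgue_on \<Omega>. \<bar>f x\<bar> \<le> F" using f(1) by (auto simp: Linf_on_def)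
  have u_nonneg: "AE x in lebesgue_on \<Omega>. u x \<ge> 0"
  proof (rule solution_nonneg[OF O sol])
    show "AE x in lebesgue_on \<Omega>. u x < 0 \<longrightarrow> 0 \<le> g x"
      using V f(2)
    proof eventually_elim
      case (elim x)
      show ?case
      proof
        assume "u x < 0"
        then have "V x * u x \<le> 0" using elim(1) by (simp add: mult_nonneg_nonpos)
        then show "0 \<le> g x" using elim by (simp add: g_def)
      qed
    qed
  qed
  have g_le: "AE x in lebesgue_on \<Omega>. g x \<le> F"
    using V F u_nonneg
  proof eventually_elim
    case (elim x)
    have "0 \<le> V x * u x" using elim by simp
    then show ?case using elim(2) unfolding g_def by linarith
  qed
  from exterior_ball_barrier[OF O sol g_le n K outside]
  obtain w C where w: "continuous_on UNIV w" "C > 0" "AE x in lebesgue_on \<Omega>. u x \<le> w x" "\<And>x. w x \<le> C"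
     "\<And>t. 0 \<le> t \<Longrightarrow> t \<le> 1 \<Longrightarrow> w (a + t *\<^sub>R n) \<le> C * t" by blast
  define W where "W x = (if x \<in> \<Omega> then 1 + max 0 (V x) else 0)" for x
  define \<beta> where "\<beta> = (1 - real DIM('a) / q) / 2"
  obtain CW where M: "morrey W \<beta> CW"
    using morrey_of_Lp[OF O assms(7,6)] unfolding W_def[abs_def, symmetric] \<beta>_def[symmetric] by blast
  have inO: "AE x in lebesgue_on \<Omega>. x \<in> \<Omega>" by (rule AE_I2) simp
  have g_abs: "AE x in lebesgue_on \<Omega>. \<bar>g x\<bar> \<le> (\<bar>F\<bar> + C) * W x"
    using V F u_nonneg w(3) inO
  proof eventually_elim
    case (elim x)
    have "u x \<le> C" using elim(4) w(4)[of x] by linarith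
    then have 1: "V x * u x \<le> V x * C" "0 \<le> V x * u x" using elim by (auto intro: mult_left_mono)
    have "\<bar>g x\<bar> \<le> \<bar>F\<bar> + V x * C" using 1 elim(2) unfolding g_def by linarith
    also have "\<dots> \<le> (\<bar>F\<bar> + C) * (1 + V x)" using elim(1) w(2) by (simp add: algebra_simps)
    also have "1 + V x = W x" using elim by (simp add: W_def)
    finally show ?case .
  qed
  interpret S: bounded_solution W \<beta> CW \<Omega> u g "\<bar>F\<bar> + C"
    by (rule bounded_solution.intro[OF M], unfold_locales) (use O sol w(2) g_abs in auto)
  define v where "v = S.cont_rep"
  have v: "continuous_on \<Omega> v" "AE x in lebesgue_on \<Omega>. u x = v x"
    unfolding v_def by (rule S.cont_rep_continuous S.cont_rep_AE)+
  have u_meas: "u \<in> borel_measurable (lebesgue_on \<Omega>)" using sol by (auto simp: weak_solution_def Lp_on_def)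
  have "v \<in> borel_measurable (lebesgue_on \<Omega>)"
    using v(1) O by (intro continuous_imp_measurable_on_sets_lebesgue) auto
  with sol v(2) have solv: "weak_solution \<Omega> v g" by (rule weak_solution_cong_AE)
  interpret T: bounded_solution W \<beta> CW \<Omega> v g "\<bar>F\<bar> + C"
    by (rule bounded_solution.intro[OF M], unfold_locales) (use O solv w(2) g_abs in auto)
  have v_nonneg: "0 \<le> v x" if "x \<in> \<Omega>" for x
  proof (rule AE_imp_everywhere[OF O(1) O(1) order_refl continuous_on_const v(1) _ that])
    show "AE x in lebesgue_on \<Omega>. x \<in> \<Omega> \<longrightarrow> 0 \<le> v x" using v(2) u_nonneg by eventually_elim simp
  qed
  have v_le: "v x \<le> w x" if "x \<in> \<Omega>" for x
  proof (rule AE_imp_everywhere[OF O(1) O(1) order_refl v(1) continuous_on_subset[OF w(1) subset_UNIV] _ that])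
    show "AE x in lebesgue_on \<Omega>. x \<in> \<Omega> \<longrightarrow> v x \<le> w x" using v(2) w(3) by eventually_elim simp
  qed
  have super: "supersolution W \<Omega> (\<lambda>x. (1 / c) * v x)" if c: "c > 0" for c
    unfolding supersolution_def
  proof (intro conjI ballI exI[of _ "\<lambda>x. (1 / c) * g x"])
    show "continuous_on \<Omega> (\<lambda>x. (1 / c) * v x)" by (intro continuous_intros v(1))
    show "weak_solution \<Omega> (\<lambda>x. (1 / c) * v x) (\<lambda>x. (1 / c) * g x)" by (rule weak_solution_scale[OF O solv])
    show "0 \<le> (1 / c) * v x" if "x \<in> \<Omega>" for x using v_nonneg[OF that] c by simp
    show "AE x in lebesgue_on \<Omega>. (1 / c) * v x < 1 \<longrightarrow> - W x \<le> (1 / c) * g x"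
      using V f(2) v(2) inO
    proof eventually_elim
      case (elim x)
      show ?case
      proof
        assume "(1 / c) * v x < 1"
        then have "V x * ((1 / c) * v x) \<le> V x * 1" using elim(1) by (intro mult_left_mono) auto
        moreover have "(1 / c) * g x = (1 / c) * f x - V x * ((1 / c) * v x)" using elim(3) by (simp add: g_def algebra_simps)
        moreover have "0 \<le> (1 / c) * f x" using elim c by simp
        ultimately show "- W x \<le> (1 / c) * g x" using elim(1,4) by (simp add: W_def)
      qed
    qed
  qed
  have "\<exists>x0\<in>\<Omega>. v x0 > 0"
  proof (rule ccontr)
    assume neg: "\<not> ?thesis"
    have u0: "AE x in lebesgue_on \<Omega>. u x = 0" using v(2) inO
    proof eventually_elim
      case (elim x)
      then have "v x = 0" using neg v_nonneg[of x] by force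
      with elim show ?case by simp
    qed
    have "AE x in lebesgue_on \<Omega>. g x = 0"
    proof (rule zero_solution_imp_zero_datum[OF O(1) sol u0])
      show "AE x in lebesgue_on \<Omega>. 0 \<le> g x" using u0 f(2) by eventually_elim (simp add: g_def)
    qed
    then have "AE x in lebesgue_on \<Omega>. f x = 0" using u0 by eventually_elim (simp add: g_def)
    with f(3) show False ..
  qed
  then obtain x0 where x0: "x0 \<in> \<Omega>" "v x0 > 0" by blast
  have upper: "v (a + t *\<^sub>R n) \<le> C * t" if "0 < t" "t < 1" "a + t *\<^sub>R n \<in> \<Omega>" for t
    using v_le[OF that(3)] w(5)[of t] that by linarith
  have "\<exists>D>0. ((\<lambda>t. v (a + t *\<^sub>R n) / t) \<longlongrightarrow> D) (at_right 0)"
    by (rule T.normal_slope_positive(1)[OF assms(3) v(1) v_nonneg super x0 n K inside outside upper])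
  then obtain D where D: "D > 0" "((\<lambda>t. v (a + t *\<^sub>R n) / t) \<longlongrightarrow> D) (at_right 0)" by blast
  have axis: "eventually (\<lambda>t. a + t *\<^sub>R n \<in> \<Omega>) (at_right 0)"
    by (rule T.normal_slope_positive(2)[OF assms(3) v(1) v_nonneg super x0 n K inside outside upper])
  have "eventually (\<lambda>t. v (a + t *\<^sub>R n) / t = precise_representative u (a + t *\<^sub>R n) / t) (at_right 0)"
    using axis by eventually_elim (simp add: precise_representative_eq[OF O(1) _ v(1) u_meas v(2)])
  then have "((\<lambda>t. precise_representative u (a + t *\<^sub>R n) / t) \<longlongrightarrow> D) (at_right 0)"
    using D(2) by (rule Lim_transform_eventually[rotated])
  then show "\<exists>D. has_normal_derivative \<Omega> (precise_representative u) a D \<and> D > 0"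
    unfolding has_normal_derivative_def ne using D(1) by blast
qed

end
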